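(* Let $(\mathcal T,d,m,\mathcal E,\mathcal F)$ be a uniform local tree Dirichlet space as described in the context, satisfying $\mathrm{UVG}(V)$, and let $\Psi$ be a scale function. Assume the heat kernel upper estimates $\mathrm{UHK}(\Psi)$ and the reverse Hölder inequality $\mathrm{RH}$ for harmonic functions. Then the heat kernel gradient estimates $\mathrm{Grad}(\Psi)$ hold.
   Context: **Local trees.** $B(x,r)=\{y:d(x,y)<r\}$. A metric space $(\mathcal T,d)$ is a *real tree* if (i) for all $u,v$ there is a unique isometric embedding $\phi_{u,v}:[0,d(u,v)]\to\mathcal T$ with $\phi_{u,v}(0)=u$, $\phi_{u,v}(d(u,v))=v$, and (ii) every injective continuous $\kappa:[0,1]\to\mathcal T$ satisfies $\kappa([0,1])=\phi_{\kappa(0),\kappa(1)}([0,d(\kappa(0),\kappa(1))])$. It is a *uniform local tree* with constant $\iota\in(0,\mathrm{diam}(\mathcal T)]$ if every ball $B(x,\iota)$ with the restricted metric is a real tree. For $d(x,y)<\iota$, $[x,y]$ and $(x,y)$ denote the images under $\phi_{x,y}$ of $[0,d(x,y)]$ and $(0,d(x,y))$. The *skeleton* is $\mathcal S=\bigcup_{x\in\mathcal T}\bigcup_{y\in B(x,\iota)}(x,y)$. The *length measure* $\nu$ is the unique measure on the $\sigma$-field generated by these open arcs with $\nu((x,y))=d(x,y)$ whenever $x,y\in\mathcal S$, $0<d(x,y)<\iota$; it is also regarded as a measure on $\mathcal T$ concentrated on $\mathcal S$. A *local arc chart* is an isometric embedding $\gamma:[0,\ell]\to\mathcal T$, $\ell\in(0,\infty)$,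 with image in some ball $B(x,\iota)$. $\mathrm{AC}(\mathcal T)$ is the set of continuous $u:\mathcal T\to\mathbb R$ such that $u\circ\gamma$ is absolutely continuous on $[0,\ell]$ for every local arc chart $\gamma$. An *orientation* is a sequence $(\gamma_n)_{n\in\mathbb N}$ of local arc charts $\gamma_n:[0,\ell_n]\to\mathcal T$ with $\mathcal S=\bigcup_n\gamma_n((0,\ell_n))$; the weak gradient of $u\in\mathrm{AC}(\mathcal T)$ is $\partial u(z)=\sum_n 1_{A_n}(z)(u\circ\gamma_n)'(\gamma_n^{-1}(z))$ for $\nu$-a.e. $z\in\mathcal S$, where $A_n=\gamma_n((0,\ell_n))\setminus\bigcup_{j<n}\gamma_j((0,\ell_j))$. **Setting.** $(\mathcal T,d)$ is an unbounded, proper, geodesic, separable uniform local tree with constant $\iota$; an arbitrary orientation is fixed. $m$ is a Radon measure on $\mathcal T$ satisfying $\mathrm{UVG}(V)$: $V:[0,\infty)\to[0,\infty)$ is increasing and there is $C_V\ge1$ with $0<C_V^{-1}V(r)\le m(B(x,r))\le C_VV(r)<\infty$ and $V(2r)\le C_VV(r)$ for all $x\in\mathcal T$, $r\in(0,\infty)$. $\mathcal F$ is the set of $u\in L^2(\mathcal T,m)$ having an $m$-version $\tilde u\in\mathrm{AC}(\mathcal T)$ with $\partial\tilde u\in L^2(\mathcal S,\nu)$, and $\mathcal E(u,v)=\int_{\mathcal S}\partial\tilde u\,\partial\tilde v\,d\nu$; this is a strongly local regular symmetric Dirichlet form on $L^2(\mathcal T,m)$. Elements of $\mathcal F$ are represented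 by their $\mathrm{AC}$ versions. $\Delta$ is the associated non-positive self-adjoint operator and $P_t=e^{t\Delta}$. The semigroup has a jointly continuous heat kernel $p_t(x,y)$, and $p_{t,x}:=p_t(x,\cdot)\in\mathcal F$. **Harmonic functions and RH.** $\mathcal F_{\rm loc}$ is the set of $u\in L^2_{\rm loc}(\mathcal T,m)$ such that for every relatively compact open $U$ there is $v\in\mathcal F$ with $u=v$ $m$-a.e. on $U$; $\partial u$ and $\mathcal E(u,\phi)=\int\partial u\,\partial\phi\,d\nu$ ($\phi\in\mathcal F\cap C_c(\mathcal T)$) are defined accordingly. For a non-empty open $\Omega\subset\mathcal T$, $h\in\mathcal F_{\rm loc}$ is *$\mathcal E$-harmonic on $\Omega$* if $\mathcal E(h,\phi)=0$ for all $\phi\in\mathcal F\cap C_c(\Omega)$. $\mathrm{RH}$: there are constants $A_{\mathrm{RH}},C_{\mathrm{RH}}\in(1,\infty)$ such that for all $(x,r)\in\mathcal T\times(0,\infty)$ and all $h\in\mathcal F_{\rm loc}$ that are $\mathcal E$-harmonic on $B(x,A_{\mathrm{RH}}r)$, $$\|\partial h\|_{L^\infty(B(x,r),\nu)}\le\frac{C_{\mathrm{RH}}}{r}\,\frac1{m(B(x,A_{\mathrm{RH}}r))}\int_{B(x,A_{\mathrm{RH}}r)}|h|\,dm.$$ **Heat kernel conditions.** A *scale function* is a continuous increasing bijection $\Psi:(0,\infty)\to(0,\infty)$ such that for some $C>1$, $1<\beta_1\le\beta_2<\infty$: $C^{-1}(R/r)^{\beta_1}\le\Psi(R)/\Psi(r)\le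 C(R/r)^{\beta_2}$ for $0<r\le R<\infty$. Put $\Phi(R,t)=\sup_{r>0}\big(\frac Rr-\frac t{\Psi(r)}\big)$. - $\mathrm{UHK}(\Psi)$: there are $C_1,c_2\in(0,\infty)$ such that for every $t>0$, $p_t(x,y)\le\frac{C_1}{m(B(x,\Psi^{-1}(t)))}\exp(-c_2\Phi(d(x,y),t))$ for $m\otimes m$-a.e. $(x,y)$. - $\mathrm{Grad}(\Psi)$: there are $C_1,c_2\in(0,\infty)$ such that for every $t>0$ and $m$-a.e. $x$, $|\partial p_{t,x}(y)|\le\frac{C_1}{\Psi^{-1}(t)\,m(B(x,\Psi^{-1}(t)))}\exp(-c_2\Phi(d(x,y),t))$ for $\nu$-a.e. $y\in\mathcal S$. *)

theory Defs
  imports "HOL-Analysis.Analysis" "HOL-Probability.Essential_Supremum"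
begin

section \<open>Local trees\<close>

text \<open>
  The space is a whole type of class \<open>heine_borel\<close> (a metric space in which bounded closed sets are
  compact, i.e. a proper metric space) and \<open>second_countable_topology\<close> (equivalent to separability
  for metric spaces).  Maps on an interval \<open>{0..l}\<close> are total functions on the reals
  whose values outside the interval are irrelevant.

  The radius \<open>\<iota>\<close> is an extended real, because \<open>(0, diam]\<close> contains \<open>\<infinity>\<close> for an unbounded space.
\<close>

definition isometry_on_interval :: "real \<Rightarrow> (real \<Rightarrow> 'a::metric_space) \<Rightarrow> bool" where
  "isometry_on_interval l \<phi> \<longleftrightarrow> (\<forall>s\<in>{0..l}. \<forall>t\<in>{0..l}. dist (\<phi> s) (\<phi> t) = \<bar>s - t\<bar>)"

definition geodesic_in :: "'a::metric_space set \<Rightarrow> 'a \<Rightarrow> 'a \<Rightarrow> (real \<Rightarrow> 'a) \<Rightarrow> bool" where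
  "geodesic_in S u v \<phi> \<longleftrightarrow>
     isometry_on_interval (dist u v) \<phi> \<and> \<phi> ` {0..dist u v} \<subseteq> S \<and> \<phi> 0 = u \<and> \<phi> (dist u v) = v"

text \<open>The map \<open>\<phi>\<^bsub>u,v\<^esub>\<close>; on \<open>{0..dist u v}\<close> it is unambiguous whenever \<open>S\<close> is a real tree.\<close>

definition the_geodesic :: "'a::metric_space set \<Rightarrow> 'a \<Rightarrow> 'a \<Rightarrow> real \<Rightarrow> 'a" where
  "the_geodesic S u v = (SOME \<phi>. geodesic_in S u v \<phi>)"

definition real_tree_on :: "'a::metric_space set \<Rightarrow> bool" where
  "real_tree_on S \<longleftrightarrow>
     (\<forall>u\<in>S. \<forall>v\<in>S. \<exists>\<phi>. geodesic_in S u v \<phi> \<and>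
        (\<forall>\<psi>. geodesic_in S u v \<psi> \<longrightarrow> (\<forall>t\<in>{0..dist u v}. \<psi> t = \<phi> t))) \<and>
     (\<forall>\<kappa>::real \<Rightarrow> 'a. continuous_on {0..1} \<kappa> \<and> inj_on \<kappa> {0..1} \<and> \<kappa> ` {0..1} \<subseteq> S \<longrightarrow>
        \<kappa> ` {0..1} = the_geodesic S (\<kappa> 0) (\<kappa> 1) ` {0..dist (\<kappa> 0) (\<kappa> 1)})"

definition geodesic_space :: "'a::metric_space itself \<Rightarrow> bool" where
  "geodesic_space _ \<longleftrightarrow> (\<forall>u v::'a. \<exists>\<phi>. geodesic_in UNIV u v \<phi>)"

definition eball :: "'a::metric_space \<Rightarrow> ereal \<Rightarrow> 'a set" where
  "eball x \<iota> = {y. ereal (dist x y) < \<iota>}"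

text \<open>The library's \<open>diameter\<close> is \<open>0\<close> on unbounded sets, hence the extended supremum.\<close>

definition uniform_local_tree :: "'a::metric_space itself \<Rightarrow> ereal \<Rightarrow> bool" where
  "uniform_local_tree _ \<iota> \<longleftrightarrow>
     0 < \<iota> \<and> \<iota> \<le> (SUP (x::'a, y)\<in>UNIV. ereal (dist x y)) \<and> (\<forall>x::'a. real_tree_on (eball x \<iota>))"

definition open_arc :: "ereal \<Rightarrow> 'a::metric_space \<Rightarrow> 'a \<Rightarrow> 'a set" where
  "open_arc \<iota> x y = the_geodesic (eball x \<iota>) x y ` {0<..<dist x y}"

definition skeleton :: "ereal \<Rightarrow> 'a::metric_space set" where
  "skeleton \<iota> = (\<Union>x. \<Union>y\<in>eball x \<iota>. open_arc \<iota> x y)"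

definition length_measure :: "ereal \<Rightarrow> 'a::metric_space measure \<Rightarrow> bool" where
  "length_measure \<iota> \<nu> \<longleftrightarrow>
     space \<nu> = skeleton \<iota> \<and>
     sets \<nu> = sigma_sets (skeleton \<iota>) {open_arc \<iota> x y |x y. y \<in> eball x \<iota>} \<and>
     (\<forall>x\<in>skeleton \<iota>. \<forall>y\<in>skeleton \<iota>. 0 < dist x y \<and> ereal (dist x y) < \<iota> \<longrightarrow>
        emeasure \<nu> (open_arc \<iota> x y) = ennreal (dist x y))"

definition local_arc_chart :: "ereal \<Rightarrow> real \<Rightarrow> (real \<Rightarrow> 'a::metric_space) \<Rightarrow> bool" where
  "local_arc_chart \<iota> l \<gamma> \<longleftrightarrow>
     0 < l \<and> isometry_on_interval l \<gamma> \<and> (\<exists>x. \<gamma> ` {0..l} \<subseteq> eball x \<iota>)"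


section \<open>Weak gradients\<close>

text \<open>
  The usual epsilon-delta absolute continuity (the library's \<open>absolutely_continuous\<close> is about
  measures); a finite set of pairs lists the end points of the non-overlapping subintervals.
\<close>

definition absolutely_continuous_function_on :: "real \<Rightarrow> real \<Rightarrow> (real \<Rightarrow> real) \<Rightarrow> bool" where
  "absolutely_continuous_function_on a b f \<longleftrightarrow>
     (\<forall>\<epsilon>>0. \<exists>\<delta>>0. \<forall>D. finite D \<and> (\<forall>(s, t)\<in>D. a \<le> s \<and> s \<le> t \<and> t \<le> b) \<and>
        pairwise (\<lambda>(s, t) (s', t'). {s<..<t} \<inter> {s'<..<t'} = {}) D \<and>
        (\<Sum>(s, t)\<in>D. t - s) < \<delta> \<longrightarrow> (\<Sum>(s, t)\<in>D. \<bar>f t - f s\<bar>) < \<epsilon>)"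

definition AC :: "ereal \<Rightarrow> ('a::metric_space \<Rightarrow> real) set" where
  "AC \<iota> = {u. continuous_on UNIV u \<and>
     (\<forall>l \<gamma>. local_arc_chart \<iota> l \<gamma> \<longrightarrow> absolutely_continuous_function_on 0 l (u \<circ> \<gamma>))}"

definition orientation :: "ereal \<Rightarrow> (nat \<Rightarrow> real) \<Rightarrow> (nat \<Rightarrow> real \<Rightarrow> 'a::metric_space) \<Rightarrow> bool" where
  "orientation \<iota> l \<gamma> \<longleftrightarrow>
     (\<forall>n. local_arc_chart \<iota> (l n) (\<gamma> n)) \<and> skeleton \<iota> = (\<Union>n. \<gamma> n ` {0<..<l n})"

text \<open>
  The sets \<open>A\<^sub>n\<close> are given by \<open>disjointed\<close>, so at most one summand is nonzero.  At the
  points where \<open>u \<circ> \<gamma>\<^sub>n\<close> is not differentiable (a null set for \<open>u\<close> in \<open>AC\<close>), \<open>deriv\<close> is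
  an unspecified constant.
\<close>

definition weak_grad ::
  "(nat \<Rightarrow> real) \<Rightarrow> (nat \<Rightarrow> real \<Rightarrow> 'a::metric_space) \<Rightarrow> ('a \<Rightarrow> real) \<Rightarrow> 'a \<Rightarrow> real" where
  "weak_grad l \<gamma> u z =
     (\<Sum>n. indicator (disjointed (\<lambda>n. \<gamma> n ` {0<..<l n}) n) z *
            deriv (u \<circ> \<gamma> n) (the_inv_into {0..l n} (\<gamma> n) z))"


section \<open>The Dirichlet form\<close>

definition L2 :: "'a measure \<Rightarrow> ('a \<Rightarrow> real) set" where
  "L2 M = {f. f \<in> borel_measurable M \<and> integrable M (\<lambda>x. (f x)\<^sup>2)}"

definition L2_norm :: "'a measure \<Rightarrow> ('a \<Rightarrow> real) \<Rightarrow> real" where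
  "L2_norm M f = sqrt (\<integral>x. (f x)\<^sup>2 \<partial>M)"

definition radon_measure :: "'a::metric_space measure \<Rightarrow> bool" where
  "radon_measure m \<longleftrightarrow>
     sets m = sets borel \<and> (\<forall>K. compact K \<longrightarrow> emeasure m K < \<infinity>) \<and>
     (\<forall>A\<in>sets borel. emeasure m A = (SUP K\<in>{K. compact K \<and> K \<subseteq> A}. emeasure m K))"

definition UVG :: "'a::metric_space measure \<Rightarrow> (real \<Rightarrow> real) \<Rightarrow> bool" where
  "UVG m V \<longleftrightarrow>
     (\<forall>r\<ge>0. 0 \<le> V r) \<and> mono_on {0..} V \<and>
     (\<exists>C\<ge>1. \<forall>x. \<forall>r>0. 0 < inverse C * V r \<and>
        ennreal (inverse C * V r) \<le> emeasure m (ball x r) \<and>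
        emeasure m (ball x r) \<le> ennreal (C * V r) \<and> V (2 * r) \<le> C * V r)"

text \<open>
  Elements of the domain are represented by their versions in \<open>AC\<close>: \<open>form_domain\<close> is the set of
  these versions, and a square integrable function is in the domain of the form iff it agrees a.e.
  with an element of \<open>form_domain\<close>.  In what follows \<open>m\<close> is the reference measure, \<open>\<nu>\<close> the length
  measure, and \<open>l\<close>, \<open>\<gamma>\<close> the orientation.
\<close>

definition form_domain ::
  "ereal \<Rightarrow> 'a::metric_space measure \<Rightarrow> 'a measure \<Rightarrow> (nat \<Rightarrow> real) \<Rightarrow> (nat \<Rightarrow> real \<Rightarrow> 'a) \<Rightarrow>
     ('a \<Rightarrow> real) set" where
  "form_domain \<iota> m \<nu> l \<gamma> = {u \<in> AC \<iota>. u \<in> L2 m \<and> weak_grad l \<gamma> u \<in> L2 \<nu>}"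

definition energy ::
  "'a::metric_space measure \<Rightarrow> (nat \<Rightarrow> real) \<Rightarrow> (nat \<Rightarrow> real \<Rightarrow> 'a) \<Rightarrow>
     ('a \<Rightarrow> real) \<Rightarrow> ('a \<Rightarrow> real) \<Rightarrow> real" where
  "energy \<nu> l \<gamma> u v = (\<integral>z. weak_grad l \<gamma> u z * weak_grad l \<gamma> v z \<partial>\<nu>)"


section \<open>The heat semigroup and the heat kernel\<close>

text \<open>
  The operator associated with the form, as a relation between representatives: \<open>u\<close> is in its
  domain and is mapped to \<open>f\<close> iff the form \<open>\<E>(u,v)\<close> equals \<open>- \<integral> f v dm\<close> for all \<open>v\<close>
  in the domain of the form.
\<close>

definition laplacian ::
  "ereal \<Rightarrow> 'a::metric_space measure \<Rightarrow> 'a measure \<Rightarrow> (nat \<Rightarrow> real) \<Rightarrow> (nat \<Rightarrow> real \<Rightarrow> 'a) \<Rightarrow>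
     ('a \<Rightarrow> real) \<Rightarrow> ('a \<Rightarrow> real) \<Rightarrow> bool" where
  "laplacian \<iota> m \<nu> l \<gamma> u f \<longleftrightarrow> u \<in> L2 m \<and> f \<in> L2 m \<and>
     (\<exists>w\<in>form_domain \<iota> m \<nu> l \<gamma>. (AE x in m. u x = w x) \<and>
        (\<forall>v\<in>form_domain \<iota> m \<nu> l \<gamma>. energy \<nu> l \<gamma> w v = - (\<integral>x. f x * v x \<partial>m)))"

text \<open>
  \<open>P\<^sub>t = e\<^bsup>tA\<^esup>\<close>: the strongly continuous contraction semigroup on \<open>L\<^sup>2(M)\<close> whose infinitesimal
  generator is exactly \<open>A\<close> (domain included); it is determined by \<open>A\<close> up to null sets.
  Operators act on representatives; linearity and the contraction property make them well defined
  on classes modulo null sets.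
\<close>

definition semigroup_generated_by ::
  "'a measure \<Rightarrow> (('a \<Rightarrow> real) \<Rightarrow> ('a \<Rightarrow> real) \<Rightarrow> bool) \<Rightarrow>
     (real \<Rightarrow> ('a \<Rightarrow> real) \<Rightarrow> 'a \<Rightarrow> real) \<Rightarrow> bool" where
  "semigroup_generated_by M A P \<longleftrightarrow>
     (\<forall>t\<ge>0. \<forall>f\<in>L2 M. P t f \<in> L2 M \<and> L2_norm M (P t f) \<le> L2_norm M f) \<and>
     (\<forall>t\<ge>0. \<forall>f\<in>L2 M. \<forall>g\<in>L2 M. \<forall>a b.
        AE x in M. P t (\<lambda>y. a * f y + b * g y) x = a * P t f x + b * P t g x) \<and>
     (\<forall>f\<in>L2 M. AE x in M. P 0 f x = f x) \<and>
     (\<forall>s\<ge>0. \<forall>t\<ge>0. \<forall>f\<in>L2 M. AE x in M. P (s + t) f x = P s (P t f) x) \<and>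
     (\<forall>f\<in>L2 M. ((\<lambda>t. L2_norm M (\<lambda>x. P t f x - f x)) \<longlongrightarrow> 0) (at_right 0)) \<and>
     (\<forall>u\<in>L2 M. \<forall>f\<in>L2 M. A u f \<longleftrightarrow>
        ((\<lambda>t. L2_norm M (\<lambda>x. (P t u x - u x) / t - f x)) \<longlongrightarrow> 0) (at_right 0))"

definition heat_kernel ::
  "'a::metric_space measure \<Rightarrow> (real \<Rightarrow> ('a \<Rightarrow> real) \<Rightarrow> 'a \<Rightarrow> real) \<Rightarrow>
     (real \<Rightarrow> 'a \<Rightarrow> 'a \<Rightarrow> real) \<Rightarrow> bool" where
  "heat_kernel m P p \<longleftrightarrow>
     (\<forall>t>0. \<forall>f\<in>L2 m. AE x in m.
        integrable m (\<lambda>y. p t x y * f y) \<and> P t f x = (\<integral>y. p t x y * f y \<partial>m))"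


section \<open>Harmonic functions and the reverse Hoelder inequality\<close>

definition L2_loc :: "'a::metric_space measure \<Rightarrow> ('a \<Rightarrow> real) set" where
  "L2_loc m = {u. u \<in> borel_measurable m \<and>
     (\<forall>K. compact K \<longrightarrow> set_integrable m K (\<lambda>x. (u x)\<^sup>2))}"

definition form_domain_loc ::
  "ereal \<Rightarrow> 'a::metric_space measure \<Rightarrow> 'a measure \<Rightarrow> (nat \<Rightarrow> real) \<Rightarrow> (nat \<Rightarrow> real \<Rightarrow> 'a) \<Rightarrow>
     ('a \<Rightarrow> real) set" where
  "form_domain_loc \<iota> m \<nu> l \<gamma> = {u \<in> L2_loc m.
     \<forall>U. open U \<and> compact (closure U) \<longrightarrow>
       (\<exists>v\<in>form_domain \<iota> m \<nu> l \<gamma>. AE x in m. x \<in> U \<longrightarrow> u x = v x)}"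

text \<open>
  The gradient of a function \<open>u\<close> in \<open>form_domain_loc\<close> is the \<open>\<nu>\<close>-a.e. unique measurable
  function that agrees on every relatively compact open \<open>U\<close> with the gradient of any element of
  \<open>form_domain\<close> equal to \<open>u\<close> on \<open>U\<close>.
\<close>

definition weak_grad_loc ::
  "ereal \<Rightarrow> 'a::metric_space measure \<Rightarrow> 'a measure \<Rightarrow> (nat \<Rightarrow> real) \<Rightarrow> (nat \<Rightarrow> real \<Rightarrow> 'a) \<Rightarrow>
     ('a \<Rightarrow> real) \<Rightarrow> 'a \<Rightarrow> real" where
  "weak_grad_loc \<iota> m \<nu> l \<gamma> u = (SOME g. g \<in> borel_measurable \<nu> \<and>
     (\<forall>U. open U \<and> compact (closure U) \<longrightarrow>
       (\<forall>v\<in>form_domain \<iota> m \<nu> l \<gamma>. (AE x in m. x \<in> U \<longrightarrow> u x = v x) \<longrightarrow>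
          (AE z in \<nu>. z \<in> U \<longrightarrow> g z = weak_grad l \<gamma> v z))))"

definition harmonic_on ::
  "ereal \<Rightarrow> 'a::metric_space measure \<Rightarrow> 'a measure \<Rightarrow> (nat \<Rightarrow> real) \<Rightarrow> (nat \<Rightarrow> real \<Rightarrow> 'a) \<Rightarrow>
     'a set \<Rightarrow> ('a \<Rightarrow> real) \<Rightarrow> bool" where
  "harmonic_on \<iota> m \<nu> l \<gamma> \<Omega> h \<longleftrightarrow>
     open \<Omega> \<and> \<Omega> \<noteq> {} \<and> h \<in> form_domain_loc \<iota> m \<nu> l \<gamma> \<and>
     (\<forall>\<phi>\<in>form_domain \<iota> m \<nu> l \<gamma>.
        compact (closure {x. \<phi> x \<noteq> 0}) \<and> closure {x. \<phi> x \<noteq> 0} \<subseteq> \<Omega> \<longrightarrow>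
        (\<integral>z. weak_grad_loc \<iota> m \<nu> l \<gamma> h z * weak_grad l \<gamma> \<phi> z \<partial>\<nu>) = 0)"

definition RH ::
  "ereal \<Rightarrow> 'a::metric_space measure \<Rightarrow> 'a measure \<Rightarrow> (nat \<Rightarrow> real) \<Rightarrow> (nat \<Rightarrow> real \<Rightarrow> 'a) \<Rightarrow> bool" where
  "RH \<iota> m \<nu> l \<gamma> \<longleftrightarrow>
     (\<exists>A>1. \<exists>C>1. \<forall>x. \<forall>r>0. \<forall>h. harmonic_on \<iota> m \<nu> l \<gamma> (ball x (A * r)) h \<longrightarrow>
        esssup (restrict_space \<nu> (ball x r)) (\<lambda>z. ennreal \<bar>weak_grad_loc \<iota> m \<nu> l \<gamma> h z\<bar>)
          \<le> ennreal (C / r * (1 / measure m (ball x (A * r)) * (LINT y:ball x (A * r)|m. \<bar>h y\<bar>))))"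


section \<open>Heat kernel conditions\<close>

definition scale_function :: "(real \<Rightarrow> real) \<Rightarrow> bool" where
  "scale_function \<Psi> \<longleftrightarrow>
     continuous_on {0<..} \<Psi> \<and> strict_mono_on {0<..} \<Psi> \<and> bij_betw \<Psi> {0<..} {0<..} \<and>
     (\<exists>C \<beta>\<^sub>1 \<beta>\<^sub>2. 1 < C \<and> 1 < \<beta>\<^sub>1 \<and> \<beta>\<^sub>1 \<le> \<beta>\<^sub>2 \<and>
        (\<forall>r R. 0 < r \<and> r \<le> R \<longrightarrow>
           inverse C * (R / r) powr \<beta>\<^sub>1 \<le> \<Psi> R / \<Psi> r \<and> \<Psi> R / \<Psi> r \<le> C * (R / r) powr \<beta>\<^sub>2))"

definition scale_inverse :: "(real \<Rightarrow> real) \<Rightarrow> real \<Rightarrow> real" where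
  "scale_inverse \<Psi> = the_inv_into {0<..} \<Psi>"

text \<open>For a scale function and \<open>R \<ge> 0\<close>, \<open>t > 0\<close> the supremum is over a set that is bounded above,
  because the lower exponent exceeds \<open>1\<close>.\<close>

definition scale_rate :: "(real \<Rightarrow> real) \<Rightarrow> real \<Rightarrow> real \<Rightarrow> real" where
  "scale_rate \<Psi> R t = (SUP r\<in>{0<..}. R / r - t / \<Psi> r)"

definition UHK ::
  "'a::metric_space measure \<Rightarrow> (real \<Rightarrow> 'a \<Rightarrow> 'a \<Rightarrow> real) \<Rightarrow> (real \<Rightarrow> real) \<Rightarrow> bool" where
  "UHK m p \<Psi> \<longleftrightarrow>
     (\<exists>C>0. \<exists>c>0. \<forall>t>0. AE (x, y) in m \<Otimes>\<^sub>M m.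
        p t x y \<le> C / measure m (ball x (scale_inverse \<Psi> t)) * exp (- c * scale_rate \<Psi> (dist x y) t))"

definition Grad ::
  "'a::metric_space measure \<Rightarrow> 'a measure \<Rightarrow> (nat \<Rightarrow> real) \<Rightarrow> (nat \<Rightarrow> real \<Rightarrow> 'a) \<Rightarrow>
     (real \<Rightarrow> 'a \<Rightarrow> 'a \<Rightarrow> real) \<Rightarrow> (real \<Rightarrow> real) \<Rightarrow> bool" where
  "Grad m \<nu> l \<gamma> p \<Psi> \<longleftrightarrow>
     (\<exists>C>0. \<exists>c>0. \<forall>t>0. AE x in m. AE y in \<nu>.
        \<bar>weak_grad l \<gamma> (p t x) y\<bar> \<le>
          C / (scale_inverse \<Psi> t * measure m (ball x (scale_inverse \<Psi> t))) *
          exp (- c * scale_rate \<Psi> (dist x y) t))"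

end

theory Submission
  imports Defs
begin

text \<open>
  The kernel \<open>u = p\<^sub>t(x, \<cdot>)\<close> solves \<open>\<Delta>u = f\<close> with \<open>f = \<partial>\<^sub>t p\<^sub>t(x, \<cdot>)\<close>.  Since \<open>s \<mapsto> \<langle>P\<^sub>s g, g\<rangle>\<close> is
  completely monotone, its second differences are of order \<open>h\<^sup>2 / s\<^sup>2\<close>; together with the upper bound
  on \<open>p\<close> and \<open>p \<ge> 0\<close>, an interpolation of \<open>f\<close> between \<open>p\<close> and its second time differences shows that
  \<open>t f\<close> satisfies the same kind of upper bound as \<open>p\<close>.

  On a ball of radius \<open>r\<close> one finds \<open>v\<close> with \<open>\<Delta>v = f\<close> there, \<open>\<bar>v\<bar> \<le> C \<Psi>(r) sup \<bar>f\<bar>\<close> and energy at most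
  \<open>C \<Psi>(r) V(r) (sup \<bar>f\<bar>)\<^sup>2\<close>: take \<open>v = \<integral>\<^sub>0\<^sup>T P\<^sub>s g ds\<close> with \<open>T\<close> a large multiple of \<open>\<Psi>(r)\<close> and \<open>g\<close> supported
  in the ball with \<open>g = P\<^sub>T g - f\<close> on it, which is a contraction by the upper bound and reverse volume doubling.
  For the corrections \<open>v\<^sub>j\<close> on concentric balls of radii \<open>2\<^sup>-\<^sup>j R\<close>, the functions \<open>u - v\<^sub>0\<close> and
  \<open>v\<^sub>j - v\<^sub>j\<^sub>+\<^sub>1\<close> are harmonic, and the reverse Hoelder inequality bounds their gradients by a series that
  converges because the lower exponent of \<open>\<Psi>\<close> exceeds \<open>1\<close>.  The gradient of \<open>v\<^sub>J\<close> tends to \<open>0\<close> in measure.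
  With \<open>R\<close> comparable to \<open>\<Psi>\<^sup>-\<^sup>1(t)\<close> this is the assertion.
\<close>

section \<open>Differentiability of absolutely continuous functions\<close>

text \<open>Of the semigroup only contraction and the generator are given. Symmetry, positivity, the
  pointwise semigroup identity and the time derivative of the kernel have to be extracted from the
  generator; statements about \<open>P\<close> hold up to null sets until continuity of
  \<open>p\<close> and averages over small balls make them pointwise. Gradients are classical
  derivatives along charts, and \<open>deriv\<close> is an unspecified number where no derivative
  exists. Even linearity of the gradient therefore rests on almost everywhere differentiability of
  absolutely continuous functions, where the development starts. The corrections are controlled in
  sup norm and in energy only, which says nothing pointwise about their gradients; this is why all
  dyadic radii are visited. Each halving costs a factor 2 in \<open>1 / r\<close> and gains the
  factor \<open>(1/2) powr \<beta>\<^sub>1\<close> from \<Psi>. A Green function on the whole space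
  need not exist (the line is recurrent), hence the finite time T. The constant in the exponent
  shrinks twice: interpolation takes a square root of the off-diagonal factor, and moving to a
  neighbouring point rescales the rate.\<close>

lemma AE_differentiable_integral:
  fixes g F :: "real \<Rightarrow> real"
  assumes g: "integrable lborel g"
    and F: "\<And>a b. a \<le> b \<Longrightarrow> F b - F a = integral {a..b} g"
  shows "AE x in lborel. F differentiable (at x)"
proof -
  have gi: "g integrable_on UNIV"
    using integrable_on_lborel[OF g] by simp
  \<comment> \<open>Lebesgue points are obtained below for averages over intervals to the right of
    x. Left difference quotients of \<open>F\<close> at x become right averages of the reflected
    function at -x.\<close>
  have gi2: "(\<lambda>x. g (- x)) integrable_on UNIV"
    using integrable_on_lborel[OF lborel_integrable_real_affine[OF g, of "-1" 0]] by simp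
  obtain N1 where N1: "negligible N1"
    "\<And>x e. \<lbrakk>x \<notin> N1; 0 < e\<rbrakk> \<Longrightarrow> \<exists>d>0. \<forall>h. 0 < h \<and> h < d \<longrightarrow>
       norm (integral (cbox x (x + h *\<^sub>R One)) g /\<^sub>R h ^ DIM(real) - g x) < e"
    using integrable_ccontinuous_explicit[of g] integrable_on_subcbox[OF gi] by (metis subset_UNIV)
  obtain N2 where N2: "negligible N2"
    "\<And>x e. \<lbrakk>x \<notin> N2; 0 < e\<rbrakk> \<Longrightarrow> \<exists>d>0. \<forall>h. 0 < h \<and> h < d \<longrightarrow>
       norm (integral (cbox x (x + h *\<^sub>R One)) (\<lambda>x. g (- x)) /\<^sub>R h ^ DIM(real) - g (- x)) < e"
    using integrable_ccontinuous_explicit[of "\<lambda>x. g (-x)"] integrable_on_subcbox[OF gi2] by (metis subset_UNIV)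
  have *: "F differentiable (at x)" if x: "x \<notin> N1" "- x \<notin> N2" for x
  proof -
    have "((\<lambda>h. (F (x + h) - F x) / h) \<longlongrightarrow> g x) (at 0)"
    proof (rule LIM_I)
      fix e :: real assume e: "0 < e"
      obtain d1 where d1: "d1 > 0" "\<And>h. 0 < h \<Longrightarrow> h < d1 \<Longrightarrow>
         norm (integral (cbox x (x + h *\<^sub>R One)) g /\<^sub>R h ^ DIM(real) - g x) < e"
        using N1(2)[OF x(1) e] by blast
      obtain d2 where d2: "d2 > 0" "\<And>h. 0 < h \<Longrightarrow> h < d2 \<Longrightarrow>
         norm (integral (cbox (-x) (-x + h *\<^sub>R One)) (\<lambda>x. g (- x)) /\<^sub>R h ^ DIM(real) - g x) < e"
        using N2(2)[OF x(2) e] by auto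
      have "norm ((F (x + h) - F x) / h - g x) < e" if h: "h \<noteq> 0" "norm h < min d1 d2" for h
      proof (cases "0 < h")
        case True
        then have "F (x + h) - F x = integral (cbox x (x + h *\<^sub>R One)) g"
          using F[of x "x+h"] by simp
        then show ?thesis using d1(2)[of h] True h by (simp add: divide_inverse mult.commute)
      next
        case False
        define k where "k = - h"
        have k: "0 < k" "k < d2" using False h by (auto simp: k_def)
        have "F x - F (x - k) = integral {x-k..x} g" using F[of "x-k" x] k by simp
        also have "\<dots> = integral {-x..-(x-k)} (\<lambda>x. g (- x))"
          using Henstock_Kurzweil_Integration.integral_reflect_real[of x "x-k" g] by simp
        also have "\<dots> = integral (cbox (-x) (-x + k *\<^sub>R One)) (\<lambda>x. g (- x))" by (simp add: algebra_simps)
        finally have "(F (x + h) - F x) / h = integral (cbox (-x) (-x + k *\<^sub>R One)) (\<lambda>x. g (- x)) /\<^sub>R k"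
          using k by (simp add: k_def field_simps)
        then show ?thesis using d2(2)[of k] k by simp
      qed
      then show "\<exists>s>0. \<forall>h. h \<noteq> 0 \<and> norm (h - 0) < s \<longrightarrow> norm ((F (x + h) - F x) / h - g x) < e"
        using d1 d2 by (intro exI[of _ "min d1 d2"]) auto
    qed
    then show ?thesis
      by (auto simp: real_differentiable_def DERIV_def)
  qed
  have "negligible (N1 \<union> uminus ` N2)"
    using N1(1) N2(1) by (intro negligible_Un negligible_differentiable_image_negligible)
      (auto intro!: differentiable_on_minus)
  then have "AE x in lebesgue. x \<notin> N1 \<union> uminus ` N2"
    by (intro AE_not_in) (simp add: negligible_iff_null_sets)
  then have "AE x in lebesgue. F differentiable (at x)"
    apply (rule AE_mp) apply (rule AE_I2) using * by (metis UnI1 UnI2 image_eqI minus_minus)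
  then show ?thesis
    by (simp add: AE_completion_iff)
qed

text \<open>Radon-Nikodym: the Stieltjes measure of \<open>F\<close> has a density with respect to
  Lebesgue measure. Boundedness of \<open>F\<close> makes its total mass finite, so the density is
  integrable and \<open>F\<close> is its indefinite integral.\<close>

lemma AE_differentiable_mono_ac:
  fixes F :: "real \<Rightarrow> real"
  assumes mono: "mono F" and cont: "continuous_on UNIV F"
    and bdd: "\<And>x. \<bar>F x\<bar> \<le> B"
    and ac: "absolutely_continuous lborel (interval_measure F)"
  shows "AE x in lborel. F differentiable (at x)"
proof -
  have m: "\<And>x y. x \<le> y \<Longrightarrow> F x \<le> F y" using mono by (rule monoD)
  have rc: "\<And>a. continuous (at_right a) F"
    using cont by (simp add: continuous_at_imp_continuous_within continuous_on_eq_continuous_at)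
  have Ioc: "emeasure (interval_measure F) {a<..b} = F b - F a" if "a \<le> b" for a b
    using emeasure_interval_measure_Ioc[OF that m rc] by simp
  obtain g where g: "g \<in> borel_measurable lborel" "density lborel g = interval_measure F"
    using sigma_finite_measure.Radon_Nikodym[OF sigma_finite_lborel ac] by auto
  have tot: "emeasure (interval_measure F) UNIV \<le> ennreal (2 * B)"
  proof -
    have "(\<lambda>n::nat. emeasure (interval_measure F) {-real n<..real n}) \<longlonglongrightarrow> emeasure (interval_measure F) (\<Union>n::nat. {-real n<..real n})"
      by (intro Lim_emeasure_incseq) (auto simp: incseq_def)
    moreover have "(\<Union>n::nat. {-real n<..real n}) = UNIV"
    proof -
      have "\<exists>n::nat. -real n < x \<and> x \<le> real n" for x
        using reals_Archimedean2[of "\<bar>x\<bar>"] by (metis abs_less_iff less_eq_real_def minus_less_iff)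
      then show ?thesis by auto
    qed
    ultimately have "(\<lambda>n::nat. emeasure (interval_measure F) {-real n<..real n}) \<longlonglongrightarrow> emeasure (interval_measure F) UNIV" by simp
    moreover have "emeasure (interval_measure F) {-real n<..real n} \<le> ennreal (2 * B)" for n
      using bdd[of "-real n"] bdd[of "real n"] by (subst Ioc) (auto intro!: ennreal_leI)
    ultimately show ?thesis by (meson LIMSEQ_le_const2)
  qed
  have fin: "(\<integral>\<^sup>+ x. g x \<partial>lborel) \<le> ennreal (2 * B)"
  proof -
    have "emeasure (density lborel g) UNIV = (\<integral>\<^sup>+ x. g x \<partial>lborel)"
      using g by (subst emeasure_density) auto
    then show ?thesis using tot g by simp
  qed
  define h where "h x = enn2real (g x)" for x
  have hm[measurable]: "h \<in> borel_measurable lborel" unfolding h_def using g by measurable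
  have ae: "AE x in lborel. g x \<noteq> \<infinity>"
    using fin g by (intro nn_integral_noteq_infinite) (auto simp: top_unique)
  have gh: "AE x in lborel. ennreal (h x) = g x"
    using ae by eventually_elim (simp add: h_def less_top)
  have hint: "integrable lborel h"
  proof (rule integrableI_bounded)
    have "(\<integral>\<^sup>+ x. ennreal (norm (h x)) \<partial>lborel) = (\<integral>\<^sup>+ x. g x \<partial>lborel)"
      using gh by (intro nn_integral_cong_AE) (auto simp: h_def elim!: eventually_mono)
    then show "(\<integral>\<^sup>+ x. ennreal (norm (h x)) \<partial>lborel) < \<infinity>"
      using fin by (simp add: le_less_trans)
  qed (rule hm)
  show ?thesis
  proof (rule AE_differentiable_integral[OF hint])
    fix a b :: real assume ab: "a \<le> b"
    have si: "set_integrable lborel {a..b} h"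
      unfolding set_integrable_def using hint by (intro integrable_mult_indicator) auto
    have "ennreal (F b - F a) = emeasure (density lborel g) {a<..b}"
      using g Ioc[OF ab] by simp
    also have "\<dots> = (\<integral>\<^sup>+ x. g x * indicator {a<..b} x \<partial>lborel)"
      using g by (subst emeasure_density) auto
    also have "\<dots> = (\<integral>\<^sup>+ x. ennreal (indicator {a..b} x * h x) \<partial>lborel)"
    proof (rule nn_integral_cong_AE)
      have "AE x in lborel. x \<noteq> a" by (rule AE_lborel_singleton)
      then show "AE x in lborel. g x * indicator {a<..b} x = ennreal (indicator {a..b} x * h x)"
        using gh by eventually_elim (auto simp: indicator_def)
    qed
    also have "\<dots> = ennreal (\<integral>x. indicator {a..b} x * h x \<partial>lborel)"
      using si by (intro nn_integral_eq_integral) (auto simp: set_integrable_def h_def)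
    also have "(\<integral>x. indicator {a..b} x * h x \<partial>lborel) = integral {a..b} h"
      using set_borel_integral_eq_integral(2)[OF si] by (simp add: set_lebesgue_integral_def)
    finally show "F b - F a = integral {a..b} h"
      using m[OF ab] by (subst (asm) ennreal_inj) (auto intro!: integral_nonneg set_borel_integral_eq_integral(1)[OF si] simp: h_def)
  qed
qed

section \<open>Finite families of intervals and their signed increments\<close>

definition nonoverlapping_in :: "(real \<times> real) set \<Rightarrow> real \<Rightarrow> real \<Rightarrow> bool" where
  "nonoverlapping_in D a b \<longleftrightarrow> finite D \<and> (\<forall>(s, t)\<in>D. a \<le> s \<and> s < t \<and> t \<le> b) \<and>
     pairwise (\<lambda>(s, t) (s', t'). {s<..<t} \<inter> {s'<..<t'} = {}) D"

definition increment_sum :: "(real \<Rightarrow> real) \<Rightarrow> (real \<times> real) set \<Rightarrow> real" where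
  "increment_sum f D = (\<Sum>(s, t)\<in>D. f t - f s)"

lemma nonoverlapping_in_mono:
  "nonoverlapping_in D a b \<Longrightarrow> c \<le> a \<Longrightarrow> b \<le> d \<Longrightarrow> nonoverlapping_in D c d"
  unfolding nonoverlapping_in_def by force

lemma nonoverlapping_inD:
  assumes "nonoverlapping_in D a b" "(s, t) \<in> D" "(s', t') \<in> D" "s < z" "z < t" "s' < z" "z < t'"
  shows "s = s' \<and> t = t'"
proof (rule ccontr)
  assume "\<not> ?thesis"
  then have "{s<..<t} \<inter> {s'<..<t'} = {}"
    using assms(1-3) unfolding nonoverlapping_in_def pairwise_def by fastforce
  then show False using assms by auto
qed

lemma nonoverlapping_inI:
  assumes "finite D" "\<And>s t. (s, t) \<in> D \<Longrightarrow> a \<le> s \<and> s < t \<and> t \<le> b"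
    "\<And>s t s' t' z. (s, t) \<in> D \<Longrightarrow> (s', t') \<in> D \<Longrightarrow> s < z \<Longrightarrow> z < t \<Longrightarrow> s' < z \<Longrightarrow> z < t' \<Longrightarrow> s = s' \<and> t = t'"
  shows "nonoverlapping_in D a b"
  unfolding nonoverlapping_in_def
proof (intro conjI pairwiseI)
  fix p q assume pq: "p \<in> D" "q \<in> D" "p \<noteq> q"
  obtain s t s' t' where [simp]: "p = (s, t)" "q = (s', t')" by (cases p, cases q)
  have "{s<..<t} \<inter> {s'<..<t'} = {}"
    using assms(3)[of s t s' t'] pq by fastforce
  then show "(case p of (s, t) \<Rightarrow> \<lambda>(s', t'). {s<..<t} \<inter> {s'<..<t'} = {}) q" by auto
qed (use assms in auto)

lemma nonoverlapping_in_Un: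
  assumes D: "nonoverlapping_in D a b" and E: "nonoverlapping_in E b c" and ab: "a \<le> b" "b \<le> c"
  shows "nonoverlapping_in (D \<union> E) a c" "increment_sum f (D \<union> E) = increment_sum f D + increment_sum f E"
proof -
  show "nonoverlapping_in (D \<union> E) a c"
  proof (rule nonoverlapping_inI)
    fix s t s' t' z assume A: "(s, t) \<in> D \<union> E" "(s', t') \<in> D \<union> E" "s < z" "z < t" "s' < z" "z < t'"
    have *: "t \<le> b" if "(s,t) \<in> D" for s t using that D unfolding nonoverlapping_in_def by auto
    have **: "b \<le> s" if "(s,t) \<in> E" for s t using that E unfolding nonoverlapping_in_def by auto
    show "s = s' \<and> t = t'"
      using A nonoverlapping_inD[OF D] nonoverlapping_inD[OF E] * ** by (smt (verit) Un_iff)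
  qed (use D E ab in \<open>auto simp: nonoverlapping_in_def\<close>)
  have "D \<inter> E = {}"
    using D E unfolding nonoverlapping_in_def by fastforce
  then show "increment_sum f (D \<union> E) = increment_sum f D + increment_sum f E"
    unfolding increment_sum_def using D E by (intro sum.union_disjoint) (auto simp: nonoverlapping_in_def)
qed

text \<open>Intervals that straddle \<open>b\<close> are cut there: \<open>l\<close> clips right
  ends, \<open>r\<close> clips left ends. Signed increments telescope across the cut, so the sum is
  preserved exactly and for all functions at once.\<close>

lemma nonoverlapping_in_split:
  assumes D: "nonoverlapping_in D a c"
  obtains D1 D2 where "nonoverlapping_in D1 a b" "nonoverlapping_in D2 b c"
    "\<And>f. increment_sum f D = increment_sum f D1 + increment_sum f D2"
proof -
  have fin: "finite D" and st: "\<And>s t. (s, t) \<in> D \<Longrightarrow> a \<le> s \<and> s < t \<and> t \<le> c"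
    using D unfolding nonoverlapping_in_def by auto
  define l where "l = (\<lambda>(s::real, t). (s, min t b))"
  define r where "r = (\<lambda>(s, t::real). (max s b, t))"
  define L where "L = {p \<in> D. fst p < b}"
  define R where "R = {p \<in> D. b < snd p}"
  \<comment> \<open>Two intervals clipped to the same pair share their left end, hence overlap just
    to the right of it and must coincide; \<open>injr\<close> is the mirror image.\<close>
  have injl: "inj_on l L"
  proof (rule inj_onI)
    fix p q assume pq: "p \<in> L" "q \<in> L" "l p = l q"
    obtain s t s' t' where [simp]: "p = (s, t)" "q = (s', t')" by (cases p, cases q)
    have "s = s'" "s < min t (min t' b)" using pq st by (auto simp: l_def L_def)
    then have "\<exists>z. s < z \<and> z < t \<and> z < t'" using dense[of s "min t (min t' b)"] by auto
    then show "p = q" using nonoverlapping_inD[OF D, of s t s' t'] pq \<open>s = s'\<close> by (auto simp: L_def)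
  qed
  have injr: "inj_on r R"
  proof (rule inj_onI)
    fix p q assume pq: "p \<in> R" "q \<in> R" "r p = r q"
    obtain s t s' t' where [simp]: "p = (s, t)" "q = (s', t')" by (cases p, cases q)
    have "t = t'" "max s (max s' b) < t" using pq st by (auto simp: r_def R_def)
    then have "\<exists>z. s < z \<and> s' < z \<and> z < t" using dense[of "max s (max s' b)" t] by auto
    then show "p = q" using nonoverlapping_inD[OF D, of s t s' t'] pq \<open>t = t'\<close> by (auto simp: R_def)
  qed
  have 1: "nonoverlapping_in (l ` L) a b"
  proof (rule nonoverlapping_inI)
    fix s t s' t' z assume A: "(s, t) \<in> l ` L" "(s', t') \<in> l ` L" "s < z" "z < t" "s' < z" "z < t'"
    then obtain u v where uv: "(s, u) \<in> L" "t = min u b" "(s', v) \<in> L" "t' = min v b"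
      by (auto simp: l_def split: prod.splits)
    then show "s = s' \<and> t = t'" using nonoverlapping_inD[OF D, of s u s' v z] A by (auto simp: L_def)
  qed (use fin st in \<open>auto simp: L_def l_def\<close>)
  have 2: "nonoverlapping_in (r ` R) b c"
  proof (rule nonoverlapping_inI)
    fix s t s' t' z assume A: "(s, t) \<in> r ` R" "(s', t') \<in> r ` R" "s < z" "z < t" "s' < z" "z < t'"
    then obtain u v where uv: "(u, t) \<in> R" "s = max u b" "(v, t') \<in> R" "s' = max v b"
      by (auto simp: r_def split: prod.splits)
    then show "s = s' \<and> t = t'" using nonoverlapping_inD[OF D, of u t v t' z] A by (auto simp: R_def)
  qed (use fin st in \<open>auto simp: R_def r_def\<close>)
  have "increment_sum f D = increment_sum f (l ` L) + increment_sum f (r ` R)" for f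
  proof -
    have "increment_sum f D = (\<Sum>(s, t)\<in>D. (f (min t b) - f (min s b)) + (f (max t b) - f (max s b)))"
      unfolding increment_sum_def by (rule sum.cong) (auto simp: min_def max_def)
    also have "\<dots> = (\<Sum>(s, t)\<in>D. f (min t b) - f (min s b)) + (\<Sum>(s, t)\<in>D. f (max t b) - f (max s b))"
      by (simp add: sum.distrib case_prod_unfold)
    also have "(\<Sum>(s, t)\<in>D. f (min t b) - f (min s b)) = (\<Sum>(s, t)\<in>L. f (min t b) - f (min s b))"
      using fin by (intro sum.mono_neutral_right ballI) (auto simp: L_def min_def, use st in force)
    also have "\<dots> = increment_sum f (l ` L)"
      unfolding increment_sum_def sum.reindex[OF injl] by (rule sum.cong) (auto simp: l_def L_def)
    also have "(\<Sum>(s, t)\<in>D. f (max t b) - f (max s b)) = (\<Sum>(s, t)\<in>R. f (max t b) - f (max s b))"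
      using fin by (intro sum.mono_neutral_right ballI) (auto simp: R_def max_def, use st in force)
    also have "\<dots> = increment_sum f (r ` R)"
      unfolding increment_sum_def sum.reindex[OF injr] by (rule sum.cong) (auto simp: r_def R_def)
    finally show ?thesis .
  qed
  with 1 2 show ?thesis using that by blast
qed

lemma nonoverlapping_in_UNION:
  assumes D: "nonoverlapping_in D a b" and E: "\<And>s t. (s, t) \<in> D \<Longrightarrow> nonoverlapping_in (E (s, t)) s t"
  shows "nonoverlapping_in (\<Union>(E ` D)) a b"
    "increment_sum f (\<Union>(E ` D)) = (\<Sum>p\<in>D. increment_sum f (E p))"
proof -
  have fin: "finite D" and st: "\<And>s t. (s, t) \<in> D \<Longrightarrow> a \<le> s \<and> s < t \<and> t \<le> b"
    using D unfolding nonoverlapping_in_def by auto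
  have finE: "\<And>p. p \<in> D \<Longrightarrow> finite (E p)" using E unfolding nonoverlapping_in_def by auto
  have E': "s \<le> u \<and> u < v \<and> v \<le> t" if "(s, t) \<in> D" "(u, v) \<in> E (s, t)" for s t u v
    using E[OF that(1)] that(2) unfolding nonoverlapping_in_def by auto
  show "nonoverlapping_in (\<Union>(E ` D)) a b"
  proof (rule nonoverlapping_inI)
    show "finite (\<Union>(E ` D))" using fin finE by auto
    show "a \<le> u \<and> u < v \<and> v \<le> b" if "(u, v) \<in> \<Union>(E ` D)" for u v
      using that E' st by fastforce
    fix u v u' v' z assume A: "(u, v) \<in> \<Union>(E ` D)" "(u', v') \<in> \<Union>(E ` D)" "u < z" "z < v" "u' < z" "z < v'"
    then obtain s t s' t' where B: "(s, t) \<in> D" "(s', t') \<in> D" "(u, v) \<in> E (s, t)" "(u', v') \<in> E (s', t')"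
      by auto
    have "s < z" "z < t" "s' < z" "z < t'" using E'[OF B(1,3)] E'[OF B(2,4)] A by auto
    then have "s = s'" "t = t'" using nonoverlapping_inD[OF D B(1,2)] by auto
    then show "u = u' \<and> v = v'" using nonoverlapping_inD[OF E[OF B(1)] B(3)] B(4) A by auto
  qed
  show "increment_sum f (\<Union>(E ` D)) = (\<Sum>p\<in>D. increment_sum f (E p))"
    unfolding increment_sum_def
  proof (rule sum.UNION_disjoint)
    show "\<forall>p\<in>D. \<forall>q\<in>D. p \<noteq> q \<longrightarrow> E p \<inter> E q = {}"
    proof (intro ballI impI)
      fix p q assume pq: "p \<in> D" "q \<in> D" "p \<noteq> q"
      obtain s t s' t' where [simp]: "p = (s, t)" "q = (s', t')" by (cases p, cases q)
      have A: "(s, t) \<in> D" "(s', t') \<in> D" "s = s' \<longrightarrow> t \<noteq> t'" using pq by auto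
      show "E p \<inter> E q = {}"
      proof (rule ccontr)
        assume "\<not> ?thesis"
        then obtain u v where uv: "(u, v) \<in> E (s, t)" "(u, v) \<in> E (s', t')" by fastforce
        obtain z where "u < z" "z < v" using dense E'[OF A(1) uv(1)] by blast
        then show False using nonoverlapping_inD[OF D A(1,2), of z] E'[OF A(1) uv(1)] E'[OF A(2) uv(2)] A(3) by auto
      qed
    qed
  qed (use fin finE in auto)
qed

text \<open>Signed increments suffice: intervals with negative increment may be left out of a
  family, so this is the positive variation of Jordan's decomposition. The empty family makes it
  nonnegative where the sums are bounded.\<close>

definition positive_variation :: "(real \<Rightarrow> real) \<Rightarrow> real \<Rightarrow> real \<Rightarrow> real" where
  "positive_variation f a b = Sup {increment_sum f D |D. nonoverlapping_in D a b}"

lemma nonoverlapping_in_empty [simp]: "nonoverlapping_in {} a b"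
  by (simp add: nonoverlapping_in_def)

lemma increment_sum_empty [simp]: "increment_sum f {} = 0"
  by (simp add: increment_sum_def)

text \<open>\<open>increment_sum id\<close> is the total length of a family, which additivity of
  Lebesgue measure bounds.\<close>

lemma increment_sum_id_le:
  assumes "nonoverlapping_in D a b" "a \<le> b"
  shows "increment_sum id D \<le> b - a"
proof -
  have fin: "finite D" using assms by (simp add: nonoverlapping_in_def)
  have "ennreal (increment_sum id D) = (\<Sum>p\<in>D. emeasure lborel {fst p<..<snd p})"
    unfolding increment_sum_def using assms
    by (subst sum_ennreal[symmetric]) (auto simp: nonoverlapping_in_def case_prod_unfold intro!: sum.cong)
  also have "\<dots> = emeasure lborel (\<Union>p\<in>D. {fst p<..<snd p})"
    using fin assms by (intro sum_emeasure) (auto simp: disjoint_family_on_def nonoverlapping_in_def pairwise_def case_prod_unfold)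
  also have "\<dots> \<le> emeasure lborel {a..b}"
    using assms by (intro emeasure_mono) (force simp: nonoverlapping_in_def case_prod_unfold)+
  finally show ?thesis using assms by simp
qed

section \<open>The positive variation of an absolutely continuous function\<close>

locale ac_function =
  fixes f :: "real \<Rightarrow> real" and l :: real
  assumes ac: "absolutely_continuous_function_on 0 l f" and l: "0 \<le> l"
begin

lemma acD:
  assumes "0 < e"
  obtains d where "0 < d"
    "\<And>D. nonoverlapping_in D 0 l \<Longrightarrow> increment_sum id D < d \<Longrightarrow> (\<Sum>(s, t)\<in>D. \<bar>f t - f s\<bar>) < e \<and> increment_sum f D < e"
proof -
  obtain d where d: "0 < d" "\<And>D. finite D \<Longrightarrow> (\<forall>(s, t)\<in>D. 0 \<le> s \<and> s \<le> t \<and> t \<le> l) \<Longrightarrow>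
        pairwise (\<lambda>(s, t) (s', t'). {s<..<t} \<inter> {s'<..<t'} = {}) D \<Longrightarrow>
        (\<Sum>(s, t)\<in>D. t - s) < d \<Longrightarrow> (\<Sum>(s, t)\<in>D. \<bar>f t - f s\<bar>) < e"
    using ac assms unfolding absolutely_continuous_function_on_def by (metis (no_types, lifting))
  have "(\<Sum>(s, t)\<in>D. \<bar>f t - f s\<bar>) < e \<and> increment_sum f D < e"
    if D: "nonoverlapping_in D 0 l" and "increment_sum id D < d" for D
  proof -
    have "(\<Sum>(s, t)\<in>D. \<bar>f t - f s\<bar>) < e"
      using that by (intro d) (auto simp: nonoverlapping_in_def increment_sum_def)
    moreover have "increment_sum f D \<le> (\<Sum>(s, t)\<in>D. \<bar>f t - f s\<bar>)"
      unfolding increment_sum_def by (intro sum_mono) auto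
    ultimately show ?thesis by simp
  qed
  then show ?thesis using d(1) that by blast
qed

text \<open>Take the modulus \<open>d\<close> for the tolerance 1 and exhaust the interval in steps
  of length \<open>d / 2\<close>; by splitting, each step adds at most 1 to any increment sum. This
  makes the supremum \<open>W\<close> meaningful.\<close>

lemma bounded_increment_sum: "\<exists>B. \<forall>D. nonoverlapping_in D 0 l \<longrightarrow> increment_sum f D \<le> B"
proof -
  obtain d where d: "0 < d"
    "\<And>D. nonoverlapping_in D 0 l \<Longrightarrow> increment_sum id D < d \<Longrightarrow> increment_sum f D < 1"
    using acD[of 1] by (metis zero_less_one)
  have *: "\<forall>D. nonoverlapping_in D 0 (min l (real n * (d / 2))) \<longrightarrow> increment_sum f D \<le> real n" for n
  proof (induction n)
    case 0
    have "D = {}" if "nonoverlapping_in D 0 0" for D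
      using that unfolding nonoverlapping_in_def by force
    then show ?case using l by simp (metis increment_sum_empty order_refl)
  next
    case (Suc n)
    show ?case
    proof (intro allI impI)
      fix D assume D: "nonoverlapping_in D 0 (min l (real (Suc n) * (d / 2)))"
      let ?b = "min l (real n * (d / 2))" and ?c = "min l (real (Suc n) * (d / 2))"
      obtain D1 D2 where D12: "nonoverlapping_in D1 0 ?b" "nonoverlapping_in D2 ?b ?c"
        "\<And>f. increment_sum f D = increment_sum f D1 + increment_sum f D2"
        using nonoverlapping_in_split[OF D] by metis
      have bc: "?b \<le> ?c" "?c - ?b < d" "0 \<le> ?b" using d(1) l by (auto simp: min_def field_simps)
      have "increment_sum id D2 < d" using increment_sum_id_le[OF D12(2) bc(1)] bc by auto
      moreover have "nonoverlapping_in D2 0 l" using D12(2) bc by (auto intro: nonoverlapping_in_mono)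
      ultimately have "increment_sum f D2 < 1" using d(2) by auto
      then show "increment_sum f D \<le> real (Suc n)" using D12 Suc by fastforce
    qed
  qed
  obtain n where "l / (d / 2) \<le> real n" using real_arch_simple by blast
  then have "min l (real n * (d / 2)) = l" using d(1) by (simp add: field_simps min_def)
  then show ?thesis using *[of n] by auto
qed

abbreviation W where "W \<equiv> positive_variation f"

lemma W_bdd: "0 \<le> a \<Longrightarrow> b \<le> l \<Longrightarrow> bdd_above {increment_sum f D |D. nonoverlapping_in D a b}"
  using bounded_increment_sum nonoverlapping_in_mono unfolding bdd_above_def by blast

lemma W_upper: "0 \<le> a \<Longrightarrow> b \<le> l \<Longrightarrow> nonoverlapping_in D a b \<Longrightarrow> increment_sum f D \<le> W a b"
  unfolding positive_variation_def by (intro cSup_upper W_bdd) auto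

lemma W_least: "(\<And>D. nonoverlapping_in D a b \<Longrightarrow> increment_sum f D \<le> B) \<Longrightarrow> W a b \<le> B"
  unfolding positive_variation_def by (intro cSup_least) (auto intro: nonoverlapping_in_empty)

lemma W_nonneg: "0 \<le> a \<Longrightarrow> b \<le> l \<Longrightarrow> 0 \<le> W a b"
  using W_upper[of a b "{}"] by simp

lemma W_approx:
  assumes "0 < e"
  obtains D where "nonoverlapping_in D a b" "W a b - e < increment_sum f D"
proof -
  have "\<exists>x\<in>{increment_sum f D |D. nonoverlapping_in D a b}. W a b - e < x"
  proof (rule less_cSupD)
    show "{increment_sum f D |D. nonoverlapping_in D a b} \<noteq> {}" using nonoverlapping_in_empty by blast
    show "W a b - e < Sup {increment_sum f D |D. nonoverlapping_in D a b}"
      using assms by (simp add: positive_variation_def)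
  qed
  then show ?thesis using that by blast
qed

lemma W_ge_increment: "0 \<le> a \<Longrightarrow> a \<le> b \<Longrightarrow> b \<le> l \<Longrightarrow> f b - f a \<le> W a b"
proof (cases "a < b")
  case True
  then have "nonoverlapping_in {(a, b)} a b" by (simp add: nonoverlapping_in_def)
  then show "0 \<le> a \<Longrightarrow> b \<le> l \<Longrightarrow> f b - f a \<le> W a b"
    using W_upper[of a b "{(a, b)}"] by (simp add: increment_sum_def)
qed (use W_nonneg in force)

lemma W_add:
  assumes "0 \<le> a" "a \<le> b" "b \<le> c" "c \<le> l"
  shows "W a c = W a b + W b c"
proof (rule antisym)
  show "W a c \<le> W a b + W b c"
  proof (rule W_least)
    fix D assume D: "nonoverlapping_in D a c"
    obtain D1 D2 where "nonoverlapping_in D1 a b" "nonoverlapping_in D2 b c"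
        "\<And>f. increment_sum f D = increment_sum f D1 + increment_sum f D2"
      using nonoverlapping_in_split[OF D] by metis
    then show "increment_sum f D \<le> W a b + W b c"
      using W_upper[of a b D1] W_upper[of b c D2] assms by simp
  qed
  show "W a b + W b c \<le> W a c"
  proof (rule field_le_epsilon)
    fix e :: real assume "0 < e"
    then have e: "0 < e / 2" by simp
    obtain D1 where D1: "nonoverlapping_in D1 a b" "W a b - e/2 < increment_sum f D1" using W_approx[OF e] .
    obtain D2 where D2: "nonoverlapping_in D2 b c" "W b c - e/2 < increment_sum f D2" using W_approx[OF e] .
    show "W a b + W b c \<le> W a c + e"
      using W_upper[OF assms(1,4) nonoverlapping_in_Un(1)[OF D1(1) D2(1) assms(2,3)]]
        nonoverlapping_in_Un(2)[OF D1(1) D2(1) assms(2,3), of f] D1(2) D2(2) by simp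
  qed
qed

text \<open>Refining each interval of \<open>D\<close> by a nearly optimal subfamily does not
  increase the total length, so the modulus of \<open>f\<close> also serves \<open>W\<close>, with a
  weak inequality in the limit.\<close>

lemma W_ac:
  assumes "0 < e"
  obtains d where "0 < d"
    "\<And>D. nonoverlapping_in D 0 l \<Longrightarrow> increment_sum id D < d \<Longrightarrow> increment_sum (W 0) D \<le> e"
proof -
  obtain d where d: "0 < d"
    "\<And>D. nonoverlapping_in D 0 l \<Longrightarrow> increment_sum id D < d \<Longrightarrow> increment_sum f D < e"
    using acD[OF assms] by metis
  have "increment_sum (W 0) D \<le> e" if D: "nonoverlapping_in D 0 l" and lt: "increment_sum id D < d" for D
  proof (rule field_le_epsilon)
    fix r :: real assume r: "0 < r"
    \<comment> \<open>The slack \<open>r\<close> is shared among the intervals of \<open>D\<close>;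
      the summand 1 covers the empty family.\<close>
    define k where "k = r / (real (card D) + 1)"
    have k: "0 < k" using r by (simp add: k_def)
    have st: "\<And>s t. (s, t) \<in> D \<Longrightarrow> 0 \<le> s \<and> s < t \<and> t \<le> l" and fin: "finite D"
      using D by (auto simp: nonoverlapping_in_def)
    have "\<forall>p. \<exists>E. nonoverlapping_in E (fst p) (snd p) \<and> W (fst p) (snd p) - k < increment_sum f E"
      using W_approx[OF k] by metis
    then obtain E where E: "\<And>p. nonoverlapping_in (E p) (fst p) (snd p)"
      "\<And>p. W (fst p) (snd p) - k < increment_sum f (E p)" by metis
    have E': "nonoverlapping_in (E (s, t)) s t" for s t using E(1)[of "(s, t)"] by simp
    note U = nonoverlapping_in_UNION[OF D, of E, OF E']
    have "increment_sum id (\<Union>(E ` D)) \<le> increment_sum id D"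
      unfolding U(2) unfolding increment_sum_def[of id D]
    proof (intro sum_mono)
      fix p assume p: "p \<in> D"
      show "increment_sum id (E p) \<le> (case p of (s, t) \<Rightarrow> id t - id s)"
        using increment_sum_id_le[OF E(1)[of p]] st[of "fst p" "snd p"] p by (simp add: case_prod_unfold)
    qed
    then have "increment_sum f (\<Union>(E ` D)) < e" using U(1) lt by (intro d) auto
    have "increment_sum (W 0) D = (\<Sum>(s, t)\<in>D. W s t)"
      unfolding increment_sum_def
    proof (rule sum.cong)
      fix p assume "p \<in> D"
      then show "(case p of (s, t) \<Rightarrow> W 0 t - W 0 s) = (case p of (s, t) \<Rightarrow> W s t)"
        using st[of "fst p" "snd p"] W_add[of 0 "fst p" "snd p"] by (auto simp: case_prod_unfold)
    qed simp
    also have "\<dots> \<le> (\<Sum>p\<in>D. increment_sum f (E p) + k)"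
      proof (rule sum_mono)
      fix p show "(case p of (s, t) \<Rightarrow> W s t) \<le> increment_sum f (E p) + k"
        using E(2)[of p] by (simp add: case_prod_unfold)
    qed
    also have "\<dots> = increment_sum f (\<Union>(E ` D)) + real (card D) * k"
      unfolding U(2) by (simp add: sum.distrib)
    also have "real (card D) * k \<le> r" using r by (simp add: k_def field_simps)
    finally show "increment_sum (W 0) D \<le> e + r"
      using \<open>increment_sum f (\<Union>(E ` D)) < e\<close> by simp
  qed
  then show ?thesis using d(1) that by blast
qed

end

text \<open>A null set lies in an open set of small length. A compact part of that open set is
  covered by finitely many components, which are disjoint intervals, so absolute continuity of
  \<open>G\<close> bounds its Stieltjes measure; inner regularity passes to the open set.
  \<open>F\<close> is \<open>G\<close> frozen outside the interval.\<close>

lemma absolutely_continuous_interval_measure: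
  fixes G :: "real \<Rightarrow> real"
  assumes l: "0 \<le> l" and mono: "mono_on {0..l} G"
    and ac: "\<And>e. 0 < e \<Longrightarrow> \<exists>d>0. \<forall>D. nonoverlapping_in D 0 l \<longrightarrow> increment_sum id D < d \<longrightarrow> increment_sum G D \<le> e"
  defines "F \<equiv> \<lambda>x. G (max 0 (min l x))"
  shows "continuous_on UNIV F" "mono F" "absolutely_continuous lborel (interval_measure F)"
proof -
  have m: "F x \<le> F y" if "x \<le> y" for x y
    unfolding F_def using that l by (intro mono_onD[OF mono]) auto
  then show mono': "mono F" by (simp add: monoI)
  have dd: "F y - F x \<le> e" if d: "\<forall>D. nonoverlapping_in D 0 l \<longrightarrow> increment_sum id D < d \<longrightarrow> increment_sum G D \<le> e"
    and xy: "x \<le> y" "y - x < d" and e: "0 < e" for x y d e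
  proof (cases "max 0 (min l x) < max 0 (min l y)")
    case True
    then have "nonoverlapping_in {(max 0 (min l x), max 0 (min l y))} 0 l"
      using l by (simp add: nonoverlapping_in_def)
    moreover have "increment_sum id {(max 0 (min l x), max 0 (min l y))} < d"
      using xy by (auto simp: increment_sum_def)
    ultimately show ?thesis using d by (auto simp: increment_sum_def F_def)
  next
    case False
    then have "max 0 (min l x) = max 0 (min l y)" using xy by auto
    then show ?thesis using e by (simp add: F_def)
  qed
  show cont: "continuous_on UNIV F"
  proof (clarsimp simp: continuous_on_iff)
    fix x e :: real assume e: "0 < e"
    obtain d where d: "d > 0" "\<forall>D. nonoverlapping_in D 0 l \<longrightarrow> increment_sum id D < d \<longrightarrow> increment_sum G D \<le> e / 2"
      using ac[of "e/2"] e by auto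
    have "dist (F y) (F x) < e" if "dist y x < d" for y
    proof (cases "x \<le> y")
      case True
      then show ?thesis using dd[OF d(2), of x y] m[of x y] that e by (simp add: dist_real_def)
    next
      case False
      then show ?thesis using dd[OF d(2), of y x] m[of y x] that e by (simp add: dist_real_def)
    qed
    then show "\<exists>d>0. \<forall>y. dist y x < d \<longrightarrow> dist (F y) (F x) < e" using d(1) by blast
  qed
  let ?\<mu> = "interval_measure F"
  note Icc = emeasure_interval_measure_Icc[OF _ m cont]
  \<comment> \<open>\<open>F\<close> is constant on either side and continuous at both ends, so
    neither a tail nor an atom carries mass. Hence the open cover may be cut down to the open
    interval, where \<open>G\<close> governs.\<close>
  have out: "emeasure ?\<mu> (- {0<..<l}) = 0"
  proof -
    have "emeasure ?\<mu> (\<Union>n::nat. {-real n..0} \<union> {l..l+real n}) = 0"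
    proof (rule emeasure_UN_eq_0)
      fix n :: nat
      have "emeasure ?\<mu> {-real n..0} = 0" "emeasure ?\<mu> {l..l+real n} = 0"
        using Icc[of "-real n" 0] Icc[of l "l + real n"] l by (auto simp: F_def)
      then show "emeasure ?\<mu> ({-real n..0} \<union> {l..l+real n}) = 0"
        by (metis emeasure_Un_null_set null_setsI atLeastAtMost_borel sets_interval_measure)
    qed auto
    moreover have "- {0<..<l} \<subseteq> (\<Union>n::nat. {-real n..0} \<union> {l..l+real n})"
    proof
      fix x assume "x \<in> - {0<..<l}"
      then have x: "x \<le> 0 \<or> l \<le> x" by auto
      obtain n :: nat where n: "\<bar>x\<bar> + l < real n" using reals_Archimedean2 by blast
      show "x \<in> (\<Union>n::nat. {-real n..0} \<union> {l..l+real n})"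
        using x n l by (intro UN_I[of n]) auto
    qed
    ultimately show ?thesis
      by (metis (no_types, lifting) emeasure_eq_0 UN_I atLeastAtMost_borel countable_Un sets.countable_UN sets.Un sets_interval_measure sets_UNIV subset_UNIV image_subset_iff)
  qed
  have fin: "finite_measure ?\<mu>"
  proof
    have "emeasure ?\<mu> UNIV \<le> emeasure ?\<mu> {0..l} + emeasure ?\<mu> (- {0<..<l})"
      by (intro order_trans[OF _ emeasure_subadditive] emeasure_mono) auto
    then show "emeasure ?\<mu> (space ?\<mu>) \<noteq> \<infinity>"
      using l by (auto simp: out Icc top_unique)
  qed
  show "absolutely_continuous lborel ?\<mu>"
    unfolding absolutely_continuous_def
  proof
    fix N assume N: "N \<in> null_sets (lborel :: real measure)"
    then have Nb: "N \<in> sets borel" by auto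
    have "emeasure ?\<mu> N \<le> ennreal e" if e: "0 < e" for e
    proof -
      obtain d where d: "d > 0" "\<And>D. nonoverlapping_in D 0 l \<Longrightarrow> increment_sum id D < d \<Longrightarrow> increment_sum G D \<le> e"
        using ac[OF e] by auto
      obtain U0 where U0: "open U0" "N \<subseteq> U0" "emeasure lborel (U0 - N) < d"
        using outer_regular_lborel[OF Nb d(1)] .
      have U0d: "emeasure lborel U0 < d"
        using U0 N by (metis Diff_Un emeasure_Diff_null_set borel_open sets_lborel)
      define U where "U = U0 \<inter> {0<..<l}"
      have Uo: "open U" using U0 by (auto simp: U_def)
      have "emeasure ?\<mu> N \<le> emeasure ?\<mu> U + emeasure ?\<mu> (- {0<..<l})"
        using U0 Uo by (intro order_trans[OF _ emeasure_subadditive] emeasure_mono) (auto simp: U_def)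
      also have "\<dots> = emeasure ?\<mu> U" using out by simp
      also have "\<dots> = (SUP K \<in> {K. K \<subseteq> U \<and> compact K}. emeasure ?\<mu> K)"
        using Uo finite_measure.emeasure_finite[OF fin] by (intro inner_regular) auto
      also have "\<dots> \<le> ennreal e"
      proof (rule SUP_least, clarify)
        fix K assume K: "K \<subseteq> U" "compact K"
        have "\<exists>\<C>\<subseteq>components U. finite \<C> \<and> K \<subseteq> \<Union>\<C>"
          using compactE[OF K(2), of "components U"] K(1) open_components[OF Uo] by (metis Union_components)
        then obtain \<C> where C: "\<C> \<subseteq> components U" "finite \<C>" "K \<subseteq> \<Union>\<C>" by auto
        have int: "\<exists>a b. c = {a<..<b} \<and> 0 \<le> a \<and> a < b \<and> b \<le> l" if "c \<in> \<C>" for c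
        proof -
          have c: "open c" "connected c" "c \<noteq> {}" "c \<subseteq> {0<..<l}"
            using that C(1) open_components[OF Uo] in_components_connected in_components_nonempty in_components_subset
            unfolding U_def by (blast+)
          have "\<exists>a b. c = {a<..<b}"
          proof (intro exI)
            have bd: "bdd_above c" "bdd_below c" using c(4) by (auto intro!: bdd_aboveI[of _ l] bdd_belowI[of _ 0] dest!: subsetD)
            have ivl: "is_interval c" using c(2) by (simp add: is_interval_connected_1)
            show "c = {Inf c<..<Sup c}"
            proof
              show "c \<subseteq> {Inf c<..<Sup c}"
              proof
                fix x assume x: "x \<in> c"
                then obtain r where r: "r > 0" "ball x r \<subseteq> c" using c(1) openE by blast
                have "x - r/2 \<in> c" "x + r/2 \<in> c" using r by (auto simp: subset_iff dist_real_def)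
                then have "Inf c \<le> x - r/2" "x + r/2 \<le> Sup c" using bd by (auto intro: cInf_lower cSup_upper)
                then show "x \<in> {Inf c<..<Sup c}" using r by auto
              qed
              show "{Inf c<..<Sup c} \<subseteq> c"
              proof
                fix x assume "x \<in> {Inf c<..<Sup c}"
                then obtain u v where "u \<in> c" "u < x" "v \<in> c" "x < v"
                  using cInf_lessD[OF c(3), of x] less_cSupD[OF c(3), of x] by auto
                then show "x \<in> c" using ivl unfolding is_interval_1 by (meson less_imp_le)
              qed
            qed
          qed
          then obtain a b where ab: "c = {a<..<b}" by auto
          then have "a < b" using c(3) by (metis greaterThanLessThan_empty_iff not_le)
          moreover then have "0 \<le> a" "b \<le> l" using c(4) by (auto simp: ab greaterThanLessThan_subseteq_greaterThanLessThan)
          ultimately show ?thesis using ab by blast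
        qed
        then obtain a b where ab: "\<And>c. c \<in> \<C> \<Longrightarrow> c = {a c<..<b c} \<and> 0 \<le> a c \<and> a c < b c \<and> b c \<le> l" by metis
        define D where "D = (\<lambda>c. (a c, b c)) ` \<C>"
        have inj: "inj_on (\<lambda>c. (a c, b c)) \<C>" 
        proof (rule inj_onI)
          fix c c' assume cc: "c \<in> \<C>" "c' \<in> \<C>" "(a c, b c) = (a c', b c')"
          have "c = {a c<..<b c}" "c' = {a c'<..<b c'}" using ab cc(1,2) by blast+
          then show "c = c'" using cc(3) by (metis prod.inject)
        qed
        have disj: "c = c'" if "c \<in> \<C>" "c' \<in> \<C>" "z \<in> c" "z \<in> c'" for c c' z
          using that components_nonoverlap[of c U c'] C(1) by blast
        have nD: "nonoverlapping_in D 0 l"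
        proof (rule nonoverlapping_inI)
          fix s t s' t' z assume A: "(s, t) \<in> D" "(s', t') \<in> D" "s < z" "z < t" "s' < z" "z < t'"
          then obtain c c' where c: "c \<in> \<C>" "s = a c" "t = b c" "c' \<in> \<C>" "s' = a c'" "t' = b c'" by (auto simp: D_def)
          have "z \<in> c" "z \<in> c'" using ab[OF c(1)] ab[OF c(4)] A c by (metis greaterThanLessThan_iff)+
          then show "s = s' \<and> t = t'" using disj c by metis
        qed (use C(2) ab in \<open>auto simp: D_def\<close>)
        have Cs: "c \<in> sets borel" if "c \<in> \<C>" for c using that C(1) open_components[OF Uo] by auto
        have sumeq: "emeasure M (\<Union>\<C>) = (\<Sum>c\<in>\<C>. emeasure M c)" if "sets M = sets borel" for M :: "real measure"
        proof -
          have "disjoint_family_on (\<lambda>c. c) \<C>"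
            unfolding disjoint_family_on_def using disj by (meson disjoint_iff)
          then have "(\<Sum>c\<in>\<C>. emeasure M ((\<lambda>c. c) c)) = emeasure M (\<Union>c\<in>\<C>. c)"
            using C(2) Cs that by (intro sum_emeasure) auto
          then show ?thesis by simp
        qed
        have inc: "increment_sum H D = (\<Sum>c\<in>\<C>. H (b c) - H (a c))" for H
          unfolding increment_sum_def D_def using inj by (subst sum.reindex) auto
        have "ennreal (increment_sum id D) = (\<Sum>c\<in>\<C>. emeasure lborel c)"
        proof -
          have "ennreal (b c - a c) = emeasure lborel c" if "c \<in> \<C>" for c
            using ab[OF that] emeasure_lborel_Ioo[of "a c" "b c"] by simp
          then show ?thesis
            unfolding inc using ab by (subst sum_ennreal[symmetric]) (auto intro!: sum.cong simp: less_imp_le)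
        qed
        also have "\<dots> = emeasure lborel (\<Union>\<C>)" by (rule sumeq[symmetric]) simp
        also have "\<dots> \<le> emeasure lborel U0"
          using C(1) U0(1) in_components_subset unfolding U_def by (intro emeasure_mono) fastforce+
        also have "\<dots> < ennreal d" by (rule U0d)
        finally have lt: "increment_sum id D < d" by (meson ennreal_leI linorder_not_less)
        have "emeasure ?\<mu> K \<le> emeasure ?\<mu> (\<Union>\<C>)"
          using C Cs by (intro emeasure_mono) auto
        also have "\<dots> = (\<Sum>c\<in>\<C>. emeasure ?\<mu> c)" by (rule sumeq) simp
        also have "\<dots> \<le> (\<Sum>c\<in>\<C>. ennreal (G (b c) - G (a c)))"
        proof (rule sum_mono)
          fix c assume c: "c \<in> \<C>"
          have "emeasure ?\<mu> c \<le> emeasure ?\<mu> {a c..b c}"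
            using ab[OF c] greaterThanLessThan_subseteq_atLeastAtMost_iff[of "a c" "b c" "a c" "b c"]
            by (intro emeasure_mono) auto
          also have "\<dots> = ennreal (G (b c) - G (a c))" 
          proof -
            have "F (a c) = G (a c)" "F (b c) = G (b c)" using ab[OF c] by (auto simp: F_def)
            then show ?thesis using Icc[of "a c" "b c"] ab[OF c] by simp
          qed
          finally show "emeasure ?\<mu> c \<le> ennreal (G (b c) - G (a c))" .
        qed
        also have "\<dots> = ennreal (increment_sum G D)"
          
        proof -
          have "G (a c) \<le> G (b c)" if "c \<in> \<C>" for c
            using ab[OF that] by (intro mono_onD[OF mono]) auto
          then show ?thesis unfolding inc by (intro sum_ennreal) auto
        qed
        also have "\<dots> \<le> ennreal e" using d(2)[OF nD lt] by (rule ennreal_leI)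
        finally show "emeasure ?\<mu> K \<le> ennreal e" .
      qed
      finally show ?thesis .
    qed
    then have "emeasure ?\<mu> N = 0"
      by (metis ennreal_le_epsilon add_0 le_zero_eq)
    then show "N \<in> null_sets ?\<mu>" using Nb by auto
  qed
qed

lemma AE_differentiable_mono_on_ac:
  fixes G :: "real \<Rightarrow> real"
  assumes l: "0 \<le> l" and mono: "mono_on {0..l} G"
    and ac: "\<And>e. 0 < e \<Longrightarrow> \<exists>d>0. \<forall>D. nonoverlapping_in D 0 l \<longrightarrow> increment_sum id D < d \<longrightarrow> increment_sum G D \<le> e"
  shows "AE x in lborel. x \<in> {0<..<l} \<longrightarrow> G differentiable (at x)"
proof -
  note * = absolutely_continuous_interval_measure[OF l mono ac]
  have "AE x in lborel. (\<lambda>x. G (max 0 (min l x))) differentiable (at x)"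
  proof (rule AE_differentiable_mono_ac)
    show "\<bar>G (max 0 (min l x))\<bar> \<le> \<bar>G 0\<bar> + \<bar>G l\<bar>" for x
    proof -
      have "G 0 \<le> G (max 0 (min l x))" "G (max 0 (min l x)) \<le> G l"
        using l by (intro mono_onD[OF mono]; simp)+
      then show ?thesis by linarith
    qed
  qed (use * in auto)
  then show ?thesis
  proof eventually_elim
    case (elim x)
    show ?case
    proof
      assume x: "x \<in> {0<..<l}"
      have "eventually (\<lambda>y. y \<in> {0<..<l}) (nhds x)" using x by (intro eventually_nhds_in_open) auto
      then have "eventually (\<lambda>y. G (max 0 (min l y)) = G y) (nhds x)"
        by eventually_elim auto
      then have "((\<lambda>y. G (max 0 (min l y))) has_field_derivative D) (at x) = (G has_field_derivative D) (at x)" for D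
        by (intro DERIV_cong_ev) auto
      then show "G differentiable (at x)" using elim by (simp add: real_differentiable_def)
    qed
  qed
qed

text \<open>Jordan decomposition: \<open>W 0\<close> and \<open>W 0 - f\<close> are both monotone
  and both absolutely continuous, and \<open>f\<close> is their difference.\<close>

theorem ac_AE_differentiable:
  assumes "absolutely_continuous_function_on 0 l f" "0 \<le> l"
  shows "AE x in lborel. x \<in> {0<..<l} \<longrightarrow> f differentiable (at x)"
proof -
  interpret ac_function f l by standard (use assms in auto)
  have "AE x in lborel. x \<in> {0<..<l} \<longrightarrow> W 0 differentiable (at x)"
  proof (rule AE_differentiable_mono_on_ac[OF assms(2)])
    show "mono_on {0..l} (W 0)"
      proof (rule mono_onI)
      fix r s assume "r \<in> {0..l}" "s \<in> {0..l}" "r \<le> s"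
      then show "W 0 r \<le> W 0 s" using W_add[of 0 r s] W_nonneg[of r s] by auto
    qed
    show "\<exists>d>0. \<forall>D. nonoverlapping_in D 0 l \<longrightarrow> increment_sum id D < d \<longrightarrow> increment_sum (W 0) D \<le> e" if "0 < e" for e
      using W_ac[OF that] by metis
  qed
  moreover have "AE x in lborel. x \<in> {0<..<l} \<longrightarrow> (\<lambda>x. W 0 x - f x) differentiable (at x)"
  proof (rule AE_differentiable_mono_on_ac[OF assms(2)])
    show "mono_on {0..l} (\<lambda>x. W 0 x - f x)"
    proof (rule mono_onI)
      fix r s assume "r \<in> {0..l}" "s \<in> {0..l}" "r \<le> s"
      then show "W 0 r - f r \<le> W 0 s - f s" using W_add[of 0 r s] W_ge_increment[of r s] by auto
    qed
    fix e :: real assume e: "0 < e"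
    obtain d1 where d1: "0 < d1" "\<And>D. nonoverlapping_in D 0 l \<Longrightarrow> increment_sum id D < d1 \<Longrightarrow> increment_sum (W 0) D \<le> e/2"
      using W_ac[of "e/2"] e by auto
    obtain d2 where d2: "0 < d2" "\<And>D. nonoverlapping_in D 0 l \<Longrightarrow> increment_sum id D < d2 \<Longrightarrow> (\<Sum>(s, t)\<in>D. \<bar>f t - f s\<bar>) < e/2"
      using acD[of "e/2"] e by (metis half_gt_zero)
    have "increment_sum (\<lambda>x. W 0 x - f x) D \<le> e" if D: "nonoverlapping_in D 0 l" "increment_sum id D < min d1 d2" for D
    proof -
      have "increment_sum (\<lambda>x. W 0 x - f x) D \<le> (\<Sum>(s, t)\<in>D. (W 0 t - W 0 s) + \<bar>f t - f s\<bar>)"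
        unfolding increment_sum_def by (intro sum_mono) auto
      also have "\<dots> = increment_sum (W 0) D + (\<Sum>(s, t)\<in>D. \<bar>f t - f s\<bar>)"
        by (simp add: increment_sum_def sum.distrib case_prod_unfold)
      finally show ?thesis using d1(2)[OF D(1)] d2(2)[OF D(1)] D(2) by auto
    qed
    then show "\<exists>d>0. \<forall>D. nonoverlapping_in D 0 l \<longrightarrow> increment_sum id D < d \<longrightarrow> increment_sum (\<lambda>x. W 0 x - f x) D \<le> e"
      using d1(1) d2(1) by (intro exI[of _ "min d1 d2"]) auto
  qed
  ultimately show ?thesis
  proof eventually_elim
    case (elim x)
    show ?case
    proof
      assume "x \<in> {0<..<l}"
      then have "(\<lambda>x. W 0 x - (W 0 x - f x)) differentiable (at x)"
        using elim by (intro differentiable_diff[of "W 0" _ "\<lambda>x. W 0 x - f x"]) blast+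
      moreover have "(\<lambda>x. W 0 x - (W 0 x - f x)) = f" by auto
      ultimately show "f differentiable (at x)" by metis
    qed
  qed
qed

text \<open>For continuous \<open>f\<close> the difference quotients over rational increments decide
  differentiability. \<open>U\<close> and \<open>L\<close> are the upper and lower derivatives
  written with countably many operations, and a derivative exists exactly where they agree and are
  finite.\<close>

lemma borel_measurable_deriv_continuous:
  fixes f :: "real \<Rightarrow> real"
  assumes f: "continuous_on UNIV f"
  shows "deriv f \<in> borel_measurable borel"
proof -
  define q where "q h t = (f (t + h) - f t) / h" for h t
  define R where "R n = {h\<in>\<rat>. h \<noteq> 0 \<and> \<bar>h\<bar> < 1 / real (Suc n)}" for n
  define U where "U t = (INF n. SUP h\<in>R n. ereal (q h t))" for t
  define L where "L t = (SUP n. INF h\<in>R n. ereal (q h t))" for t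
  have R: "countable (R n)" for n unfolding R_def by (rule countable_subset[OF _ countable_rat]) auto
  have [measurable]: "f \<in> borel_measurable borel" using f by (rule borel_measurable_continuous_onI)
  have qm[measurable]: "q h \<in> borel_measurable borel" for h unfolding q_def by measurable
  have Um[measurable]: "U \<in> borel_measurable borel" unfolding U_def using R by measurable
  have Lm[measurable]: "L \<in> borel_measurable borel" unfolding L_def using R by measurable
  have Rne: "\<exists>h. h \<in> R n \<and> h \<in> R m" for n m
  proof -
    have "(1 / of_nat (Suc (Suc (max n m))) :: real) \<in> \<rat>" by (intro Rats_divide Rats_1 Rats_of_nat)
    moreover have "1 / real (Suc (Suc (max n m))) < 1 / real (Suc n)" "1 / real (Suc (Suc (max n m))) < 1 / real (Suc m)"
      by (auto simp: field_simps)
    ultimately show ?thesis unfolding R_def by (intro exI[of _ "1 / real (Suc (Suc (max n m)))"]) auto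
  qed
  have LU: "L t \<le> U t" for t
    unfolding L_def U_def
  proof (intro SUP_least INF_greatest)
    fix n m obtain h where "h \<in> R n" "h \<in> R m" using Rne by blast
    then show "(INF h\<in>R n. ereal (q h t)) \<le> (SUP h\<in>R m. ereal (q h t))"
      by (meson INF_lower SUP_upper order_trans)
  qed
  have iff: "(f has_field_derivative D) (at t) \<longleftrightarrow> U t = ereal D \<and> L t = ereal D" for t D
  proof
    assume "(f has_field_derivative D) (at t)"
    then have lim: "((\<lambda>h. q h t) \<longlongrightarrow> D) (at 0)" unfolding DERIV_def q_def .
    have *: "ereal (D - e) \<le> L t \<and> U t \<le> ereal (D + e)" if e: "0 < e" for e
    proof -
      obtain d where d: "d > 0" "\<And>h. h \<noteq> 0 \<Longrightarrow> norm h < d \<Longrightarrow> norm (q h t - D) < e"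
        using LIM_D[OF lim e] by auto
      obtain n where n: "1 / real (Suc n) < d" using d(1) by (metis nat_approx_posE)
      have "\<bar>q h t - D\<bar> < e" if "h \<in> R n" for h using that n d(2)[of h] by (auto simp: R_def)
      then have "\<And>h. h \<in> R n \<Longrightarrow> ereal (D - e) \<le> ereal (q h t) \<and> ereal (q h t) \<le> ereal (D + e)"
        by (force simp: abs_less_iff)
      then have "ereal (D - e) \<le> (INF h\<in>R n. ereal (q h t))" "(SUP h\<in>R n. ereal (q h t)) \<le> ereal (D + e)"
        by (auto intro!: INF_greatest SUP_least)
      then show ?thesis unfolding L_def U_def by (meson INF_lower SUP_upper UNIV_I order_trans)
    qed
    have "U t \<le> ereal D"
    proof (rule ereal_le_epsilon2)
      fix e :: real assume "0 < e"
      then show "U t \<le> ereal D + ereal e" using *[of e] by simp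
    qed
    moreover have "ereal D \<le> L t"
    proof (rule ereal_le_epsilon2)
      fix e :: real assume "0 < e"
      then show "ereal D \<le> L t + ereal e" using *[of e] by (cases "L t") auto
    qed
    ultimately show "U t = ereal D \<and> L t = ereal D" using LU[of t] by (metis antisym order_trans)
  next
    assume A: "U t = ereal D \<and> L t = ereal D"
    have "((\<lambda>h. q h t) \<longlongrightarrow> D) (at 0)"
    proof (rule LIM_I)
      fix e :: real assume e: "0 < e"
      have "U t < ereal (D + e/2)" "ereal (D - e/2) < L t" using A e by auto
      then obtain n m where nm: "(SUP h\<in>R n. ereal (q h t)) < ereal (D + e/2)" "ereal (D - e/2) < (INF h\<in>R m. ereal (q h t))"
        unfolding U_def L_def INF_less_iff less_SUP_iff by auto
      define r where "r = min (1 / real (Suc n)) (1 / real (Suc m))"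
      have r: "0 < r" by (auto simp: r_def)
      have rat: "q h t \<in> {D - e/2..D + e/2}" if "h \<in> \<rat>" "h \<noteq> 0" "\<bar>h\<bar> < r" for h
      proof -
        have "h \<in> R n" "h \<in> R m" using that by (auto simp: R_def r_def)
        then have "ereal (q h t) < ereal (D + e/2)" "ereal (D - e/2) < ereal (q h t)"
          using nm by (meson SUP_upper INF_lower le_less_trans less_le_trans)+
        then show ?thesis by simp
      qed
      \<comment> \<open>A real increment is a limit of rational ones from the same punctured
        interval, and continuity of \<open>f\<close> carries the bound \<open>e/2\<close> over to
        it.\<close>
      have "norm (q h t - D) < e" if h: "h \<noteq> 0" "norm (h - 0) < r" for h
      proof -
        have "h \<in> closure \<rat>" using Rats_closure_real by auto
        have "\<exists>X. (\<forall>n. X n \<in> \<rat> \<inter> ({-r<..<r} - {0})) \<and> X \<longlonglongrightarrow> h"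
        proof -
          have "h \<in> closure (\<rat> \<inter> ({-r<..<r} - {0}))"
          proof -
            have "open ({-r<..<r} - {0})" by (intro open_Diff) auto
            then have "closure (({-r<..<r} - {0}) \<inter> \<rat>) = closure ({-r<..<r} - {0})"
              using Rats_closure_real by (metis closure_open_Int_superset subset_UNIV)
            moreover have "h \<in> {-r<..<r} - {0}" using h by auto
            ultimately show ?thesis using closure_subset by (metis Int_commute subsetD)
          qed
          then show ?thesis by (simp add: closure_sequential)
        qed
        then obtain X where X: "\<And>n. X n \<in> \<rat> \<inter> ({-r<..<r} - {0})" "X \<longlonglongrightarrow> h" by auto
        have "(\<lambda>n. q (X n) t) \<longlonglongrightarrow> q h t"
          unfolding q_def using h X(2) f
          by (intro tendsto_intros isCont_tendsto_compose[of _ f]) (auto simp: continuous_on_eq_continuous_at)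
        moreover have X': "q (X n) t \<in> {D - e/2..D + e/2}" for n
          using X(1)[of n] by (intro rat) (auto simp: abs_less_iff)
        ultimately have "D - e/2 \<le> q h t" "q h t \<le> D + e/2"
          using LIMSEQ_le_const[of _ _ "D - e/2"] LIMSEQ_le_const2[of _ _ "D + e/2"] by (meson atLeastAtMost_iff)+
        then show ?thesis using e unfolding real_norm_def by linarith
      qed
      then show "\<exists>s>0. \<forall>h. h \<noteq> 0 \<and> norm (h - 0) < s \<longrightarrow> norm (q h t - D) < e" using r by blast
    qed
    then show "(f has_field_derivative D) (at t)" unfolding DERIV_def q_def .
  qed
  \<comment> \<open>Where no derivative exists, \<open>deriv\<close> chooses from the empty
    predicate and thus returns one fixed number, the same at all such points. This is what keeps it
    measurable.\<close>
  have "deriv f = (\<lambda>t. if U t = L t \<and> \<bar>U t\<bar> \<noteq> \<infinity> then real_of_ereal (U t) else (SOME D. False))"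
  proof
    fix t show "deriv f t = (if U t = L t \<and> \<bar>U t\<bar> \<noteq> \<infinity> then real_of_ereal (U t) else (SOME D. False))"
    proof (cases "U t = L t \<and> \<bar>U t\<bar> \<noteq> \<infinity>")
      case True
      then have "(f has_field_derivative real_of_ereal (U t)) (at t)" by (auto simp: iff ereal_real)
      then show ?thesis unfolding if_P[OF True] by (rule DERIV_imp_deriv)
    next
      case False
      then have "\<not> (f has_field_derivative D) (at t)" for D by (auto simp: iff)
      then show ?thesis unfolding deriv_def if_not_P[OF False] by simp
    qed
  qed
  moreover have "(\<lambda>t. if U t = L t \<and> \<bar>U t\<bar> \<noteq> \<infinity> then real_of_ereal (U t) else (SOME D. False)) \<in> borel_measurable borel"
    by measurable
  ultimately show ?thesis by simp
qed

section \<open>Square integrable functions\<close>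

lemma L2_D:
  assumes "f \<in> L2 M"
  shows L2_measurable: "f \<in> borel_measurable M" and L2_integrable_power2: "integrable M (\<lambda>x. (f x)\<^sup>2)"
  using assms by (auto simp: L2_def)

lemma L2_dominated:
  assumes g: "g \<in> L2 M" and f: "f \<in> borel_measurable M" and le: "AE x in M. \<bar>f x\<bar> \<le> \<bar>g x\<bar>"
  shows "f \<in> L2 M"
proof -
  have "integrable M (\<lambda>x. (f x)\<^sup>2)"
    using L2_integrable_power2[OF g]
  proof (rule Bochner_Integration.integrable_bound)
    show "AE x in M. norm ((f x)\<^sup>2) \<le> norm ((g x)\<^sup>2)"
      using le by eventually_elim (simp add: abs_le_square_iff)
  qed (use f in measurable)
  then show ?thesis using f by (simp add: L2_def)
qed

lemma L2_scale:
  assumes "f \<in> L2 M"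
  shows "(\<lambda>x. c * f x) \<in> L2 M"
  using assms by (auto simp: L2_def power_mult_distrib)

lemma L2_mult_integrable:
  assumes f: "f \<in> L2 M" and g: "g \<in> L2 M"
  shows "integrable M (\<lambda>x. f x * g x)"
proof (rule Bochner_Integration.integrable_bound)
  show "integrable M (\<lambda>x. (f x)\<^sup>2 + (g x)\<^sup>2)"
    using f g by (simp add: L2_integrable_power2)
  have "\<bar>a * b\<bar> \<le> a\<^sup>2 + b\<^sup>2" for a b :: real
  proof -
    have "0 \<le> (\<bar>a\<bar> - \<bar>b\<bar>)\<^sup>2 + a\<^sup>2 + b\<^sup>2" by (intro add_nonneg_nonneg) auto
    then show ?thesis by (simp add: power2_diff abs_mult)
  qed
  then show "AE x in M. norm (f x * g x) \<le> norm ((f x)\<^sup>2 + (g x)\<^sup>2)" by auto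
  show "(\<lambda>x. f x * g x) \<in> borel_measurable M" using L2_measurable[OF f] L2_measurable[OF g] by measurable
qed

lemma L2_add:
  assumes f: "f \<in> L2 M" and g: "g \<in> L2 M"
  shows "(\<lambda>x. f x + g x) \<in> L2 M"
  using f g L2_mult_integrable[OF f g]
  by (simp add: L2_def power2_sum borel_measurable_add mult.assoc)

lemma L2_lincomb: "f \<in> L2 M \<Longrightarrow> g \<in> L2 M \<Longrightarrow> (\<lambda>x. a * f x + b * g x) \<in> L2 M"
  by (intro L2_add L2_scale)

lemma L2_diff: "f \<in> L2 M \<Longrightarrow> g \<in> L2 M \<Longrightarrow> (\<lambda>x. f x - g x) \<in> L2 M"
  using L2_lincomb[of f M g 1 "-1"] by simp

lemma L2_divide: "f \<in> L2 M \<Longrightarrow> (\<lambda>x. f x / c) \<in> L2 M"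
  using L2_scale[of f M "1/c"] by simp

lemma L2_minus: "f \<in> L2 M \<Longrightarrow> (\<lambda>x. - f x) \<in> L2 M"
  using L2_scale[of f M "-1"] by simp

lemma L2_norm_nonneg [simp]: "0 \<le> L2_norm M f"
  by (simp add: L2_norm_def)

lemma L2_norm_power2: "(L2_norm M f)\<^sup>2 = (\<integral>x. (f x)\<^sup>2 \<partial>M)"
  by (simp add: L2_norm_def)

lemma L2_norm_le_iff: "0 \<le> C \<Longrightarrow> L2_norm M f \<le> C \<longleftrightarrow> (\<integral>x. (f x)\<^sup>2 \<partial>M) \<le> C\<^sup>2"
  by (metis L2_norm_nonneg L2_norm_power2 power2_le_imp_le power_mono)

lemma L2_norm_cong_AE:
  assumes "f \<in> borel_measurable M" "g \<in> borel_measurable M" "AE x in M. f x = g x"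
  shows "L2_norm M f = L2_norm M g"
  unfolding L2_norm_def using assms by (intro arg_cong[of _ _ sqrt] integral_cong_AE) auto

lemma L2_norm_scale: "L2_norm M (\<lambda>x. c * f x) = \<bar>c\<bar> * L2_norm M f"
  by (simp add: L2_norm_def power_mult_distrib real_sqrt_mult)

lemma L2_norm_minus: "L2_norm M (\<lambda>x. - f x) = L2_norm M f"
  by (simp add: L2_norm_def)

lemma L2_norm_divide: "L2_norm M (\<lambda>x. f x / c) = L2_norm M f / \<bar>c\<bar>"
  using L2_norm_scale[of M "1/c" f] by simp

lemma L2_norm_diff_commute: "L2_norm M (\<lambda>x. f x - g x) = L2_norm M (\<lambda>x. g x - f x)"
  by (simp add: L2_norm_def power2_commute)

lemma L2_norm_zero [simp]: "L2_norm M (\<lambda>x. 0) = 0"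
  by (simp add: L2_norm_def)

lemma L2_norm_eq_0:
  assumes "f \<in> L2 M" "L2_norm M f = 0"
  shows "AE x in M. f x = 0"
proof -
  have "(\<integral>x. (f x)\<^sup>2 \<partial>M) = 0" using assms(2) by (simp add: L2_norm_power2[symmetric])
  then show ?thesis
    using integral_nonneg_eq_0_iff_AE[OF L2_integrable_power2[OF assms(1)]] by simp
qed

lemma L2_Cauchy_Schwarz:
  assumes f: "f \<in> L2 M" and g: "g \<in> L2 M"
  shows "\<bar>\<integral>x. f x * g x \<partial>M\<bar> \<le> L2_norm M f * L2_norm M g"
proof -
  let ?a = "L2_norm M f" and ?b = "L2_norm M g" and ?c = "\<integral>x. f x * g x \<partial>M"
  have ineq: "0 \<le> s\<^sup>2 * ?a\<^sup>2 + 2 * s * t * ?c + t\<^sup>2 * ?b\<^sup>2" for s t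
  proof -
    have "0 \<le> (\<integral>x. (s * f x + t * g x)\<^sup>2 \<partial>M)" by simp
    also have "\<dots> = (\<integral>x. s\<^sup>2 * (f x)\<^sup>2 + 2 * s * t * (f x * g x) + t\<^sup>2 * (g x)\<^sup>2 \<partial>M)"
      by (intro Bochner_Integration.integral_cong) (auto simp: power2_eq_square algebra_simps)
    also have "\<dots> = s\<^sup>2 * ?a\<^sup>2 + 2 * s * t * ?c + t\<^sup>2 * ?b\<^sup>2"
      using L2_integrable_power2[OF f] L2_integrable_power2[OF g] L2_mult_integrable[OF f g]
      by (simp add: L2_norm_power2)
    finally show ?thesis .
  qed
  have "?c\<^sup>2 \<le> ?a\<^sup>2 * ?b\<^sup>2"
  proof (cases "?b = 0")
    case False
    have "0 \<le> ?b\<^sup>2 * (?a\<^sup>2 * ?b\<^sup>2 - ?c\<^sup>2)"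
      using ineq[of "?b\<^sup>2" "- ?c"] by (simp add: power2_eq_square algebra_simps)
    then show ?thesis using False by (simp add: zero_le_mult_iff)
  next
    \<comment> \<open>With the norm of \<open>g\<close> zero the quadratic form is affine in t, so a
      nonzero linear coefficient would make it negative for suitable t.\<close>
    case True
    show ?thesis
    proof (cases "?c = 0")
      case False
      have "0 \<le> ?a\<^sup>2 - 2 * (?a\<^sup>2 + 1)"
      proof -
        have "2 * 1 * (- (?a\<^sup>2 + 1) / ?c) * ?c = - (2 * (?a\<^sup>2 + 1))" using False by simp
        then show ?thesis using ineq[of 1 "- (?a\<^sup>2 + 1) / ?c"] True by simp
      qed
      then have False by (smt (verit) zero_le_power2)
      then show ?thesis ..
    qed (use True in auto)
  qed
  then have "?c\<^sup>2 \<le> (?a * ?b)\<^sup>2" by (simp add: power_mult_distrib)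
  then show ?thesis by (metis L2_norm_nonneg abs_le_square_iff abs_of_nonneg mult_nonneg_nonneg)
qed

lemma L2_norm_triangle:
  assumes f: "f \<in> L2 M" and g: "g \<in> L2 M"
  shows "L2_norm M (\<lambda>x. f x + g x) \<le> L2_norm M f + L2_norm M g"
proof -
  have "(\<integral>x. (f x + g x)\<^sup>2 \<partial>M) = (\<integral>x. (f x)\<^sup>2 + (2 * (f x * g x) + (g x)\<^sup>2) \<partial>M)"
    by (intro Bochner_Integration.integral_cong) (auto simp: power2_eq_square algebra_simps)
  also have "\<dots> = (L2_norm M f)\<^sup>2 + 2 * (\<integral>x. f x * g x \<partial>M) + (L2_norm M g)\<^sup>2"
    using L2_integrable_power2[OF f] L2_integrable_power2[OF g] L2_mult_integrable[OF f g]
    by (simp add: L2_norm_power2)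
  also have "\<dots> \<le> (L2_norm M f + L2_norm M g)\<^sup>2"
    using L2_Cauchy_Schwarz[OF f g] by (simp add: power2_sum)
  finally show ?thesis by (subst L2_norm_le_iff) auto
qed

lemma L2_norm_triangle_diff:
  assumes f: "f \<in> L2 M" and g: "g \<in> L2 M"
  shows "L2_norm M (\<lambda>x. f x - g x) \<le> L2_norm M f + L2_norm M g"
  using L2_norm_triangle[OF f L2_minus[OF g]] by (simp add: L2_norm_minus)

lemma L2_norm_reverse_triangle:
  assumes "f \<in> L2 M" "g \<in> L2 M"
  shows "\<bar>L2_norm M f - L2_norm M g\<bar> \<le> L2_norm M (\<lambda>x. f x - g x)"
proof -
  have "L2_norm M f \<le> L2_norm M (\<lambda>x. f x - g x) + L2_norm M g"
    using L2_norm_triangle[OF L2_diff[OF assms] assms(2)] by simp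
  moreover have "L2_norm M g \<le> L2_norm M (\<lambda>x. f x - g x) + L2_norm M f"
    using L2_norm_triangle[OF L2_diff[OF assms(2,1)] assms(1)] by (simp add: L2_norm_diff_commute[of M g f])
  ultimately show ?thesis by linarith
qed

lemma L2_norm_diff_power2:
  assumes f: "f \<in> L2 M" and g: "g \<in> L2 M"
  shows "(L2_norm M (\<lambda>x. f x - g x))\<^sup>2 = (L2_norm M f)\<^sup>2 - 2 * (\<integral>x. f x * g x \<partial>M) + (L2_norm M g)\<^sup>2"
proof -
  have "(\<integral>x. (f x - g x)\<^sup>2 \<partial>M) = (\<integral>x. (f x)\<^sup>2 - 2 * (f x * g x) + (g x)\<^sup>2 \<partial>M)"
    by (intro Bochner_Integration.integral_cong) (auto simp: power2_eq_square algebra_simps)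
  then show ?thesis
    using L2_integrable_power2[OF f] L2_integrable_power2[OF g] L2_mult_integrable[OF f g]
    by (simp add: L2_norm_power2)
qed

lemma L2_norm_le_dual:
  assumes f: "f \<in> L2 M" and C: "0 \<le> C" "\<And>g. g \<in> L2 M \<Longrightarrow> \<bar>\<integral>x. f x * g x \<partial>M\<bar> \<le> C * L2_norm M g"
  shows "L2_norm M f \<le> C"
proof (cases "L2_norm M f = 0")
  case False
  have "(L2_norm M f)\<^sup>2 \<le> C * L2_norm M f"
  proof -
    have "(\<integral>x. f x * f x \<partial>M) = (L2_norm M f)\<^sup>2"
      by (simp only: L2_norm_power2) (simp add: power2_eq_square)
    then show ?thesis using C(2)[OF f] by simp
  qed
  moreover have "0 < L2_norm M f" using False L2_norm_nonneg[of M f] by linarith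
  ultimately show ?thesis by (simp add: power2_eq_square)
qed (use C in simp)

lemma L2_nn_integral:
  assumes "f \<in> L2 M"
  shows "(\<integral>\<^sup>+x. ennreal ((f x)\<^sup>2) \<partial>M) = ennreal ((L2_norm M f)\<^sup>2)"
  using assms by (simp add: L2_norm_power2 nn_integral_eq_integral L2_integrable_power2)

lemma L2I_nn_integral:
  assumes "f \<in> borel_measurable M" "(\<integral>\<^sup>+x. ennreal ((f x)\<^sup>2) \<partial>M) \<le> ennreal (C\<^sup>2)" "0 \<le> C"
  shows "f \<in> L2 M" "L2_norm M f \<le> C"
proof -
  have "integrable M (\<lambda>x. (f x)\<^sup>2)"
    using assms by (intro integrableI_bounded) (auto simp: less_top[symmetric] top_unique)
  then show f: "f \<in> L2 M" using assms by (simp add: L2_def)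
  then show "L2_norm M f \<le> C"
  proof -
    have "ennreal ((L2_norm M f)\<^sup>2) \<le> ennreal (C\<^sup>2)" using assms(2) L2_nn_integral[OF f] by metis
    then have "(L2_norm M f)\<^sup>2 \<le> C\<^sup>2" by (subst (asm) ennreal_le_iff) auto
    then show ?thesis using assms(3) by (rule power2_le_imp_le)
  qed
qed

text \<open>Takes the place of completeness: the limit is already known pointwise, and lower
  semicontinuity of the norm supplies membership and the bound.\<close>

lemma L2_Fatou:
  fixes u :: "nat \<Rightarrow> 'a \<Rightarrow> real"
  assumes u: "\<And>n. u n \<in> L2 M" and f: "f \<in> borel_measurable M"
    and lim: "AE x in M. (\<lambda>n. u n x) \<longlonglongrightarrow> f x"
    and C: "0 \<le> C" "eventually (\<lambda>n. L2_norm M (u n) \<le> C) sequentially"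
  shows "f \<in> L2 M" "L2_norm M f \<le> C"
proof -
  have "(\<integral>\<^sup>+x. ennreal ((f x)\<^sup>2) \<partial>M) = (\<integral>\<^sup>+x. liminf (\<lambda>n. ennreal ((u n x)\<^sup>2)) \<partial>M)"
  proof (rule nn_integral_cong_AE)
    show "AE x in M. ennreal ((f x)\<^sup>2) = liminf (\<lambda>n. ennreal ((u n x)\<^sup>2))"
      using lim
    proof eventually_elim
      case (elim x)
      then have "(\<lambda>n. ennreal ((u n x)\<^sup>2)) \<longlonglongrightarrow> ennreal ((f x)\<^sup>2)"
        by (intro tendsto_ennrealI tendsto_power)
      then show ?case by (rule lim_imp_Liminf[OF trivial_limit_sequentially, symmetric])
    qed
  qed
  also have "\<dots> \<le> liminf (\<lambda>n. \<integral>\<^sup>+x. ennreal ((u n x)\<^sup>2) \<partial>M)"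
    using u by (intro nn_integral_liminf) (auto simp: L2_def)
  also have "\<dots> = liminf (\<lambda>n. ennreal ((L2_norm M (u n))\<^sup>2))"
    by (simp add: L2_nn_integral[OF u])
  also have "\<dots> \<le> ennreal (C\<^sup>2)"
  proof (rule Liminf_le)
    show "eventually (\<lambda>n. ennreal ((L2_norm M (u n))\<^sup>2) \<le> ennreal (C\<^sup>2)) sequentially"
      using C(2) by eventually_elim (auto intro!: ennreal_leI power_mono)
  qed simp
  finally show "f \<in> L2 M" "L2_norm M f \<le> C" using L2I_nn_integral[OF f _ C(1)] by auto
qed

lemma L2_norm_indicator:
  assumes "A \<in> sets M" "emeasure M A < \<infinity>"
  shows "(indicator A :: 'a \<Rightarrow> real) \<in> L2 M" "L2_norm M (indicator A) = sqrt (measure M A)"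
proof -
  have [simp]: "(\<lambda>x. (indicator A x :: real)\<^sup>2) = indicator A" by (auto simp: indicator_def)
  show "(indicator A :: 'a \<Rightarrow> real) \<in> L2 M" using assms by (auto simp: L2_def)
  show "L2_norm M (indicator A) = sqrt (measure M A)"
    unfolding L2_norm_def using assms sets.sets_into_space[OF assms(1)] by (simp add: Int_absorb2)
qed

text \<open>Cauchy-Schwarz in \<open>s\<close> against the constant 1 bounds
  \<open>(h x)\<^sup>2\<close> by the mass of \<open>I\<close> times the integral of
  \<open>(H s x)\<^sup>2\<close>, and Tonelli integrates this over \<open>M\<close>. The last clause
  is Fubini. With \<open>C = 0\<close> the lemma turns identities that hold almost everywhere for
  each single \<open>s\<close> into an identity of integrals.\<close>

lemma Minkowski_integral:
  fixes H :: "'b \<Rightarrow> 'a \<Rightarrow> real"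
  assumes I: "finite_measure I" and M: "sigma_finite_measure M"
    and H: "(\<lambda>(s, x). H s x) \<in> borel_measurable (I \<Otimes>\<^sub>M M)"
    and L2: "\<And>s. s \<in> space I \<Longrightarrow> H s \<in> L2 M" "\<And>s. s \<in> space I \<Longrightarrow> L2_norm M (H s) \<le> C" and C: "0 \<le> C"
  defines "h \<equiv> \<lambda>x. \<integral>s. H s x \<partial>I"
  shows "AE x in M. integrable I (\<lambda>s. H s x)"
    and "h \<in> L2 M" and "L2_norm M h \<le> measure I (space I) * C"
    and "\<And>g. g \<in> L2 M \<Longrightarrow> (\<integral>x. h x * g x \<partial>M) = (\<integral>s. (\<integral>x. H s x * g x \<partial>M) \<partial>I)"
proof -
  interpret I: finite_measure I by fact
  interpret M: sigma_finite_measure M by fact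
  interpret IM: pair_sigma_finite I M ..
  let ?T = "measure I (space I)"
  note H[measurable]
  have Hs: "(\<lambda>s. H s x) \<in> borel_measurable I" if "x \<in> space M" for x
    using that by measurable
  have hm: "h \<in> borel_measurable M"
    unfolding h_def using H by (intro I.borel_measurable_lebesgue_integral) (simp add: case_prod_unfold measurable_pair_swap_iff[of _ M I])
  have "(\<integral>\<^sup>+x. (\<integral>\<^sup>+s. ennreal ((H s x)\<^sup>2) \<partial>I) \<partial>M) = (\<integral>\<^sup>+s. (\<integral>\<^sup>+x. ennreal ((H s x)\<^sup>2) \<partial>M) \<partial>I)"
    by (rule IM.Fubini') measurable
  also have "\<dots> \<le> (\<integral>\<^sup>+s. ennreal (C\<^sup>2) \<partial>I)"
    using L2 by (intro nn_integral_mono) (auto simp: L2_nn_integral intro!: ennreal_leI power_mono)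
  also have "\<dots> = ennreal (?T * C\<^sup>2)"
    by (simp add: I.emeasure_eq_measure ennreal_mult mult.commute)
  finally have dbl: "(\<integral>\<^sup>+x. (\<integral>\<^sup>+s. ennreal ((H s x)\<^sup>2) \<partial>I) \<partial>M) \<le> ennreal (?T * C\<^sup>2)" .
  have fin: "AE x in M. (\<integral>\<^sup>+s. ennreal ((H s x)\<^sup>2) \<partial>I) \<noteq> \<infinity>"
  proof (rule nn_integral_noteq_infinite)
    show "(\<lambda>x. \<integral>\<^sup>+s. ennreal ((H s x)\<^sup>2) \<partial>I) \<in> borel_measurable M"
      by (rule I.borel_measurable_nn_integral) (simp add: case_prod_unfold, measurable)
  qed (use dbl in \<open>auto simp: top_unique\<close>)
  have one: "(\<lambda>_. 1) \<in> L2 I" "L2_norm I (\<lambda>_. 1) = sqrt ?T" by (auto simp: L2_def L2_norm_def)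
  have HL2: "AE x in M. (\<lambda>s. H s x) \<in> L2 I"
    using fin AE_space
  proof eventually_elim
    case (elim x)
    then obtain c where c: "0 \<le> c" "(\<integral>\<^sup>+s. ennreal ((H s x)\<^sup>2) \<partial>I) = ennreal c"
      by (metis ennreal_cases infinity_ennreal_def)
    show ?case using L2I_nn_integral(1)[OF Hs[OF elim(2)], of "sqrt c"] c by simp
  qed
  then show int: "AE x in M. integrable I (\<lambda>s. H s x)"
    by eventually_elim (use L2_mult_integrable[OF _ one(1)] in simp)
  have "(\<integral>\<^sup>+x. ennreal ((h x)\<^sup>2) \<partial>M) \<le> (\<integral>\<^sup>+x. ennreal ?T * (\<integral>\<^sup>+s. ennreal ((H s x)\<^sup>2) \<partial>I) \<partial>M)"
  proof (rule nn_integral_mono_AE)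
    show "AE x in M. ennreal ((h x)\<^sup>2) \<le> ennreal ?T * (\<integral>\<^sup>+s. ennreal ((H s x)\<^sup>2) \<partial>I)"
      using HL2
    proof eventually_elim
      case (elim x)
      have "\<bar>h x\<bar> \<le> L2_norm I (\<lambda>s. H s x) * sqrt ?T"
        using L2_Cauchy_Schwarz[OF elim one(1)] one(2) by (simp add: h_def)
      then have "(h x)\<^sup>2 \<le> (L2_norm I (\<lambda>s. H s x) * sqrt ?T)\<^sup>2"
        by (metis L2_norm_nonneg abs_le_square_iff abs_of_nonneg mult_nonneg_nonneg real_sqrt_ge_zero measure_nonneg)
      then have "ennreal ((h x)\<^sup>2) \<le> ennreal (?T * (L2_norm I (\<lambda>s. H s x))\<^sup>2)"
        by (intro ennreal_leI) (simp add: power_mult_distrib mult.commute)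
      then show ?case by (simp add: L2_nn_integral[OF elim] ennreal_mult)
    qed
  qed
  also have "\<dots> = ennreal ?T * (\<integral>\<^sup>+x. (\<integral>\<^sup>+s. ennreal ((H s x)\<^sup>2) \<partial>I) \<partial>M)"
  proof (rule nn_integral_cmult)
    show "(\<lambda>x. \<integral>\<^sup>+s. ennreal ((H s x)\<^sup>2) \<partial>I) \<in> borel_measurable M"
      by (rule I.borel_measurable_nn_integral) (simp add: case_prod_unfold, measurable)
  qed
  also have "\<dots> \<le> ennreal ?T * ennreal (?T * C\<^sup>2)" using dbl by (intro mult_left_mono) auto
  also have "\<dots> = ennreal ((?T * C)\<^sup>2)" using C by (simp add: ennreal_mult[symmetric] power2_eq_square ac_simps)
  finally have "(\<integral>\<^sup>+x. ennreal ((h x)\<^sup>2) \<partial>M) \<le> ennreal ((?T * C)\<^sup>2)" .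
  then show "h \<in> L2 M" "L2_norm M h \<le> ?T * C"
    using L2I_nn_integral[OF hm] C by auto
  fix g assume g: "g \<in> L2 M"
  note [measurable] = L2_measurable[OF g]
  have "integrable (I \<Otimes>\<^sub>M M) (\<lambda>(s, x). H s x * g x)"
  proof (rule integrableI_bounded)
    show Hg: "(\<lambda>(s, x). H s x * g x) \<in> borel_measurable (I \<Otimes>\<^sub>M M)" by measurable
    note Hg[measurable]
    have "(\<integral>\<^sup>+z. ennreal (norm (case z of (s, x) \<Rightarrow> H s x * g x)) \<partial>(I \<Otimes>\<^sub>M M)) = (\<integral>\<^sup>+s. (\<integral>\<^sup>+x. ennreal \<bar>H s x * g x\<bar> \<partial>M) \<partial>I)"
      by (subst M.nn_integral_fst[symmetric]) simp_all
    also have "\<dots> \<le> (\<integral>\<^sup>+s. ennreal (C * L2_norm M g) \<partial>I)"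
    proof (rule nn_integral_mono)
      fix s assume s: "s \<in> space I"
      have a: "(\<lambda>x. \<bar>H s x\<bar>) \<in> L2 M" "(\<lambda>x. \<bar>g x\<bar>) \<in> L2 M"
        using L2(1)[OF s] g by (auto simp: L2_def)
      have "(\<integral>\<^sup>+x. ennreal \<bar>H s x * g x\<bar> \<partial>M) = ennreal (\<integral>x. \<bar>H s x\<bar> * \<bar>g x\<bar> \<partial>M)"
        using L2_mult_integrable[OF a] by (simp add: abs_mult nn_integral_eq_integral)
      also have "\<dots> \<le> ennreal (C * L2_norm M g)"
      proof (rule ennreal_leI)
        have "(\<integral>x. \<bar>H s x\<bar> * \<bar>g x\<bar> \<partial>M) \<le> L2_norm M (H s) * L2_norm M g"
          using L2_Cauchy_Schwarz[OF a] by (simp add: L2_norm_def)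
        also have "\<dots> \<le> C * L2_norm M g" using L2(2)[OF s] by (intro mult_right_mono) auto
        finally show "(\<integral>x. \<bar>H s x\<bar> * \<bar>g x\<bar> \<partial>M) \<le> C * L2_norm M g" .
      qed
      finally show "(\<integral>\<^sup>+x. ennreal \<bar>H s x * g x\<bar> \<partial>M) \<le> ennreal (C * L2_norm M g)" .
    qed
    also have "\<dots> < \<infinity>" by (simp add: ennreal_mult_less_top I.emeasure_eq_measure)
    finally show "(\<integral>\<^sup>+z. ennreal (norm (case z of (s, x) \<Rightarrow> H s x * g x)) \<partial>(I \<Otimes>\<^sub>M M)) < \<infinity>" .
  qed
  from IM.Fubini_integral[OF this]
  show "(\<integral>x. h x * g x \<partial>M) = (\<integral>s. (\<integral>x. H s x * g x \<partial>M) \<partial>I)"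
    by (simp add: h_def)
qed

section \<open>Gradients on local trees\<close>

lemma borel_eq_open_intervals: "(borel :: real measure) = sigma UNIV (range (\<lambda>(a, b). {a<..<b}))"
  using borel_eq_box[where 'a = real] by (simp add: box_real)

section \<open>Charts, measurability and null sets of the length measure\<close>

locale local_tree_gradient =
  fixes \<iota> :: ereal
    and l :: "nat \<Rightarrow> real" and \<gamma> :: "nat \<Rightarrow> real \<Rightarrow> 'a::{heine_borel, second_countable_topology}"
    and \<nu> :: "'a measure"
  assumes local_tree: "uniform_local_tree TYPE('a) \<iota>"
    and orientation: "orientation \<iota> l \<gamma>"
    and length_measure: "length_measure \<iota> \<nu>"
begin

lemma \<iota>_pos: "0 < \<iota>" and real_tree: "real_tree_on (eball (x::'a) \<iota>)"
  using local_tree by (auto simp: uniform_local_tree_def)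

lemma space_\<nu>: "space \<nu> = skeleton \<iota>"
  using length_measure by (simp add: length_measure_def)

lemma l_pos: "0 < l n"
  using orientation by (simp add: orientation_def local_arc_chart_def)

lemma chart: "local_arc_chart \<iota> (l n) (\<gamma> n)"
  using orientation by (simp add: orientation_def)

lemma skeleton_charts: "skeleton \<iota> = (\<Union>n. \<gamma> n ` {0<..<l n})"
  using orientation by (simp add: orientation_def)

lemma dist_chart: "s \<in> {0..l n} \<Longrightarrow> t \<in> {0..l n} \<Longrightarrow> dist (\<gamma> n s) (\<gamma> n t) = \<bar>s - t\<bar>"
  using chart[of n] by (simp add: local_arc_chart_def isometry_on_interval_def)

lemma inj_chart: "inj_on (\<gamma> n) {0..l n}"
  by (rule inj_onI) (use dist_chart in force)

lemma inj_chart': "inj_on (\<gamma> n) {0<..<l n}"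
  by (rule inj_on_subset[OF inj_chart]) auto

lemma continuous_on_chart: "continuous_on {0..l n} (\<gamma> n)"
  unfolding continuous_on_iff using dist_chart by (auto simp: dist_real_def)

text \<open>The shifted chart is itself a geodesic in the ball around its starting point, since the
  piece is shorter than \<iota>; uniqueness of geodesics in that real tree identifies it with the
  chosen one.\<close>

lemma open_arc_eq_chart:
  assumes "0 \<le> s" "s < t" "t \<le> l n" "ereal (t - s) < \<iota>"
  shows "open_arc \<iota> (\<gamma> n s) (\<gamma> n t) = \<gamma> n ` {s<..<t}"
proof -
  let ?B = "eball (\<gamma> n s) \<iota>"
  have d: "dist (\<gamma> n s) (\<gamma> n t) = t - s" using dist_chart[of s n t] assms by auto
  define \<psi> where "\<psi> r = \<gamma> n (s + r)" for r
  have G: "geodesic_in ?B (\<gamma> n s) (\<gamma> n t) \<psi>"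
  proof -
    have "\<psi> r \<in> ?B" if "r \<in> {0..t - s}" for r
    proof -
      have "dist (\<gamma> n s) (\<gamma> n (s + r)) = r" using dist_chart[of s n "s + r"] assms that by auto
      then show ?thesis using that assms(4) by (auto simp: eball_def \<psi>_def intro: le_less_trans[of _ "ereal (t - s)"])
    qed
    moreover have "isometry_on_interval (t - s) \<psi>"
      using assms dist_chart[of _ n] by (auto simp: isometry_on_interval_def \<psi>_def)
    ultimately show ?thesis unfolding geodesic_in_def d by (auto simp: \<psi>_def)
  qed
  moreover have "geodesic_in ?B (\<gamma> n s) (\<gamma> n t) (the_geodesic ?B (\<gamma> n s) (\<gamma> n t))"
    unfolding the_geodesic_def by (rule someI[where P = "geodesic_in ?B (\<gamma> n s) (\<gamma> n t)", OF G])
  moreover have "\<gamma> n s \<in> ?B" "\<gamma> n t \<in> ?B" using \<iota>_pos assms(4) d by (auto simp: eball_def zero_ereal_def)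
  ultimately have "the_geodesic ?B (\<gamma> n s) (\<gamma> n t) r = \<psi> r" if "r \<in> {0..t - s}" for r
    using real_tree[of "\<gamma> n s"] that d unfolding real_tree_on_def by metis
  then have "open_arc \<iota> (\<gamma> n s) (\<gamma> n t) = \<psi> ` {0<..<t - s}"
    unfolding open_arc_def d by (intro image_cong) auto
  also have "\<dots> = \<gamma> n ` ((+) s ` {0<..<t - s})" by (auto simp: \<psi>_def)
  also have "(+) s ` {0<..<t - s} = {s<..<t}" 
  proof
    show "{s<..<t} \<subseteq> (+) s ` {0<..<t - s}"
    proof
      fix x assume "x \<in> {s<..<t}"
      then show "x \<in> (+) s ` {0<..<t - s}" by (intro image_eqI[of _ _ "x - s"]) auto
    qed
  qed auto
  finally show ?thesis .
qed

text \<open>\<iota> may be infinite, hence a real step below it.\<close>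

lemma short_step: obtains \<delta> :: real where "0 < \<delta>" "ereal \<delta> < \<iota>"
proof -
  obtain r where "0 < r" "r < \<iota>" using dense[OF \<iota>_pos] by auto
  then show ?thesis using that[of "real_of_ereal r"] by (cases r) (auto simp: zero_ereal_def)
qed

lemma chart_short_interval_sets:
  assumes "0 \<le> s" "t \<le> l n" "ereal (t - s) < \<iota>"
  shows "\<gamma> n ` {s<..<t} \<in> sets \<nu>"
proof (cases "s < t")
  case True
  have "\<gamma> n t \<in> eball (\<gamma> n s) \<iota>" using dist_chart[of s n t] assms True by (simp add: eball_def)
  then have "open_arc \<iota> (\<gamma> n s) (\<gamma> n t) \<in> sets \<nu>"
    using length_measure unfolding length_measure_def by (auto intro!: sigma_sets.Basic)
  then show ?thesis using open_arc_eq_chart[of s t n] True assms by simp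
qed simp

text \<open>The generating arcs join points closer than \<iota>, but a chart inside a ball of radius
  \<iota> can be longer than that. A long interval is a countable union of short rational
  ones.\<close>

lemma chart_interval_sets:
  assumes "0 \<le> s" "t \<le> l n"
  shows "\<gamma> n ` {s<..<t} \<in> sets \<nu>"
proof -
  obtain \<delta> :: real where \<delta>: "0 < \<delta>" "ereal \<delta> < \<iota>" by (rule short_step)
  define J where "J = {(a, b). a \<in> \<rat> \<and> b \<in> \<rat> \<and> s \<le> a \<and> b \<le> t \<and> b - a < \<delta>}"
  have "countable J" unfolding J_def
    by (rule countable_subset[of _ "\<rat> \<times> \<rat>"]) (auto intro: countable_rat)
  have "{s<..<t} = (\<Union>(a, b)\<in>J. {a<..<b})"
  proof
    show "(\<Union>(a, b)\<in>J. {a<..<b}) \<subseteq> {s<..<t}" by (auto simp: J_def)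
    show "{s<..<t} \<subseteq> (\<Union>(a, b)\<in>J. {a<..<b})"
    proof
      fix x assume x: "x \<in> {s<..<t}"
      obtain a where a: "a \<in> \<rat>" "max s (x - \<delta>/2) < a" "a < x" using Rats_dense_in_real[of "max s (x - \<delta>/2)" x] x \<delta> by auto
      obtain b where b: "b \<in> \<rat>" "x < b" "b < min t (x + \<delta>/2)" using Rats_dense_in_real[of x "min t (x + \<delta>/2)"] x \<delta> by auto
      have "(a, b) \<in> J" using a b by (auto simp: J_def)
      then show "x \<in> (\<Union>(a, b)\<in>J. {a<..<b})" using a b by force
    qed
  qed
  then have "\<gamma> n ` {s<..<t} = (\<Union>p\<in>J. \<gamma> n ` {fst p<..<snd p})" by (auto simp: image_UN case_prod_unfold)
  also have "\<dots> \<in> sets \<nu>"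
  proof (rule sets.countable_UN'[OF \<open>countable J\<close>])
    have "\<gamma> n ` {fst p<..<snd p} \<in> sets \<nu>" if "p \<in> J" for p
      using that assms \<delta> by (intro chart_short_interval_sets)
        (auto simp: J_def intro: less_trans[of _ "ereal \<delta>"])
    then show "(\<lambda>p. \<gamma> n ` {fst p<..<snd p}) ` J \<subseteq> sets \<nu>" by auto
  qed
  finally show ?thesis .
qed

lemma chart_image_sets:
  assumes "B \<in> sets borel"
  shows "\<gamma> n ` (B \<inter> {0<..<l n}) \<in> sets \<nu>"
proof -
  have "B \<in> sigma_sets UNIV (range (\<lambda>(a, b). {a<..<b}))"
    using assms by (subst (asm) borel_eq_open_intervals) auto
  then show ?thesis
  proof induction
    case (Basic C)
    then obtain a b where "C = {a<..<b}" by auto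
    then have "C \<inter> {0<..<l n} = {max a 0<..<min b (l n)}" by auto
    then show ?case by (auto intro!: chart_interval_sets)
  next
    case (Compl C)
    have "\<gamma> n ` ((UNIV - C) \<inter> {0<..<l n}) = \<gamma> n ` {0<..<l n} - \<gamma> n ` (C \<inter> {0<..<l n})"
      using inj_chart'[of n] by (auto simp: inj_on_def)
    then show ?case using Compl chart_interval_sets[of 0 "l n" n] by auto
  next
    case (Union C)
    have "\<gamma> n ` (\<Union> (range C) \<inter> {0<..<l n}) = (\<Union>i. \<gamma> n ` (C i \<inter> {0<..<l n}))" by auto
    then show ?case using Union by auto
  qed auto
qed

definition chart_inv :: "nat \<Rightarrow> 'a \<Rightarrow> real" where
  "chart_inv n = the_inv_into {0..l n} (\<gamma> n)"

lemma chart_inv [simp]: "t \<in> {0..l n} \<Longrightarrow> chart_inv n (\<gamma> n t) = t"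
  unfolding chart_inv_def by (rule the_inv_into_f_f[OF inj_chart])

lemma chart_inv_measurable:
  assumes "a \<ge> 0" "b \<le> l n"
  shows "chart_inv n \<in> borel_measurable (restrict_space \<nu> (\<gamma> n ` {a<..<b}))"
proof (rule measurableI)
  fix B :: "real set" assume B: "B \<in> sets borel"
  have S: "\<gamma> n ` {a<..<b} \<in> sets \<nu>" using assms by (rule chart_interval_sets)
  have "chart_inv n -` B \<inter> \<gamma> n ` {a<..<b} = \<gamma> n ` ((B \<inter> {a<..<b}) \<inter> {0<..<l n})"
    using assms by auto
  then have "chart_inv n -` B \<inter> \<gamma> n ` {a<..<b} \<in> sets \<nu>"
    using B by (metis chart_image_sets greaterThanLessThan_borel sets.Int)
  then show "chart_inv n -` B \<inter> space (restrict_space \<nu> (\<gamma> n ` {a<..<b})) \<in> sets (restrict_space \<nu> (\<gamma> n ` {a<..<b}))"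
    using S sets.sets_into_space[OF S] by (simp add: space_restrict_space2 sets_restrict_space_iff)
qed auto

text \<open>On a short arc, pulling \<nu> back to the line by the inverse chart gives Lebesgue
  measure: the two finite measures agree on open intervals, an intersection-stable generator.
  Countably many short arcs exhaust the chart.\<close>

lemma chart_null_image:
  assumes N: "N \<in> null_sets lborel"
  shows "\<gamma> n ` (N \<inter> {0<..<l n}) \<in> null_sets \<nu>"
proof -
  obtain \<delta> :: real where \<delta>: "0 < \<delta>" "ereal \<delta> < \<iota>" by (rule short_step)
  \<comment> \<open>End points strictly inside the chart lie in the skeleton, and only for such
    points does \<open>length_measure\<close> prescribe the mass of the arc.\<close>
  define J where "J = {(a, b). a \<in> \<rat> \<and> b \<in> \<rat> \<and> 0 < a \<and> a < b \<and> b < l n \<and> b - a < \<delta>}"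
  have J: "countable J" unfolding J_def
    by (rule countable_subset[of _ "\<rat> \<times> \<rat>"]) (auto intro: countable_rat)
  have Nb: "N \<in> sets borel" using N by auto
  have one: "\<gamma> n ` (N \<inter> {a<..<b}) \<in> null_sets \<nu>" if ab: "(a, b) \<in> J" for a b
  proof -
    have ab': "0 < a" "a < b" "b < l n" "ereal (b - a) < \<iota>"
      using ab \<delta> by (auto simp: J_def intro: less_trans[of _ "ereal \<delta>"])
    define S where "S = \<gamma> n ` {a<..<b}"
    have S: "S \<in> sets \<nu>" unfolding S_def using ab' by (intro chart_interval_sets) auto
    define N1 where "N1 = distr (restrict_space lborel {a<..<b}) borel (\<lambda>x. x)"
    define N2 where "N2 = distr (restrict_space \<nu> S) borel (chart_inv n)"
    have e1: "emeasure N1 B = emeasure lborel (B \<inter> {a<..<b})" if "B \<in> sets borel" for B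
      unfolding N1_def using that by (subst emeasure_distr) (auto simp: emeasure_restrict_space space_restrict_space measurable_restrict_space1 Int_commute)
    have e2: "emeasure N2 B = emeasure \<nu> (\<gamma> n ` (B \<inter> {a<..<b}))" if "B \<in> sets borel" for B
    proof -
      have "chart_inv n \<in> borel_measurable (restrict_space \<nu> S)"
        unfolding S_def using ab' by (intro chart_inv_measurable) auto
      then have "emeasure N2 B = emeasure (restrict_space \<nu> S) (chart_inv n -` B \<inter> space (restrict_space \<nu> S))"
        unfolding N2_def using that by (rule emeasure_distr)
      also have "chart_inv n -` B \<inter> space (restrict_space \<nu> S) = \<gamma> n ` (B \<inter> {a<..<b})"
        using ab' S sets.sets_into_space[OF S] by (auto simp: space_restrict_space2 S_def)
      also have "emeasure (restrict_space \<nu> S) \<dots> = emeasure \<nu> (\<gamma> n ` (B \<inter> {a<..<b}))"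
        using S sets.sets_into_space[OF S] by (intro emeasure_restrict_space) (auto simp: S_def Int_absorb2)
      finally show ?thesis .
    qed
    have "N1 = N2"
    proof (rule measure_eqI_generator_eq)
      let ?E = "range (\<lambda>(a, b). {a<..<b :: real})"
      show "Int_stable ?E"
      proof (rule Int_stableI)
        fix A B assume "A \<in> ?E" "B \<in> ?E"
        then obtain a b c d where "A = {a<..<b}" "B = {c<..<d}" by auto
        then have "A \<inter> B = {max a c<..<min b d}" by auto
        then show "A \<inter> B \<in> ?E" by auto
      qed
      show "?E \<subseteq> Pow UNIV" by auto
      show "sets N1 = sigma_sets UNIV ?E" "sets N2 = sigma_sets UNIV ?E"
        unfolding N1_def N2_def by (simp_all, (subst borel_eq_open_intervals, simp)+)
      show "range (\<lambda>k::nat. {-real k<..<real k}) \<subseteq> ?E" by auto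
      have "\<exists>k::nat. - real k < x \<and> x < real k" for x
        using reals_Archimedean2[of "\<bar>x\<bar>"] by (metis abs_less_iff minus_less_iff)
      then show "(\<Union>k::nat. {-real k<..<real k}) = UNIV" by auto
      show "emeasure N1 {-real k<..<real k} \<noteq> \<infinity>" for k :: nat
      proof -
        have "emeasure lborel ({-real k<..<real k} \<inter> {a<..<b}) \<le> emeasure lborel {a<..<b}"
          by (intro emeasure_mono) auto
        then show ?thesis using ab' by (auto simp: e1 top_unique)
      qed
      fix X assume "X \<in> ?E"
      then obtain c d where X: "X = {c<..<d}" by auto
      let ?c = "max a c" and ?d = "min b d"
      have cd: "X \<inter> {a<..<b} = {?c<..<?d}" by (auto simp: X)
      show "emeasure N1 X = emeasure N2 X"
      proof (cases "?c < ?d")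
        case True
        have sh: "ereal (?d - ?c) < \<iota>" using ab'(4) by (rule le_less_trans[rotated]) auto
        have "\<gamma> n ?c \<in> skeleton \<iota>" "\<gamma> n ?d \<in> skeleton \<iota>"
          unfolding skeleton_charts using True ab' by (auto intro!: exI[of _ n] imageI)
        moreover have "dist (\<gamma> n ?c) (\<gamma> n ?d) = ?d - ?c" using dist_chart[of ?c n ?d] True ab' by auto
        ultimately have "emeasure \<nu> (open_arc \<iota> (\<gamma> n ?c) (\<gamma> n ?d)) = ennreal (?d - ?c)"
          using length_measure True sh unfolding length_measure_def by (metis diff_gt_0_iff_gt)
        moreover have "open_arc \<iota> (\<gamma> n ?c) (\<gamma> n ?d) = \<gamma> n ` {?c<..<?d}"
          using True ab' sh by (intro open_arc_eq_chart) auto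
        ultimately have "emeasure \<nu> (\<gamma> n ` {?c<..<?d}) = ennreal (?d - ?c)" by simp
        moreover have "emeasure lborel {?c<..<?d} = ennreal (?d - ?c)" using True by (intro emeasure_lborel_Ioo) auto
        ultimately show ?thesis using e1[of X] e2[of X] cd by (simp add: X)
      next
        case False
        then have "X \<inter> {a<..<b} = {}" using cd by auto
        then show ?thesis using e1[of X] e2[of X] by (simp add: X)
      qed
    qed
    then have "emeasure \<nu> (\<gamma> n ` (N \<inter> {a<..<b})) = emeasure lborel (N \<inter> {a<..<b})"
      using e1[OF Nb] e2[OF Nb] by simp
    also have "\<dots> = 0" using N by (metis emeasure_mono inf_le1 le_zero_eq null_setsD1 null_setsD2)
    finally have "emeasure \<nu> (\<gamma> n ` (N \<inter> {a<..<b})) = 0" .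
    moreover have "\<gamma> n ` (N \<inter> {a<..<b}) \<in> sets \<nu>"
    proof -
      have "N \<inter> {a<..<b} = (N \<inter> {a<..<b}) \<inter> {0<..<l n}" using ab' by auto
      then show ?thesis using chart_image_sets[of "N \<inter> {a<..<b}" n] Nb by auto
    qed
    ultimately show ?thesis by auto
  qed
  have "{0<..<l n} \<subseteq> (\<Union>(a, b)\<in>J. {a<..<b})"
  proof
    fix x assume x: "x \<in> {0<..<l n}"
    obtain a where a: "a \<in> \<rat>" "max 0 (x - \<delta>/2) < a" "a < x" using Rats_dense_in_real[of "max 0 (x - \<delta>/2)" x] x \<delta> by auto
    obtain b where b: "b \<in> \<rat>" "x < b" "b < min (l n) (x + \<delta>/2)" using Rats_dense_in_real[of x "min (l n) (x + \<delta>/2)"] x \<delta> by auto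
    have "(a, b) \<in> J" using a b by (auto simp: J_def)
    then show "x \<in> (\<Union>(a, b)\<in>J. {a<..<b})" using a b by force
  qed
  moreover have "(\<Union>(a, b)\<in>J. {a<..<b}) \<subseteq> {0<..<l n}" by (auto simp: J_def)
  ultimately have "{0<..<l n} = (\<Union>(a, b)\<in>J. {a<..<b})" by auto
  then have "\<gamma> n ` (N \<inter> {0<..<l n}) = (\<Union>p\<in>J. \<gamma> n ` (N \<inter> {fst p<..<snd p}))"
    by (auto simp: case_prod_unfold)
  also have "\<dots> \<in> null_sets \<nu>"
    using one by (intro null_sets_UN' J) auto
  finally show ?thesis .
qed

section \<open>The weak gradient read in charts\<close>

abbreviation grad :: "('a \<Rightarrow> real) \<Rightarrow> 'a \<Rightarrow> real" where
  "grad \<equiv> weak_grad l \<gamma>"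

abbreviation own_arc :: "nat \<Rightarrow> 'a set" where
  "own_arc n \<equiv> disjointed (\<lambda>n. \<gamma> n ` {0<..<l n}) n"

lemma grad_own_arc:
  assumes "z \<in> own_arc n"
  shows "grad u z = deriv (u \<circ> \<gamma> n) (chart_inv n z)"
proof -
  have "grad u z = (\<Sum>k. if k = n then deriv (u \<circ> \<gamma> n) (chart_inv n z) else 0)"
    unfolding weak_grad_def
  proof (rule suminf_cong)
    fix k
    show "indicator (own_arc k) z * deriv (u \<circ> \<gamma> k) (the_inv_into {0..l k} (\<gamma> k) z) =
      (if k = n then deriv (u \<circ> \<gamma> n) (chart_inv n z) else 0)"
    proof (cases "k = n")
      case False
      then have "z \<notin> own_arc k"
        using assms disjoint_family_disjointed[of "\<lambda>n. \<gamma> n ` {0<..<l n}"] unfolding disjoint_family_on_def by blast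
      then show ?thesis using False by simp
    qed (use assms in \<open>simp add: chart_inv_def\<close>)
  qed
  also have "\<dots> = deriv (u \<circ> \<gamma> n) (chart_inv n z)"
    using sums_single[of n "\<lambda>_. deriv (u \<circ> \<gamma> n) (chart_inv n z)"] by (simp add: sums_iff)
  finally show ?thesis .
qed

lemma own_arc_subset: "own_arc n \<subseteq> \<gamma> n ` {0<..<l n}"
  by (rule disjointed_subset)

lemma skeleton_own_arc:
  assumes "z \<in> skeleton \<iota>"
  obtains n t where "z \<in> own_arc n" "t \<in> {0<..<l n}" "z = \<gamma> n t" "\<And>u. grad u z = deriv (u \<circ> \<gamma> n) t"
proof -
  have "z \<in> (\<Union>n. own_arc n)" using assms by (simp add: skeleton_charts UN_disjointed_eq)
  then obtain n where n: "z \<in> own_arc n" by auto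
  then obtain t where t: "t \<in> {0<..<l n}" "z = \<gamma> n t" using own_arc_subset by blast
  then show ?thesis using that[OF n t] grad_own_arc[OF n] by auto
qed

text \<open>Transfers statements from chart parameters to the tree: countably many charts contribute
  null images, and at each point of the skeleton one chart computes the gradients of all functions
  simultaneously.\<close>

lemma AE_skeletonI:
  assumes "\<And>n. AE t in lborel. t \<in> {0<..<l n} \<longrightarrow> R n t"
  shows "AE z in \<nu>. \<exists>n t. t \<in> {0<..<l n} \<and> z = \<gamma> n t \<and> (\<forall>u. grad u z = deriv (u \<circ> \<gamma> n) t) \<and> R n t"
proof -
  have "\<exists>N. N \<in> null_sets lborel \<and> {t. \<not> (t \<in> {0<..<l n} \<longrightarrow> R n t)} \<subseteq> N" for n
    using assms[of n] by (auto simp: eventually_ae_filter)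
  then obtain N where N: "\<And>n. N n \<in> null_sets lborel" "\<And>n. {t. \<not> (t \<in> {0<..<l n} \<longrightarrow> R n t)} \<subseteq> N n"
    by metis
  have null: "(\<Union>n. \<gamma> n ` (N n \<inter> {0<..<l n})) \<in> null_sets \<nu>"
    using chart_null_image[OF N(1)] by (intro null_sets_UN) auto
  show ?thesis
  proof (rule AE_I'[OF null], safe)
    fix z assume z: "z \<in> space \<nu>" "\<nexists>n t. t \<in> {0<..<l n} \<and> z = \<gamma> n t \<and> (\<forall>u. grad u z = deriv (u \<circ> \<gamma> n) t) \<and> R n t"
    obtain n t where nt: "t \<in> {0<..<l n}" "z = \<gamma> n t" "\<And>u. grad u z = deriv (u \<circ> \<gamma> n) t"
      using skeleton_own_arc[of z] z(1) by (metis space_\<nu>)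
    then have "\<not> R n t" using z(2) by blast
    then have "t \<in> N n" using N(2)[of n] nt(1) by blast
    then show "z \<in> (\<Union>n. \<gamma> n ` (N n \<inter> {0<..<l n}))" using nt by blast
  qed
qed

lemma open_skeleton_sets:
  assumes U: "open U"
  shows "U \<inter> skeleton \<iota> \<in> sets \<nu>"
proof -
  have "\<gamma> n ` ({t. \<gamma> n t \<in> U} \<inter> {0<..<l n}) \<in> sets \<nu>" for n
  proof -
    have "continuous_on {0<..<l n} (\<gamma> n)" using continuous_on_chart by (rule continuous_on_subset) auto
    then have "open (\<gamma> n -` U \<inter> {0<..<l n})"
      using U by (intro continuous_on_open_vimage[THEN iffD1, rule_format]) auto
    then have "\<gamma> n ` ((\<gamma> n -` U \<inter> {0<..<l n}) \<inter> {0<..<l n}) \<in> sets \<nu>"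
      by (intro chart_image_sets) auto
    moreover have "(\<gamma> n -` U \<inter> {0<..<l n}) \<inter> {0<..<l n} = {t. \<gamma> n t \<in> U} \<inter> {0<..<l n}" by auto
    ultimately show ?thesis by simp
  qed
  moreover have "U \<inter> skeleton \<iota> = (\<Union>n. \<gamma> n ` ({t. \<gamma> n t \<in> U} \<inter> {0<..<l n}))"
    by (auto simp: skeleton_charts)
  ultimately show ?thesis by auto
qed

text \<open>A derivative depends only on the germ of the function, whether it exists or not, so
  locality holds at every point of the skeleton in \<open>U\<close>.\<close>

lemma grad_local:
  assumes U: "open U" and eq: "\<And>x. x \<in> U \<Longrightarrow> u x = v x" and z: "z \<in> skeleton \<iota>" "z \<in> U"
  shows "grad u z = grad v z"
proof -
  obtain n t where nt: "t \<in> {0<..<l n}" "z = \<gamma> n t" "\<And>u. grad u z = deriv (u \<circ> \<gamma> n) t"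
    using skeleton_own_arc[OF z(1)] by metis
  have "continuous_on {0<..<l n} (\<gamma> n)" using continuous_on_chart by (rule continuous_on_subset) auto
  then have "open (\<gamma> n -` U \<inter> {0<..<l n})"
    using U by (intro continuous_on_open_vimage[THEN iffD1, rule_format]) auto
  then have "eventually (\<lambda>s. s \<in> \<gamma> n -` U \<inter> {0<..<l n}) (nhds t)"
    using nt z by (intro eventually_nhds_in_open) auto
  then have "eventually (\<lambda>s. (u \<circ> \<gamma> n) s = (v \<circ> \<gamma> n) s) (nhds t)"
    by eventually_elim (use eq in auto)
  then show ?thesis unfolding nt(3) by (intro deriv_cong_ev) auto
qed

lemma grad_measurable:
  assumes u: "continuous_on UNIV u"
  shows "grad u \<in> borel_measurable \<nu>"
proof -
  have own: "own_arc n \<in> sets \<nu>" for n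
    using sets.range_disjointed_sets[of "\<lambda>n. \<gamma> n ` {0<..<l n}" \<nu>] chart_interval_sets[of 0 "l n" for n] by auto
  have "(\<lambda>z. indicator (own_arc n) z * deriv (u \<circ> \<gamma> n) (chart_inv n z)) \<in> borel_measurable \<nu>" for n
  proof -
    \<comment> \<open>Clamping the parameter extends \<open>u \<circ> \<gamma> n\<close>
      continuously to the line without changing germs inside the chart; the values of
      \<open>\<gamma> n\<close> outside its interval are arbitrary.\<close>
    define g where "g t = u (\<gamma> n (max 0 (min (l n) t)))" for t
    have "continuous_on UNIV g" unfolding g_def
    proof (rule continuous_on_compose2[OF u])
      show "continuous_on UNIV (\<lambda>t. \<gamma> n (max 0 (min (l n) t)))"
        using l_pos[of n] by (intro continuous_on_compose2[OF continuous_on_chart] continuous_intros) auto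
    qed auto
    then have gm: "deriv g \<in> borel_measurable borel" by (rule borel_measurable_deriv_continuous)
    let ?S = "\<gamma> n ` {0<..<l n}"
    have S: "?S \<in> sets \<nu>" by (rule chart_interval_sets) auto
    have "(\<lambda>z. deriv g (chart_inv n z)) \<in> borel_measurable (restrict_space \<nu> ?S)"
      using measurable_compose[OF chart_inv_measurable gm] by auto
    then have "(\<lambda>z. deriv g (chart_inv n z) * indicator ?S z) \<in> borel_measurable \<nu>"
      using S by (subst (asm) borel_measurable_restrict_space_iff) (auto simp: mult.commute sets.Int_space_eq2)
    then have "(\<lambda>z. indicator (own_arc n) z * (deriv g (chart_inv n z) * indicator ?S z)) \<in> borel_measurable \<nu>"
      by (intro borel_measurable_times[OF borel_measurable_indicator[OF own]])
    moreover have "indicator (own_arc n) z * (deriv g (chart_inv n z) * indicator ?S z) =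
      indicator (own_arc n) z * deriv (u \<circ> \<gamma> n) (chart_inv n z)" for z
    proof (cases "z \<in> own_arc n")
      case True
      then obtain t where t: "t \<in> {0<..<l n}" "z = \<gamma> n t" using own_arc_subset by blast
      have "eventually (\<lambda>s. s \<in> {0<..<l n}) (nhds t)" using t by (intro eventually_nhds_in_open) auto
      then have "eventually (\<lambda>s. g s = (u \<circ> \<gamma> n) s) (nhds t)" by eventually_elim (auto simp: g_def)
      then have "deriv g t = deriv (u \<circ> \<gamma> n) t" by (intro deriv_cong_ev) auto
      then show ?thesis using t by simp
    qed simp
    ultimately show ?thesis by simp
  qed
  then show ?thesis
    unfolding weak_grad_def chart_inv_def[symmetric] by (intro borel_measurable_suminf)
qed

section \<open>Absolutely continuous functions on the tree and linearity of the gradient\<close>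

lemma AC_continuous: "(u :: 'a \<Rightarrow> real) \<in> AC \<iota> \<Longrightarrow> continuous_on UNIV u"
  by (simp add: AC_def)

lemma AC_AE_differentiable:
  fixes u :: "'a \<Rightarrow> real"
  assumes "u \<in> AC \<iota>"
  shows "AE t in lborel. t \<in> {0<..<l n} \<longrightarrow> (u \<circ> \<gamma> n) differentiable (at t)"
  using assms chart[of n] l_pos[of n] by (intro ac_AE_differentiable) (auto simp: AC_def)

text \<open>One comparison of increments with two given functions serves both linear combinations
  and truncations.\<close>

lemma absolutely_continuous_function_on_lipschitz:
  assumes u: "absolutely_continuous_function_on a b u" and v: "absolutely_continuous_function_on a b v"
    and le: "\<And>s t. \<bar>w t - w s\<bar> \<le> A * \<bar>u t - u s\<bar> + B * \<bar>v t - v s\<bar>" and AB: "0 \<le> A" "0 \<le> B"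
  shows "absolutely_continuous_function_on a b w"
proof -
  define good where "good = (\<lambda>D. finite D \<and> (\<forall>(s, t)\<in>D. a \<le> s \<and> s \<le> t \<and> t \<le> b) \<and>
        pairwise (\<lambda>(s, t) (s', t'). {s<..<t} \<inter> {s'<..<t'} = {}) D)"
  have alt: "absolutely_continuous_function_on a b f \<longleftrightarrow> (\<forall>e>0. \<exists>d>0. \<forall>D. good D \<and> (\<Sum>(s, t)\<in>D. t - s) < d \<longrightarrow>
      (\<Sum>(s, t)\<in>D. \<bar>f t - f s\<bar>) < e)" for f
    unfolding absolutely_continuous_function_on_def good_def conj_assoc ..
  show ?thesis
    unfolding alt
  proof (intro allI impI)
    fix e :: real assume e: "0 < e"
    define e' where "e' = e / (2 * (A + B + 1))"
    have e': "0 < e'" using e AB by (simp add: e'_def)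
    obtain d1 where d1: "d1 > 0" "\<And>D. good D \<Longrightarrow> (\<Sum>(s, t)\<in>D. t - s) < d1 \<Longrightarrow> (\<Sum>(s, t)\<in>D. \<bar>u t - u s\<bar>) < e'"
      using u e' unfolding alt by meson
    obtain d2 where d2: "d2 > 0" "\<And>D. good D \<Longrightarrow> (\<Sum>(s, t)\<in>D. t - s) < d2 \<Longrightarrow> (\<Sum>(s, t)\<in>D. \<bar>v t - v s\<bar>) < e'"
      using v e' unfolding alt by meson
    have "(\<Sum>(s, t)\<in>D. \<bar>w t - w s\<bar>) < e" if D: "good D" "(\<Sum>(s, t)\<in>D. t - s) < min d1 d2" for D
    proof -
      have "(\<Sum>(s, t)\<in>D. \<bar>w t - w s\<bar>) \<le> (\<Sum>(s, t)\<in>D. A * \<bar>u t - u s\<bar> + B * \<bar>v t - v s\<bar>)"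
        by (intro sum_mono) (auto intro: le)
      also have "\<dots> = A * (\<Sum>(s, t)\<in>D. \<bar>u t - u s\<bar>) + B * (\<Sum>(s, t)\<in>D. \<bar>v t - v s\<bar>)"
        by (simp add: sum.distrib sum_distrib_left case_prod_unfold)
      also have "\<dots> \<le> A * e' + B * e'"
        using d1(2)[OF D(1)] d2(2)[OF D(1)] D(2) AB by (intro add_mono mult_left_mono) auto
      also have "\<dots> < 2 * (A + B + 1) * e'"
      proof -
        have "0 \<le> A * e'" "0 \<le> B * e'" using e' AB by auto
        moreover have "2 * (A + B + 1) * e' = 2 * (A * e') + 2 * (B * e') + 2 * e'" by (simp add: algebra_simps)
        ultimately show ?thesis using e' by linarith
      qed
      also have "\<dots> = e" using AB by (simp add: e'_def)
      finally show ?thesis .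
    qed
    then show "\<exists>d>0. \<forall>D. good D \<and> (\<Sum>(s, t)\<in>D. t - s) < d \<longrightarrow> (\<Sum>(s, t)\<in>D. \<bar>w t - w s\<bar>) < e"
      using d1(1) d2(1) by (intro exI[of _ "min d1 d2"]) auto
  qed
qed

lemma AC_lipschitz:
  fixes u v w :: "'a \<Rightarrow> real"
  assumes u: "u \<in> AC \<iota>" and v: "v \<in> AC \<iota>" and w: "continuous_on UNIV w"
    and le: "\<And>x y. \<bar>w x - w y\<bar> \<le> A * \<bar>u x - u y\<bar> + B * \<bar>v x - v y\<bar>" and AB: "0 \<le> A" "0 \<le> B"
  shows "w \<in> AC \<iota>"
  unfolding AC_def
proof (intro CollectI conjI allI impI w)
  fix k \<kappa> assume "local_arc_chart \<iota> k (\<kappa> :: real \<Rightarrow> 'a)"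
  then have "absolutely_continuous_function_on 0 k (u \<circ> \<kappa>)" "absolutely_continuous_function_on 0 k (v \<circ> \<kappa>)"
    using u v by (auto simp: AC_def)
  then show "absolutely_continuous_function_on 0 k (w \<circ> \<kappa>)"
    by (rule absolutely_continuous_function_on_lipschitz[where A = A and B = B]) (use le AB in auto)
qed

lemma AC_lincomb:
  fixes u v :: "'a \<Rightarrow> real"
  assumes u: "u \<in> AC \<iota>" and v: "v \<in> AC \<iota>"
  shows "(\<lambda>x. a * u x + b * v x) \<in> AC \<iota>"
proof (rule AC_lipschitz[OF u v, where A = "\<bar>a\<bar>" and B = "\<bar>b\<bar>"])
  show "continuous_on UNIV (\<lambda>x. a * u x + b * v x)"
    using u v by (intro continuous_intros AC_continuous)
  show "\<bar>a * u x + b * v x - (a * u y + b * v y)\<bar> \<le> \<bar>a\<bar> * \<bar>u x - u y\<bar> + \<bar>b\<bar> * \<bar>v x - v y\<bar>" for x y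
  proof -
    have "a * u x + b * v x - (a * u y + b * v y) = a * (u x - u y) + b * (v x - v y)" by (simp add: algebra_simps)
    then show ?thesis using abs_triangle_ineq[of "a * (u x - u y)" "b * (v x - v y)"] by (simp add: abs_mult)
  qed
qed auto

text \<open>At a point where a derivative fails to exist \<open>deriv\<close> is a fixed number and
  linearity can break down; by \<open>AC_AE_differentiable\<close> such parameters form null sets in
  all charts.\<close>

lemma grad_lincomb:
  fixes u v :: "'a \<Rightarrow> real"
  assumes u: "u \<in> AC \<iota>" and v: "v \<in> AC \<iota>"
  shows "AE z in \<nu>. grad (\<lambda>x. a * u x + b * v x) z = a * grad u z + b * grad v z"
proof -
  have "AE t in lborel. t \<in> {0<..<l n} \<longrightarrow> (u \<circ> \<gamma> n) differentiable (at t) \<and> (v \<circ> \<gamma> n) differentiable (at t)" for n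
    using AC_AE_differentiable[OF u, of n] AC_AE_differentiable[OF v, of n] by eventually_elim auto
  from AE_skeletonI[OF this] show ?thesis
  proof eventually_elim
    case (elim z)
    then obtain n t where nt: "t \<in> {0<..<l n}" "z = \<gamma> n t" "\<And>u. grad u z = deriv (u \<circ> \<gamma> n) t"
      "(u \<circ> \<gamma> n) differentiable (at t)" "(v \<circ> \<gamma> n) differentiable (at t)" by auto
    then have "((u \<circ> \<gamma> n) has_field_derivative deriv (u \<circ> \<gamma> n) t) (at t)"
      "((v \<circ> \<gamma> n) has_field_derivative deriv (v \<circ> \<gamma> n) t) (at t)"
      by (metis DERIV_imp_deriv real_differentiableE)+
    then have "((\<lambda>s. a * (u \<circ> \<gamma> n) s + b * (v \<circ> \<gamma> n) s) has_field_derivative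
        a * deriv (u \<circ> \<gamma> n) t + b * deriv (v \<circ> \<gamma> n) t) (at t)"
      by (intro DERIV_add DERIV_cmult)
    moreover have "(\<lambda>s. a * (u \<circ> \<gamma> n) s + b * (v \<circ> \<gamma> n) s) = (\<lambda>x. a * u x + b * v x) \<circ> \<gamma> n" by auto
    ultimately show ?case by (metis DERIV_imp_deriv nt(3))
  qed
qed

end

section \<open>Level sets and truncation\<close>

lemma countable_isolated_points:
  fixes S :: "real set"
  shows "countable {t \<in> S. \<not> t islimpt S}"
proof -
  define I where "I = {t \<in> S. \<not> t islimpt S}"
  have "\<exists>p. fst p \<in> \<rat> \<and> snd p \<in> \<rat> \<and> S \<inter> {fst p<..<snd p} = {t}" if t: "t \<in> I" for t
  proof -
    obtain T where T: "t \<in> T" "open T" "S \<inter> T = {t}"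
      using t unfolding I_def islimpt_def by blast
    obtain e where e: "e > 0" "ball t e \<subseteq> T" using T openE by blast
    obtain a where a: "a \<in> \<rat>" "t - e < a" "a < t" using Rats_dense_in_real[of "t - e" t] e by auto
    obtain b where b: "b \<in> \<rat>" "t < b" "b < t + e" using Rats_dense_in_real[of t "t + e"] e by auto
    have "{a<..<b} \<subseteq> T" using e a b by (auto simp: subset_iff dist_real_def)
    then have "S \<inter> {a<..<b} = {t}" using T a b t by (auto simp: I_def)
    then show ?thesis using a b by (intro exI[of _ "(a, b)"]) auto
  qed
  then obtain p where p: "\<And>t. t \<in> I \<Longrightarrow> p t \<in> \<rat> \<times> \<rat> \<and> S \<inter> {fst (p t)<..<snd (p t)} = {t}"
    by (metis mem_Times_iff)
  have "inj_on p I" by (rule inj_onI) (metis p singleton_inject)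
  moreover have "countable (p ` I)"
    by (rule countable_subset[of _ "\<rat> \<times> \<rat>"]) (use p in \<open>blast intro: countable_rat countable_SIGMA\<close>)+
  ultimately show ?thesis unfolding I_def[symmetric] using countable_image_inj_on by blast
qed

text \<open>At a limit point of the level set both derivatives vanish if they exist, so the only other
  possibility is that neither exists and both \<open>deriv\<close>s are the same unspecified constant.\<close>

lemma deriv_truncation:
  fixes f :: "real \<Rightarrow> real"
  assumes f: "isCont f t" and iso: "f t = c \<Longrightarrow> t islimpt {s. f s = c}"
  defines "g \<equiv> \<lambda>s. max 0 (f s - c)"
  shows "deriv g t = deriv f t \<or> deriv g t = 0"
proof -
  consider "f t < c" | "c < f t" | "f t = c" by linarith
  then show ?thesis
  proof cases
    case 1
    have "eventually (\<lambda>s. f s < c) (nhds t)"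
      using f 1 by (metis continuous_at order_tendstoD(2) tendsto_at_iff_tendsto_nhds)
    then have "eventually (\<lambda>s. g s = 0) (nhds t)" by eventually_elim (simp add: g_def)
    then have "deriv g t = deriv (\<lambda>_. 0) t" by (intro deriv_cong_ev) auto
    then show ?thesis by simp
  next
    case 2
    have "eventually (\<lambda>s. c < f s) (nhds t)"
      using f 2 by (metis continuous_at order_tendstoD(1) tendsto_at_iff_tendsto_nhds)
    then have "eventually (\<lambda>s. g s = f s - c) (nhds t)" by eventually_elim (simp add: g_def)
    then have *: "(g has_field_derivative D) (at t) \<longleftrightarrow> ((\<lambda>s. f s - c) has_field_derivative D) (at t)" for D
      by (intro DERIV_cong_ev) auto
    have "((\<lambda>s. f s - c) has_field_derivative D) (at t) \<longleftrightarrow> (f has_field_derivative D) (at t)" for D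
      by (simp add: DERIV_def)
    then show ?thesis unfolding deriv_def using * by simp
  next
    case 3
    then have lim: "t islimpt {s. f s = c}" using iso by simp
    have zero: "D = 0" if h: "(h has_field_derivative D) (at t)" and hc: "\<And>s. f s = c \<Longrightarrow> h s = h t" for h D
    proof -
      obtain X where X: "\<And>n. X n \<in> {s. f s = c} - {t}" "X \<longlonglongrightarrow> t"
        using lim unfolding islimpt_sequential by blast
      have "((\<lambda>s. (h s - h t) / (s - t)) \<longlongrightarrow> D) (at t)"
        using h by (simp add: has_field_derivative_iff)
      then have "(\<lambda>n. (h (X n) - h t) / (X n - t)) \<longlonglongrightarrow> D"
        by (rule tendsto_compose_eventually[OF _ X(2)]) (use X(1) in auto)
      moreover have "(\<lambda>n. (h (X n) - h t) / (X n - t)) = (\<lambda>n. 0)" using X(1) hc by fastforce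
      ultimately have "(\<lambda>n::nat. 0::real) \<longlonglongrightarrow> D" by metis
      then show "D = 0" using LIMSEQ_unique[OF _ tendsto_const] by metis
    qed
    show ?thesis
    proof (cases "\<exists>D. (g has_field_derivative D) (at t)")
      case True
      then obtain D where D: "(g has_field_derivative D) (at t)" by auto
      moreover have "D = 0" using zero[OF D] 3 by (auto simp: g_def)
      ultimately show ?thesis by (simp add: DERIV_imp_deriv)
    next
      case False
      have "\<not> (f has_field_derivative D) (at t)" for D
      proof
        assume D: "(f has_field_derivative D) (at t)"
        then have "D = 0" using zero[OF D] 3 by auto
        then have F: "((\<lambda>h. (f (t + h) - f t) / h) \<longlongrightarrow> 0) (at 0)" using D by (simp add: DERIV_def)
        have "((\<lambda>h. (g (t + h) - g t) / h) \<longlongrightarrow> 0) (at 0)"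
        proof (rule Lim_null_comparison[OF _ tendsto_norm_zero[OF F]])
          have "\<bar>(g (t + h) - g t) / h\<bar> \<le> \<bar>(f (t + h) - f t) / h\<bar>" for h
            unfolding abs_divide by (intro divide_right_mono) (auto simp: g_def 3)
          then show "eventually (\<lambda>h. norm ((g (t + h) - g t) / h) \<le> norm ((f (t + h) - f t) / h)) (at 0)" by simp
        qed
        then have "(g has_field_derivative 0) (at t)" by (simp add: DERIV_def)
        then show False using False by blast
      qed
      then show ?thesis using False unfolding deriv_def by simp
    qed
  qed
qed

context local_tree_gradient
begin

lemma AC_truncation:
  fixes u :: "'a \<Rightarrow> real"
  assumes "u \<in> AC \<iota>"
  shows "(\<lambda>x. max 0 (u x - c)) \<in> AC \<iota>"
proof (rule AC_lipschitz[OF assms assms, where A = 1 and B = 0])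
  show "continuous_on UNIV (\<lambda>x. max 0 (u x - c))"
    using assms by (intro continuous_intros AC_continuous)
  show "\<bar>max 0 (u x - c) - max 0 (u y - c)\<bar> \<le> 1 * \<bar>u x - u y\<bar> + 0 * \<bar>u x - u y\<bar>" for x y
    unfolding max_def by (auto simp: abs_if)
qed simp_all

text \<open>The only obstruction is an isolated point of the level set in some chart, and each chart
  has countably many of these. The alternative in the conclusion yields both the domination by
  \<open>grad u\<close> and the sign of the product of the two gradients.\<close>

lemma grad_truncation:
  fixes u :: "'a \<Rightarrow> real"
  assumes u: "u \<in> AC \<iota>"
  shows "AE z in \<nu>. grad (\<lambda>x. max 0 (u x - c)) z = grad u z \<or> grad (\<lambda>x. max 0 (u x - c)) z = 0"
proof -
  let ?S = "\<lambda>n. {s. (u \<circ> \<gamma> n) s = c}"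
  have "AE t in lborel. t \<in> {0<..<l n} \<longrightarrow> t \<notin> {t \<in> ?S n. \<not> t islimpt ?S n}" for n
    by (rule eventually_mono[OF AE_not_in[OF countable_imp_null_set_lborel[OF countable_isolated_points[of "?S n"]]]]) blast
  from AE_skeletonI[OF this] show ?thesis
  proof eventually_elim
    case (elim z)
    then obtain n t where nt: "t \<in> {0<..<l n}" "z = \<gamma> n t" "\<And>u. grad u z = deriv (u \<circ> \<gamma> n) t"
      "t \<notin> {t \<in> ?S n. \<not> t islimpt ?S n}" by auto
    have "continuous_on {0<..<l n} (u \<circ> \<gamma> n)"
    proof (rule continuous_on_compose)
      show "continuous_on {0<..<l n} (\<gamma> n)" by (rule continuous_on_subset[OF continuous_on_chart]) auto
      show "continuous_on (\<gamma> n ` {0<..<l n}) u" by (rule continuous_on_subset[OF AC_continuous[OF u]]) auto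
    qed
    then have "isCont (u \<circ> \<gamma> n) t" using nt(1) by (simp add: continuous_on_eq_continuous_at o_def)
    from deriv_truncation[OF this, of c]
    have "deriv (\<lambda>s. max 0 ((u \<circ> \<gamma> n) s - c)) t = deriv (u \<circ> \<gamma> n) t \<or> deriv (\<lambda>s. max 0 ((u \<circ> \<gamma> n) s - c)) t = 0"
      using nt(4) by auto
    moreover have "(\<lambda>s. max 0 ((u \<circ> \<gamma> n) s - c)) = (\<lambda>x. max 0 (u x - c)) \<circ> \<gamma> n" by auto
    ultimately show ?case by (simp add: nt(3))
  qed
qed

end

section \<open>The Dirichlet form of a local tree\<close>

locale local_tree_form = local_tree_gradient \<iota> l \<gamma> \<nu>
  for \<iota> :: ereal and l :: "nat \<Rightarrow> real"
    and \<gamma> :: "nat \<Rightarrow> real \<Rightarrow> 'a::{heine_borel, second_countable_topology}"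
    and \<nu> :: "'a measure" +
  fixes m :: "'a measure"
  assumes sets_m [measurable_cong]: "sets m = sets borel"
    and open_pos: "\<And>U. open U \<Longrightarrow> U \<noteq> {} \<Longrightarrow> 0 < emeasure m U"
    and ball_finite: "\<And>x r. emeasure m (ball x r) < \<infinity>"
begin

abbreviation "\<F> \<equiv> form_domain \<iota> m \<nu> l \<gamma>"
abbreviation "\<L> \<equiv> laplacian \<iota> m \<nu> l \<gamma>"

lemma space_m: "space m = UNIV"
  using sets_eq_imp_space_eq[OF sets_m] by simp

lemma UN_balls: "(\<Union>n::nat. ball x (real n)) = (UNIV :: 'a set)"
  using reals_Archimedean2 by auto

lemma sigma_finite_m: "sigma_finite_measure m"
proof
  have "countable (range (\<lambda>n::nat. ball undefined (real n)) :: 'a set set)" by simp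
  moreover have "\<forall>a\<in>range (\<lambda>n::nat. ball undefined (real n)). emeasure m a \<noteq> \<infinity>"
    using ball_finite by (metis (no_types, lifting) imageE less_irrefl)
  ultimately show "\<exists>A. countable A \<and> A \<subseteq> sets m \<and> \<Union>A = space m \<and> (\<forall>a\<in>A. emeasure m a \<noteq> \<infinity>)"
    using UN_balls[of undefined] by (intro exI[of _ "range (\<lambda>n::nat. ball undefined (real n))"]) (auto simp: sets_m space_m)
qed

text \<open>Full support of \<open>m\<close>: a nonempty open set of exceptions would have positive
  measure. This is how versions in \<open>AC\<close> inherit relations known almost
  everywhere.\<close>

lemma AE_imp_everywhere:
  assumes ae: "AE x in m. x \<in> U \<longrightarrow> P x" and U: "open U" "open {x \<in> U. \<not> P x}" and x: "x \<in> U"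
  shows "P x"
proof (rule ccontr)
  assume "\<not> P x"
  then have "0 < emeasure m {x \<in> U. \<not> P x}" using x by (intro open_pos U) auto
  moreover have "{x \<in> U. \<not> P x} \<in> sets m" using U(2) by (simp add: sets_m)
  moreover have "AE y in m. y \<notin> {x \<in> U. \<not> P x}" using ae by eventually_elim auto
  ultimately show False
    using AE_iff_null[of m "\<lambda>y. y \<notin> {x \<in> U. \<not> P x}"] by (simp add: space_m null_sets_def AE_iff_measurable[OF _ refl])
qed

lemma open_Collect_less_on:
  fixes u v :: "'a \<Rightarrow> real"
  assumes "continuous_on UNIV u" "continuous_on UNIV v" "open U"
  shows "open {x \<in> U. v x < u x}"
proof -
  have "open (U \<inter> {x. v x < u x})" using assms by (intro open_Int open_Collect_less)
  then show ?thesis by (simp add: Collect_conj_eq)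
qed

lemma AE_le_imp_le:
  fixes u v :: "'a \<Rightarrow> real"
  assumes "continuous_on UNIV u" "continuous_on UNIV v" and "open U"
    and "AE x in m. x \<in> U \<longrightarrow> u x \<le> v x" "x \<in> U"
  shows "u x \<le> v x"
  using assms(4) by (rule AE_imp_everywhere) (use assms open_Collect_less_on[of u v U] in \<open>auto simp: not_le\<close>)

lemma AE_eq_imp_eq:
  fixes u v :: "'a \<Rightarrow> real"
  assumes "continuous_on UNIV u" "continuous_on UNIV v" and "open U"
    and "AE x in m. x \<in> U \<longrightarrow> u x = v x" "x \<in> U"
  shows "u x = v x"
proof (rule antisym)
  show "u x \<le> v x" by (rule AE_le_imp_le[OF assms(1-3) _ assms(5)]) (use assms(4) in \<open>auto elim: eventually_mono\<close>)
  show "v x \<le> u x" by (rule AE_le_imp_le[OF assms(2,1,3) _ assms(5)]) (use assms(4) in \<open>auto elim: eventually_mono\<close>)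
qed

lemma \<F>_D:
  assumes "u \<in> \<F>"
  shows \<F>_AC: "u \<in> AC \<iota>" and \<F>_L2: "u \<in> L2 m" and \<F>_grad: "grad u \<in> L2 \<nu>" and \<F>_continuous: "continuous_on UNIV u"
  using assms AC_continuous[of u] by (auto simp: form_domain_def)

lemma \<F>_lincomb:
  assumes u: "u \<in> \<F>" and v: "v \<in> \<F>"
  shows "(\<lambda>x. a * u x + b * v x) \<in> \<F>"
proof -
  have ac: "(\<lambda>x. a * u x + b * v x) \<in> AC \<iota>" using u v by (intro AC_lincomb \<F>_AC)
  moreover have "grad (\<lambda>x. a * u x + b * v x) \<in> L2 \<nu>"
  proof (rule L2_dominated)
    show "(\<lambda>z. a * grad u z + b * grad v z) \<in> L2 \<nu>" using u v by (intro L2_lincomb \<F>_grad)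
    show "grad (\<lambda>x. a * u x + b * v x) \<in> borel_measurable \<nu>" by (rule grad_measurable[OF AC_continuous[OF ac]])
    show "AE z in \<nu>. \<bar>grad (\<lambda>x. a * u x + b * v x) z\<bar> \<le> \<bar>a * grad u z + b * grad v z\<bar>"
      using grad_lincomb[OF \<F>_AC[OF u] \<F>_AC[OF v], of a b] by eventually_elim simp
  qed
  ultimately show ?thesis using u v by (auto simp: form_domain_def intro: L2_lincomb)
qed

lemma \<F>_diff: "u \<in> \<F> \<Longrightarrow> v \<in> \<F> \<Longrightarrow> (\<lambda>x. u x - v x) \<in> \<F>"
  using \<F>_lincomb[of u v 1 "-1"] by simp

lemma grad_diff:
  assumes "u \<in> \<F>" "v \<in> \<F>"
  shows "AE z in \<nu>. grad (\<lambda>x. u x - v x) z = grad u z - grad v z"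
  using grad_lincomb[OF \<F>_AC[OF assms(1)] \<F>_AC[OF assms(2)], of 1 "-1"] by simp

text \<open>The product of the two gradients is almost everywhere either a square or zero. This sign
  is the source of the Markov property of the semigroup.\<close>

lemma \<F>_truncation:
  assumes u: "u \<in> \<F>" and c: "0 \<le> c"
  shows "(\<lambda>x. max 0 (u x - c)) \<in> \<F>"
    and "0 \<le> energy \<nu> l \<gamma> u (\<lambda>x. max 0 (u x - c))"
proof -
  let ?v = "\<lambda>x. max 0 (u x - c)"
  have ac: "?v \<in> AC \<iota>" using u by (intro AC_truncation \<F>_AC)
  have "?v \<in> L2 m"
  proof (rule L2_dominated[OF \<F>_L2[OF u]])
    show "?v \<in> borel_measurable m" using L2_measurable[OF \<F>_L2[OF u]] by measurable
    show "AE x in m. \<bar>?v x\<bar> \<le> \<bar>u x\<bar>" using c by (auto simp: max_def)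
  qed
  moreover have "grad ?v \<in> L2 \<nu>"
  proof (rule L2_dominated[OF \<F>_grad[OF u]])
    show "grad ?v \<in> borel_measurable \<nu>" by (rule grad_measurable[OF AC_continuous[OF ac]])
    show "AE z in \<nu>. \<bar>grad ?v z\<bar> \<le> \<bar>grad u z\<bar>"
      using grad_truncation[OF \<F>_AC[OF u], of c] by eventually_elim auto
  qed
  ultimately show "?v \<in> \<F>" using ac by (simp add: form_domain_def)
  show "0 \<le> energy \<nu> l \<gamma> u ?v"
    unfolding energy_def
  proof (rule integral_nonneg_AE)
    show "AE z in \<nu>. 0 \<le> grad u z * grad ?v z"
      using grad_truncation[OF \<F>_AC[OF u], of c] by eventually_elim auto
  qed
qed

section \<open>The generator as a relation between representatives\<close>

lemma laplacian_L2: "\<L> u f \<Longrightarrow> u \<in> L2 m" "\<L> u f \<Longrightarrow> f \<in> L2 m"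
  by (auto simp: laplacian_def)

lemma laplacian_obtain:
  assumes "\<L> u f"
  obtains w where "w \<in> \<F>" "AE x in m. u x = w x" "\<L> w f"
    "\<And>v. v \<in> \<F> \<Longrightarrow> energy \<nu> l \<gamma> w v = - (\<integral>x. f x * v x \<partial>m)"
proof -
  obtain w where w: "w \<in> \<F>" "AE x in m. u x = w x"
    "\<And>v. v \<in> \<F> \<Longrightarrow> energy \<nu> l \<gamma> w v = - (\<integral>x. f x * v x \<partial>m)" and f: "f \<in> L2 m"
    using assms unfolding laplacian_def by blast
  moreover have "\<L> w f" using w f \<F>_L2[OF w(1)] unfolding laplacian_def by (intro conjI bexI[OF _ w(1)]) auto
  ultimately show ?thesis using that by blast
qed

lemma laplacian_energy:
  assumes "\<L> u f" "u \<in> \<F>" "v \<in> \<F>"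
  shows "energy \<nu> l \<gamma> u v = - (\<integral>x. f x * v x \<partial>m)"
proof -
  obtain w where w: "w \<in> \<F>" "AE x in m. u x = w x"
    "\<And>v. v \<in> \<F> \<Longrightarrow> energy \<nu> l \<gamma> w v = - (\<integral>x. f x * v x \<partial>m)"
    using laplacian_obtain[OF assms(1)] by metis
  have "u x = w x" for x
    by (rule AE_eq_imp_eq[of u w UNIV]) (use w assms(2) \<F>_continuous in auto)
  then have "u = w" by auto
  then show ?thesis using w(3)[OF assms(3)] by simp
qed

lemma laplacian_symmetric:
  assumes u: "\<L> u f" and v: "\<L> v g"
  shows "(\<integral>x. f x * v x \<partial>m) = (\<integral>x. u x * g x \<partial>m)"
proof -
  obtain w where w: "w \<in> \<F>" "AE x in m. u x = w x"
    "\<And>v. v \<in> \<F> \<Longrightarrow> energy \<nu> l \<gamma> w v = - (\<integral>x. f x * v x \<partial>m)" using laplacian_obtain[OF u] by metis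
  obtain y where y: "y \<in> \<F>" "AE x in m. v x = y x"
    "\<And>v. v \<in> \<F> \<Longrightarrow> energy \<nu> l \<gamma> y v = - (\<integral>x. g x * v x \<partial>m)" using laplacian_obtain[OF v] by metis
  note [measurable] = L2_measurable[OF laplacian_L2(1)[OF u]] L2_measurable[OF laplacian_L2(2)[OF u]]
    L2_measurable[OF laplacian_L2(1)[OF v]] L2_measurable[OF laplacian_L2(2)[OF v]]
    L2_measurable[OF \<F>_L2[OF w(1)]] L2_measurable[OF \<F>_L2[OF y(1)]]
  have "(\<integral>x. f x * v x \<partial>m) = (\<integral>x. f x * y x \<partial>m)"
    using y(2) by (intro integral_cong_AE) (measurable, auto elim: eventually_mono)
  also have "\<dots> = - energy \<nu> l \<gamma> w y" using w(3)[OF y(1)] by simp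
  also have "energy \<nu> l \<gamma> w y = energy \<nu> l \<gamma> y w" by (simp add: energy_def mult.commute)
  also have "- energy \<nu> l \<gamma> y w = (\<integral>x. g x * w x \<partial>m)" using y(3)[OF w(1)] by simp
  also have "\<dots> = (\<integral>x. u x * g x \<partial>m)"
    using w(2) by (intro integral_cong_AE) (measurable, auto elim: eventually_mono)
  finally show ?thesis .
qed

section \<open>Local gradients and harmonic functions\<close>

lemma \<F>_form_domain_loc:
  assumes h: "h \<in> \<F>"
  shows "h \<in> form_domain_loc \<iota> m \<nu> l \<gamma>"
proof -
  have "h \<in> L2_loc m"
    unfolding L2_loc_def set_integrable_def
  proof (intro CollectI conjI allI impI)
    show "h \<in> borel_measurable m" by (rule L2_measurable[OF \<F>_L2[OF h]])
    fix K :: "'a set" assume "compact K"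
    then show "integrable m (\<lambda>x. indicat_real K x *\<^sub>R (h x)\<^sup>2)"
      by (intro integrable_mult_indicator L2_integrable_power2[OF \<F>_L2[OF h]]) (simp add: sets_m borel_compact)
  qed
  then show ?thesis using h unfolding form_domain_loc_def by auto
qed

text \<open>\<open>grad h\<close> meets the specification behind the choice operator: continuous
  functions that agree almost everywhere on an open set agree on it, and gradients are local. Any
  other choice coincides with it on each of countably many balls, whose closures are
  compact.\<close>

lemma weak_grad_loc_eq:
  assumes h: "h \<in> \<F>"
  defines "g \<equiv> weak_grad_loc \<iota> m \<nu> l \<gamma> h"
  shows "g \<in> borel_measurable \<nu>" and "AE z in \<nu>. g z = grad h z"
proof -
  define P where "P g \<longleftrightarrow> g \<in> borel_measurable \<nu> \<and> (\<forall>U. open U \<and> compact (closure U) \<longrightarrow>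
       (\<forall>v\<in>\<F>. (AE x in m. x \<in> U \<longrightarrow> h x = v x) \<longrightarrow>
          (AE z in \<nu>. z \<in> U \<longrightarrow> g z = grad v z)))" for g
  have "P (grad h)"
    unfolding P_def
  proof (intro conjI allI ballI impI)
    show "grad h \<in> borel_measurable \<nu>" by (rule grad_measurable[OF \<F>_continuous[OF h]])
    fix U v assume U: "open U \<and> compact (closure U)" and v: "v \<in> \<F>" and ae: "AE x in m. x \<in> U \<longrightarrow> h x = v x"
    have eq: "h x = v x" if "x \<in> U" for x
      using AE_eq_imp_eq[OF \<F>_continuous[OF h] \<F>_continuous[OF v] _ ae that] U by simp
    show "AE z in \<nu>. z \<in> U \<longrightarrow> grad h z = grad v z"
    proof (rule AE_I2, rule impI)
      fix z assume z: "z \<in> space \<nu>" "z \<in> U"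
      show "grad h z = grad v z"
        by (rule grad_local[of U]) (use U eq z space_\<nu> in auto)
    qed
  qed
  then have "P g" unfolding g_def weak_grad_loc_def P_def[symmetric] by (rule someI[where P = P])
  then show "g \<in> borel_measurable \<nu>" by (simp add: P_def)
  have ball: "AE z in \<nu>. z \<in> ball undefined (real n) \<longrightarrow> g z = grad h z" for n
  proof -
    have "open (ball (undefined::'a) (real n)) \<and> compact (closure (ball (undefined::'a) (real n)))"
      by (auto intro: compact_closure[THEN iffD2])
    then show ?thesis using \<open>P g\<close> h unfolding P_def by blast
  qed
  then have "AE z in \<nu>. \<forall>n::nat. z \<in> ball undefined (real n) \<longrightarrow> g z = grad h z" by (subst AE_all_countable) (rule allI)
  then show "AE z in \<nu>. g z = grad h z"
    by (rule eventually_mono) (use UN_balls[of undefined] in blast)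
qed

text \<open>A test function supported in \<Omega> sees the two Laplacians only there, where they
  coincide.\<close>

lemma harmonic_diff:
  assumes u: "\<L> u f" "u \<in> \<F>" and v: "\<L> v g" "v \<in> \<F>" and \<Omega>: "open \<Omega>" "\<Omega> \<noteq> {}"
    and eq: "\<And>x. x \<in> \<Omega> \<Longrightarrow> f x = g x"
  shows "harmonic_on \<iota> m \<nu> l \<gamma> \<Omega> (\<lambda>x. u x - v x)"
  unfolding harmonic_on_def
proof (intro conjI ballI impI \<Omega>)
  let ?h = "\<lambda>x. u x - v x"
  have h: "?h \<in> \<F>" using u v by (intro \<F>_diff)
  then show "?h \<in> form_domain_loc \<iota> m \<nu> l \<gamma>" by (rule \<F>_form_domain_loc)
  fix \<phi> assume \<phi>: "\<phi> \<in> \<F>" and sup: "compact (closure {x. \<phi> x \<noteq> 0}) \<and> closure {x. \<phi> x \<noteq> 0} \<subseteq> \<Omega>"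
  note [measurable] = weak_grad_loc_eq(1)[OF h] L2_measurable[OF \<F>_grad[OF \<phi>]] L2_measurable[OF \<F>_grad[OF u(2)]]
     L2_measurable[OF \<F>_grad[OF v(2)]]
  have "(\<integral>z. weak_grad_loc \<iota> m \<nu> l \<gamma> ?h z * grad \<phi> z \<partial>\<nu>) = (\<integral>z. grad u z * grad \<phi> z - grad v z * grad \<phi> z \<partial>\<nu>)"
  proof (rule integral_cong_AE)
    show "AE z in \<nu>. weak_grad_loc \<iota> m \<nu> l \<gamma> ?h z * grad \<phi> z = grad u z * grad \<phi> z - grad v z * grad \<phi> z"
      using weak_grad_loc_eq(2)[OF h] grad_diff[OF u(2) v(2)] 
    proof eventually_elim
      case (elim z)
      show ?case unfolding elim by (simp add: left_diff_distrib)
    qed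
  qed measurable
  also have "\<dots> = energy \<nu> l \<gamma> u \<phi> - energy \<nu> l \<gamma> v \<phi>"
    unfolding energy_def using u v \<phi> by (intro Bochner_Integration.integral_diff L2_mult_integrable \<F>_grad)
  also have "\<dots> = (\<integral>x. g x * \<phi> x \<partial>m) - (\<integral>x. f x * \<phi> x \<partial>m)"
    using laplacian_energy[OF u \<phi>] laplacian_energy[OF v \<phi>] by simp
  also have "(\<lambda>x. g x * \<phi> x) = (\<lambda>x. f x * \<phi> x)"
  proof
    fix x show "g x * \<phi> x = f x * \<phi> x"
      using eq[of x] sup closure_subset[of "{x. \<phi> x \<noteq> 0}"] by (cases "\<phi> x = 0") auto
  qed
  finally show "(\<integral>z. weak_grad_loc \<iota> m \<nu> l \<gamma> ?h z * grad \<phi> z \<partial>\<nu>) = 0" by simp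
qed

lemma measure_ball_pos: "0 < r \<Longrightarrow> 0 < measure m (ball x r)"
  using open_pos[of "ball x r"] ball_finite[of x r] by (auto simp: measure_def enn2real_positive_iff)

text \<open>The form in which the reverse Hoelder inequality is applied: the mean of
  \<open>\<bar>h\<bar>\<close> is replaced by a supremum and the chosen local gradient by
  \<open>grad h\<close>.\<close>

lemma gradient_bound_harmonic:
  assumes RH: "\<And>x r h. 0 < r \<Longrightarrow> harmonic_on \<iota> m \<nu> l \<gamma> (ball x (A * r)) h \<Longrightarrow>
        esssup (restrict_space \<nu> (ball x r)) (\<lambda>z. ennreal \<bar>weak_grad_loc \<iota> m \<nu> l \<gamma> h z\<bar>)
          \<le> ennreal (C / r * (1 / measure m (ball x (A * r)) * (LINT y:ball x (A * r)|m. \<bar>h y\<bar>)))"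
    and A: "1 < A" "0 < C" and r: "0 < r"
    and h: "h \<in> \<F>" "harmonic_on \<iota> m \<nu> l \<gamma> (ball x (A * r)) h"
    and U: "\<And>y. y \<in> ball x (A * r) \<Longrightarrow> \<bar>h y\<bar> \<le> U"
  shows "AE z in \<nu>. z \<in> ball x r \<longrightarrow> \<bar>grad h z\<bar> \<le> C / r * U"
proof -
  let ?B = "ball x (A * r)" and ?g = "weak_grad_loc \<iota> m \<nu> l \<gamma> h"
  have mp: "0 < measure m ?B" using A r by (intro measure_ball_pos) simp
  have "\<bar>h x\<bar> \<le> U" using A r by (intro U) simp
  then have U0: "0 \<le> U" by linarith
  have iB: "set_integrable m ?B (\<lambda>_. 1 :: real)"
    using ball_finite[of x "A * r"] by (simp add: set_integrable_def sets_m)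
  have "(LINT y:?B|m. \<bar>h y\<bar>) \<le> (LINT y:?B|m. U * 1)"
    unfolding set_lebesgue_integral_def
  proof (rule integral_mono_AE')
    show "integrable m (\<lambda>x. indicat_real ?B x *\<^sub>R (U * 1))"
      using set_integrable_mult_right[OF iB, of U] by (simp add: set_integrable_def)
    show "AE x in m. indicat_real ?B x *\<^sub>R \<bar>h x\<bar> \<le> indicat_real ?B x *\<^sub>R (U * 1)"
      using U by (auto simp: indicator_def)
    show "AE x in m. 0 \<le> indicat_real ?B x *\<^sub>R (U * 1)" using U0 by auto
  qed
  also have "\<dots> = U * measure m ?B"
    using ball_finite[of x "A * r"] by (simp add: set_lebesgue_integral_def sets_m space_m mult.commute)
  finally have "1 / measure m ?B * (LINT y:?B|m. \<bar>h y\<bar>) \<le> U"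
    using mp by (simp add: field_simps)
  then have le: "ennreal (C / r * (1 / measure m ?B * (LINT y:?B|m. \<bar>h y\<bar>))) \<le> ennreal (C / r * U)"
    using A r by (intro ennreal_leI mult_left_mono) auto
  have S: "ball x r \<inter> space \<nu> \<in> sets \<nu>" using open_skeleton_sets[of "ball x r"] by (simp add: space_\<nu>)
  have "AE z in restrict_space \<nu> (ball x r). ennreal \<bar>?g z\<bar> \<le> ennreal (C / r * U)"
    using esssup_AE[of "\<lambda>z. ennreal \<bar>?g z\<bar>" "restrict_space \<nu> (ball x r)"]
    by (rule eventually_mono) (use RH[OF r h(2)] le in \<open>meson order_trans\<close>)
  then have "AE z in \<nu>. z \<in> ball x r \<longrightarrow> ennreal \<bar>?g z\<bar> \<le> ennreal (C / r * U)"
    using S by (subst (asm) AE_restrict_space_iff) (auto simp: Int_commute)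
  then show ?thesis
    using weak_grad_loc_eq(2)[OF h(1)]
  proof eventually_elim
    case (elim z)
    have "0 \<le> C / r * U" using A r U0 by simp
    then show ?case using elim by (auto simp: ennreal_le_iff)
  qed
qed

end

section \<open>Time integrals of the heat semigroup\<close>

lemma integral_restrict_split:
  fixes q :: "real \<Rightarrow> real"
  assumes q: "integrable (restrict_space lborel {a<..<d}) q" and abd: "a \<le> b" "b \<le> d"
  shows "(\<integral>s. q s \<partial>restrict_space lborel {a<..<d}) =
    (\<integral>s. q s \<partial>restrict_space lborel {a<..<b}) + (\<integral>s. q s \<partial>restrict_space lborel {b<..<d})"
proof -
  have i: "set_integrable lborel {a<..<d} q"
    using q by (simp add: integrable_restrict_space set_integrable_def)
  have i1: "set_integrable lborel {a<..<b} q" "set_integrable lborel {b<..<d} q"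
    using i abd by (auto intro: set_integrable_subset)
  have "(\<integral>s. indicator {a<..<d} s * q s \<partial>lborel) = (\<integral>s. indicator {a<..<b} s * q s + indicator {b<..<d} s * q s \<partial>lborel)"
  proof (rule integral_cong_AE)
    show "AE s in lborel. indicator {a<..<d} s * q s = indicator {a<..<b} s * q s + indicator {b<..<d} s * q s"
      using AE_lborel_singleton[of b] by eventually_elim (use abd in \<open>auto simp: indicator_def\<close>)
  qed (use i i1 in \<open>auto simp: set_integrable_def\<close>)
  also have "\<dots> = (\<integral>s. indicator {a<..<b} s * q s \<partial>lborel) + (\<integral>s. indicator {b<..<d} s * q s \<partial>lborel)"
    using i1 by (intro Bochner_Integration.integral_add) (auto simp: set_integrable_def)
  finally show ?thesis by (simp add: integral_restrict_space)
qed

lemma integral_restrict_shift: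
  fixes q :: "real \<Rightarrow> real"
  shows "(\<integral>s. q (c + s) \<partial>restrict_space lborel {a<..<b}) = (\<integral>s. q s \<partial>restrict_space lborel {c + a<..<c + b})"
proof -
  have "(\<integral>s. indicator {c + a<..<c + b} s * q s \<partial>lborel) = (\<integral>s. indicator {c + a<..<c + b} (c + 1 * s) * q (c + 1 * s) \<partial>lborel)"
    using lborel_integral_real_affine[of 1 "\<lambda>s. indicator {c + a<..<c + b} s * q s" c] by simp
  also have "\<dots> = (\<integral>s. indicator {a<..<b} s * q (c + s) \<partial>lborel)"
    by (intro Bochner_Integration.integral_cong) (auto simp: indicator_def)
  finally show ?thesis by (simp add: integral_restrict_space)
qed

text \<open>Shifting the window \<open>(0, T)\<close> by \<open>h\<close> leaves the overlap in
  place, so only the two end pieces of length \<open>h\<close> remain.\<close>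

lemma integral_restrict_increment:
  fixes q :: "real \<Rightarrow> real"
  assumes q: "integrable (restrict_space lborel {0<..<T + h}) q" and Th: "0 \<le> T" "0 \<le> h"
  shows "(\<integral>s. q (h + s) \<partial>restrict_space lborel {0<..<T}) - (\<integral>s. q s \<partial>restrict_space lborel {0<..<T}) =
    (\<integral>s. q (T + s) \<partial>restrict_space lborel {0<..<h}) - (\<integral>s. q s \<partial>restrict_space lborel {0<..<h})"
  using integral_restrict_split[OF q, of T] integral_restrict_split[OF q, of h] Th
    integral_restrict_shift[where q = q and c = h and a = 0 and b = T]
    integral_restrict_shift[where q = q and c = T and a = 0 and b = h]
  by (simp add: add.commute)

locale heat_semigroup = local_tree_form \<iota> l \<gamma> \<nu> m
  for \<iota> :: ereal and l :: "nat \<Rightarrow> real"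
    and \<gamma> :: "nat \<Rightarrow> real \<Rightarrow> 'a::{heine_borel, second_countable_topology}"
    and \<nu> m :: "'a measure" +
  fixes P :: "real \<Rightarrow> ('a \<Rightarrow> real) \<Rightarrow> 'a \<Rightarrow> real"
    and p :: "real \<Rightarrow> 'a \<Rightarrow> 'a \<Rightarrow> real"
  assumes semigroup: "semigroup_generated_by m (laplacian \<iota> m \<nu> l \<gamma>) P"
    and kernel: "heat_kernel m P p"
    and kernel_continuous: "continuous_on ({0<..} \<times> UNIV \<times> UNIV) (\<lambda>(t, x, y). p t x y)"
    and kernel_domain: "\<And>t x. 0 < t \<Longrightarrow> p t x \<in> form_domain \<iota> m \<nu> l \<gamma>"
begin

sublocale sigma_finite_measure m by (rule sigma_finite_m)

abbreviation "nm \<equiv> L2_norm m"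
abbreviation ip :: "('a \<Rightarrow> real) \<Rightarrow> ('a \<Rightarrow> real) \<Rightarrow> real" where "ip f g \<equiv> \<integral>x. f x * g x \<partial>m"

lemma ip_self: "ip f f = (nm f)\<^sup>2" by (simp only: L2_norm_power2) (simp add: power2_eq_square)

lemma ip_cong:
  assumes "f \<in> L2 m" "f' \<in> L2 m" "g \<in> L2 m" "AE x in m. f x = f' x"
  shows "ip f g = ip f' g" "ip g f = ip g f'"
  using assms(1-3)[THEN L2_measurable] assms(4)
  by (auto intro!: integral_cong_AE elim!: eventually_mono)

lemma ip_diff:
  assumes "f \<in> L2 m" "g \<in> L2 m" "k \<in> L2 m"
  shows "ip (\<lambda>x. f x - g x) k = ip f k - ip g k" "ip k (\<lambda>x. f x - g x) = ip k f - ip k g"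
  using assms by (simp_all add: left_diff_distrib right_diff_distrib L2_mult_integrable)

lemma nm_cong: "f \<in> L2 m \<Longrightarrow> g \<in> L2 m \<Longrightarrow> AE x in m. f x = g x \<Longrightarrow> nm f = nm g"
  by (intro L2_norm_cong_AE L2_measurable)

lemma P_L2 [simp, intro]: "0 \<le> t \<Longrightarrow> f \<in> L2 m \<Longrightarrow> P t f \<in> L2 m"
  and P_contraction: "0 \<le> t \<Longrightarrow> f \<in> L2 m \<Longrightarrow> nm (P t f) \<le> nm f"
  and P_lincomb: "0 \<le> t \<Longrightarrow> f \<in> L2 m \<Longrightarrow> g \<in> L2 m \<Longrightarrow>
        AE x in m. P t (\<lambda>y. a * f y + b * g y) x = a * P t f x + b * P t g x"
  and P_0: "f \<in> L2 m \<Longrightarrow> AE x in m. P 0 f x = f x"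
  and P_add: "0 \<le> s \<Longrightarrow> 0 \<le> t \<Longrightarrow> f \<in> L2 m \<Longrightarrow> AE x in m. P (s + t) f x = P s (P t f) x"
  and P_tendsto: "f \<in> L2 m \<Longrightarrow> ((\<lambda>t. nm (\<lambda>x. P t f x - f x)) \<longlongrightarrow> 0) (at_right 0)"
  and generator: "u \<in> L2 m \<Longrightarrow> f \<in> L2 m \<Longrightarrow>
        \<L> u f \<longleftrightarrow> ((\<lambda>t. nm (\<lambda>x. (P t u x - u x) / t - f x)) \<longlongrightarrow> 0) (at_right 0)"
  using semigroup unfolding semigroup_generated_by_def by auto

lemma P_diff:
  assumes "0 \<le> t" "f \<in> L2 m" "g \<in> L2 m"
  shows "AE x in m. P t (\<lambda>y. f y - g y) x = P t f x - P t g x"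
  using P_lincomb[OF assms, of 1 "-1"] by simp

lemma P_scale:
  assumes "0 \<le> t" "f \<in> L2 m"
  shows "AE x in m. P t (\<lambda>y. c * f y) x = c * P t f x"
  using P_lincomb[OF assms assms(2), of c 0] by simp

lemma nm_P_diff:
  assumes "0 \<le> t" "f \<in> L2 m" "g \<in> L2 m"
  shows "nm (\<lambda>x. P t f x - P t g x) \<le> nm (\<lambda>x. f x - g x)"
proof -
  have "nm (\<lambda>x. P t f x - P t g x) = nm (P t (\<lambda>y. f y - g y))"
    using P_diff[OF assms] assms by (intro nm_cong) (auto intro!: L2_diff elim: eventually_mono)
  also have "\<dots> \<le> nm (\<lambda>x. f x - g x)" using assms by (intro P_contraction L2_diff)
  finally show ?thesis .
qed

lemma P_cong:
  assumes "0 \<le> t" "f \<in> L2 m" "g \<in> L2 m" "AE x in m. f x = g x"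
  shows "AE x in m. P t f x = P t g x"
proof -
  have "nm (\<lambda>x. f x - g x) = nm (\<lambda>x. 0)"
    using assms(4) by (intro nm_cong[OF L2_diff[OF assms(2,3)]]) (auto simp: L2_def elim: eventually_mono)
  then have "nm (\<lambda>x. P t f x - P t g x) = 0"
    using nm_P_diff[OF assms(1-3)] L2_norm_nonneg[of m "\<lambda>x. P t f x - P t g x"] by simp
  then have "AE x in m. P t f x - P t g x = 0"
    using assms by (intro L2_norm_eq_0) (auto intro: L2_diff)
  then show ?thesis by simp
qed

lemma P_commute:
  assumes "0 \<le> s" "0 \<le> t" "f \<in> L2 m"
  shows "AE x in m. P s (P t f) x = P t (P s f) x"
  using P_add[OF assms] P_add[OF assms(2,1,3)] by (simp add: add.commute) (auto elim: eventually_elim2)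

text \<open>Extending by zero to nonpositive times makes the kernel jointly measurable on all of the
  time line.\<close>

definition pz :: "real \<Rightarrow> 'a \<Rightarrow> 'a \<Rightarrow> real" where
  "pz t x y = (if 0 < t then p t x y else 0)"

text \<open>\<open>P t f\<close> is an arbitrary representative for each \<open>t\<close>
  separately, so nothing is known about its measurability in time. \<open>Q\<close> is a version
  that is jointly measurable in time and space and has a value at every point; time integrals are
  taken of \<open>Q\<close>.\<close>

definition Q :: "real \<Rightarrow> ('a \<Rightarrow> real) \<Rightarrow> 'a \<Rightarrow> real" where
  "Q t f x = (\<integral>y. pz t x y * f y \<partial>m)"

lemma pz_measurable [measurable (raw)]:
  assumes [measurable]: "f \<in> borel_measurable M" "g \<in> measurable M m" "h \<in> measurable M m"
  shows "(\<lambda>z. pz (f z) (g z) (h z)) \<in> borel_measurable M"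
proof -
  let ?S = "{0<..} \<times> UNIV \<times> UNIV :: (real \<times> 'a \<times> 'a) set"
  have "(\<lambda>z. indicator ?S z *\<^sub>R (case z of (t, x, y) \<Rightarrow> p t x y)) \<in> borel_measurable borel"
    by (intro borel_measurable_continuous_on_indicator kernel_continuous borel_open open_Times) auto
  moreover have "(\<lambda>z. (f z, g z, h z)) \<in> measurable M borel"
  proof -
    have "(\<lambda>z. (f z, g z, h z)) \<in> measurable M (borel \<Otimes>\<^sub>M (borel \<Otimes>\<^sub>M borel))"
      using assms by (auto simp: measurable_cong_sets[OF refl sets_m])
    then show ?thesis by (simp add: borel_prod)
  qed
  ultimately have "(\<lambda>z. indicator ?S (f z, g z, h z) *\<^sub>R p (f z) (g z) (h z)) \<in> borel_measurable M"
    by (auto dest: measurable_compose_rev)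
  moreover have "indicator ?S (f z, g z, h z) *\<^sub>R p (f z) (g z) (h z) = pz (f z) (g z) (h z)" for z
    by (auto simp: pz_def indicator_def)
  ultimately show ?thesis by simp
qed

lemma Q_measurable [measurable (raw)]:
  assumes [measurable]: "f \<in> borel_measurable m" "a \<in> borel_measurable M" "b \<in> measurable M m"
  shows "(\<lambda>z. Q (a z) f (b z)) \<in> borel_measurable M"
  unfolding Q_def by measurable

lemma kernel_L2: "0 < t \<Longrightarrow> p t x \<in> L2 m"
  using kernel_domain by (rule \<F>_L2)

lemma Q_eq_ip: "0 < t \<Longrightarrow> Q t f x = ip (p t x) f"
  by (simp add: Q_def pz_def)

lemma P_eq_Q:
  assumes "0 < t" "f \<in> L2 m"
  shows "AE x in m. P t f x = Q t f x"
  using kernel assms unfolding heat_kernel_def by (auto simp: Q_eq_ip elim: eventually_mono)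

lemma Q_L2: assumes "0 < t" "f \<in> L2 m" shows "Q t f \<in> L2 m"
proof (rule L2_dominated[OF P_L2])
  show "Q t f \<in> borel_measurable m" using L2_measurable[OF assms(2)] by measurable
  show "AE x in m. \<bar>Q t f x\<bar> \<le> \<bar>P t f x\<bar>" using P_eq_Q[OF assms] by eventually_elim simp
qed (use assms in auto)

lemma nm_Q_le: assumes "0 < t" "f \<in> L2 m" shows "nm (Q t f) \<le> nm f"
proof -
  have "nm (P t f) = nm (Q t f)" using assms P_eq_Q[OF assms] by (intro nm_cong Q_L2) auto
  then show ?thesis using P_contraction[of t f] assms by simp
qed

lemma Q_diff: "0 < t \<Longrightarrow> f \<in> L2 m \<Longrightarrow> g \<in> L2 m \<Longrightarrow> Q t (\<lambda>y. f y - g y) x = Q t f x - Q t g x"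
  by (simp only: Q_eq_ip) (rule ip_diff(2)[OF _ _ kernel_L2])

lemma nm_P_increment:
  assumes "0 \<le> s" "0 \<le> h" "f \<in> L2 m"
  shows "nm (\<lambda>x. P (s + h) f x - P s f x) \<le> nm (\<lambda>x. P h f x - f x)"
proof -
  have "nm (\<lambda>x. P (s + h) f x - P s f x) = nm (\<lambda>x. P s (P h f) x - P s f x)"
    using P_add[OF assms] assms by (intro nm_cong L2_diff) (auto elim: eventually_mono)
  then show ?thesis using nm_P_diff[of s "P h f" f] assms by simp
qed

lemma nm_Q_increment:
  assumes "0 < s" "0 < h" "f \<in> L2 m"
  shows "nm (\<lambda>x. Q (s + h) f x - Q s f x) \<le> nm (\<lambda>x. P h f x - f x)"
proof -
  have "nm (\<lambda>x. Q (s + h) f x - Q s f x) = nm (\<lambda>x. P (s + h) f x - P s f x)"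
  proof (rule nm_cong)
    show "AE x in m. Q (s + h) f x - Q s f x = P (s + h) f x - P s f x"
      using P_eq_Q[of s f] P_eq_Q[of "s + h" f] assms by (auto elim: eventually_elim2)
  qed (use assms in \<open>auto intro!: L2_diff Q_L2\<close>)
  then show ?thesis using nm_P_increment[of s h f] assms by simp
qed

definition time_integral :: "real \<Rightarrow> ('a \<Rightarrow> real) \<Rightarrow> 'a \<Rightarrow> real" where
  "time_integral T f x = (\<integral>s. Q s f x \<partial>restrict_space lborel {0<..<T})"

lemma finite_measure_interval: "finite_measure (restrict_space lborel {a<..<b :: real})"
  by (rule finite_measureI, cases "a \<le> b") (simp_all add: emeasure_restrict_space space_restrict_space)

lemma measure_interval: "a \<le> b \<Longrightarrow> measure (restrict_space lborel {a<..<b}) (space (restrict_space lborel {a<..<b :: real})) = b - a"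
  by (simp add: measure_restrict_space space_restrict_space)

lemma interval_measurable: "f \<in> borel_measurable (borel \<Otimes>\<^sub>M M) \<Longrightarrow> f \<in> borel_measurable (restrict_space lborel {a<..<b :: real} \<Otimes>\<^sub>M M)"
proof -
  assume [measurable]: "f \<in> borel_measurable (borel \<Otimes>\<^sub>M M)"
  have "(\<lambda>z. f (fst z, snd z)) \<in> borel_measurable (restrict_space lborel {a<..<b :: real} \<Otimes>\<^sub>M M)"
  proof -
    have [measurable]: "(\<lambda>x. x) \<in> measurable (restrict_space lborel {a<..<b :: real}) borel"
      by (intro measurable_restrict_space1) simp
    have [measurable]: "fst \<in> measurable (restrict_space lborel {a<..<b :: real} \<Otimes>\<^sub>M M) borel"
      using measurable_compose[OF measurable_fst \<open>(\<lambda>x. x) \<in> _\<close>] by simp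
    show ?thesis by measurable
  qed
  then show ?thesis by simp
qed

lemma time_integral_Minkowski:
  assumes f: "f \<in> L2 m" and T: "0 \<le> T"
  shows "AE x in m. integrable (restrict_space lborel {0<..<T}) (\<lambda>s. Q s f x)"
    and "time_integral T f \<in> L2 m" and "nm (time_integral T f) \<le> T * nm f"
    and "\<And>g. g \<in> L2 m \<Longrightarrow> ip (time_integral T f) g = (\<integral>s. ip (Q s f) g \<partial>restrict_space lborel {0<..<T})"
proof -
  note [measurable] = L2_measurable[OF f]
  have *: "(\<lambda>(s, x). Q s f x) \<in> borel_measurable (restrict_space lborel {0<..<T} \<Otimes>\<^sub>M m)"
    by (intro interval_measurable) measurable
  have **: "\<And>s. s \<in> space (restrict_space lborel {0<..<T}) \<Longrightarrow> Q s f \<in> L2 m"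
    "\<And>s. s \<in> space (restrict_space lborel {0<..<T}) \<Longrightarrow> nm (Q s f) \<le> nm f"
    using f by (auto simp: space_restrict_space intro: Q_L2 nm_Q_le)
  note M = Minkowski_integral[OF finite_measure_interval sigma_finite_m * ** L2_norm_nonneg, folded time_integral_def]
  show "AE x in m. integrable (restrict_space lborel {0<..<T}) (\<lambda>s. Q s f x)"
    "time_integral T f \<in> L2 m" "nm (time_integral T f) \<le> T * nm f"
    "\<And>g. g \<in> L2 m \<Longrightarrow> ip (time_integral T f) g = (\<integral>s. ip (Q s f) g \<partial>restrict_space lborel {0<..<T})"
    using M measure_interval[OF T] by auto
qed

text \<open>\<open>P h\<close> shifts the time window by \<open>h\<close>, so all but the two end
  pieces cancel. The identity \<open>Q h (Q s f) = Q (h + s) f\<close> is known only off a null set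
  that depends on \<open>s\<close>; its defect \<open>H\<close> must therefore be removed after
  integration in \<open>s\<close>.\<close>

lemma time_integral_increment_eq:
  assumes f: "f \<in> L2 m" and T: "0 < T" and h: "0 < h"
  shows "AE x in m. P h (time_integral T f) x - time_integral T f x =
    (\<integral>s. (Q (T + s) f x - Q s f x) \<partial>restrict_space lborel {0<..<h})"
proof -
  let ?I = "restrict_space lborel {0<..<T}"
  have fm[measurable]: "f \<in> borel_measurable m" using L2_measurable[OF f] .
  define H where "H s x = Q h (Q s f) x - Q (h + s) f x" for s x
  have QQ[measurable]: "(\<lambda>(s, x). Q h (Q s f) x) \<in> borel_measurable (borel \<Otimes>\<^sub>M m)"
    unfolding Q_def[of h] by measurable
  have Hm: "(\<lambda>(s, x). H s x) \<in> borel_measurable (?I \<Otimes>\<^sub>M m)"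
    unfolding H_def by (intro interval_measurable) measurable
  have s0: "AE x in m. H s x = 0" if s: "s \<in> space ?I" for s
  proof -
    have s: "0 < s" using s by (simp add: space_restrict_space)
    have "AE x in m. Q h (Q s f) x = P h (P s f) x"
    proof -
      have "AE x in m. P h (P s f) x = P h (Q s f) x"
        using s h f P_eq_Q[OF s f] by (intro P_cong Q_L2) auto
      moreover have "AE x in m. P h (Q s f) x = Q h (Q s f) x"
        using s h f by (intro P_eq_Q Q_L2) auto
      ultimately show ?thesis by eventually_elim simp
    qed
    moreover have "AE x in m. P (h + s) f x = P h (P s f) x" using P_add[of h s f] s h f by auto
    moreover have "AE x in m. P (h + s) f x = Q (h + s) f x" using s h f by (intro P_eq_Q) auto
    ultimately show ?thesis unfolding H_def by eventually_elim simp
  qed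
  have HL: "H s \<in> L2 m" if "s \<in> space ?I" for s
    unfolding H_def using that f h by (intro L2_diff Q_L2) (auto simp: space_restrict_space)
  have HN: "nm (H s) \<le> 0" if "s \<in> space ?I" for s
    using nm_cong[OF HL[OF that] _ s0[OF that]] by (simp add: L2_def)
  \<comment> \<open>Each \<open>H s\<close> has norm 0, so Minkowski with bound 0 shows that the
    integrated defect vanishes almost everywhere.\<close>
  note M = Minkowski_integral[OF finite_measure_interval sigma_finite_m Hm HL HN]
  have "AE x in m. (\<integral>s. H s x \<partial>?I) = 0"
    using M(2,3) by (intro L2_norm_eq_0) (auto intro: antisym)
  moreover have "AE x in m. integrable ?I (\<lambda>s. H s x)" using M(1) by simp
  moreover have "AE x in m. P h (time_integral T f) x = Q h (time_integral T f) x"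
    using f T h by (intro P_eq_Q time_integral_Minkowski) auto
  moreover have "AE x in m. integrable (restrict_space lborel {0<..<T + h}) (\<lambda>s. Q s f x)"
    using f T h by (intro time_integral_Minkowski) auto
  ultimately show ?thesis
  proof eventually_elim
    case (elim x)
    have px: "p h x \<in> L2 m" using h by (rule kernel_L2)
    have int2: "integrable (restrict_space lborel {a<..<b}) (\<lambda>s. Q s f x)" if "0 \<le> a" "b \<le> T + h" for a b
    proof -
      have "set_integrable lborel {0<..<T + h} (\<lambda>s. Q s f x)"
        using elim(4) by (simp add: integrable_restrict_space set_integrable_def)
      then have "set_integrable lborel {a<..<b} (\<lambda>s. Q s f x)" by (rule set_integrable_subset) (use that in auto)
      then show ?thesis by (simp add: integrable_restrict_space set_integrable_def)
    qed
    have shift: "integrable (restrict_space lborel {0<..<b}) (\<lambda>s. Q (c + s) f x)" if "0 \<le> c" "c + b \<le> T + h" for b c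
    proof -
      have "integrable lborel (\<lambda>s. indicator {c<..<c+b} s *\<^sub>R Q s f x)"
        using int2[of c "c + b"] that by (simp add: integrable_restrict_space)
      from lborel_integrable_real_affine[OF this, of 1 c]
      have "integrable lborel (\<lambda>s. indicator {0<..<b} s *\<^sub>R Q (c + s) f x)"
        by (rule Bochner_Integration.integrable_cong[THEN iffD1, rotated -1]) (auto simp: indicator_def)
      then show ?thesis by (simp add: integrable_restrict_space)
    qed
    \<comment> \<open>Evaluation at \<open>x\<close> is the pairing with \<open>p h x\<close>,
      through which the time integral can be pulled.\<close>
    have "Q h (time_integral T f) x = (\<integral>s. ip (Q s f) (p h x) \<partial>?I)"
      using time_integral_Minkowski(4)[OF f _ px, of T] T h by (simp add: Q_eq_ip mult.commute)
    also have "\<dots> = (\<integral>s. Q h (Q s f) x \<partial>?I)"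
      using h by (simp add: Q_eq_ip mult.commute)
    also have "\<dots> = (\<integral>s. H s x + Q (h + s) f x \<partial>?I)" by (simp add: H_def)
    also have "\<dots> = (\<integral>s. H s x \<partial>?I) + (\<integral>s. Q (h + s) f x \<partial>?I)"
      using elim(2) shift[of h T] h by (intro Bochner_Integration.integral_add) auto
    finally have "P h (time_integral T f) x - time_integral T f x = (\<integral>s. Q (h + s) f x \<partial>?I) - (\<integral>s. Q s f x \<partial>?I)"
      using elim(1,3) by (simp add: time_integral_def)
    also have "\<dots> = (\<integral>s. Q (T + s) f x \<partial>restrict_space lborel {0<..<h}) - (\<integral>s. Q s f x \<partial>restrict_space lborel {0<..<h})"
      using elim(4) T h by (intro integral_restrict_increment) auto
    also have "\<dots> = (\<integral>s. (Q (T + s) f x - Q s f x) \<partial>restrict_space lborel {0<..<h})"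
      using shift[of T h] int2[of 0 h] T h by (intro Bochner_Integration.integral_diff[symmetric]) auto
    finally show ?case .
  qed
qed

text \<open>A time average of functions within \<open>C\<close> of \<open>k\<close> stays within
  \<open>C\<close> of \<open>k\<close>. The uniform bound \<open>B\<close> gives integrability in
  time, which is what allows \<open>k\<close> to be subtracted under the integral.\<close>

lemma integral_average_bound:
  assumes f: "f \<in> L2 m" and h: "0 < h" and C: "0 \<le> C"
    and Hm: "(\<lambda>(s, x). H s x) \<in> borel_measurable (borel \<Otimes>\<^sub>M m)"
    and H: "\<And>s. 0 < s \<Longrightarrow> s < h \<Longrightarrow> H s \<in> L2 m" and k: "k \<in> L2 m"
    and le: "\<And>s. 0 < s \<Longrightarrow> s < h \<Longrightarrow> nm (\<lambda>x. H s x - k x) \<le> C"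
    and int: "AE x in m. v x = (\<integral>s. H s x \<partial>restrict_space lborel {0<..<h})"
    and HC: "\<And>s. 0 < s \<Longrightarrow> s < h \<Longrightarrow> nm (H s) \<le> B" and v: "v \<in> L2 m"
  shows "nm (\<lambda>x. v x / h - k x) \<le> C"
proof -
  let ?I = "restrict_space lborel {0<..<h}"
  note [measurable] = L2_measurable[OF k] Hm
  have "nm (H (h/2)) \<le> B" using HC[of "h/2"] h by simp
  then have B: "0 \<le> B" using L2_norm_nonneg[of m "H (h/2)"] by linarith
  have m2: "(\<lambda>(s, x). H s x - k x) \<in> borel_measurable (borel \<Otimes>\<^sub>M m)" by measurable
  note M1 = Minkowski_integral[OF finite_measure_interval sigma_finite_m interval_measurable[OF Hm], of 0 h B]
  note M2 = Minkowski_integral[OF finite_measure_interval sigma_finite_m interval_measurable[OF m2], of 0 h C]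
  have i1: "AE x in m. integrable ?I (\<lambda>s. H s x)"
    using H HC B by (intro M1) (auto simp: space_restrict_space)
  have e: "AE x in m. v x / h - k x = (1 / h) * (\<integral>s. (H s x - k x) \<partial>?I)"
    using i1 int
  proof eventually_elim
    case (elim x)
    have "(\<integral>s. (H s x - k x) \<partial>?I) = (\<integral>s. H s x \<partial>?I) - (\<integral>s. k x \<partial>?I)"
      using elim(1) finite_measure_interval[of 0 h] by (intro Bochner_Integration.integral_diff) (auto intro: finite_measure.integrable_const)
    also have "(\<integral>s. k x \<partial>?I) = h * k x" using measure_interval[of 0 h] h by simp
    finally show ?case using elim(2) h by (simp add: field_simps)
  qed
  have L: "(\<lambda>x. \<integral>s. (H s x - k x) \<partial>?I) \<in> L2 m" "nm (\<lambda>x. \<integral>s. (H s x - k x) \<partial>?I) \<le> h * C"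
    using M2(2,3) H k le C measure_interval[of 0 h] h by (auto simp: space_restrict_space intro: L2_diff)
  have "nm (\<lambda>x. v x / h - k x) = nm (\<lambda>x. (1 / h) * (\<integral>s. (H s x - k x) \<partial>?I))"
    by (rule nm_cong[OF L2_diff[OF L2_divide[OF v] k] L2_scale[OF L(1)] e])
  also have "\<dots> \<le> C" using L(2) h unfolding L2_norm_scale by (simp add: field_simps)
  finally show ?thesis .
qed

lemma P_small:
  assumes "f \<in> L2 m" "0 < e"
  obtains d where "0 < d" "\<And>s. 0 < s \<Longrightarrow> s < d \<Longrightarrow> nm (\<lambda>x. P s f x - f x) < e"
proof -
  have "eventually (\<lambda>s. nm (\<lambda>x. P s f x - f x) < e) (at_right 0)"
    using order_tendstoD(2)[OF P_tendsto[OF assms(1)] assms(2)] .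
  then show ?thesis using that unfolding eventually_at_right_field by auto
qed

lemma nm_Q_minus:
  assumes "0 < s" "f \<in> L2 m"
  shows "nm (\<lambda>x. Q s f x - f x) = nm (\<lambda>x. P s f x - f x)"
  using assms P_eq_Q[OF assms] by (intro nm_cong L2_diff Q_L2) (auto elim: eventually_mono)

text \<open>The fundamental theorem of calculus for the semigroup: the difference quotient of the
  time integral is the average of \<open>Q (T + s) f - Q s f\<close> over \<open>0 < s < h\<close>,
  which converges by strong continuity.\<close>

lemma laplacian_time_integral:
  assumes f: "f \<in> L2 m" and T: "0 < T"
  shows "\<L> (time_integral T f) (\<lambda>x. Q T f x - f x)"
proof -
  let ?v = "time_integral T f" and ?k = "\<lambda>x. Q T f x - f x"
  have v: "?v \<in> L2 m" and k: "?k \<in> L2 m" using f T by (auto intro: time_integral_Minkowski L2_diff Q_L2)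
  note [measurable] = L2_measurable[OF f]
  have "((\<lambda>h. nm (\<lambda>x. (P h ?v x - ?v x) / h - ?k x)) \<longlongrightarrow> 0) (at_right 0)"
  proof (rule tendstoI)
    fix e :: real assume e: "0 < e"
    obtain d where d: "0 < d" "\<And>s. 0 < s \<Longrightarrow> s < d \<Longrightarrow> nm (\<lambda>x. P s f x - f x) < e/4"
      using P_small[OF f, of "e/4"] e by auto
    have "nm (\<lambda>x. (P h ?v x - ?v x) / h - ?k x) \<le> e/2" if h: "0 < h" "h < d" for h
    proof (rule integral_average_bound[where H = "\<lambda>s x. Q (T + s) f x - Q s f x" and B = "2 * nm f", OF f h(1)])
      show "AE x in m. P h ?v x - ?v x = (\<integral>s. (Q (T + s) f x - Q s f x) \<partial>restrict_space lborel {0<..<h})"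
        by (rule time_integral_increment_eq[OF f T h(1)])
      fix s assume s: "0 < s" "s < h"
      show "(\<lambda>x. Q (T + s) f x - Q s f x) \<in> L2 m" using s T f by (auto intro!: L2_diff Q_L2)
      have a: "(\<lambda>x. Q (T + s) f x - Q T f x) \<in> L2 m" "(\<lambda>x. Q s f x - f x) \<in> L2 m" using s T f by (auto intro!: L2_diff Q_L2)
      have "nm (\<lambda>x. Q (T + s) f x - Q s f x - ?k x) = nm (\<lambda>x. (Q (T + s) f x - Q T f x) - (Q s f x - f x))"
        by (simp add: algebra_simps)
      also have "\<dots> \<le> nm (\<lambda>x. Q (T + s) f x - Q T f x) + nm (\<lambda>x. Q s f x - f x)"
        by (rule L2_norm_triangle_diff[OF a])
      also have "\<dots> \<le> e/4 + e/4"
        using nm_Q_increment[of T s f] nm_Q_minus[of s f] d(2)[of s] s h T f by auto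
      finally show "nm (\<lambda>x. Q (T + s) f x - Q s f x - ?k x) \<le> e/2" by simp
      show "nm (\<lambda>x. Q (T + s) f x - Q s f x) \<le> 2 * nm f"
        using L2_norm_triangle_diff[OF Q_L2[of "T+s" f] Q_L2[of s f]] nm_Q_le[of "T+s" f] nm_Q_le[of s f] s T f
        by simp
    qed (use e k v h in \<open>auto intro!: L2_diff\<close>)
    then have "dist (nm (\<lambda>x. (P h ?v x - ?v x) / h - ?k x)) 0 < e" if "0 < h" "h < d" for h
      using that e by (fastforce simp: dist_real_def)
    then show "eventually (\<lambda>h. dist (nm (\<lambda>x. (P h ?v x - ?v x) / h - ?k x)) 0 < e) (at_right 0)"
      unfolding eventually_at_right_field using d(1) by auto
  qed
  then show ?thesis using generator[OF v k] by simp
qed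

text \<open>Together with \<open>laplacian_time_integral\<close> this makes the domain of the
  generator dense.\<close>

lemma time_average_tendsto:
  assumes f: "f \<in> L2 m"
  shows "((\<lambda>T. nm (\<lambda>x. time_integral T f x / T - f x)) \<longlongrightarrow> 0) (at_right 0)"
proof (rule tendstoI)
  fix e :: real assume e: "0 < e"
  note [measurable] = L2_measurable[OF f]
  obtain d where d: "0 < d" "\<And>s. 0 < s \<Longrightarrow> s < d \<Longrightarrow> nm (\<lambda>x. P s f x - f x) < e/2"
    using P_small[OF f, of "e/2"] e by auto
  have "nm (\<lambda>x. time_integral T f x / T - f x) \<le> e/2" if T: "0 < T" "T < d" for T
  proof (rule integral_average_bound[where H = "\<lambda>s x. Q s f x" and B = "nm f", OF f T(1)])
    show "AE x in m. time_integral T f x = (\<integral>s. Q s f x \<partial>restrict_space lborel {0<..<T})"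
      by (simp add: time_integral_def)
    fix s assume s: "0 < s" "s < T"
    show "nm (\<lambda>x. Q s f x - f x) \<le> e/2" using nm_Q_minus[of s f] d(2)[of s] s T f by auto
  qed (use e f T in \<open>auto intro: Q_L2 nm_Q_le time_integral_Minkowski\<close>)
  then have "dist (nm (\<lambda>x. time_integral T f x / T - f x)) 0 < e" if "0 < T" "T < d" for T
    using that e by (fastforce simp: dist_real_def)
  then show "eventually (\<lambda>T. dist (nm (\<lambda>x. time_integral T f x / T - f x)) 0 < e) (at_right 0)"
    unfolding eventually_at_right_field using d(1) by auto
qed

end

section \<open>Symmetry and time regularity of the semigroup\<close>

text \<open>The first differences \<open>d\<close> are nonnegative, decreasing and sum to at most
  \<open>a 0\<close>, so \<open>N * d N\<close> is at most \<open>a 0\<close>. The second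
  differences decrease and their sum from N to 2N is at most \<open>d N\<close>. The two averaging
  steps together give the factor \<open>N\<^sup>2\<close>.\<close>

lemma second_difference_decay:
  fixes a :: "nat \<Rightarrow> real"
  defines "e \<equiv> \<lambda>k. a k - 2 * a (Suc k) + a (Suc (Suc k))"
  assumes a: "\<And>k. 0 \<le> a k" and e: "\<And>k. 0 \<le> e k" "\<And>k. e (Suc k) \<le> e k" and dec: "\<And>k. a (Suc k) \<le> a k"
  shows "(real N)\<^sup>2 * e (2 * N) \<le> a 0"
proof -
  define d where "d k = a k - a (Suc k)" for k
  have ed: "e k = d k - d (Suc k)" for k by (simp add: e_def d_def)
  have d0: "0 \<le> d k" for k using dec[of k] by (simp add: d_def)
  have dd: "d (Suc k) \<le> d k" for k using e(1)[of k] ed[of k] by simp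
  have "real N * d N = (\<Sum>k<N. d N)" by simp
  also have "\<dots> \<le> (\<Sum>k<N. d k)" 
  proof (rule sum_mono)
    fix k assume "k \<in> {..<N}"
    then show "d N \<le> d k" by (intro lift_Suc_antimono_le[of d, OF dd]) simp
  qed
  also have "\<dots> = a 0 - a N" unfolding d_def by (rule sum_lessThan_telescope')
  also have "\<dots> \<le> a 0" using a[of N] by simp
  finally have 1: "real N * d N \<le> a 0" .
  have "real N * e (2 * N) = (\<Sum>k<N. e (2 * N))" by simp
  also have "\<dots> \<le> (\<Sum>k<N. e (N + k))" 
  proof (rule sum_mono)
    fix k assume "k \<in> {..<N}"
    then show "e (2 * N) \<le> e (N + k)" by (intro lift_Suc_antimono_le[of e, OF e(2)]) simp
  qed
  also have "\<dots> = d N - d (N + N)"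
    unfolding ed using sum_lessThan_telescope'[of "\<lambda>k. d (N + k)" N] by simp
  also have "\<dots> \<le> d N" using d0[of "N+N"] by simp
  finally have "real N * e (2 * N) \<le> d N" .
  then have "real N * (real N * e (2 * N)) \<le> real N * d N" by (intro mult_left_mono) auto
  then show ?thesis using 1 by (simp add: power2_eq_square)
qed

text \<open>A function with second differences bounded by \<open>M h\<^sup>2\<close> has difference quotients that are
  Cauchy, first along commensurable increments and then by continuity.\<close>

lemma difference_quotients_Cauchy:
  fixes F :: "real \<Rightarrow> real"
  assumes cont: "continuous_on {a..} F" and M: "0 \<le> M"
    and sd: "\<And>s h. a \<le> s \<Longrightarrow> 0 < h \<Longrightarrow> \<bar>F (s + 2 * h) - 2 * F (s + h) + F s\<bar> \<le> M * h\<^sup>2"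
    and h: "0 < h" and k: "0 < k"
  shows "\<bar>(F (a + h) - F a) / h - (F (a + k) - F a) / k\<bar> \<le> M * (h + k)"
proof -
  define q where "q h = (F (a + h) - F a) / h" for h
  have step: "\<bar>q (real n * h) - q h\<bar> \<le> M * (real n * h)" if h: "0 < h" and n: "0 < n" for n h
  proof -
    define D where "D j = F (a + real (Suc j) * h) - F (a + real j * h)" for j
    have "\<bar>D j - D 0\<bar> \<le> real j * (M * h\<^sup>2)" for j
    proof (induction j)
      case (Suc j)
      have "\<bar>F ((a + real j * h) + 2 * h) - 2 * F ((a + real j * h) + h) + F (a + real j * h)\<bar> \<le> M * h\<^sup>2"
        using h by (intro sd) auto
      also have "F ((a + real j * h) + 2 * h) - 2 * F ((a + real j * h) + h) + F (a + real j * h) = D (Suc j) - D j"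
        by (simp add: D_def algebra_simps)
      finally show ?case using Suc by (simp add: algebra_simps)
    qed simp
    then have b: "\<bar>D j - D 0\<bar> \<le> real n * (M * h\<^sup>2)" if "j < n" for j
      using that M by (meson less_imp_le mult_right_mono of_nat_le_iff order_trans zero_le_mult_iff zero_le_power2)
    have "F (a + real n * h) - F a - real n * (F (a + h) - F a) = (\<Sum>j<n. D j - D 0)"
      unfolding sum_subtractf using sum_lessThan_telescope[of "\<lambda>j. F (a + real j * h)" n] by (simp add: D_def)
    also have "\<bar>\<dots>\<bar> \<le> (\<Sum>j<n. real n * (M * h\<^sup>2))"
      by (rule order_trans[OF sum_abs]) (intro sum_mono, use b in auto)
    also have "\<dots> = M * (real n * h)\<^sup>2" by (simp add: power2_eq_square)
    finally have "\<bar>F (a + real n * h) - F a - real n * (F (a + h) - F a)\<bar> / (real n * h) \<le> M * (real n * h)\<^sup>2 / (real n * h)"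
      using h n by (intro divide_right_mono) auto
    also have "M * (real n * h)\<^sup>2 / (real n * h) = M * (real n * h)" using h n by (simp add: power2_eq_square)
    also have "\<bar>F (a + real n * h) - F a - real n * (F (a + h) - F a)\<bar> / (real n * h) = \<bar>q (real n * h) - q h\<bar>"
    proof -
      have "(F (a + real n * h) - F a - real n * (F (a + h) - F a)) / (real n * h) = q (real n * h) - q h"
        using h n by (simp add: q_def diff_divide_distrib)
      moreover have "\<bar>x\<bar> / (real n * h) = \<bar>x / (real n * h)\<bar>" for x using h n by simp
      ultimately show ?thesis by metis
    qed
    finally show ?thesis .
  qed
  have rat: "\<bar>q h - q (real i / real j * h)\<bar> \<le> M * (h + real i / real j * h)" if "0 < i" "0 < j" for i j
  proof -
    define \<delta> where "\<delta> = h / real j"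
    have d: "0 < \<delta>" "h = real j * \<delta>" "real i / real j * h = real i * \<delta>" using h that by (auto simp: \<delta>_def)
    show ?thesis using step[OF d(1) that(1)] step[OF d(1) that(2)] unfolding d(3)
      by (simp add: d(2)[symmetric] distrib_left)
  qed
  have "\<exists>X. (\<forall>n. X n \<in> \<rat> \<and> 0 < X n) \<and> X \<longlonglongrightarrow> k / h"
  proof -
    have "\<exists>r\<in>\<rat>. k / h < r \<and> r < k / h + inverse (real (Suc n))" for n by (rule Rats_dense_in_real) simp
    then obtain X where X: "\<And>n. X n \<in> \<rat>" "\<And>n. k / h < X n" "\<And>n. X n < k / h + inverse (real (Suc n))" by metis
    have "X \<longlonglongrightarrow> k / h"
    proof (rule tendsto_sandwich[where f = "\<lambda>_. k / h" and h = "\<lambda>n. k / h + inverse (real (Suc n))"])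
      show "(\<lambda>n. k / h + inverse (real (Suc n))) \<longlonglongrightarrow> k / h"
        using tendsto_add[OF tendsto_const LIMSEQ_inverse_real_of_nat] by simp
    qed (use X in \<open>auto intro!: always_eventually less_imp_le\<close>)
    moreover have "0 < k / h" using h k by simp
    ultimately show ?thesis using X by (intro exI[of _ X]) (meson less_trans)
  qed
  then obtain X where X: "\<And>n. X n \<in> \<rat>" "\<And>n. 0 < X n" "X \<longlonglongrightarrow> k / h" by auto
  have Xh: "(\<lambda>n. X n * h) \<longlonglongrightarrow> k" using tendsto_mult_right[OF X(3), of h] h by simp
  have "\<bar>q h - q (X n * h)\<bar> \<le> M * (h + X n * h)" for n
  proof -
    obtain i j where ij: "X n = of_int i / of_int j" "0 < j" using X(1)[of n] by (auto elim: Rats_cases')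
    then have "0 < i" using X(2)[of n] by (simp add: zero_less_divide_iff)
    then show ?thesis using rat[of "nat i" "nat j"] ij by simp
  qed
  moreover have "(\<lambda>n. \<bar>q h - q (X n * h)\<bar>) \<longlonglongrightarrow> \<bar>q h - q k\<bar>"
  proof -
    have "(\<lambda>n. F (a + X n * h)) \<longlonglongrightarrow> F (a + k)"
    proof (rule continuous_on_tendsto_compose[OF cont])
      show "(\<lambda>n. a + X n * h) \<longlonglongrightarrow> a + k" using Xh by (intro tendsto_intros)
      show "a + k \<in> {a..}" using k by simp
      show "\<forall>\<^sub>F n in sequentially. a + X n * h \<in> {a..}" using X(2) h by (auto intro!: always_eventually simp: less_imp_le)
    qed
    then show ?thesis unfolding q_def using Xh k by (intro tendsto_intros) auto
  qed
  moreover have "(\<lambda>n. M * (h + X n * h)) \<longlonglongrightarrow> M * (h + k)" using Xh by (intro tendsto_intros)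
  ultimately show ?thesis unfolding q_def[symmetric] by (meson LIMSEQ_le)
qed

section \<open>Symmetry of the semigroup\<close>

context heat_semigroup
begin

text \<open>\<open>P t\<close> is a contraction and commutes with difference quotients. Hence along
  the whole orbit the quotients converge at the rate they have at \<open>u\<close>, uniformly in
  \<open>t\<close>; the telescoping argument for symmetry relies on this uniformity.\<close>

lemma laplacian_P:
  assumes L: "\<L> u f" and t: "0 \<le> t"
  shows "\<L> (P t u) (P t f)"
    and "\<And>h. 0 < h \<Longrightarrow> nm (\<lambda>x. (P h (P t u) x - P t u x) / h - P t f x) \<le> nm (\<lambda>x. (P h u x - u x) / h - f x)"
proof -
  note u = laplacian_L2(1)[OF L] and f = laplacian_L2(2)[OF L]
  show le: "nm (\<lambda>x. (P h (P t u) x - P t u x) / h - P t f x) \<le> nm (\<lambda>x. (P h u x - u x) / h - f x)" if h: "0 < h" for h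
  proof -
    let ?d = "\<lambda>x. (P h u x - u x) / h"
    have d: "?d \<in> L2 m" using u h by (intro L2_divide L2_diff P_L2) auto
    have "AE x in m. P t ?d x = (P h (P t u) x - P t u x) / h"
    proof -
      have "AE x in m. P t (\<lambda>x. (1/h) * (P h u x - u x)) x = (1/h) * P t (\<lambda>x. P h u x - u x) x"
        using u h t by (intro P_scale L2_diff P_L2) auto
      moreover have "AE x in m. P t (\<lambda>x. P h u x - u x) x = P t (P h u) x - P t u x"
        using u h t by (intro P_diff P_L2) auto
      moreover have "AE x in m. P t (P h u) x = P h (P t u) x" using u h t by (intro P_commute) auto
      ultimately show ?thesis by eventually_elim simp
    qed
    then have "nm (\<lambda>x. (P h (P t u) x - P t u x) / h - P t f x) = nm (\<lambda>x. P t ?d x - P t f x)"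
      using u f t h d by (intro nm_cong L2_diff L2_divide P_L2) (auto elim: eventually_mono)
    also have "\<dots> \<le> nm (\<lambda>x. ?d x - f x)" using t d f by (rule nm_P_diff)
    finally show ?thesis .
  qed
  have lim: "((\<lambda>h. nm (\<lambda>x. (P h u x - u x) / h - f x)) \<longlongrightarrow> 0) (at_right 0)" using L generator[OF u f] by simp
  have "((\<lambda>h. nm (\<lambda>x. (P h (P t u) x - P t u x) / h - P t f x)) \<longlongrightarrow> 0) (at_right 0)"
  proof (rule tendsto_sandwich[OF _ _ tendsto_const lim])
    show "\<forall>\<^sub>F h in at_right 0. nm (\<lambda>x. (P h (P t u) x - P t u x) / h - P t f x) \<le> nm (\<lambda>x. (P h u x - u x) / h - f x)"
      using le by (auto simp: eventually_at_right_field intro!: exI[of _ 1])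
  qed simp
  then show "\<L> (P t u) (P t f)" using generator[of "P t u" "P t f"] u f t by simp
qed

text \<open>The first-order terms cancel because the generator is symmetric, which leaves
  \<open>h\<close> times the errors of the difference quotients.\<close>

lemma P_symmetric_step:
  assumes a: "\<L> a \<alpha>" and w: "\<L> w \<beta>" and h: "0 < h"
  shows "\<bar>ip (P h a) w - ip a (P h w)\<bar> \<le>
    h * (nm (\<lambda>x. (P h a x - a x) / h - \<alpha> x) * nm w + nm a * nm (\<lambda>x. (P h w x - w x) / h - \<beta> x))"
proof -
  note L2s = laplacian_L2(1)[OF a] laplacian_L2(2)[OF a] laplacian_L2(1)[OF w] laplacian_L2(2)[OF w]
  have Pa: "P h a \<in> L2 m" "P h w \<in> L2 m" using h L2s by auto
  let ?A = "\<lambda>x. (P h a x - a x) / h - \<alpha> x" and ?B = "\<lambda>x. (P h w x - w x) / h - \<beta> x"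
  have AB: "?A \<in> L2 m" "?B \<in> L2 m" using Pa L2s by (auto intro!: L2_diff L2_divide)
  have e: "P h a x * w x - a x * P h w x = h * (?A x * w x - a x * ?B x + (\<alpha> x * w x - a x * \<beta> x))" for x
    using h by (simp add: field_simps)
  have "ip (P h a) w - ip a (P h w) = (\<integral>x. P h a x * w x - a x * P h w x \<partial>m)"
    using Pa L2s by (simp add: L2_mult_integrable)
  also have "\<dots> = h * (\<integral>x. ?A x * w x - a x * ?B x + (\<alpha> x * w x - a x * \<beta> x) \<partial>m)"
    unfolding e by simp
  also have "(\<integral>x. ?A x * w x - a x * ?B x + (\<alpha> x * w x - a x * \<beta> x) \<partial>m)
     = (ip ?A w - ip a ?B) + (ip \<alpha> w - ip a \<beta>)"
    using L2_mult_integrable[OF AB(1) L2s(3)] L2_mult_integrable[OF L2s(1) AB(2)]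
      L2_mult_integrable[OF L2s(2,3)] L2_mult_integrable[OF L2s(1,4)]
    by (simp only: Bochner_Integration.integral_add Bochner_Integration.integral_diff Bochner_Integration.integrable_diff)
  also have "ip \<alpha> w - ip a \<beta> = 0" using laplacian_symmetric[OF a w] by simp
  finally have "\<bar>ip (P h a) w - ip a (P h w)\<bar> = h * \<bar>ip ?A w - ip a ?B\<bar>" using h by (simp add: abs_mult)
  also have "\<dots> \<le> h * (nm ?A * nm w + nm a * nm ?B)"
    using L2_Cauchy_Schwarz[OF AB(1) L2s(3)] L2_Cauchy_Schwarz[OF L2s(1) AB(2)] h
    by (intro mult_left_mono) linarith+
  finally show ?thesis .
qed

text \<open>\<open>D k\<close> interpolates between the two sides by moving time from
  \<open>v\<close> to \<open>u\<close> in \<open>n\<close> equal steps. Each step changes it by at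
  most \<open>h * e h\<close> with \<open>h = t / n\<close>, and the total \<open>t * e h\<close>
  tends to 0.\<close>

lemma P_symmetric_laplacian:
  assumes u: "\<L> u f" and v: "\<L> v g" and t: "0 < t"
  shows "ip (P t u) v = ip u (P t v)"
proof -
  note L2s = laplacian_L2(1)[OF u] laplacian_L2(2)[OF u] laplacian_L2(1)[OF v] laplacian_L2(2)[OF v]
  define e where "e h = nm (\<lambda>x. (P h u x - u x) / h - f x) * nm v + nm u * nm (\<lambda>x. (P h v x - v x) / h - g x)" for h
  have e0: "(e \<longlongrightarrow> 0) (at_right 0)"
  proof -
    have "(e \<longlongrightarrow> 0 * nm v + nm u * 0) (at_right 0)"
      unfolding e_def using generator[OF L2s(1,2)] generator[OF L2s(3,4)] u v by (intro tendsto_intros) auto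
    then show ?thesis by simp
  qed
  have le: "\<bar>ip (P t u) v - ip u (P t v)\<bar> \<le> t * e (t / real n)" if n: "0 < n" for n
  proof -
    define h where "h = t / real n"
    have h: "0 < h" "real n * h = t" using t n by (auto simp: h_def)
    define D where "D k = ip (P (real k * h) u) (P (real (n - k) * h) v)" for k
    have step: "\<bar>D (Suc k) - D k\<bar> \<le> h * e h" if k: "k < n" for k
    proof -
      let ?a = "P (real k * h) u" and ?w = "P (real (n - Suc k) * h) v"
      have nn: "0 \<le> real k * h" "0 \<le> real (n - Suc k) * h" "0 \<le> h" using h by auto
      have La: "\<L> ?a (P (real k * h) f)" and Lw: "\<L> ?w (P (real (n - Suc k) * h) g)"
        using laplacian_P(1)[OF u nn(1)] laplacian_P(1)[OF v nn(2)] .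
      have "D (Suc k) = ip (P h ?a) ?w"
        unfolding D_def using P_add[OF nn(3,1) L2s(1)] h L2s
        by (intro ip_cong) (auto simp: algebra_simps)
      moreover have "D k = ip ?a (P h ?w)"
      proof -
        have "real (n - k) * h = h + real (n - Suc k) * h" using k by (simp add: of_nat_diff algebra_simps)
        then have "AE x in m. P (real (n - k) * h) v x = P h ?w x" using P_add[OF nn(3,2) L2s(3)] by metis
        then show ?thesis unfolding D_def by (rule ip_cong(2)[rotated -1]) (use h L2s in auto)
      qed
      ultimately have "\<bar>D (Suc k) - D k\<bar> \<le> h * (nm (\<lambda>x. (P h ?a x - ?a x) / h - P (real k * h) f x) * nm ?w
          + nm ?a * nm (\<lambda>x. (P h ?w x - ?w x) / h - P (real (n - Suc k) * h) g x))"
        using P_symmetric_step[OF La Lw h(1)] by simp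
      also have "\<dots> \<le> h * e h"
        unfolding e_def
        using h(1) laplacian_P(2)[OF u nn(1) h(1)] laplacian_P(2)[OF v nn(2) h(1)] P_contraction[OF nn(1) L2s(1)] P_contraction[OF nn(2) L2s(3)]
        by (intro mult_left_mono add_mono mult_mono) auto
      finally show ?thesis .
    qed
    have "D n - D 0 = (\<Sum>k<n. D (Suc k) - D k)" by (rule sum_lessThan_telescope[symmetric])
    also have "\<bar>\<dots>\<bar> \<le> (\<Sum>k<n. h * e h)" by (rule order_trans[OF sum_abs]) (intro sum_mono, use step in auto)
    also have "\<dots> = t * e h" using h(2) by (simp add: mult.assoc[symmetric])
    also have "D n = ip (P t u) v"
    proof -
      have "ip (P t u) (P 0 v) = ip (P t u) v"
        using P_0[OF L2s(3)] by (rule ip_cong(2)[rotated -1]) (use L2s t in auto)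
      then show ?thesis by (simp add: D_def h(2))
    qed
    also have "D 0 = ip u (P t v)"
    proof -
      have "ip (P 0 u) (P t v) = ip u (P t v)"
        using P_0[OF L2s(1)] by (rule ip_cong(1)[rotated -1]) (use L2s t in auto)
      then show ?thesis by (simp add: D_def h(2))
    qed
    finally show ?thesis unfolding h_def .
  qed
  have lim: "(\<lambda>n. t * e (t / real (Suc n))) \<longlonglongrightarrow> t * 0"
  proof (intro tendsto_mult tendsto_const filterlim_compose[OF e0])
    have "(\<lambda>n. t * inverse (real (Suc n))) \<longlonglongrightarrow> t * 0"
      by (intro tendsto_mult tendsto_const LIMSEQ_inverse_real_of_nat)
    then have "(\<lambda>n. t / real (Suc n)) \<longlonglongrightarrow> 0" by (simp add: divide_inverse)
    then show "filterlim (\<lambda>n. t / real (Suc n)) (at_right 0) sequentially"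
      unfolding filterlim_at using t by (auto intro!: always_eventually)
  qed
  have "\<bar>ip (P t u) v - ip u (P t v)\<bar> \<le> t * 0"
    by (rule LIMSEQ_le_const[OF lim], intro exI allI impI le, simp)
  then show ?thesis by simp
qed

lemma ip_tendsto:
  assumes f: "f \<in> L2 m" "\<And>n. F n \<in> L2 m" and g: "g \<in> L2 m" "\<And>n. G n \<in> L2 m"
    and Ff: "(\<lambda>n. nm (\<lambda>x. F n x - f x)) \<longlonglongrightarrow> 0" and Gg: "(\<lambda>n. nm (\<lambda>x. G n x - g x)) \<longlonglongrightarrow> 0"
  shows "(\<lambda>n. ip (F n) (G n)) \<longlonglongrightarrow> ip f g"
proof -
  have nG: "(\<lambda>n. nm (G n)) \<longlonglongrightarrow> nm g"
  proof (rule LIM_zero_cancel)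
    show "(\<lambda>n. nm (G n) - nm g) \<longlonglongrightarrow> 0"
      by (rule Lim_null_comparison[OF _ Gg]) (use L2_norm_reverse_triangle[OF g(2) g(1)] in auto)
  qed
  have "(\<lambda>n. ip (F n) (G n) - ip f g) \<longlonglongrightarrow> 0"
  proof (rule Lim_null_comparison)
    show "\<forall>\<^sub>F n in sequentially. norm (ip (F n) (G n) - ip f g) \<le>
       nm (\<lambda>x. F n x - f x) * nm (G n) + nm f * nm (\<lambda>x. G n x - g x)"
    proof (rule always_eventually, rule allI)
      fix n
      have "ip (F n) (G n) - ip f g = ip (\<lambda>x. F n x - f x) (G n) + ip f (\<lambda>x. G n x - g x)"
        using f g by (simp add: ip_diff)
      then show "norm (ip (F n) (G n) - ip f g) \<le> nm (\<lambda>x. F n x - f x) * nm (G n) + nm f * nm (\<lambda>x. G n x - g x)"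
        using L2_Cauchy_Schwarz[OF L2_diff[OF f(2)[of n] f(1)] g(2)[of n]] L2_Cauchy_Schwarz[OF f(1) L2_diff[OF g(2)[of n] g(1)]]
        by simp
    qed
    have "(\<lambda>n. nm (\<lambda>x. F n x - f x) * nm (G n) + nm f * nm (\<lambda>x. G n x - g x)) \<longlonglongrightarrow> 0 * nm g + nm f * 0"
      by (intro tendsto_intros Ff Gg nG)
    then show "(\<lambda>n. nm (\<lambda>x. F n x - f x) * nm (G n) + nm f * nm (\<lambda>x. G n x - g x)) \<longlonglongrightarrow> 0" by simp
  qed
  then show ?thesis by (rule LIM_zero_cancel)
qed

text \<open>By density: the averages \<open>A k n\<close> of the orbit over a short time are in the
  domain of the generator and converge to \<open>k\<close>.\<close>

lemma P_symmetric:
  assumes f: "f \<in> L2 m" and g: "g \<in> L2 m" and t: "0 \<le> t"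
  shows "ip (P t f) g = ip f (P t g)"
proof (cases "t = 0")
  case True
  have "ip (P 0 f) g = ip f g" "ip f (P 0 g) = ip f g" using P_0 f g by (auto intro!: ip_cong)
  then show ?thesis using True by simp
next
  case False
  then have t: "0 < t" using t by simp
  define T where "T n = inverse (real (Suc n))" for n
  have T: "0 < T n" for n by (simp add: T_def)
  have T0: "filterlim T (at_right 0) sequentially"
    unfolding filterlim_at T_def using LIMSEQ_inverse_real_of_nat by (auto intro!: always_eventually)
  define A where "A k n = (\<lambda>x. time_integral (T n) k x / T n)" for k n
  have AL: "A k n \<in> L2 m" if "k \<in> L2 m" for k n
    unfolding A_def using that T[of n] by (intro L2_divide time_integral_Minkowski) auto
  have A0: "(\<lambda>n. nm (\<lambda>x. A k n x - k x)) \<longlonglongrightarrow> 0" if "k \<in> L2 m" for k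
    unfolding A_def using filterlim_compose[OF time_average_tendsto[OF that] T0] .
  have PA0: "(\<lambda>n. nm (\<lambda>x. P t (A k n) x - P t k x)) \<longlonglongrightarrow> 0" if k: "k \<in> L2 m" for k
    by (rule Lim_null_comparison[OF _ A0[OF k]]) (use nm_P_diff[of t "A k _" k] AL[OF k] k t in auto)
  have eq: "ip (P t (A f n)) (A g n) = ip (A f n) (P t (A g n))" for n
  proof -
    have L: "\<L> (time_integral (T n) f) (\<lambda>x. Q (T n) f x - f x)" "\<L> (time_integral (T n) g) (\<lambda>x. Q (T n) g x - g x)"
      using laplacian_time_integral T f g by auto
    have Ae: "AE x in m. P t (A k n) x = P t (time_integral (T n) k) x / T n" if k: "k \<in> L2 m" for k
      unfolding A_def using P_scale[of t "time_integral (T n) k" "1 / T n"] t time_integral_Minkowski(2)[OF k, of "T n"] T[of n]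
      by simp
    have L2t: "time_integral (T n) k \<in> L2 m" if "k \<in> L2 m" for k using time_integral_Minkowski(2)[OF that] T[of n] by simp
    have "ip (P t (A f n)) (A g n) = ip (\<lambda>x. P t (time_integral (T n) f) x / T n) (A g n)"
      using Ae[OF f] f g t AL L2t by (intro ip_cong L2_divide) auto
    also have "\<dots> = ip (P t (time_integral (T n) f)) (time_integral (T n) g) / (T n * T n)"
      by (simp add: A_def)
    also have "\<dots> = ip (time_integral (T n) f) (P t (time_integral (T n) g)) / (T n * T n)"
      using P_symmetric_laplacian[OF L t] by simp
    also have "\<dots> = ip (A f n) (\<lambda>x. P t (time_integral (T n) g) x / T n)"
      by (simp add: A_def)
    also have "\<dots> = ip (A f n) (P t (A g n))"
      using Ae[OF g] f g t AL L2t by (intro ip_cong L2_divide) (auto elim: eventually_mono)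
    finally show ?thesis .
  qed
  have "(\<lambda>n. ip (P t (A f n)) (A g n)) \<longlonglongrightarrow> ip (P t f) g"
    using f g t AL A0 PA0 by (intro ip_tendsto) auto
  moreover have "(\<lambda>n. ip (A f n) (P t (A g n))) \<longlonglongrightarrow> ip f (P t g)"
    using f g t AL A0 PA0 by (intro ip_tendsto) auto
  ultimately show ?thesis unfolding eq by (rule LIMSEQ_unique)
qed

section \<open>Decay of time increments by complete monotonicity\<close>

lemma ip_P_add:
  assumes "0 \<le> s" "0 \<le> t" "f \<in> L2 m" "g \<in> L2 m"
  shows "ip (P (s + t) f) g = ip (P s f) (P t g)"
proof -
  have "ip (P (s + t) f) g = ip (P (t + s) f) g" by (simp add: add.commute)
  also have "\<dots> = ip (P t (P s f)) g" using P_add[OF assms(2,1,3)] assms by (intro ip_cong) auto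
  also have "\<dots> = ip (P s f) (P t g)" using assms by (intro P_symmetric) auto
  finally show ?thesis .
qed

lemma ip_P_self:
  assumes "0 \<le> s" "f \<in> L2 m"
  shows "ip (P s f) f = (nm (P (s/2) f))\<^sup>2"
  using ip_P_add[of "s/2" "s/2" f f] assms by (simp add: ip_self)

lemma ip_P_self_antimono:
  assumes "0 \<le> s" "s \<le> t" "f \<in> L2 m"
  shows "ip (P t f) f \<le> ip (P s f) f"
proof -
  have "nm (P (t/2) f) = nm (P ((t-s)/2) (P (s/2) f))"
    using P_add[of "(t-s)/2" "s/2" f] assms by (intro nm_cong) (auto simp: field_simps)
  also have "\<dots> \<le> nm (P (s/2) f)" using assms by (intro P_contraction) auto
  finally show ?thesis using assms by (simp add: ip_P_self power_mono)
qed

definition incr :: "real \<Rightarrow> ('a \<Rightarrow> real) \<Rightarrow> 'a \<Rightarrow> real" where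
  "incr h f x = P h f x - f x"

lemma incr_L2 [simp, intro]: "0 \<le> h \<Longrightarrow> f \<in> L2 m \<Longrightarrow> incr h f \<in> L2 m"
  unfolding incr_def by (intro L2_diff P_L2)

lemma P_incr:
  assumes "0 \<le> h" "0 \<le> s" "f \<in> L2 m"
  shows "AE x in m. P s (incr h f) x = incr h (P s f) x"
proof -
  have "AE x in m. P s (\<lambda>x. P h f x - f x) x = P s (P h f) x - P s f x"
    using assms by (intro P_diff) auto
  moreover have "AE x in m. P s (P h f) x = P h (P s f) x" using assms by (intro P_commute)
  ultimately show ?thesis unfolding incr_def by eventually_elim simp
qed

text \<open>With \<open>d = P h f - f\<close>, the second differences of the sequence
  \<open>a\<close> are the pairings of \<open>P (k h) d\<close> with \<open>d\<close>. They are
  nonnegative and decreasing by symmetry, and at index 2N they equal the squared norm of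
  \<open>P (N h) d\<close>. This replaces the spectral bound of order \<open>1 / t\<close> for the
  generator applied to the semigroup.\<close>

lemma nm_P_incr_nat:
  assumes h: "0 < h" and f: "f \<in> L2 m"
  shows "real N * nm (P (real N * h) (incr h f)) \<le> nm f"
proof -
  let ?d = "incr h f"
  define a where "a k = ip (P (real k * h) f) f" for k
  have d: "?d \<in> L2 m" and Pf: "P h f \<in> L2 m" using h f by auto
  have e: "a k - 2 * a (Suc k) + a (Suc (Suc k)) = ip (P (real k * h) ?d) ?d" for k
  proof -
    let ?s = "real k * h"
    have s: "0 \<le> ?s" using h by simp
    have "AE x in m. P ?s ?d x = P ?s (P h f) x - P ?s f x"
      unfolding incr_def[abs_def] using s Pf f by (rule P_diff)
    then have "ip (P ?s ?d) ?d = ip (\<lambda>x. P ?s (P h f) x - P ?s f x) ?d"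
      using s Pf f d by (intro ip_cong L2_diff) auto
    also have "\<dots> = ip (P ?s (P h f)) (P h f) - ip (P ?s (P h f)) f - (ip (P ?s f) (P h f) - ip (P ?s f) f)"
      unfolding incr_def[abs_def] using s Pf f by (simp add: ip_diff L2_diff)
    also have "ip (P ?s (P h f)) (P h f) = a (Suc (Suc k))"
    proof -
      have "a (Suc (Suc k)) = ip (P ((?s + h) + h) f) f" by (simp add: a_def algebra_simps)
      also have "\<dots> = ip (P (?s + h) f) (P h f)" using s h f by (intro ip_P_add) auto
      also have "\<dots> = ip (P ?s (P h f)) (P h f)" using s h f P_add[of ?s h f] by (intro ip_cong) auto
      finally show ?thesis ..
    qed
    also have "ip (P ?s (P h f)) f = a (Suc k)"
    proof -
      have "a (Suc k) = ip (P (?s + h) f) f" by (simp add: a_def algebra_simps)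
      also have "\<dots> = ip (P ?s (P h f)) f" using s h f P_add[of ?s h f] by (intro ip_cong) auto
      finally show ?thesis ..
    qed
    also have "ip (P ?s f) (P h f) = a (Suc k)"
      using ip_P_add[of ?s h f f] s h f by (simp add: a_def algebra_simps)
    finally show ?thesis by (simp add: a_def)
  qed
  have "(real N)\<^sup>2 * (a (2 * N) - 2 * a (Suc (2 * N)) + a (Suc (Suc (2 * N)))) \<le> a 0"
  proof (rule second_difference_decay)
    show "0 \<le> a k" for k unfolding a_def using h f by (simp add: ip_P_self)
    show "0 \<le> a k - 2 * a (Suc k) + a (Suc (Suc k))" for k
      unfolding e using h d by (simp add: ip_P_self)
    show "a (Suc (k)) - 2 * a (Suc (Suc k)) + a (Suc (Suc (Suc k))) \<le> a k - 2 * a (Suc k) + a (Suc (Suc k))" for k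
      unfolding e using h d by (intro ip_P_self_antimono) (auto simp: algebra_simps)
    show "a (Suc k) \<le> a k" for k unfolding a_def using h f by (intro ip_P_self_antimono) (auto simp: algebra_simps)
  qed
  also have "a 0 = (nm f)\<^sup>2"
  proof -
    have "a 0 = ip f f" unfolding a_def using P_0[OF f] f by (intro ip_cong) auto
    then show ?thesis by (simp only: ip_self)
  qed
  finally have "(real N * nm (P (real N * h) ?d))\<^sup>2 \<le> (nm f)\<^sup>2"
    unfolding e using h d by (simp add: ip_P_self power_mult_distrib)
  then show ?thesis by (rule power2_le_imp_le) simp
qed

lemma nm_P_incr:
  assumes h: "0 < h" and s: "0 < s" and f: "f \<in> L2 m"
  shows "nm (P s (incr h f)) \<le> 2 * h / s * nm f"
proof -
  have d: "incr h f \<in> L2 m" using h f by simp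
  show ?thesis
  proof (cases "h \<le> s")
    case True
    \<comment> \<open>Rounding \<open>s / h >= 1\<close> down to an integer loses at most a factor
      2, the 2 of the statement; for \<open>h > s\<close> the trivial bound by twice the norm of
      \<open>f\<close> suffices.\<close>
    define N where "N = nat \<lfloor>s / h\<rfloor>"
    have sh: "1 \<le> s / h" using True h by simp
    have N: "real N \<le> s / h" "s / h < real N + 1" "1 \<le> real N"
    proof -
      have fl: "1 \<le> \<lfloor>s / h\<rfloor>" using sh by (simp add: le_floor_iff)
      then have "real N = of_int \<lfloor>s / h\<rfloor>" by (simp add: N_def)
      then show "real N \<le> s / h" "s / h < real N + 1" "1 \<le> real N" using fl by linarith+
    qed
    have Nh: "real N * h \<le> s" using N(1) h by (simp add: field_simps)
    have "nm (P s (incr h f)) = nm (P (s - real N * h) (P (real N * h) (incr h f)))"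
      using P_add[of "s - real N * h" "real N * h" "incr h f"] Nh h s d by (intro nm_cong) auto
    also have "\<dots> \<le> nm (P (real N * h) (incr h f))" using Nh h d by (intro P_contraction) auto
    also have "\<dots> \<le> nm f / real N"
      using nm_P_incr_nat[OF h f, of N] N(3) by (simp add: field_simps)
    also have "\<dots> \<le> nm f * (2 * h / s)"
    proof -
      have "h * 1 \<le> h * real N" using N(3) h by (intro mult_left_mono) auto
      moreover have "s < h * real N + h" using N(2) h by (simp add: field_simps)
      moreover have "2 * h * real N = 2 * (h * real N)" by simp
      ultimately have "s \<le> 2 * h * real N" by linarith
      then have "1 / real N \<le> 2 * h / s" using N(3) s h by (simp add: field_simps)
      then show ?thesis using mult_left_mono[of "1 / real N" "2 * h / s" "nm f"] by simp
    qed
    finally show ?thesis by (simp add: mult.commute)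
  next
    case False
    have "nm (P s (incr h f)) \<le> nm (incr h f)" using s d by (intro P_contraction) auto
    also have "\<dots> \<le> nm (P h f) + nm f" unfolding incr_def[abs_def] using h f by (intro L2_norm_triangle_diff) auto
    also have "\<dots> \<le> 2 * nm f" using P_contraction[of h f] h f by simp
    also have "\<dots> \<le> (2 * h / s) * nm f" using False h s by (intro mult_right_mono) (auto simp: field_simps)
    finally show ?thesis .
  qed
qed

lemma nm_incr_P:
  assumes h: "0 < h" and s: "0 < s" and f: "f \<in> L2 m"
  shows "nm (incr h (P s f)) \<le> 2 * h / s * nm f"
proof -
  have "nm (incr h (P s f)) = nm (P s (incr h f))" using P_incr[of h s f] assms by (intro nm_cong) auto
  then show ?thesis using nm_P_incr[OF assms] by simp
qed

text \<open>A second difference consists of two increments. Each is smoothed by half of the time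
  \<open>s\<close> and so costs \<open>4 * h / s\<close>, which together gives the constant
  16.\<close>

lemma ip_P_second_difference:
  assumes s: "0 < a" "a \<le> s" and h: "0 < h" and f: "f \<in> L2 m" and g: "g \<in> L2 m"
  shows "\<bar>ip (P (s + 2 * h) f) g - 2 * ip (P (s + h) f) g + ip (P s f) g\<bar> \<le> 16 / a\<^sup>2 * nm f * nm g * h\<^sup>2"
proof -
  have s0: "0 < s" using s by simp
  let ?f1 = "P (s/2) f"
  have f1: "?f1 \<in> L2 m" "incr h ?f1 \<in> L2 m" "P (s/2) (incr h ?f1) \<in> L2 m" "incr h (P (s/2) (incr h ?f1)) \<in> L2 m"
    using s0 h f by auto
  have Pf: "P s f \<in> L2 m" "P (s + h) f \<in> L2 m" "P (s + 2 * h) f \<in> L2 m" using s0 h f by auto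
  have ae: "AE x in m. incr h (P (s/2) (incr h ?f1)) x = P (s + 2 * h) f x - 2 * P (s + h) f x + P s f x"
  proof -
    have "AE x in m. P (s/2) (incr h ?f1) x = incr h (P (s/2) ?f1) x" using s0 h f1 by (intro P_incr) auto
    moreover have "AE x in m. P s f x = P (s/2) ?f1 x" using P_add[of "s/2" "s/2" f] s0 f by simp
    ultimately have w: "AE x in m. P (s/2) (incr h ?f1) x = P h (P s f) x - P s f x"
    proof -
      assume A: "AE x in m. P (s/2) (incr h ?f1) x = incr h (P (s/2) ?f1) x" "AE x in m. P s f x = P (s/2) ?f1 x"
      have "AE x in m. P h (P s f) x = P h (P (s/2) ?f1) x" using h s0 f f1 A(2) by (intro P_cong) auto
      then show ?thesis using A unfolding incr_def by eventually_elim simp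
    qed
    then have A1: "AE x in m. P h (P (s/2) (incr h ?f1)) x = P h (\<lambda>x. P h (P s f) x - P s f x) x"
      using h s0 f f1 by (intro P_cong L2_diff P_L2) auto
    have A2: "AE x in m. P h (\<lambda>x. P h (P s f) x - P s f x) x = P h (P h (P s f)) x - P h (P s f) x"
      using h s0 f by (intro P_diff) auto
    have A3: "AE x in m. P (s + h) f x = P h (P s f) x"
      using P_add[of h s f] h s0 f by (simp add: add.commute)
    have A4: "AE x in m. P h (P (s + h) f) x = P h (P h (P s f)) x"
      using h s0 f A3 by (intro P_cong) auto
    have "h + (s + h) = s + 2 * h" by simp
    then have A5: "AE x in m. P (s + 2 * h) f x = P h (P (s + h) f) x"
      using P_add[of h "s + h" f] h s0 f by (metis add_nonneg_nonneg less_imp_le)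
    show ?thesis
      using w A1 A2 A3 A4 A5 unfolding incr_def[of h "P (s/2) (incr h ?f1)"]
    proof eventually_elim
      case (elim x)
      show ?case unfolding elim(6) elim(5) elim(2) elim(3) elim(1) elim(4) by simp
    qed
  qed
  have "ip (P (s + 2 * h) f) g - 2 * ip (P (s + h) f) g + ip (P s f) g = ip (\<lambda>x. P (s + 2 * h) f x - 2 * P (s + h) f x + P s f x) g"
  proof -
    have "(P (s + 2 * h) f x - 2 * P (s + h) f x + P s f x) * g x =
        P (s + 2 * h) f x * g x - 2 * (P (s + h) f x * g x) + P s f x * g x" for x
      by (simp add: algebra_simps)
    then show ?thesis
      using L2_mult_integrable[OF Pf(1) g] L2_mult_integrable[OF Pf(2) g] L2_mult_integrable[OF Pf(3) g] by simp
  qed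
  also have "\<dots> = ip (incr h (P (s/2) (incr h ?f1))) g"
    using ae Pf f1 g by (intro ip_cong L2_add L2_diff L2_scale) auto
  finally have eq: "ip (P (s + 2 * h) f) g - 2 * ip (P (s + h) f) g + ip (P s f) g = ip (incr h (P (s/2) (incr h ?f1))) g" .
  have "\<bar>ip (P (s + 2 * h) f) g - 2 * ip (P (s + h) f) g + ip (P s f) g\<bar> \<le> nm (incr h (P (s/2) (incr h ?f1))) * nm g"
    unfolding eq by (rule L2_Cauchy_Schwarz[OF f1(4) g])
  also have "\<dots> \<le> (4 * h / s * (4 * h / s * nm f)) * nm g"
  proof (rule mult_right_mono)
    have "nm (incr h (P (s/2) (incr h ?f1))) \<le> 4 * h / s * nm (incr h ?f1)"
      using nm_incr_P[of h "s/2" "incr h ?f1"] h s0 f1 by simp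
    also have "\<dots> \<le> 4 * h / s * (4 * h / s * nm f)"
      using nm_incr_P[of h "s/2" f] h s0 f by (intro mult_left_mono) auto
    finally show "nm (incr h (P (s/2) (incr h ?f1))) \<le> 4 * h / s * (4 * h / s * nm f)" .
  qed simp
  also have "\<dots> = 16 / s\<^sup>2 * (nm f * nm g * h\<^sup>2)" by (simp add: power2_eq_square)
  also have "\<dots> \<le> 16 / a\<^sup>2 * (nm f * nm g * h\<^sup>2)"
    using s by (intro mult_right_mono divide_left_mono power_mono mult_nonneg_nonneg) auto
  finally show ?thesis by (simp add: mult.assoc)
qed

lemma ip_P_continuous:
  assumes f: "f \<in> L2 m" and g: "g \<in> L2 m"
  shows "continuous_on {0..} (\<lambda>s. ip (P s f) g)"
  unfolding continuous_on_iff
proof (intro ballI allI impI)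
  fix s e :: real assume s: "s \<in> {0..}" and e: "0 < e"
  obtain d where d: "0 < d" "\<And>h. 0 < h \<Longrightarrow> h < d \<Longrightarrow> nm (\<lambda>x. P h f x - f x) < e / (nm g + 1)"
    using P_small[OF f, of "e / (nm g + 1)"] e by (auto simp: add_nonneg_pos)
  have *: "\<bar>ip (P (r + h) f) g - ip (P r f) g\<bar> < e" if "0 \<le> r" "0 < h" "h < d" for r h
  proof -
    have L: "P (r + h) f \<in> L2 m" "P r f \<in> L2 m" using that f by auto
    have "\<bar>ip (P (r + h) f) g - ip (P r f) g\<bar> = \<bar>ip (\<lambda>x. P (r + h) f x - P r f x) g\<bar>"
      using L g by (simp add: ip_diff)
    also have "\<dots> \<le> nm (\<lambda>x. P (r + h) f x - P r f x) * nm g" by (intro L2_Cauchy_Schwarz L2_diff L g)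
    also have "\<dots> \<le> e / (nm g + 1) * nm g"
      using nm_P_increment[of r h f] d(2)[of h] that f by (intro mult_right_mono) auto
    also have "\<dots> < e"
    proof -
      have "0 < nm g + 1" by (rule add_nonneg_pos) auto
      then show ?thesis using e by (simp add: field_simps)
    qed
    finally show ?thesis .
  qed
  have "dist (ip (P r f) g) (ip (P s f) g) < e" if r: "r \<in> {0..}" "dist r s < d" for r
  proof -
    consider "r = s" | "r < s" | "s < r" by linarith
    then show ?thesis
    proof cases
      case 2
      then show ?thesis using *[of r "s - r"] r s by (auto simp: dist_real_def)
    next
      case 3
      then show ?thesis using *[of s "r - s"] r s by (auto simp: dist_real_def)
    qed (use e in simp)
  qed
  then show "\<exists>d>0. \<forall>r\<in>{0..}. dist r s < d \<longrightarrow> dist (ip (P r f) g) (ip (P s f) g) < e" using d(1) by blast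
qed

lemma ip_P_quotients:
  assumes a: "0 < a" and f: "f \<in> L2 m" and g: "g \<in> L2 m" and h: "0 < h" and k: "0 < k"
  shows "\<bar>(ip (P (a + h) f) g - ip (P a f) g) / h - (ip (P (a + k) f) g - ip (P a f) g) / k\<bar>
    \<le> 16 / a\<^sup>2 * nm f * nm g * (h + k)"
proof (rule difference_quotients_Cauchy[where F = "\<lambda>s. ip (P s f) g"])
  show "continuous_on {a..} (\<lambda>s. ip (P s f) g)"
    by (rule continuous_on_subset[OF ip_P_continuous[OF f g]]) (use a in auto)
  show "\<bar>ip (P (s + 2 * h) f) g - 2 * ip (P (s + h) f) g + ip (P s f) g\<bar> \<le> 16 / a\<^sup>2 * nm f * nm g * h\<^sup>2"
    if "a \<le> s" "0 < h" for s h using ip_P_second_difference[OF a that f g] .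
qed (use a h k in auto)

end

section \<open>Continuous heat kernels\<close>

text \<open>Allow the slope \<open>e\<close>: the last time up to which the bound from \<tau> holds
  cannot lie before \<open>T\<close>. Then \<open>e\<close> tends to 0, and finally \<tau>. At time
  0 only continuity is assumed, because an orbit of the semigroup need not be differentiable
  there.\<close>

lemma Dini_nonincreasing:
  fixes n :: "real \<Rightarrow> real"
  assumes cont: "continuous_on {0..T} n" and T: "0 < T"
    and dini: "\<And>t e. 0 < t \<Longrightarrow> t < T \<Longrightarrow> 0 < e \<Longrightarrow> \<exists>d>0. \<forall>h. 0 < h \<and> h < d \<longrightarrow> n (t + h) \<le> n t + e * h"
  shows "n T \<le> n 0"
proof -
  have *: "n T \<le> n \<tau> + e * (T - \<tau>)" if \<tau>: "0 < \<tau>" "\<tau> < T" and e: "0 < e" for \<tau> e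
  proof -
    define S where "S = {s \<in> {\<tau>..T}. n s \<le> n \<tau> + e * (s - \<tau>)}"
    have "closed S" unfolding S_def
    proof (rule continuous_on_closed_Collect_le)
      show "continuous_on {\<tau>..T} n" by (rule continuous_on_subset[OF cont]) (use \<tau> in auto)
    qed (intro continuous_intros, simp)
    moreover have "\<tau> \<in> S" "bdd_above S" using \<tau> by (auto simp: S_def intro: bdd_aboveI[of _ T])
    ultimately have SS: "Sup S \<in> S" by (intro closed_contains_Sup) auto
    show ?thesis
    proof (cases "Sup S = T")
      case True
      then show ?thesis using SS by (simp add: S_def)
    next
      case False
      let ?s = "Sup S"
      have s: "\<tau> \<le> ?s" "?s < T" "n ?s \<le> n \<tau> + e * (?s - \<tau>)" using SS False by (auto simp: S_def)
      obtain d where d: "0 < d" "\<And>h. 0 < h \<Longrightarrow> h < d \<Longrightarrow> n (?s + h) \<le> n ?s + e * h"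
        using dini[of ?s e] s \<tau> e by auto
      define h where "h = min (d / 2) (T - ?s)"
      have h: "0 < h" "h < d" "?s + h \<le> T" using d(1) s by (auto simp: h_def)
      have "n (?s + h) \<le> n \<tau> + e * (?s + h - \<tau>)" using d(2)[OF h(1,2)] s(3) by (simp add: algebra_simps)
      then have "?s + h \<in> S" using h s by (simp add: S_def)
      then have "?s + h \<le> ?s" using \<open>bdd_above S\<close> by (rule cSup_upper)
      then show ?thesis using h by simp
    qed
  qed
  have **: "n T \<le> n \<tau>" if \<tau>: "0 < \<tau>" "\<tau> < T" for \<tau>
  proof (rule field_le_epsilon)
    fix e :: real assume "0 < e"
    then show "n T \<le> n \<tau> + e" using *[OF \<tau>, of "e / (T - \<tau>)"] \<tau> by simp
  qed
  have "(\<lambda>k. n (T / real (Suc (Suc k)))) \<longlonglongrightarrow> n 0"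
  proof (rule continuous_on_tendsto_compose[OF cont])
    have "(\<lambda>k. T * inverse (real (Suc k))) \<longlonglongrightarrow> T * 0" by (intro tendsto_intros LIMSEQ_inverse_real_of_nat)
    then have "(\<lambda>k. T / real (Suc k)) \<longlonglongrightarrow> 0" by (simp add: divide_inverse)
    then show "(\<lambda>k. T / real (Suc (Suc k))) \<longlonglongrightarrow> 0" by (rule LIMSEQ_Suc)
    show "\<forall>\<^sub>F k in sequentially. T / real (Suc (Suc k)) \<in> {0..T}"
    proof (rule always_eventually, rule allI)
      fix k have "T / real (Suc (Suc k)) \<le> T / 1" using T by (intro divide_left_mono) auto
      then show "T / real (Suc (Suc k)) \<in> {0..T}" using T by simp
    qed
  qed (use T in auto)
  then show ?thesis
  proof (rule LIMSEQ_le_const)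
    have "n T \<le> n (T / real (Suc (Suc k)))" for k
    proof (rule **)
      have "T / real (Suc (Suc k)) < T / 1" using T by (intro divide_strict_left_mono) auto
      then show "T / real (Suc (Suc k)) < T" by simp
    qed (use T in auto)
    then show "\<exists>N. \<forall>k\<ge>N. n T \<le> n (T / real (Suc (Suc k)))" by blast
  qed
qed

section \<open>Pointwise identities for the continuous kernel\<close>

context heat_semigroup
begin

lemma kernel_near:
  assumes "0 < t" "0 < e"
  obtains d where "0 < d"
    "\<And>s z w. 0 < s \<Longrightarrow> dist s t < d \<Longrightarrow> dist z x < d \<Longrightarrow> dist w y < d \<Longrightarrow> \<bar>p s z w - p t x y\<bar> < e"
proof -
  have "(t, x, y) \<in> {0<..} \<times> UNIV \<times> UNIV" using assms by simp
  then obtain d where d: "0 < d" "\<And>q. q \<in> {0<..} \<times> UNIV \<times> UNIV \<Longrightarrow> dist q (t, x, y) < d \<Longrightarrow>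
      dist (case q of (t, x, y) \<Rightarrow> p t x y) (p t x y) < e"
    using kernel_continuous assms(2) unfolding continuous_on_iff by (metis (no_types, lifting) case_prod_conv)
  have "\<bar>p s z w - p t x y\<bar> < e" if "0 < s" "dist s t < d/3" "dist z x < d/3" "dist w y < d/3" for s z w
  proof -
    have "dist (s, z, w) (t, x, y) \<le> dist s t + dist (z, w) (x, y)"
      unfolding dist_Pair_Pair by (rule sqrt_sum_squares_le_sum) auto
    also have "dist (z, w) (x, y) \<le> dist z x + dist w y"
      unfolding dist_Pair_Pair by (rule sqrt_sum_squares_le_sum) auto
    finally have "dist (s, z, w) (t, x, y) < d" using that by linarith
    then show ?thesis using d(2)[of "(s, z, w)"] that by (simp add: dist_real_def)
  qed
  then show ?thesis using d(1) that[of "d/3"] by simp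
qed

text \<open>Normalised indicators of shrinking balls: square integrable approximations of the point
  mass at \<open>y\<close>. They turn operator identities into identities at given points of the
  kernel.\<close>

definition avg :: "'a \<Rightarrow> nat \<Rightarrow> 'a \<Rightarrow> real" where
  "avg y n x = indicator (ball y (1 / real (Suc n))) x / measure m (ball y (1 / real (Suc n)))"

lemma avg_L2 [simp]: "avg y n \<in> L2 m"
  unfolding avg_def[abs_def] by (intro L2_divide L2_norm_indicator(1) ball_finite) (simp add: sets_m)

lemma avg_nonneg: "0 \<le> avg y n x"
  by (simp add: avg_def)

lemma avg_integral: "integrable m (avg y n)" "(\<integral>x. avg y n x \<partial>m) = 1"
proof -
  have s: "ball y (1 / real (Suc n)) \<in> sets m" by (simp add: sets_m)
  show "integrable m (avg y n)" unfolding avg_def[abs_def] using s ball_finite[of y "1 / real (Suc n)"] by simp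
  show "(\<integral>x. avg y n x \<partial>m) = 1"
    unfolding avg_def using s ball_finite[of y "1 / real (Suc n)"] measure_ball_pos[of "1 / real (Suc n)" y]
    by (simp add: space_m)
qed

lemma avg_bound:
  assumes g: "g \<in> borel_measurable m" and e: "0 \<le> e"
    and b: "\<And>w. dist w y < 1 / real (Suc n) \<Longrightarrow> \<bar>g w - c\<bar> \<le> e"
  shows "\<bar>ip g (avg y n) - c\<bar> \<le> e"
proof -
  note [measurable] = g L2_measurable[OF avg_L2[of y n]]
  have le: "\<bar>(g w - c) * avg y n w\<bar> \<le> e * avg y n w" for w
  proof (cases "w \<in> ball y (1 / real (Suc n))")
    case True
    then have "\<bar>g w - c\<bar> \<le> e" by (intro b) (simp add: dist_commute)
    then show ?thesis using avg_nonneg[of y n w] by (simp add: abs_mult mult_right_mono)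
  qed (simp add: avg_def)
  have i1: "integrable m (\<lambda>w. (g w - c) * avg y n w)"
    by (rule Bochner_Integration.integrable_bound[OF integrable_mult_right[OF avg_integral(1), of e]])
      (use le order_trans[OF le abs_ge_self] in auto)
  have "ip g (avg y n) = (\<integral>w. (g w - c) * avg y n w + c * avg y n w \<partial>m)"
    by (simp add: algebra_simps)
  also have "\<dots> = (\<integral>w. (g w - c) * avg y n w \<partial>m) + c"
    using i1 avg_integral[of y n] by simp
  finally have "\<bar>ip g (avg y n) - c\<bar> = \<bar>\<integral>w. (g w - c) * avg y n w \<partial>m\<bar>" by simp
  also have "\<dots> \<le> (\<integral>w. \<bar>(g w - c) * avg y n w\<bar> \<partial>m)" by (rule integral_abs_bound)
  also have "\<dots> \<le> (\<integral>w. e * avg y n w \<partial>m)"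
    using i1 avg_integral[of y n] le by (intro integral_mono) auto
  also have "\<dots> = e" using avg_integral[of y n] by simp
  finally show ?thesis .
qed

lemma inverse_Suc_small:
  assumes "0 < (d :: real)"
  obtains N where "\<And>n. N \<le> n \<Longrightarrow> 1 / real (Suc n) < d"
proof -
  obtain N where N: "1 / real (Suc N) < d" using nat_approx_posE[OF assms] by metis
  have "1 / real (Suc n) < d" if "N \<le> n" for n
  proof -
    have "1 / real (Suc n) \<le> 1 / real (Suc N)" using that by (intro divide_left_mono) auto
    then show ?thesis using N by linarith
  qed
  then show ?thesis using that by blast
qed

lemma avg_kernel:
  assumes t: "0 < t" and e: "0 < e"
  obtains N where "\<And>n k. N \<le> n \<Longrightarrow> N \<le> k \<Longrightarrow> \<bar>ip (Q t (avg y n)) (avg x k) - p t x y\<bar> \<le> e"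
    "\<And>n. N \<le> n \<Longrightarrow> \<bar>Q t (avg y n) x - p t x y\<bar> \<le> e"
proof -
  obtain d where d: "0 < d" "\<And>s z w. 0 < s \<Longrightarrow> dist s t < d \<Longrightarrow> dist z x < d \<Longrightarrow> dist w y < d \<Longrightarrow> \<bar>p s z w - p t x y\<bar> < e"
    using kernel_near[OF t e] by metis
  obtain N where N: "\<And>n. N \<le> n \<Longrightarrow> 1 / real (Suc n) < d" using inverse_Suc_small[OF d(1)] by metis
  have 1: "\<bar>Q t (avg y n) z - p t x y\<bar> \<le> e" if "N \<le> n" "dist z x < d" for n z
  proof -
    have "\<bar>ip (p t z) (avg y n) - p t x y\<bar> \<le> e"
    proof (rule avg_bound)
      show "p t z \<in> borel_measurable m" using kernel_L2[OF t] by (rule L2_measurable)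
      show "\<bar>p t z w - p t x y\<bar> \<le> e" if "dist w y < 1 / real (Suc n)" for w
        using d(2)[of t z w] t \<open>dist z x < d\<close> that N[OF \<open>N \<le> n\<close>] d(1) by simp
    qed (use e in simp)
    then show ?thesis using t by (simp add: Q_eq_ip)
  qed
  have 2: "\<bar>ip (Q t (avg y n)) (avg x k) - p t x y\<bar> \<le> e" if "N \<le> n" "N \<le> k" for n k
  proof (rule avg_bound)
    show "Q t (avg y n) \<in> borel_measurable m" using Q_L2[OF t avg_L2] by (rule L2_measurable)
    show "\<bar>Q t (avg y n) w - p t x y\<bar> \<le> e" if "dist w x < 1 / real (Suc k)" for w
      using 1[OF \<open>N \<le> n\<close>] that N[OF \<open>N \<le> k\<close>] by simp
  qed (use e in simp)
  show ?thesis using that[of N] 1[of _ x] 2 d(1) by simp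
qed

lemma Q_symmetric:
  assumes "0 < t" "f \<in> L2 m" "g \<in> L2 m"
  shows "ip (Q t f) g = ip f (Q t g)"
proof -
  have "ip (Q t f) g = ip (P t f) g"
    using P_eq_Q[OF assms(1,2)] assms by (intro ip_cong Q_L2) (auto elim: eventually_mono)
  also have "\<dots> = ip f (P t g)" using assms by (intro P_symmetric) auto
  also have "\<dots> = ip f (Q t g)"
    using P_eq_Q[OF assms(1,3)] assms by (intro ip_cong Q_L2) auto
  finally show ?thesis .
qed

lemma ip_Q_add:
  assumes "0 < s" "0 < t" "f \<in> L2 m" "g \<in> L2 m"
  shows "ip (Q (s + t) f) g = ip (Q s f) (Q t g)"
proof -
  have "ip (Q (s + t) f) g = ip (P (s + t) f) g"
    using P_eq_Q[of "s + t" f] assms by (intro ip_cong Q_L2) (auto elim: eventually_mono)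
  also have "\<dots> = ip (P s f) (P t g)" using assms by (intro ip_P_add) auto
  also have "\<dots> = ip (Q s f) (P t g)" using P_eq_Q[of s f] assms by (intro ip_cong Q_L2) auto
  also have "\<dots> = ip (Q s f) (Q t g)" using P_eq_Q[of t g] assms by (intro ip_cong Q_L2) auto
  finally show ?thesis .
qed

text \<open>Symmetry of the operator is tested on averages around \<open>x\<close> and
  \<open>y\<close>; continuity of \<open>p\<close> removes the averages.\<close>

lemma kernel_symmetric:
  assumes t: "0 < t"
  shows "p t x y = p t y x"
proof -
  have "\<bar>p t x y - p t y x\<bar> \<le> 0 + e" if e: "0 < e" for e
  proof -
    have e2: "0 < e/2" using e by simp
    obtain N where N: "\<And>n k. N \<le> n \<Longrightarrow> N \<le> k \<Longrightarrow> \<bar>ip (Q t (avg y n)) (avg x k) - p t x y\<bar> \<le> e/2"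
      using avg_kernel[OF t e2] by metis
    obtain K where K: "\<And>n k. K \<le> n \<Longrightarrow> K \<le> k \<Longrightarrow> \<bar>ip (Q t (avg x n)) (avg y k) - p t y x\<bar> \<le> e/2"
      using avg_kernel[OF t e2] by metis
    let ?n = "max N K"
    have "ip (Q t (avg y ?n)) (avg x ?n) = ip (Q t (avg x ?n)) (avg y ?n)"
      using Q_symmetric[OF t avg_L2 avg_L2] by (simp add: mult.commute)
    moreover have "N \<le> ?n" "K \<le> ?n" by auto
    ultimately show ?thesis using N[of ?n ?n] K[of ?n ?n] by linarith
  qed
  then show ?thesis using field_le_epsilon[of "\<bar>p t x y - p t y x\<bar>" 0] by simp
qed

text \<open>The inner products of \<open>Q t (avg y n)\<close> and \<open>Q t (avg y k)\<close> are
  double averages of \<open>p (2 t)\<close> near the diagonal point \<open>(y, y)\<close>, so the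
  sequence is Cauchy. The pointwise limit is \<open>p t y\<close> by symmetry, and Fatou turns this
  into convergence in norm.\<close>

lemma avg_kernel_L2:
  assumes t: "0 < t"
  shows "(\<lambda>n. nm (\<lambda>z. Q t (avg y n) z - p t y z)) \<longlonglongrightarrow> 0"
proof (rule LIMSEQ_I)
  fix r :: real assume r: "0 < r"
  \<comment> \<open>The squared norm of a difference is a combination of inner products with
    coefficients 1, -2, 1; their common limit cancels and leaves an error of at most
    \<open>4 * e\<close>.\<close>
  define e where "e = (r/2)\<^sup>2 / 4"
  have e: "0 < e" using r by (simp add: e_def)
  let ?u = "\<lambda>n. Q t (avg y n)"
  have uL: "?u n \<in> L2 m" for n using t by (intro Q_L2) auto
  obtain N where N: "\<And>n k. N \<le> n \<Longrightarrow> N \<le> k \<Longrightarrow> \<bar>ip (Q (t + t) (avg y n)) (avg y k) - p (t + t) y y\<bar> \<le> e"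
    using avg_kernel[of "t + t" e y y] t e by (metis add_pos_pos)
  have uu: "\<bar>ip (?u n) (?u k) - p (t + t) y y\<bar> \<le> e" if "N \<le> n" "N \<le> k" for n k
    using N[OF that] ip_Q_add[OF t t avg_L2 avg_L2] by simp
  have d: "nm (\<lambda>z. ?u n z - ?u k z) \<le> r/2" if "N \<le> n" "N \<le> k" for n k
  proof -
    have "(nm (\<lambda>z. ?u n z - ?u k z))\<^sup>2 = ip (?u n) (?u n) - 2 * ip (?u n) (?u k) + ip (?u k) (?u k)"
      using L2_norm_diff_power2[OF uL uL, of n k] by (simp only: ip_self)
    also have "\<dots> \<le> 4 * e" using uu[OF that(1,1)] uu[OF that] uu[OF that(2,2)] by linarith
    also have "\<dots> = (r/2)\<^sup>2" by (simp add: e_def)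
    finally show ?thesis by (rule power2_le_imp_le) (use r in simp)
  qed
  have "nm (\<lambda>z. ?u n z - p t y z) \<le> r/2" if n: "N \<le> n" for n
  proof (rule L2_Fatou(2))
    show "(\<lambda>z. ?u n z - ?u k z) \<in> L2 m" for k by (intro L2_diff uL)
    show "(\<lambda>z. ?u n z - p t y z) \<in> borel_measurable m"
      by (intro L2_measurable L2_diff uL kernel_L2 t)
    have "(\<lambda>k. ?u k z) \<longlonglongrightarrow> p t y z" for z
    proof (rule LIMSEQ_I)
      fix q :: real assume q: "0 < q"
      then obtain K where "\<And>n. K \<le> n \<Longrightarrow> \<bar>Q t (avg y n) z - p t z y\<bar> \<le> q/2"
        using avg_kernel[where x = z and y = y, OF t half_gt_zero[OF q]] by metis
      then have "\<forall>n\<ge>K. norm (?u n z - p t y z) < q" using q kernel_symmetric[OF t, of z y] by fastforce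
      then show "\<exists>K. \<forall>n\<ge>K. norm (?u n z - p t y z) < q" by blast
    qed
    then show "AE z in m. (\<lambda>k. ?u n z - ?u k z) \<longlonglongrightarrow> ?u n z - p t y z" by (auto intro!: tendsto_intros)
    show "\<forall>\<^sub>F k in sequentially. nm (\<lambda>z. ?u n z - ?u k z) \<le> r/2"
      using d[OF n] by (auto simp: eventually_sequentially)
  qed (use r in simp)
  then have "\<forall>n\<ge>N. norm (nm (\<lambda>z. ?u n z - p t y z) - 0) < r" using r by (auto intro: le_less_trans[of _ "r/2"])
  then show "\<exists>N. \<forall>n\<ge>N. norm (nm (\<lambda>z. ?u n z - p t y z) - 0) < r" by blast
qed

text \<open>The inner products of \<open>Q s (avg x n)\<close> and \<open>Q t (avg y n)\<close> have
  two limits: one by convergence in norm, and one as double averages of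
  \<open>p (s + t)\<close>.\<close>

lemma Chapman_Kolmogorov:
  assumes s: "0 < s" and t: "0 < t"
  shows "p (s + t) x y = ip (p s x) (p t y)"
proof -
  have "(\<lambda>n. ip (Q s (avg x n)) (Q t (avg y n))) \<longlonglongrightarrow> ip (p s x) (p t y)"
    using s t by (intro ip_tendsto avg_kernel_L2 Q_L2 kernel_L2) auto
  moreover have "(\<lambda>n. ip (Q s (avg x n)) (Q t (avg y n))) \<longlonglongrightarrow> p (s + t) y x"
  proof (rule LIMSEQ_I)
    fix r :: real assume r: "0 < r"
    obtain N where N: "\<And>n k. N \<le> n \<Longrightarrow> N \<le> k \<Longrightarrow> \<bar>ip (Q (s + t) (avg x n)) (avg y k) - p (s + t) y x\<bar> \<le> r/2"
      using avg_kernel[where x = y and y = x, OF add_pos_pos[OF s t] half_gt_zero[OF r]] by metis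
    have "norm (ip (Q s (avg x n)) (Q t (avg y n)) - p (s + t) y x) < r" if "N \<le> n" for n
      using N[OF that that] ip_Q_add[OF s t avg_L2[of x n] avg_L2[of y n]] r by simp
    then show "\<exists>N. \<forall>n\<ge>N. norm (ip (Q s (avg x n)) (Q t (avg y n)) - p (s + t) y x) < r" by blast
  qed
  ultimately have "ip (p s x) (p t y) = p (s + t) y x" by (rule LIMSEQ_unique)
  then show ?thesis using kernel_symmetric[of "s + t" x y] s t by simp
qed

lemma kernel_add:
  assumes "0 < s" "0 < t"
  shows "p (s + t) x = Q s (p t x)"
proof
  fix y show "p (s + t) x y = Q s (p t x) y"
    using Chapman_Kolmogorov[OF assms, of y x] kernel_symmetric[of "s + t" x y] assms by (simp add: Q_eq_ip)
qed

lemma nm_kernel: "0 < t \<Longrightarrow> (nm (p t x))\<^sup>2 = p (2 * t) x x"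
  using Chapman_Kolmogorov[of t t x x] by (simp only: ip_self) simp

text \<open>Part of the time is spent on the kernel. A value at a point thereby becomes a pairing
  with the square integrable function \<open>p t x\<close>, to which the estimates for time
  differences apply.\<close>

lemma Q_shift:
  assumes "0 < s" "0 < t" "f \<in> L2 m"
  shows "Q (s + t) f x = ip (P s (p t x)) f"
proof -
  have "Q (s + t) f x = ip (Q s (p t x)) f" using assms kernel_add[OF assms(1,2), of x] by (simp add: Q_eq_ip)
  also have "\<dots> = ip (P s (p t x)) f"
    using P_eq_Q[OF assms(1) kernel_L2[OF assms(2)], of x] assms
    by (intro ip_cong Q_L2 kernel_L2) (auto elim: eventually_mono intro: kernel_L2)
  finally show ?thesis .
qed

section \<open>The time derivative, pointwise and in norm\<close>

definition quot :: "real \<Rightarrow> ('a \<Rightarrow> real) \<Rightarrow> real \<Rightarrow> 'a \<Rightarrow> real" where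
  "quot t f h x = (Q (t + h) f x - Q t f x) / h"

definition Qdot :: "real \<Rightarrow> ('a \<Rightarrow> real) \<Rightarrow> 'a \<Rightarrow> real" where
  "Qdot t f x = lim (\<lambda>n. quot t f (1 / real (Suc n)) x)"

lemma quot_Cauchy:
  assumes t: "0 < t" and f: "f \<in> L2 m" and h: "0 < h" "0 < k"
  shows "\<bar>quot t f h x - quot t f k x\<bar> \<le> 64 / t\<^sup>2 * nm (p (t/2) x) * nm f * (h + k)"
proof -
  \<comment> \<open>Half of \<open>t\<close> makes \<open>p (t/2) x\<close> square integrable and
    the other half is left for differentiation in time, so 16 becomes
    \<open>16 / (t/2)\<^sup>2 = 64 / t\<^sup>2\<close>.\<close>
  have "Q (t + r) f x = ip (P (t/2 + r) (p (t/2) x)) f" if "0 \<le> r" for r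
    using Q_shift[of "t/2 + r" "t/2" f x] t f that by (simp add: add.commute add.left_commute)
  from this[of h] this[of k] this[of 0] show ?thesis
    using ip_P_quotients[of "t/2" "p (t/2) x" f h k] t f h kernel_L2[of "t/2" x]
    by (simp add: quot_def power_divide)
qed

lemma Qdot_tendsto:
  assumes t: "0 < t" and f: "f \<in> L2 m"
  shows "(\<lambda>n. quot t f (1 / real (Suc n)) x) \<longlonglongrightarrow> Qdot t f x"
proof -
  define M where "M = 64 / t\<^sup>2 * nm (p (t/2) x) * nm f"
  have M: "0 \<le> M" by (simp add: M_def)
  have "Cauchy (\<lambda>n. quot t f (1 / real (Suc n)) x)"
  proof (rule metric_CauchyI)
    fix e :: real assume e: "0 < e"
    have "0 < e / (2 * (M + 1))" using e M by simp
    then obtain N where N: "\<And>n. N \<le> n \<Longrightarrow> 1 / real (Suc n) < e / (2 * (M + 1))" using inverse_Suc_small by metis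
    have "dist (quot t f (1 / real (Suc i)) x) (quot t f (1 / real (Suc j)) x) < e" if "N \<le> i" "N \<le> j" for i j
    proof -
      have "dist (quot t f (1 / real (Suc i)) x) (quot t f (1 / real (Suc j)) x) \<le> M * (1 / real (Suc i) + 1 / real (Suc j))"
        using quot_Cauchy[OF t f, of "1 / real (Suc i)" "1 / real (Suc j)" x] by (simp add: dist_real_def M_def)
      also have "\<dots> \<le> (M + 1) * (1 / real (Suc i) + 1 / real (Suc j))" by (intro mult_right_mono) auto
      also have "\<dots> < (M + 1) * (e / (2 * (M + 1)) + e / (2 * (M + 1)))"
        using N[OF that(1)] N[OF that(2)] M by (intro mult_strict_left_mono add_strict_mono) auto
      also have "\<dots> = e"
      proof -
        have "b * (e / (2 * b) + e / (2 * b)) = e" if "b \<noteq> 0" for b using that by (simp add: field_simps)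
        from this[of "M + 1"] show ?thesis using M by linarith
      qed
      finally show ?thesis .
    qed
    then show "\<exists>N. \<forall>i\<ge>N. \<forall>j\<ge>N. dist (quot t f (1 / real (Suc i)) x) (quot t f (1 / real (Suc j)) x) < e" by blast
  qed
  then show ?thesis unfolding Qdot_def by (simp add: Cauchy_convergent_iff convergent_LIMSEQ_iff)
qed

lemma quot_Qdot:
  assumes t: "0 < t" and f: "f \<in> L2 m" and h: "0 < h"
  shows "\<bar>quot t f h x - Qdot t f x\<bar> \<le> 64 / t\<^sup>2 * nm (p (t/2) x) * nm f * h"
proof -
  let ?M = "64 / t\<^sup>2 * nm (p (t/2) x) * nm f"
  have "(\<lambda>n. \<bar>quot t f h x - quot t f (1 / real (Suc n)) x\<bar>) \<longlonglongrightarrow> \<bar>quot t f h x - Qdot t f x\<bar>"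
    by (intro tendsto_intros Qdot_tendsto t f)
  moreover have "(\<lambda>n. ?M * (h + 1 / real (Suc n))) \<longlonglongrightarrow> ?M * (h + 0)"
    using LIMSEQ_inverse_real_of_nat by (intro tendsto_intros) (simp add: divide_inverse)
  moreover have "\<bar>quot t f h x - quot t f (1 / real (Suc n)) x\<bar> \<le> ?M * (h + 1 / real (Suc n))" for n
    by (rule quot_Cauchy[OF t f h]) simp
  ultimately show ?thesis using LIMSEQ_le by fastforce
qed

lemma quot_L2: "0 < t \<Longrightarrow> 0 < h \<Longrightarrow> f \<in> L2 m \<Longrightarrow> quot t f h \<in> L2 m"
  unfolding quot_def[abs_def] by (intro L2_divide L2_diff Q_L2) auto

lemma nm_quot_diff:
  assumes t: "0 < t" and f: "f \<in> L2 m" and h: "0 < h" "0 < k"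
  shows "nm (\<lambda>x. quot t f h x - quot t f k x) \<le> 16 / t\<^sup>2 * nm f * (h + k)"
proof (rule L2_norm_le_dual)
  show "(\<lambda>x. quot t f h x - quot t f k x) \<in> L2 m" using assms by (intro L2_diff quot_L2)
  show "0 \<le> 16 / t\<^sup>2 * nm f * (h + k)" using h by simp
  fix g assume g: "g \<in> L2 m"
  have eq: "ip (quot t f r) g = (ip (P (t + r) f) g - ip (P t f) g) / r" if r: "0 < r" for r
  proof -
    have L: "Q (t + r) f \<in> L2 m" "Q t f \<in> L2 m" using t r f by (auto intro: Q_L2)
    have "ip (quot t f r) g = ip (\<lambda>x. Q (t + r) f x - Q t f x) g / r" by (simp add: quot_def)
    also have "\<dots> = (ip (Q (t + r) f) g - ip (Q t f) g) / r" using L g by (simp add: ip_diff)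
    also have "ip (Q (t + r) f) g = ip (P (t + r) f) g"
      using P_eq_Q[of "t + r" f] t r f g L by (intro ip_cong) (auto elim: eventually_mono)
    also have "ip (Q t f) g = ip (P t f) g"
      using P_eq_Q[of t f] t r f g L by (intro ip_cong) (auto elim: eventually_mono)
    finally show ?thesis .
  qed
  have E: "ip (\<lambda>x. quot t f h x - quot t f k x) g = ip (quot t f h) g - ip (quot t f k) g"
    using assms g by (intro ip_diff quot_L2)
  have "16 / t\<^sup>2 * nm f * (h + k) * nm g = 16 / t\<^sup>2 * nm f * nm g * (h + k)" by simp
  then show "\<bar>ip (\<lambda>x. quot t f h x - quot t f k x) g\<bar> \<le> 16 / t\<^sup>2 * nm f * (h + k) * nm g"
    unfolding E eq[OF h(1)] eq[OF h(2)] using ip_P_quotients[OF t f g h] by linarith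
qed

text \<open>Fatou applied to the differences of two quotients. The second step is eventually smaller
  than \<open>h\<close>, which turns \<open>16 * (h + k)\<close> into \<open>32 * h\<close>.\<close>

lemma nm_quot_Qdot:
  assumes t: "0 < t" and f: "f \<in> L2 m" and h: "0 < h"
  shows "(\<lambda>x. quot t f h x - Qdot t f x) \<in> L2 m" "nm (\<lambda>x. quot t f h x - Qdot t f x) \<le> 32 / t\<^sup>2 * nm f * h"
proof -
  have m: "Qdot t f \<in> borel_measurable m"
    unfolding Qdot_def[abs_def] using quot_L2[OF t _ f] by (intro borel_measurable_lim_metric) (auto simp: L2_def)
  let ?u = "\<lambda>n x. quot t f h x - quot t f (1 / real (Suc n)) x"
  have u: "?u n \<in> L2 m" for n using assms by (intro L2_diff quot_L2) auto
  have um: "(\<lambda>x. quot t f h x - Qdot t f x) \<in> borel_measurable m"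
    using m L2_measurable[OF quot_L2[OF t h f]] by measurable
  have lim: "AE x in m. (\<lambda>n. ?u n x) \<longlonglongrightarrow> quot t f h x - Qdot t f x"
    using Qdot_tendsto[OF t f] by (auto intro!: tendsto_intros)
  have c: "0 \<le> 32 / t\<^sup>2 * nm f * h" using h by simp
  obtain N where N: "\<And>n. N \<le> n \<Longrightarrow> 1 / real (Suc n) < h" using inverse_Suc_small[OF h] by metis
  have "nm (?u n) \<le> 32 / t\<^sup>2 * nm f * h" if "N \<le> n" for n
  proof -
    have "nm (?u n) \<le> 16 / t\<^sup>2 * nm f * (h + 1 / real (Suc n))"
      by (rule nm_quot_diff[OF t f h]) simp
    also have "\<dots> \<le> 16 / t\<^sup>2 * nm f * (h + h)" using N[OF that] by (intro mult_left_mono) auto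
    finally show ?thesis by simp
  qed
  then have ev: "\<forall>\<^sub>F n in sequentially. nm (?u n) \<le> 32 / t\<^sup>2 * nm f * h"
    by (auto simp: eventually_sequentially)
  show "(\<lambda>x. quot t f h x - Qdot t f x) \<in> L2 m" "nm (\<lambda>x. quot t f h x - Qdot t f x) \<le> 32 / t\<^sup>2 * nm f * h"
    by (rule L2_Fatou[of ?u, OF u um lim c ev])+
qed

lemma Qdot_L2: assumes "0 < t" "f \<in> L2 m" shows "Qdot t f \<in> L2 m"
  using L2_diff[OF quot_L2[OF assms(1) zero_less_one assms(2)] nm_quot_Qdot(1)[OF assms zero_less_one]] by simp

text \<open>Smoothing: every square integrable \<open>f\<close> enters the domain of the generator
  at positive times.\<close>

lemma laplacian_Q:
  assumes t: "0 < t" and f: "f \<in> L2 m"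
  shows "\<L> (Q t f) (Qdot t f)"
proof -
  have Qt: "Q t f \<in> L2 m" using t f by (rule Q_L2)
  have eq: "nm (\<lambda>x. (P h (Q t f) x - Q t f x) / h - Qdot t f x) = nm (\<lambda>x. quot t f h x - Qdot t f x)" if h: "0 < h" for h
  proof -
    have "AE x in m. P h (Q t f) x = P h (P t f) x"
      using P_eq_Q[OF t f] h t f Qt by (intro P_cong) (auto elim: eventually_mono)
    moreover have "AE x in m. P (h + t) f x = P h (P t f) x" using h t f by (intro P_add) auto
    moreover have "AE x in m. P (h + t) f x = Q (h + t) f x" using h t f by (intro P_eq_Q) auto
    ultimately have ae: "AE x in m. (P h (Q t f) x - Q t f x) / h - Qdot t f x = quot t f h x - Qdot t f x"
      by eventually_elim (simp add: quot_def add.commute)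
    show ?thesis
      by (rule nm_cong[OF _ _ ae]) (use h t f Qt in \<open>auto intro!: L2_diff L2_divide quot_L2 Qdot_L2\<close>)
  qed
  have "((\<lambda>h. nm (\<lambda>x. (P h (Q t f) x - Q t f x) / h - Qdot t f x)) \<longlongrightarrow> 0) (at_right 0)"
  proof (rule tendsto_sandwich[OF _ _ tendsto_const])
    show "\<forall>\<^sub>F h in at_right 0. nm (\<lambda>x. (P h (Q t f) x - Q t f x) / h - Qdot t f x) \<le> 32 / t\<^sup>2 * nm f * h"
      using eq nm_quot_Qdot(2)[OF t f] by (auto simp: eventually_at_right_field intro!: exI[of _ 1])
    have "((\<lambda>h. 32 / t\<^sup>2 * nm f * h) \<longlongrightarrow> 32 / t\<^sup>2 * nm f * 0) (at_right 0)" by (intro tendsto_intros)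
    then show "((\<lambda>h. 32 / t\<^sup>2 * nm f * h) \<longlongrightarrow> 0) (at_right 0)" by simp
  qed simp
  then show ?thesis using generator[OF Qt Qdot_L2[OF t f]] by simp
qed

end

section \<open>The Markov property\<close>

context heat_semigroup
begin

lemma P_cont_increment:
  assumes f: "f \<in> L2 m" and e: "0 < e"
  obtains d where "0 < d" "\<And>r s. 0 \<le> r \<Longrightarrow> 0 \<le> s \<Longrightarrow> \<bar>r - s\<bar> < d \<Longrightarrow> nm (\<lambda>x. P r f x - P s f x) < e"
proof -
  obtain d where d: "0 < d" "\<And>h. 0 < h \<Longrightarrow> h < d \<Longrightarrow> nm (\<lambda>x. P h f x - f x) < e"
    using P_small[OF f e] by metis
  have "nm (\<lambda>x. P r f x - P s f x) < e" if "0 \<le> r" "0 \<le> s" "\<bar>r - s\<bar> < d" for r s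
  proof -
    consider "r = s" | "r < s" | "s < r" by linarith
    then show ?thesis
    proof cases
      case 2
      then show ?thesis using nm_P_increment[of r "s - r" f] d(2)[of "s - r"] that f
        by (simp add: L2_norm_diff_commute[of m "P r f" "P s f"])
    next
      case 3
      then show ?thesis using nm_P_increment[of s "r - s" f] d(2)[of "r - s"] that f by simp
    qed (use e in simp)
  qed
  then show ?thesis using d(1) that by blast
qed

text \<open>The squared norm of the positive part \<open>v s\<close> of \<open>P s f - c\<close>
  starts at 0. Its derivative is twice the pairing of \<open>v s\<close> with the Laplacian of the
  orbit, that is, minus twice the energy of the orbit against its truncation, which is
  nonnegative.\<close>

lemma sub_markov:
  assumes f: "f \<in> L2 m" and c: "0 \<le> c" and fc: "AE x in m. f x \<le> c" and T: "0 < T"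
  shows "AE x in m. P T f x \<le> c"
proof -
  define v where "v s x = max 0 (P s f x - c)" for s x
  have vL: "v s \<in> L2 m" if "0 \<le> s" for s
  proof (rule L2_dominated[OF P_L2[OF that f]])
    show "v s \<in> borel_measurable m" unfolding v_def[abs_def] using L2_measurable[OF P_L2[OF that f]] by measurable
  qed (use c in \<open>auto simp: v_def max_def\<close>)
  have vdiff: "nm (\<lambda>x. v r x - v s x) \<le> nm (\<lambda>x. P r f x - P s f x)" if "0 \<le> r" "0 \<le> s" for r s
  proof -
    have "(\<integral>x. (v r x - v s x)\<^sup>2 \<partial>m) \<le> (\<integral>x. (P r f x - P s f x)\<^sup>2 \<partial>m)"
    proof (rule integral_mono)
      show "integrable m (\<lambda>x. (v r x - v s x)\<^sup>2)" "integrable m (\<lambda>x. (P r f x - P s f x)\<^sup>2)"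
        using that f vL by (auto intro!: L2_integrable_power2 L2_diff)
      show "(v r x - v s x)\<^sup>2 \<le> (P r f x - P s f x)\<^sup>2" for x
        unfolding abs_le_square_iff[symmetric] v_def max_def by auto
    qed
    then show ?thesis unfolding L2_norm_def by (rule real_sqrt_le_mono)
  qed
  define n where "n s = (nm (v s))\<^sup>2" for s
  have cont: "continuous_on {0..T} n"
    unfolding n_def
  proof (intro continuous_intros)
    show "continuous_on {0..T} (\<lambda>s. nm (v s))"
      unfolding continuous_on_iff
    proof (intro ballI allI impI)
      fix s e :: real assume s: "s \<in> {0..T}" and e: "0 < e"
      obtain d where d: "0 < d" "\<And>r s. 0 \<le> r \<Longrightarrow> 0 \<le> s \<Longrightarrow> \<bar>r - s\<bar> < d \<Longrightarrow> nm (\<lambda>x. P r f x - P s f x) < e"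
        using P_cont_increment[OF f e] by metis
      have "dist (nm (v r)) (nm (v s)) < e" if "r \<in> {0..T}" "dist r s < d" for r
        using L2_norm_reverse_triangle[OF vL vL, of r s] vdiff[of r s] d(2)[of r s] that s
        by (auto simp: dist_real_def)
      then show "\<exists>d>0. \<forall>r\<in>{0..T}. dist r s < d \<longrightarrow> dist (nm (v r)) (nm (v s)) < e" using d(1) by blast
    qed
  qed
  have "n T \<le> n 0"
  proof (rule Dini_nonincreasing[OF cont T])
    fix t e :: real assume t: "0 < t" and e: "0 < e"
    have QL: "Q t f \<in> L2 m" "Qdot t f \<in> L2 m" using t f by (auto intro: Q_L2 Qdot_L2)
    have vt: "v t \<in> L2 m" using t by (intro vL) simp
    have neg: "ip (v t) (Qdot t f) \<le> 0"
    proof -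
      obtain w where w: "w \<in> \<F>" "AE x in m. Q t f x = w x"
        "\<And>v. v \<in> \<F> \<Longrightarrow> energy \<nu> l \<gamma> w v = - ip (Qdot t f) v"
        using laplacian_obtain[OF laplacian_Q[OF t f]] by metis
      let ?w = "\<lambda>x. max 0 (w x - c)"
      have "ip (Qdot t f) ?w \<le> 0" using w(3) \<F>_truncation[OF w(1) c] by fastforce
      moreover have "AE x in m. v t x = ?w x"
        using w(2) P_eq_Q[OF t f] by eventually_elim (simp add: v_def)
      then have "ip (v t) (Qdot t f) = ip ?w (Qdot t f)"
        by (rule ip_cong(1)[rotated -1]) (use vt QL \<F>_truncation(1)[OF w(1) c] \<F>_L2 in auto)
      ultimately show ?thesis by (simp add: mult.commute)
    qed
    define K where "K = 32 / t\<^sup>2 * nm f"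
    \<comment> \<open>Collects the terms of second order in the step: the error of the difference
      quotient against its limit, and the square of the quotient itself.\<close>
    define B where "B = 2 * nm (v t) * K + (nm (Qdot t f) + K)\<^sup>2"
    have K: "0 \<le> K" by (simp add: K_def)
    have B: "0 \<le> B" using K by (simp add: B_def)
    have main: "n (t + h) \<le> n t + h * (h * B)" if h: "0 < h" "h < 1" for h
    proof -
      let ?q = "quot t f h"
      have qL: "?q \<in> L2 m" using t h f by (intro quot_L2) auto
      have vth: "v (t + h) \<in> L2 m" using t h by (intro vL) simp
      have pt: "AE x in m. (v (t + h) x)\<^sup>2 \<le> (v t x)\<^sup>2 + 2 * h * (v t x * ?q x) + h\<^sup>2 * (?q x)\<^sup>2"
      proof -
        have "AE x in m. P (t + h) f x = Q (t + h) f x" using t h f by (intro P_eq_Q) auto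
        then show ?thesis using P_eq_Q[OF t f]
        proof eventually_elim
          case (elim x)
          define a where "a = P t f x - c"
          define \<delta> where "\<delta> = h * ?q x"
          have e1: "P (t + h) f x - c = a + \<delta>" using elim h by (simp add: a_def \<delta>_def quot_def)
          \<comment> \<open>The square of the positive part is differentiable with derivative twice
            the positive part, and its Taylor error is at most the square of the increment.\<close>
          have "(max 0 (a + \<delta>))\<^sup>2 \<le> (max 0 a)\<^sup>2 + 2 * (max 0 a) * \<delta> + \<delta>\<^sup>2"
          proof (cases "0 \<le> a")
            case True
            have "(max 0 (a + \<delta>))\<^sup>2 \<le> (a + \<delta>)\<^sup>2" by (auto simp: max_def)
            then show ?thesis using True by (simp add: power2_sum)
          next
            case False
            have "(max 0 (a + \<delta>))\<^sup>2 \<le> \<delta>\<^sup>2"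
              unfolding abs_le_square_iff[symmetric] using False by (auto simp: max_def)
            then show ?thesis using False by simp
          qed
          then show ?case unfolding v_def e1 a_def[symmetric] by (simp add: \<delta>_def power_mult_distrib ac_simps)
        qed
      qed
      have i: "integrable m (\<lambda>x. (v t x)\<^sup>2)" "integrable m (\<lambda>x. v t x * ?q x)" "integrable m (\<lambda>x. (?q x)\<^sup>2)"
        using vt qL by (auto intro: L2_integrable_power2 L2_mult_integrable)
      have "n (t + h) = (\<integral>x. (v (t + h) x)\<^sup>2 \<partial>m)" by (simp add: n_def L2_norm_power2)
      also have "\<dots> \<le> (\<integral>x. (v t x)\<^sup>2 + 2 * h * (v t x * ?q x) + h\<^sup>2 * (?q x)\<^sup>2 \<partial>m)"
        using i pt L2_integrable_power2[OF vth] by (intro integral_mono_AE) auto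
      also have "\<dots> = n t + 2 * h * ip (v t) ?q + h\<^sup>2 * (nm ?q)\<^sup>2"
        using i by (simp add: n_def L2_norm_power2)
      also have "\<dots> \<le> n t + 2 * h * (nm (v t) * (K * h)) + h\<^sup>2 * (nm (Qdot t f) + K)\<^sup>2"
      proof (intro add_mono order_refl mult_left_mono power_mono)
        have d: "(\<lambda>x. ?q x - Qdot t f x) \<in> L2 m" "nm (\<lambda>x. ?q x - Qdot t f x) \<le> K * h"
          using nm_quot_Qdot[OF t f h(1)] by (auto simp: K_def)
        have "ip (v t) ?q = ip (v t) (\<lambda>x. ?q x - Qdot t f x) + ip (v t) (Qdot t f)"
          using ip_diff(2)[OF qL QL(2) vt] by simp
        also have "\<dots> \<le> nm (v t) * nm (\<lambda>x. ?q x - Qdot t f x)"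
          using L2_Cauchy_Schwarz[OF vt d(1)] neg by linarith
        also have "\<dots> \<le> nm (v t) * (K * h)" using d(2) by (intro mult_left_mono) auto
        finally show "ip (v t) ?q \<le> nm (v t) * (K * h)" .
        have "nm ?q \<le> nm (\<lambda>x. ?q x - Qdot t f x) + nm (Qdot t f)"
          using L2_norm_triangle[OF d(1) QL(2)] by simp
        also have "\<dots> \<le> K * 1 + nm (Qdot t f)"
          using d(2) mult_left_mono[OF less_imp_le[OF h(2)] K] by linarith
        finally show "nm ?q \<le> nm (Qdot t f) + K" by simp
      qed (use h in auto)
      also have "\<dots> = n t + h * (h * B)" by (simp add: B_def power2_eq_square algebra_simps)
      finally show ?thesis .
    qed
    have "n (t + h) \<le> n t + e * h" if h: "0 < h" "h < min 1 (e / (B + 1))" for h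
    proof -
      have "h * (B + 1) < e" using h B by (simp add: field_simps)
      moreover have "h * B \<le> h * (B + 1)" using h by (intro mult_left_mono) auto
      ultimately have "h * B \<le> e" by linarith
      then have "h * (h * B) \<le> h * e" by (rule mult_left_mono) (use h in simp)
      moreover have "n (t + h) \<le> n t + h * (h * B)" using h by (intro main) auto
      moreover have "h * e = e * h" by simp
      ultimately show ?thesis by linarith
    qed
    then show "\<exists>d>0. \<forall>h. 0 < h \<and> h < d \<longrightarrow> n (t + h) \<le> n t + e * h"
      using e B by (intro exI[of _ "min 1 (e / (B + 1))"]) auto
  qed
  also have "n 0 = 0"
  proof -
    have "AE x in m. v 0 x = 0" using fc P_0[OF f] by eventually_elim (simp add: v_def)
    then have "nm (v 0) = nm (\<lambda>x. 0)" by (intro nm_cong vL) (auto simp: L2_def)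
    then show ?thesis by (simp add: n_def)
  qed
  finally have "nm (v T) = 0" by (simp add: n_def)
  then have "AE x in m. v T x = 0" using T by (intro L2_norm_eq_0 vL) auto
  then show ?thesis by eventually_elim (simp add: v_def max_def split: if_splits)
qed

lemma sub_markov_Q:
  assumes f: "f \<in> L2 m" and c: "0 \<le> c" and fc: "AE x in m. f x \<le> c" and t: "0 < t"
  shows "AE x in m. Q t f x \<le> c"
  using sub_markov[OF assms] P_eq_Q[OF t f] by eventually_elim simp

lemma Q_minus: "Q t (\<lambda>y. - f y) x = - Q t f x"
  by (simp add: Q_def)

lemma kernel_nonneg:
  assumes t: "0 < t"
  shows "0 \<le> p t x y"
proof -
  have "0 \<le> p t x y + e" if e: "0 < e" for e
  proof -
    obtain N where N: "\<And>n k. N \<le> n \<Longrightarrow> N \<le> k \<Longrightarrow> \<bar>ip (Q t (avg y n)) (avg x k) - p t x y\<bar> \<le> e"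
      using avg_kernel[OF t e] by metis
    have "AE z in m. Q t (\<lambda>z. - avg y N z) z \<le> 0"
      by (rule sub_markov_Q) (auto intro: L2_minus avg_nonneg t)
    then have "AE z in m. 0 \<le> Q t (avg y N) z * avg x N z"
      by eventually_elim (simp add: Q_minus avg_nonneg)
    then have "0 \<le> ip (Q t (avg y N)) (avg x N)" by (rule integral_nonneg_AE)
    then show ?thesis using N[of N N] by simp
  qed
  then show ?thesis using field_le_epsilon[of 0 "p t x y"] by simp
qed

text \<open>\<open>sub_markov_Q\<close> holds off a null set only. Pairing with averages around
  \<open>x\<close> moves the bound to the given point, because \<open>Q t (avg x n)\<close>
  converges in norm to \<open>p t x\<close>.\<close>

lemma Q_bound:
  assumes g: "g \<in> L2 m" and G: "AE x in m. \<bar>g x\<bar> \<le> G" "0 \<le> G" and t: "0 < t"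
  shows "\<bar>Q t g x\<bar> \<le> G"
proof -
  have "AE z in m. Q t g z \<le> G" using g G t by (intro sub_markov_Q) (auto elim: eventually_mono)
  moreover have "AE z in m. Q t (\<lambda>y. - g y) z \<le> G"
    using g G t by (intro sub_markov_Q L2_minus) (auto elim: eventually_mono)
  ultimately have ae: "AE z in m. \<bar>Q t g z\<bar> \<le> G" by eventually_elim (auto simp: Q_minus)
  have QL: "Q t g \<in> L2 m" using t g by (rule Q_L2)
  have le: "\<bar>ip (Q t (avg x n)) g\<bar> \<le> G" for n
  proof -
    have "\<bar>ip (Q t (avg x n)) g\<bar> = \<bar>ip (avg x n) (Q t g)\<bar>" using Q_symmetric[OF t avg_L2 g] by simp
    also have "\<dots> \<le> (\<integral>z. \<bar>avg x n z * Q t g z\<bar> \<partial>m)" by (rule integral_abs_bound)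
    also have "\<dots> \<le> (\<integral>z. G * avg x n z \<partial>m)"
    proof (rule integral_mono_AE)
      show "integrable m (\<lambda>z. \<bar>avg x n z * Q t g z\<bar>)" using L2_mult_integrable[OF avg_L2 QL] by (rule integrable_abs)
      show "integrable m (\<lambda>z. G * avg x n z)" using avg_integral(1) by simp
      show "AE z in m. \<bar>avg x n z * Q t g z\<bar> \<le> G * avg x n z"
        using ae
      proof eventually_elim
        case (elim z)
        then show ?case using avg_nonneg[of x n z] mult_right_mono[of "\<bar>Q t g z\<bar>" G "avg x n z"]
          by (simp add: abs_mult mult.commute)
      qed
    qed
    also have "\<dots> = G" using avg_integral[of x n] by simp
    finally show ?thesis .
  qed
  have "(\<lambda>n. ip (Q t (avg x n)) g) \<longlonglongrightarrow> ip (p t x) g"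
    using t g by (intro ip_tendsto avg_kernel_L2 Q_L2 kernel_L2) auto
  then have "(\<lambda>n. \<bar>ip (Q t (avg x n)) g\<bar>) \<longlonglongrightarrow> \<bar>ip (p t x) g\<bar>" by (rule tendsto_rabs)
  then have "\<bar>ip (p t x) g\<bar> \<le> G" by (rule LIMSEQ_le_const2) (use le in blast)
  then show ?thesis using t by (simp add: Q_eq_ip)
qed

lemma time_integral_bound:
  assumes g: "g \<in> L2 m" and G: "AE x in m. \<bar>g x\<bar> \<le> G" "0 \<le> G" and T: "0 \<le> T"
  shows "\<bar>time_integral T g x\<bar> \<le> T * G"
proof -
  let ?I = "restrict_space lborel {0<..<T}"
  have b: "\<bar>Q s g x\<bar> \<le> G" if "s \<in> space ?I" for s
    using Q_bound[OF g G, of s] that by (simp add: space_restrict_space)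
  have "\<bar>time_integral T g x\<bar> \<le> (\<integral>s. \<bar>Q s g x\<bar> \<partial>?I)"
    unfolding time_integral_def by (rule integral_abs_bound)
  also have "\<dots> \<le> (\<integral>s. G \<partial>?I)"
    by (rule integral_mono_AE') (use b G finite_measure_interval[of 0 T] in \<open>auto intro!: finite_measure.integrable_const\<close>)
  also have "\<dots> = T * G" using measure_interval[OF T] by simp
  finally show ?thesis .
qed

text \<open>The point mass at \<open>x\<close> is not square integrable, so the first half of the
  time is spent to reach \<open>p (t/2) x\<close>, and the rest is differentiated.\<close>

definition pdot :: "real \<Rightarrow> 'a \<Rightarrow> 'a \<Rightarrow> real" where
  "pdot t x = Qdot (t/2) (p (t/2) x)"

lemma laplacian_kernel:
  assumes t: "0 < t"
  shows "\<L> (p t x) (pdot t x)"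
  using laplacian_Q[of "t/2" "p (t/2) x"] kernel_add[of "t/2" "t/2" x] t by (simp add: pdot_def kernel_L2)

text \<open>The interpolation with its step \<open>h\<close> still free: a difference quotient of
  size \<open>E / h\<close> plus the error from second differences, of size \<open>h\<close>. The
  diagonal values in \<open>M\<close> are the squared norms of \<open>p (t/4) y\<close> and
  \<open>p (t/2) x\<close>.\<close>

lemma pdot_bound:
  assumes t: "0 < t" and h: "0 < h" and E: "p t x y \<le> E" "p (t + h) x y \<le> E"
    and M: "p (t/2) y y \<le> M" "p t x x \<le> M"
  shows "\<bar>pdot t x y\<bar> \<le> E / h + 256 / t\<^sup>2 * M * h"
proof -
  have q: "quot (t/2) (p (t/2) x) h y = (p (t + h) x y - p t x y) / h"
  proof -
    have "Q (t/2 + h) (p (t/2) x) y = p (t + h) x y"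
      using kernel_add[of "t/2 + h" "t/2" x] t h by (simp add: algebra_simps)
    moreover have "Q (t/2) (p (t/2) x) y = p t x y" using kernel_add[of "t/2" "t/2" x] t by simp
    ultimately show ?thesis by (simp add: quot_def)
  qed
  have "\<bar>(p (t + h) x y - p t x y) / h - pdot t x y\<bar> \<le> 64 / (t/2)\<^sup>2 * nm (p (t/4) y) * nm (p (t/2) x) * h"
    using quot_Qdot[of "t/2" "p (t/2) x" h y] t h kernel_L2[of "t/2" x] by (simp add: pdot_def q)
  also have "\<dots> = 256 / t\<^sup>2 * h * (nm (p (t/4) y) * nm (p (t/2) x))" by (simp add: power_divide)
  also have "\<dots> \<le> 256 / t\<^sup>2 * h * M"
  proof (rule mult_left_mono)
    have M0: "0 \<le> M" using kernel_nonneg[OF t, of x x] M(2) by linarith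
    have "(nm (p (t/4) y))\<^sup>2 \<le> M" "(nm (p (t/2) x))\<^sup>2 \<le> M"
      using nm_kernel[of "t/4" y] nm_kernel[of "t/2" x] t M by auto
    then have "nm (p (t/4) y) \<le> sqrt M" "nm (p (t/2) x) \<le> sqrt M" by (auto intro: real_le_rsqrt)
    then have "nm (p (t/4) y) * nm (p (t/2) x) \<le> sqrt M * sqrt M" using M0 by (intro mult_mono) auto
    then show "nm (p (t/4) y) * nm (p (t/2) x) \<le> M" using M0 by simp
  qed (use h in simp)
  finally have 1: "\<bar>(p (t + h) x y - p t x y) / h - pdot t x y\<bar> \<le> 256 / t\<^sup>2 * M * h" by (simp add: ac_simps)
  \<comment> \<open>By positivity of the kernel both values lie between 0 and
    \<open>E\<close>.\<close>
  have "\<bar>p (t + h) x y - p t x y\<bar> \<le> E"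
    using kernel_nonneg[OF t, of x y] kernel_nonneg[of "t + h" x y] t h E by linarith
  then have "\<bar>(p (t + h) x y - p t x y) / h\<bar> \<le> E / h" using h by (simp add: abs_divide divide_right_mono)
  then show ?thesis using 1 by linarith
qed

end

section \<open>Scale functions\<close>

text \<open>From \<open>s0\<close> on the power term dominates; before it the linear term is at most
  \<open>A * s0\<close>.\<close>

lemma linear_minus_powr_bounded:
  fixes \<beta> k A :: real
  assumes \<beta>: "1 < \<beta>" and k: "0 < k" and A: "0 \<le> A"
  obtains B where "0 \<le> B" "\<And>s. 0 \<le> s \<Longrightarrow> A * s - k * s powr \<beta> \<le> B"
proof -
  define s0 where "s0 = (A / k) powr (1 / (\<beta> - 1))"
  have s0: "0 \<le> s0" by (simp add: s0_def)
  have "A * s - k * s powr \<beta> \<le> A * s0" if s: "0 \<le> s" for s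
  proof (cases "s \<le> s0")
    case True
    then have "A * s \<le> A * s0" using A by (intro mult_left_mono)
    moreover have "0 \<le> k * s powr \<beta>" using k by simp
    ultimately show ?thesis by linarith
  next
    case False
    then have s: "s0 < s" "0 < s" using s0 by auto
    have "A / k \<le> s powr (\<beta> - 1)"
    proof -
      have "s0 powr (\<beta> - 1) = A / k" using A k \<beta> by (simp add: s0_def powr_powr)
      moreover have "s0 powr (\<beta> - 1) \<le> s powr (\<beta> - 1)" using s s0 \<beta> by (intro powr_mono2) auto
      ultimately show ?thesis by simp
    qed
    then have "A \<le> k * s powr (\<beta> - 1)" using k by (simp add: field_simps)
    then have "A * s \<le> k * s powr (\<beta> - 1) * s" using s by (intro mult_right_mono) auto
    also have "\<dots> = k * s powr \<beta>" using s by (simp add: powr_diff)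
    finally show ?thesis using A s0 mult_nonneg_nonneg[OF A s0] by linarith
  qed
  then show ?thesis using that[of "A * s0"] A s0 by simp
qed

locale scale =
  fixes \<Psi> :: "real \<Rightarrow> real" and C \<beta>\<^sub>1 \<beta>\<^sub>2 :: real
  assumes strict_mono: "strict_mono_on {0<..} \<Psi>" and bij: "bij_betw \<Psi> {0<..} {0<..}"
    and C: "1 < C" and \<beta>\<^sub>1: "1 < \<beta>\<^sub>1" and \<beta>\<^sub>2: "\<beta>\<^sub>1 \<le> \<beta>\<^sub>2"
    and growth: "\<And>r R. 0 < r \<Longrightarrow> r \<le> R \<Longrightarrow>
      inverse C * (R / r) powr \<beta>\<^sub>1 \<le> \<Psi> R / \<Psi> r \<and> \<Psi> R / \<Psi> r \<le> C * (R / r) powr \<beta>\<^sub>2"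
begin

abbreviation "\<Psi>i \<equiv> scale_inverse \<Psi>"

lemma \<Psi>_pos: "0 < r \<Longrightarrow> 0 < \<Psi> r"
  using bij by (auto simp: bij_betw_def)

lemma \<Psi>_mono: "0 < r \<Longrightarrow> r \<le> s \<Longrightarrow> \<Psi> r \<le> \<Psi> s"
  using strict_mono unfolding strict_mono_on_def by (metis greaterThan_iff less_eq_real_def less_le_trans)

lemma \<Psi>i_pos: "0 < t \<Longrightarrow> 0 < \<Psi>i t" and \<Psi>_\<Psi>i: "0 < t \<Longrightarrow> \<Psi> (\<Psi>i t) = t"
proof -
  assume t: "0 < t"
  have inj: "inj_on \<Psi> {0<..}" and im: "t \<in> \<Psi> ` {0<..}" using bij t by (auto simp: bij_betw_def)
  show "\<Psi> (\<Psi>i t) = t" unfolding scale_inverse_def by (rule f_the_inv_into_f[OF inj im])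
  show "0 < \<Psi>i t" unfolding scale_inverse_def using the_inv_into_into[OF inj im, of "{0<..}"] by simp
qed

lemma \<Psi>i_\<Psi>: "0 < r \<Longrightarrow> \<Psi>i (\<Psi> r) = r"
  unfolding scale_inverse_def using bij by (intro the_inv_into_f_f) (auto simp: bij_betw_def)

lemma \<Psi>i_le: "0 < t \<Longrightarrow> 0 < r \<Longrightarrow> t \<le> \<Psi> r \<Longrightarrow> \<Psi>i t \<le> r"
  using strict_mono \<Psi>i_pos[of t] \<Psi>_\<Psi>i[of t] unfolding strict_mono_on_def by (metis greaterThan_iff not_le)

lemma \<Psi>i_mono: "0 < s \<Longrightarrow> s \<le> t \<Longrightarrow> \<Psi>i s \<le> \<Psi>i t"
  by (intro \<Psi>i_le) (auto simp: \<Psi>i_pos \<Psi>_\<Psi>i)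

lemma \<Psi>_upper: "0 < r \<Longrightarrow> 1 \<le> \<alpha> \<Longrightarrow> \<Psi> (\<alpha> * r) \<le> C * \<alpha> powr \<beta>\<^sub>2 * \<Psi> r"
  using growth[of r "\<alpha> * r"] \<Psi>_pos[of r] by (simp add: field_simps)

lemma \<Psi>_lower: "0 < r \<Longrightarrow> 1 \<le> \<alpha> \<Longrightarrow> inverse C * \<alpha> powr \<beta>\<^sub>1 * \<Psi> r \<le> \<Psi> (\<alpha> * r)"
  using growth[of r "\<alpha> * r"] \<Psi>_pos[of r] by (simp add: pos_le_divide_eq)

lemma exists_powr_ge:
  assumes "0 < a"
  obtains \<alpha> :: real where "1 \<le> \<alpha>" "K \<le> \<alpha> powr a"
proof -
  define \<alpha> where "\<alpha> = (max 1 K) powr (1 / a)"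
  have "1 \<le> \<alpha>" unfolding \<alpha>_def using assms by (intro ge_one_powr_ge_zero) auto
  moreover have "\<alpha> powr a = max 1 K" unfolding \<alpha>_def using assms by (simp add: powr_powr)
  ultimately show ?thesis using that[of \<alpha>] by simp
qed

text \<open>Lets the volume at times down to \<open>t / 4\<close> be compared with the volume at
  time \<open>t\<close>.\<close>

lemma \<Psi>i_quarter: obtains \<kappa> where "1 \<le> \<kappa>" "\<And>t. 0 < t \<Longrightarrow> \<Psi>i t \<le> \<kappa> * \<Psi>i (t / 4)"
proof -
  obtain \<kappa> where k: "1 \<le> \<kappa>" "4 * C \<le> \<kappa> powr \<beta>\<^sub>1" using exists_powr_ge[of \<beta>\<^sub>1 "4 * C"] \<beta>\<^sub>1 by auto
  have "\<Psi>i t \<le> \<kappa> * \<Psi>i (t / 4)" if t: "0 < t" for t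
  proof (rule \<Psi>i_le)
    have r: "0 < \<Psi>i (t/4)" using t by (intro \<Psi>i_pos) simp
    then show "0 < \<kappa> * \<Psi>i (t/4)" using k by simp
    have "t = inverse C * (4 * C) * \<Psi> (\<Psi>i (t/4))" using t C by (simp add: \<Psi>_\<Psi>i)
    also have "\<dots> \<le> inverse C * \<kappa> powr \<beta>\<^sub>1 * \<Psi> (\<Psi>i (t/4))"
      using k C \<Psi>_pos[OF r] by (intro mult_right_mono mult_left_mono) auto
    also have "\<dots> \<le> \<Psi> (\<kappa> * \<Psi>i (t/4))" by (rule \<Psi>_lower[OF r k(1)])
    finally show "t \<le> \<Psi> (\<kappa> * \<Psi>i (t/4))" .
  qed (rule t)
  then show ?thesis using that k by blast
qed

lemma rate_at_smaller_scale:
  assumes R: "0 < R" and r: "0 < r" "r \<le> R" and t: "0 \<le> t"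
  shows "inverse C * (R / r) powr \<beta>\<^sub>1 * (t / \<Psi> R) \<le> t / \<Psi> r"
proof -
  have "inverse C * (R / r) powr \<beta>\<^sub>1 \<le> \<Psi> R / \<Psi> r" using growth[of r R] r by simp
  then have "inverse C * (R / r) powr \<beta>\<^sub>1 * (t / \<Psi> R) \<le> \<Psi> R / \<Psi> r * (t / \<Psi> R)"
    using t \<Psi>_pos[OF R] by (intro mult_right_mono) auto
  also have "\<dots> = t / \<Psi> r" using \<Psi>_pos[OF R] by simp
  finally show ?thesis .
qed

text \<open>For \<open>r < 1\<close> substitute \<open>s = 1 / r\<close>: the time term is at least
  a multiple of \<open>s powr \<beta>\<^sub>1\<close>, which beats the linear term because the
  exponent exceeds 1. For larger \<open>r\<close> the bound \<open>d\<close> suffices.\<close>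

lemma rate_bdd:
  assumes t: "0 < t" and d: "0 \<le> d"
  shows "bdd_above ((\<lambda>r. d / r - t / \<Psi> r) ` {0<..})"
proof -
  have k: "0 < inverse C * (t / \<Psi> 1)" using C t \<Psi>_pos[of 1] by simp
  obtain B where B: "0 \<le> B" "\<And>s. 0 \<le> s \<Longrightarrow> d * s - inverse C * (t / \<Psi> 1) * s powr \<beta>\<^sub>1 \<le> B"
    using linear_minus_powr_bounded[OF \<beta>\<^sub>1 k d] by metis
  show ?thesis
  proof (rule bdd_aboveI2[where M = "max d B"])
    fix r :: real assume "r \<in> {0<..}"
    then have r: "0 < r" by simp
    show "d / r - t / \<Psi> r \<le> max d B"
    proof (cases "1 \<le> r")
      case True
      have "d / r \<le> d / 1" using True d by (intro divide_left_mono) auto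
      moreover have "0 \<le> t / \<Psi> r" using t \<Psi>_pos[OF r] by simp
      ultimately show ?thesis by simp
    next
      case False
      then have "inverse C * (1 / r) powr \<beta>\<^sub>1 * (t / \<Psi> 1) \<le> t / \<Psi> r"
        using r t by (intro rate_at_smaller_scale) auto
      moreover have "d * (1 / r) - inverse C * (t / \<Psi> 1) * (1 / r) powr \<beta>\<^sub>1 \<le> B" using r by (intro B) simp
      moreover have "inverse C * (1 / r) powr \<beta>\<^sub>1 * (t / \<Psi> 1) = inverse C * (t / \<Psi> 1) * (1 / r) powr \<beta>\<^sub>1" by simp
      ultimately have "d * (1 / r) - t / \<Psi> r \<le> B" by linarith
      then show ?thesis by simp
    qed
  qed
qed

lemma rate_upper: "0 < t \<Longrightarrow> 0 \<le> d \<Longrightarrow> 0 < r \<Longrightarrow> d / r - t / \<Psi> r \<le> scale_rate \<Psi> d t"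
  unfolding scale_rate_def by (rule cSUP_upper[OF _ rate_bdd]) auto

lemma rate_le: "(\<And>r. 0 < r \<Longrightarrow> d / r - t / \<Psi> r \<le> B) \<Longrightarrow> scale_rate \<Psi> d t \<le> B"
  unfolding scale_rate_def by (rule cSUP_least) auto

text \<open>Moving by \<open>2 R\<close> and doubling the time changes the rate only by a factor and a constant:
  far away the optimal scale is enlarged by \<open>\<alpha>\<close>, and nearby the rate is bounded.\<close>

lemma rate_shift:
  obtains c K where "0 < c" "\<And>t d \<rho>\<^sub>0. 0 < t \<Longrightarrow> 0 \<le> d \<Longrightarrow> 0 < \<rho>\<^sub>0 \<Longrightarrow>
    \<exists>\<rho>>0. c * (d / \<rho>\<^sub>0 - t / \<Psi> \<rho>\<^sub>0) - K \<le> (d - 2 * \<Psi>i t) / \<rho> - 2 * t / \<Psi> \<rho>"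
proof -
  \<comment> \<open>Enlarging the scale by \<alpha> and halving the distance multiply the distance
    term by \<open>c = 1 / (2 * \<alpha>)\<close>; the time term gains
    \<open>\<alpha> powr \<beta>\<^sub>1 / C\<close>. The condition makes this gain absorb both the
    doubled time and the factor \<open>c\<close>.\<close>
  obtain \<alpha> where \<alpha>: "1 \<le> \<alpha>" "4 * C \<le> \<alpha> powr (\<beta>\<^sub>1 - 1)" using exists_powr_ge[of "\<beta>\<^sub>1 - 1" "4 * C"] \<beta>\<^sub>1 by auto
  have iC: "0 < inverse C" using C by simp
  obtain B where B: "0 \<le> B" "\<And>s. 0 \<le> s \<Longrightarrow> 4 * s - inverse C * s powr \<beta>\<^sub>1 \<le> B"
    using linear_minus_powr_bounded[OF \<beta>\<^sub>1 iC, of 4] by auto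
  define c where "c = 1 / (2 * \<alpha>)"
  have c: "0 < c" using \<alpha> by (simp add: c_def)
  \<comment> \<open>For nearby points the rate is at most \<open>max 4 B\<close>, so the left side
    is at most -4, while the scale \<open>\<Psi>i t\<close> gives at least -2 - 2 on the
    right.\<close>
  define K where "K = 4 + c * max 4 B"
  have "\<exists>\<rho>>0. c * (d / \<rho>\<^sub>0 - t / \<Psi> \<rho>\<^sub>0) - K \<le> (d - 2 * \<Psi>i t) / \<rho> - 2 * t / \<Psi> \<rho>"
    if t: "0 < t" and d: "0 \<le> d" and \<rho>: "0 < \<rho>\<^sub>0" for t d \<rho>\<^sub>0
  proof (cases "4 * \<Psi>i t \<le> d")
    case True
    have 1: "(d / 2) / (\<alpha> * \<rho>\<^sub>0) \<le> (d - 2 * \<Psi>i t) / (\<alpha> * \<rho>\<^sub>0)"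
      using True \<alpha> \<rho> by (intro divide_right_mono) auto
    have "2 * t / \<Psi> (\<alpha> * \<rho>\<^sub>0) \<le> 2 * t / (inverse C * \<alpha> powr \<beta>\<^sub>1 * \<Psi> \<rho>\<^sub>0)"
      using \<Psi>_lower[OF \<rho> \<alpha>(1)] t C \<alpha> \<Psi>_pos[OF \<rho>] \<Psi>_pos[of "\<alpha> * \<rho>\<^sub>0"] \<rho>
      by (intro divide_left_mono mult_pos_pos) auto
    also have "\<dots> = c * (t / \<Psi> \<rho>\<^sub>0) * (4 * C / \<alpha> powr (\<beta>\<^sub>1 - 1))"
      using C \<alpha> \<Psi>_pos[OF \<rho>] by (simp add: c_def powr_diff field_simps)
    also have "\<dots> \<le> c * (t / \<Psi> \<rho>\<^sub>0) * 1"
      using \<alpha> c t \<Psi>_pos[OF \<rho>] by (intro mult_left_mono) auto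
    finally have 2: "2 * t / \<Psi> (\<alpha> * \<rho>\<^sub>0) \<le> c * (t / \<Psi> \<rho>\<^sub>0)" by simp
    have 3: "(d / 2) / (\<alpha> * \<rho>\<^sub>0) = c * (d / \<rho>\<^sub>0)" by (simp add: c_def)
    have "0 \<le> K" using c by (simp add: K_def)
    then have "c * (d / \<rho>\<^sub>0 - t / \<Psi> \<rho>\<^sub>0) - K \<le> (d - 2 * \<Psi>i t) / (\<alpha> * \<rho>\<^sub>0) - 2 * t / \<Psi> (\<alpha> * \<rho>\<^sub>0)"
      using 1 2 3 by (simp add: right_diff_distrib)
    then show ?thesis using \<alpha> \<rho> by (intro exI[of _ "\<alpha> * \<rho>\<^sub>0"]) auto
  next
    case False
    let ?R = "\<Psi>i t"
    have R: "0 < ?R" using t by (rule \<Psi>i_pos)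
    have 1: "d / \<rho>\<^sub>0 - t / \<Psi> \<rho>\<^sub>0 \<le> max 4 B"
    proof (cases "?R \<le> \<rho>\<^sub>0")
      case True
      have "d / \<rho>\<^sub>0 \<le> 4 * ?R / \<rho>\<^sub>0" using False \<rho> by (intro divide_right_mono) auto
      also have "\<dots> \<le> 4" using True \<rho> by (simp add: field_simps)
      finally have "d / \<rho>\<^sub>0 \<le> 4" .
      moreover have "0 \<le> t / \<Psi> \<rho>\<^sub>0" using t \<Psi>_pos[OF \<rho>] by simp
      ultimately show ?thesis by simp
    next
      case F2: False
      have "inverse C * (?R / \<rho>\<^sub>0) powr \<beta>\<^sub>1 * (t / \<Psi> ?R) \<le> t / \<Psi> \<rho>\<^sub>0"
        using F2 R \<rho> t by (intro rate_at_smaller_scale) auto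
      then have "inverse C * (?R / \<rho>\<^sub>0) powr \<beta>\<^sub>1 \<le> t / \<Psi> \<rho>\<^sub>0" using t by (simp add: \<Psi>_\<Psi>i)
      moreover have "4 * (?R / \<rho>\<^sub>0) - inverse C * (?R / \<rho>\<^sub>0) powr \<beta>\<^sub>1 \<le> B" using R \<rho> by (intro B) simp
      moreover have "d / \<rho>\<^sub>0 \<le> 4 * (?R / \<rho>\<^sub>0)" using False \<rho> by (simp add: divide_right_mono)
      ultimately show ?thesis by linarith
    qed
    have "c * (d / \<rho>\<^sub>0 - t / \<Psi> \<rho>\<^sub>0) - K \<le> - 4" using mult_left_mono[OF 1, of c] c by (simp add: K_def)
    also have "\<dots> \<le> (d - 2 * ?R) / ?R - 2 * t / \<Psi> ?R"
    proof -
      have "(d - 2 * ?R) / ?R = d / ?R - 2" using R by (simp add: diff_divide_distrib)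
      moreover have "0 \<le> d / ?R" using d R by simp
      ultimately show ?thesis using t by (simp add: \<Psi>_\<Psi>i)
    qed
    finally show ?thesis using R by blast
  qed
  then show ?thesis using that c by blast
qed

lemma \<Psi>_dyadic:
  assumes "0 < r"
  shows "\<Psi> (r * (1/2) ^ j) \<le> C * \<Psi> r * ((1/2) powr \<beta>\<^sub>1) ^ j"
proof -
  have p: "0 < r * (1/2) ^ j" using assms by simp
  have "inverse C * (2 ^ j) powr \<beta>\<^sub>1 * \<Psi> (r * (1/2) ^ j) \<le> \<Psi> (2 ^ j * (r * (1/2) ^ j))"
    using p by (rule \<Psi>_lower) simp
  also have "2 ^ j * (r * (1/2) ^ j) = r" by (simp add: power_divide)
  finally have "\<Psi> (r * (1/2) ^ j) \<le> C * \<Psi> r / (2 ^ j) powr \<beta>\<^sub>1"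
    using C by (simp add: field_simps)
  also have "1 / (2 ^ j :: real) powr \<beta>\<^sub>1 = ((1/2) powr \<beta>\<^sub>1) ^ j"
    by (simp add: powr_realpow[symmetric] powr_powr powr_divide mult.commute power_divide powr_power)
  then have "C * \<Psi> r / (2 ^ j) powr \<beta>\<^sub>1 = C * \<Psi> r * ((1/2) powr \<beta>\<^sub>1) ^ j"
    by (metis (no_types, lifting) times_divide_eq_right mult.right_neutral)
  finally show ?thesis .
qed

end

lemma scale_functionE:
  assumes "scale_function \<Psi>"
  obtains C \<beta>\<^sub>1 \<beta>\<^sub>2 where "scale \<Psi> C \<beta>\<^sub>1 \<beta>\<^sub>2"
  using assms unfolding scale_function_def scale_def by blast

section \<open>Upper bounds for the kernel and its time derivative\<close>

locale heat_kernel_upper = heat_semigroup \<iota> l \<gamma> \<nu> m P p + scale \<Psi> C \<beta>\<^sub>1 \<beta>\<^sub>2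
  for \<iota> :: ereal and l :: "nat \<Rightarrow> real"
    and \<gamma> :: "nat \<Rightarrow> real \<Rightarrow> 'a::{heine_borel, second_countable_topology}"
    and \<nu> m :: "'a measure"
    and P :: "real \<Rightarrow> ('a \<Rightarrow> real) \<Rightarrow> 'a \<Rightarrow> real"
    and p :: "real \<Rightarrow> 'a \<Rightarrow> 'a \<Rightarrow> real"
    and \<Psi> :: "real \<Rightarrow> real" and C \<beta>\<^sub>1 \<beta>\<^sub>2 :: real +
  fixes V :: "real \<Rightarrow> real" and CV C\<^sub>1 c\<^sub>2 :: real
  assumes unbounded: "\<not> bounded (UNIV :: 'a set)"
    and geodesic: "geodesic_space TYPE('a)"
    and V_mono: "mono_on {0..} V" and CV: "1 \<le> CV"
    and V_pos: "\<And>r. 0 < r \<Longrightarrow> 0 < V r"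
    and V_lower: "\<And>x r. 0 < r \<Longrightarrow> V r / CV \<le> measure m (ball x r)"
    and V_upper: "\<And>x r. 0 < r \<Longrightarrow> measure m (ball x r) \<le> CV * V r"
    and V_double: "\<And>r. 0 < r \<Longrightarrow> V (2 * r) \<le> CV * V r"
    and C\<^sub>1: "0 < C\<^sub>1" and c\<^sub>2: "0 < c\<^sub>2"
    and upper: "\<And>t. 0 < t \<Longrightarrow> AE (x, y) in m \<Otimes>\<^sub>M m.
        p t x y \<le> C\<^sub>1 / measure m (ball x (scale_inverse \<Psi> t)) * exp (- c\<^sub>2 * scale_rate \<Psi> (dist x y) t)"
begin

lemma V_le: "0 < r \<Longrightarrow> r \<le> s \<Longrightarrow> V r \<le> V s"
  using V_mono by (auto simp: mono_on_def)

lemma V_scale: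
  assumes \<kappa>: "0 < \<kappa>"
  obtains D where "1 \<le> D" "\<And>r. 0 < r \<Longrightarrow> V (\<kappa> * r) \<le> D * V r"
proof -
  obtain n :: nat where n: "\<kappa> < 2 ^ n" using real_arch_pow[of 2 \<kappa>] by auto
  have *: "V (2 ^ k * r) \<le> CV ^ k * V r" if "0 < r" for k r
  proof (induction k)
    case (Suc k)
    have "V (2 ^ Suc k * r) = V (2 * (2 ^ k * r))" by (simp add: mult.assoc)
    also have "\<dots> \<le> CV * V (2 ^ k * r)" using that by (intro V_double) simp
    also have "\<dots> \<le> CV * (CV ^ k * V r)" using Suc CV by (intro mult_left_mono) auto
    finally show ?case by simp
  qed simp
  have "V (\<kappa> * r) \<le> CV ^ n * V r" if r: "0 < r" for r
  proof -
    have "\<kappa> * r \<le> 2 ^ n * r" using n r by (intro mult_right_mono) auto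
    then have "V (\<kappa> * r) \<le> V (2 ^ n * r)" using r \<kappa> by (intro V_le) auto
    then show ?thesis using *[OF r, of n] by linarith
  qed
  then show ?thesis using that[of "CV ^ n"] CV by simp
qed

text \<open>A geodesic of length at least \<open>a * r\<close> carries \<open>N\<close> points at
  spacing \<open>3 * r\<close>, and their disjoint balls of radius \<open>r\<close> fit into the
  ball of radius \<open>a * r\<close>. Comparing measures with \<open>V\<close> costs
  \<open>CV\<close> once from below and once from above.\<close>

lemma reverse_doubling:
  obtains a where "1 \<le> a" "\<And>r. 0 < r \<Longrightarrow> K * V r \<le> V (a * r)"
proof -
  obtain N :: nat where N: "K * CV\<^sup>2 \<le> real N" using real_arch_simple by blast
  define a where "a = 3 * real (Suc N)"
  have "K * V r \<le> V (a * r)" if r: "0 < r" for r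
  proof -
    fix x0 :: 'a
    have "\<exists>y. a * r \<le> dist x0 y"
    proof (rule ccontr)
      assume "\<not> ?thesis"
      then have "\<forall>y\<in>UNIV. dist x0 y \<le> a * r" by (auto simp: not_le less_imp_le)
      then show False using unbounded unfolding bounded_def by blast
    qed
    then obtain y where y: "a * r \<le> dist x0 y" by auto
    obtain \<phi> where \<phi>: "isometry_on_interval (dist x0 y) \<phi>" "\<phi> 0 = x0"
      using geodesic unfolding geodesic_space_def geodesic_in_def by metis
    define z where "z i = \<phi> (3 * r * real i)" for i :: nat
    have in_range: "3 * r * real i \<in> {0..dist x0 y}" if "i < N" for i
    proof -
      have "3 * r * real i \<le> 3 * r * real (Suc N)" using that r by (intro mult_left_mono) auto
      also have "\<dots> = a * r" by (simp add: a_def)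
      also note y
      finally show ?thesis using r by simp
    qed
    have zz: "dist (z i) (z j) = 3 * r * \<bar>real i - real j\<bar>" if "i < N" "j < N" for i j
    proof -
      have "dist (z i) (z j) = \<bar>3 * r * real i - 3 * r * real j\<bar>"
        using \<phi>(1) in_range[OF that(1)] in_range[OF that(2)] unfolding isometry_on_interval_def z_def by auto
      also have "\<dots> = 3 * r * \<bar>real i - real j\<bar>" using r by (simp add: abs_mult right_diff_distrib[symmetric])
      finally show ?thesis .
    qed
    have z0: "dist x0 (z i) = 3 * r * real i" if "i < N" for i
    proof -
      have "0 \<in> {0..dist x0 y}" by simp
      then have "dist (\<phi> 0) (z i) = \<bar>0 - 3 * r * real i\<bar>"
        using \<phi>(1) in_range[OF that] unfolding isometry_on_interval_def z_def by blast
      then show ?thesis using r \<phi>(2) by simp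
    qed
    have disj: "disjoint_family_on (\<lambda>i. ball (z i) r) {..<N}"
      unfolding disjoint_family_on_def
    proof (intro ballI impI)
      fix i j assume ij: "i \<in> {..<N}" "j \<in> {..<N}" "i \<noteq> j"
      have "1 \<le> \<bar>real i - real j\<bar>" using ij(3) by linarith
      then have "3 * r * 1 \<le> dist (z i) (z j)" using zz[of i j] ij r by (simp add: mult_left_mono)
      then show "ball (z i) r \<inter> ball (z j) r = {}" using r by (intro disjoint_ballI) simp
    qed
    have sub: "(\<Union>i<N. ball (z i) r) \<subseteq> ball x0 (a * r)"
    proof
      fix w assume "w \<in> (\<Union>i<N. ball (z i) r)"
      then obtain i where i: "i < N" "dist (z i) w < r" by auto
      have "dist x0 w < 3 * r * real i + r" using z0[OF i(1)] dist_triangle[of x0 w "z i"] i(2) by simp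
      also have "\<dots> \<le> 3 * r * real (Suc i)" using r by (simp add: algebra_simps)
      also have "\<dots> \<le> 3 * r * real (Suc N)" using i(1) r by (intro mult_left_mono) auto
      finally show "w \<in> ball x0 (a * r)" by (simp add: a_def ac_simps)
    qed
    have fm: "ball x s \<in> fmeasurable m" for x s using ball_finite[of x s] by (simp add: fmeasurable_def sets_m)
    have "real N * (V r / CV) = (\<Sum>i<N. V r / CV)" by simp
    also have "\<dots> \<le> (\<Sum>i<N. measure m (ball (z i) r))" by (intro sum_mono V_lower r)
    also have "\<dots> = measure m (\<Union>i<N. ball (z i) r)"
    proof (rule measure_finite_Union[symmetric])
      show "emeasure m (ball (z i) r) \<noteq> \<infinity>" for i using ball_finite[of "z i" r] by simp
    qed (use disj in \<open>auto simp: sets_m\<close>)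
    also have "\<dots> \<le> measure m (ball x0 (a * r))"
      using sub fm by (intro measure_mono_fmeasurable) (auto simp: sets_m)
    also have "\<dots> \<le> CV * V (a * r)" using r by (intro V_upper) (simp add: a_def)
    finally have "real N * V r \<le> CV\<^sup>2 * V (a * r)" using CV by (simp add: field_simps power2_eq_square)
    moreover have "K * CV\<^sup>2 * V r \<le> real N * V r" using N V_pos[OF r] by (intro mult_right_mono) auto
    ultimately have "CV\<^sup>2 * (K * V r) \<le> CV\<^sup>2 * V (a * r)" by (simp add: ac_simps)
    then show "K * V r \<le> V (a * r)" using CV by (simp add: mult_le_cancel_left)
  qed
  moreover have "1 \<le> a" by (simp add: a_def)
  ultimately show ?thesis using that by blast
qed

section \<open>Upper bounds at every point\<close>

definition A where "A = C\<^sub>1 * CV"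

lemma A_pos: "0 < A" using C\<^sub>1 CV by (simp add: A_def)

text \<open>For one fixed scale \<rho>, and with \<open>V\<close> in place of the measure of the
  ball, the right side is continuous in both points. A violation at one pair would therefore persist
  on a product of small balls, which has positive measure.\<close>

lemma kernel_upper:
  assumes t: "0 < t" and \<rho>: "0 < \<rho>"
  shows "p t x y \<le> A / V (\<Psi>i t) * exp (- c\<^sub>2 * (dist x y / \<rho> - t / \<Psi> \<rho>))"
proof (rule ccontr)
  let ?b = "\<lambda>z w. A / V (\<Psi>i t) * exp (- c\<^sub>2 * (dist z w / \<rho> - t / \<Psi> \<rho>))"
  assume "\<not> p t x y \<le> ?b x y"
  then have gt: "?b x y < p t x y" by simp
  define e where "e = (p t x y - ?b x y) / 2"
  have e: "0 < e" using gt by (simp add: e_def)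
  obtain d1 where d1: "0 < d1" "\<And>s z w. 0 < s \<Longrightarrow> dist s t < d1 \<Longrightarrow> dist z x < d1 \<Longrightarrow> dist w y < d1 \<Longrightarrow> \<bar>p s z w - p t x y\<bar> < e"
    using kernel_near[OF t e] by metis
  have "continuous_on UNIV (\<lambda>q. ?b (fst q) (snd q))"
    using \<rho> by (intro continuous_intros) auto
  then obtain d2 where d2: "0 < d2" "\<And>q. dist q (x, y) < d2 \<Longrightarrow> dist (?b (fst q) (snd q)) (?b x y) < e"
    using e unfolding continuous_on_iff by (metis UNIV_I fst_conv snd_conv)
  define d where "d = min d1 (d2 / 2)"
  have d: "0 < d" using d1(1) d2(1) by (simp add: d_def)
  have big: "?b z w < p t z w" if "z \<in> ball x d" "w \<in> ball y d" for z w
  proof -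
    have "dist (z, w) (x, y) \<le> dist z x + dist w y"
      unfolding dist_Pair_Pair by (rule sqrt_sum_squares_le_sum) auto
    also have "\<dots> < d2" using that by (simp add: d_def dist_commute)
    finally have "dist (?b z w) (?b x y) < e" using d2(2)[of "(z, w)"] by simp
    moreover have "\<bar>p t z w - p t x y\<bar> < e"
      using that t by (intro d1(2)) (auto simp: d_def dist_commute d1(1))
    moreover have "p t x y - ?b x y = 2 * e" by (simp add: e_def)
    ultimately show ?thesis unfolding dist_real_def by linarith
  qed
  have le: "C\<^sub>1 / measure m (ball z (\<Psi>i t)) * exp (- c\<^sub>2 * scale_rate \<Psi> (dist z w) t) \<le> ?b z w" for z w
  proof (intro mult_mono)
    have Vp: "0 < V (\<Psi>i t)" using t by (intro V_pos \<Psi>i_pos)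
    have "C\<^sub>1 / measure m (ball z (\<Psi>i t)) \<le> C\<^sub>1 / (V (\<Psi>i t) / CV)"
      using C\<^sub>1 CV Vp V_lower[OF \<Psi>i_pos[OF t], of z] by (intro divide_left_mono mult_pos_pos)
        (auto intro: less_le_trans[of 0 "V (\<Psi>i t) / CV"])
    then show "C\<^sub>1 / measure m (ball z (\<Psi>i t)) \<le> A / V (\<Psi>i t)" by (simp add: A_def)
    have "dist z w / \<rho> - t / \<Psi> \<rho> \<le> scale_rate \<Psi> (dist z w) t" using t \<rho> by (intro rate_upper) auto
    then show "exp (- c\<^sub>2 * scale_rate \<Psi> (dist z w) t) \<le> exp (- c\<^sub>2 * (dist z w / \<rho> - t / \<Psi> \<rho>))"
      using c\<^sub>2 by simp
    show "0 \<le> A / V (\<Psi>i t)" using A_pos Vp by simp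
  qed simp
  have "AE q in m \<Otimes>\<^sub>M m. q \<notin> ball x d \<times> ball y d"
    using upper[OF t] by (rule eventually_mono) (use le big in \<open>fastforce simp: not_le[symmetric] intro: order_trans\<close>)
  moreover have S: "ball x d \<times> ball y d \<in> sets (m \<Otimes>\<^sub>M m)" by (intro pair_measureI) (simp_all add: sets_m)
  ultimately have "emeasure (m \<Otimes>\<^sub>M m) (ball x d \<times> ball y d) = 0"
    by (subst (asm) AE_iff_measurable[OF S]) (use sets.sets_into_space[OF S] in auto)
  moreover have "emeasure (m \<Otimes>\<^sub>M m) (ball x d \<times> ball y d) = emeasure m (ball x d) * emeasure m (ball y d)"
    by (intro emeasure_pair_measure_Times) (simp_all add: sets_m)
  moreover have "0 < emeasure m (ball x d)" "0 < emeasure m (ball y d)" using d by (auto intro!: open_pos)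
  ultimately show False by (metis mult_eq_0_iff less_irrefl)
qed

lemma kernel_diagonal_upper:
  assumes t: "0 < t"
  shows "p t x y \<le> A * exp c\<^sub>2 / V (\<Psi>i t)"
proof -
  have "p t x y \<le> A / V (\<Psi>i t) * exp (- c\<^sub>2 * (dist x y / \<Psi>i t - 1))"
    using kernel_upper[OF t \<Psi>i_pos[OF t], of x y] t by (simp add: \<Psi>_\<Psi>i)
  also have "\<dots> \<le> A / V (\<Psi>i t) * exp c\<^sub>2"
  proof (rule mult_left_mono)
    have "0 \<le> c\<^sub>2 * (dist x y / \<Psi>i t)" using c\<^sub>2 \<Psi>i_pos[OF t] by simp
    then show "exp (- c\<^sub>2 * (dist x y / \<Psi>i t - 1)) \<le> exp c\<^sub>2" by (simp add: right_diff_distrib)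
    show "0 \<le> A / V (\<Psi>i t)" using A_pos V_pos[OF \<Psi>i_pos[OF t]] by simp
  qed
  finally show ?thesis by simp
qed

text \<open>The time is doubled so that one factor covers all times between \<open>t\<close> and
  \<open>2 * t\<close>.\<close>

definition E where "E t d \<rho> = exp (- c\<^sub>2 * (d / \<rho> - 2 * t / \<Psi> \<rho>))"

text \<open>The minimum with 1 combines the on-diagonal and off-diagonal bounds; it later keeps the
  time step of the interpolation below \<open>t\<close>.\<close>

lemma kernel_upper_later:
  assumes t: "0 < t" and s: "t \<le> s" "s \<le> 2 * t" and \<rho>: "0 < \<rho>"
  shows "p s x y \<le> A * exp c\<^sub>2 / V (\<Psi>i t) * min 1 (E t (dist x y) \<rho>)"
proof -
  have s0: "0 < s" using t s by simp
  have V: "0 < V (\<Psi>i t)" "V (\<Psi>i t) \<le> V (\<Psi>i s)" using t s by (auto intro!: V_pos \<Psi>i_pos V_le \<Psi>i_mono)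
  have "p s x y \<le> A * exp c\<^sub>2 / V (\<Psi>i s)" by (rule kernel_diagonal_upper[OF s0])
  also have "\<dots> \<le> A * exp c\<^sub>2 / V (\<Psi>i t)" using A_pos V by (intro divide_left_mono mult_pos_pos) auto
  finally have 1: "p s x y \<le> A * exp c\<^sub>2 / V (\<Psi>i t) * 1" by simp
  have "p s x y \<le> A / V (\<Psi>i s) * exp (- c\<^sub>2 * (dist x y / \<rho> - s / \<Psi> \<rho>))" by (rule kernel_upper[OF s0 \<rho>])
  also have "\<dots> \<le> A * exp c\<^sub>2 / V (\<Psi>i t) * E t (dist x y) \<rho>"
  proof (intro mult_mono)
    have "A / V (\<Psi>i s) \<le> A / V (\<Psi>i t)" using A_pos V by (intro divide_left_mono mult_pos_pos) auto
    also have "\<dots> \<le> A * exp c\<^sub>2 / V (\<Psi>i t)" using A_pos V c\<^sub>2 by (intro divide_right_mono) auto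
    finally show "A / V (\<Psi>i s) \<le> A * exp c\<^sub>2 / V (\<Psi>i t)" .
    have "s / \<Psi> \<rho> \<le> 2 * t / \<Psi> \<rho>" using s \<Psi>_pos[OF \<rho>] by (intro divide_right_mono) auto
    then show "exp (- c\<^sub>2 * (dist x y / \<rho> - s / \<Psi> \<rho>)) \<le> E t (dist x y) \<rho>"
      using c\<^sub>2 by (simp add: E_def)
    show "0 \<le> A * exp c\<^sub>2 / V (\<Psi>i t)" using A_pos V by simp
  qed simp
  finally show ?thesis using 1 unfolding min_def by auto
qed

lemma kernel_and_derivative_upper:
  obtains B where "0 < B"
    "\<And>t x y \<rho>. 0 < t \<Longrightarrow> 0 < \<rho> \<Longrightarrow> p t x y \<le> B / V (\<Psi>i t) * exp (- (c\<^sub>2/2) * (dist x y / \<rho> - 2 * t / \<Psi> \<rho>))"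
    "\<And>t x y \<rho>. 0 < t \<Longrightarrow> 0 < \<rho> \<Longrightarrow> \<bar>pdot t x y\<bar> \<le> B / (t * V (\<Psi>i t)) * exp (- (c\<^sub>2/2) * (dist x y / \<rho> - 2 * t / \<Psi> \<rho>))"
proof -
  obtain \<kappa> where \<kappa>: "1 \<le> \<kappa>" "\<And>t. 0 < t \<Longrightarrow> \<Psi>i t \<le> \<kappa> * \<Psi>i (t / 4)" using \<Psi>i_quarter by metis
  obtain D where D: "1 \<le> D" "\<And>r. 0 < r \<Longrightarrow> V (\<kappa> * r) \<le> D * V r" using V_scale[of \<kappa>] \<kappa>(1) by auto
  define A' where "A' = A * exp c\<^sub>2"
  have A': "0 < A'" using A_pos by (simp add: A'_def)
  define B where "B = A' * (1 + 256 * D)"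
  have B: "A' \<le> B" "0 < B" using A' D(1) by (auto simp: B_def)
  have est: "p t x y \<le> B / V (\<Psi>i t) * exp (- (c\<^sub>2/2) * (dist x y / \<rho> - 2 * t / \<Psi> \<rho>)) \<and>
    \<bar>pdot t x y\<bar> \<le> B / (t * V (\<Psi>i t)) * exp (- (c\<^sub>2/2) * (dist x y / \<rho> - 2 * t / \<Psi> \<rho>))"
    if t: "0 < t" and \<rho>: "0 < \<rho>" for t x y \<rho>
  proof -
    let ?V = "V (\<Psi>i t)" and ?E = "E t (dist x y) \<rho>"
    have V: "0 < ?V" using t by (intro V_pos \<Psi>i_pos)
    \<comment> \<open>The kernel is of order \<open>q\<^sup>2\<close> and only \<open>q\<close>
      survives for its time derivative; hence the exponent \<open>c\<^sub>2/2\<close>.\<close>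
    define q where "q = sqrt (min 1 ?E)"
    have Ep: "0 < ?E" by (simp add: E_def)
    have q: "0 < q" "q \<le> 1" "q\<^sup>2 = min 1 ?E" using Ep by (auto simp: q_def)
    have qE: "q \<le> exp (- (c\<^sub>2/2) * (dist x y / \<rho> - 2 * t / \<Psi> \<rho>))"
    proof -
      have "q\<^sup>2 \<le> ?E" using q(3) by simp
      also have "?E = (exp (- (c\<^sub>2/2) * (dist x y / \<rho> - 2 * t / \<Psi> \<rho>)))\<^sup>2"
        unfolding E_def power2_eq_square exp_add[symmetric] by simp
      finally show ?thesis by (rule power2_le_imp_le) simp
    qed
    have up: "p s x y \<le> A' / ?V * q\<^sup>2" if "t \<le> s" "s \<le> 2 * t" for s
      using kernel_upper_later[OF t that \<rho>, of x y] unfolding q(3) A'_def .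
    have qq: "q\<^sup>2 \<le> q" using q unfolding power2_eq_square by (intro mult_left_le) auto
    have "p t x y \<le> A' / ?V * q\<^sup>2" using up[of t] t by simp
    also have "\<dots> \<le> B / ?V * exp (- (c\<^sub>2/2) * (dist x y / \<rho> - 2 * t / \<Psi> \<rho>))"
      using A' B V qq qE by (intro mult_mono divide_right_mono) auto
    finally have 1: "p t x y \<le> B / ?V * exp (- (c\<^sub>2/2) * (dist x y / \<rho> - 2 * t / \<Psi> \<rho>))" .
    have VV: "1 / V (\<Psi>i s) \<le> D / ?V" if "t/4 \<le> s" "0 < s" for s
    proof -
      have "?V \<le> V (\<kappa> * \<Psi>i (t/4))" using t \<kappa>(2) by (intro V_le \<Psi>i_pos) auto
      also have "\<dots> \<le> D * V (\<Psi>i (t/4))" using t by (intro D(2) \<Psi>i_pos) auto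
      also have "\<dots> \<le> D * V (\<Psi>i s)" using that t D(1) by (intro mult_left_mono V_le \<Psi>i_mono \<Psi>i_pos) auto
      finally show ?thesis using V V_pos[OF \<Psi>i_pos[OF that(2)]] by (simp add: field_simps)
    qed
    have diag: "p s z z \<le> A' * D / ?V" if "t/4 \<le> s" "0 < s" for s z
    proof -
      have "p s z z \<le> A' * (1 / V (\<Psi>i s))" using kernel_diagonal_upper[OF that(2), of z z] by (simp add: A'_def)
      also have "\<dots> \<le> A' * (D / ?V)" using VV[OF that] A' by (intro mult_left_mono) auto
      finally show ?thesis by simp
    qed
    \<comment> \<open>Balances the two terms of \<open>pdot_bound\<close>:
      \<open>q\<^sup>2 / h\<close> and \<open>h / t\<^sup>2\<close> both become
      \<open>q / t\<close>.\<close>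
    define h where "h = t * q"
    have h: "0 < h" "h \<le> t" using t q by (auto simp: h_def mult_left_le)
    have "\<bar>pdot t x y\<bar> \<le> (A' / ?V * q\<^sup>2) / h + 256 / t\<^sup>2 * (A' * D / ?V) * h"
      using t h by (intro pdot_bound up diag) auto
    also have "\<dots> = B / (t * ?V) * q"
      using t q(1) V by (simp add: h_def B_def power2_eq_square field_simps)
    also have "\<dots> \<le> B / (t * ?V) * exp (- (c\<^sub>2/2) * (dist x y / \<rho> - 2 * t / \<Psi> \<rho>))"
      using qE B t V by (intro mult_left_mono) auto
    finally show ?thesis using 1 by simp
  qed
  show ?thesis using that[of B] B est by blast
qed

end

section \<open>The gradient estimate\<close>

lemma L2_Chebyshev:
  assumes g: "g \<in> L2 M" and e: "0 < e"
  shows "emeasure M {x \<in> space M. e \<le> \<bar>g x\<bar>} \<le> ennreal ((L2_norm M g)\<^sup>2 / e\<^sup>2)"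
proof -
  note [measurable] = L2_measurable[OF g]
  let ?S = "{x \<in> space M. e \<le> \<bar>g x\<bar>}"
  have "emeasure M ?S = (\<integral>\<^sup>+x. indicator ?S x \<partial>M)" by simp
  also have "\<dots> \<le> (\<integral>\<^sup>+x. ennreal ((g x / e)\<^sup>2) \<partial>M)"
  proof (rule nn_integral_mono)
    fix x show "indicator ?S x \<le> ennreal ((g x / e)\<^sup>2)"
    proof (cases "x \<in> ?S")
      case True
      then have "e\<^sup>2 \<le> (g x)\<^sup>2" using e by (simp add: abs_le_square_iff[symmetric])
      then have "1 \<le> (g x / e)\<^sup>2" using e by (simp add: power_divide)
      then show ?thesis using True by simp
    qed simp
  qed
  also have "\<dots> = ennreal ((L2_norm M (\<lambda>x. g x / e))\<^sup>2)" by (rule L2_nn_integral[OF L2_divide[OF g]])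
  also have "\<dots> = ennreal ((L2_norm M g)\<^sup>2 / e\<^sup>2)" using e by (simp add: L2_norm_divide power_divide)
  finally show ?thesis .
qed

context heat_kernel_upper
begin

text \<open>A maximal \<open>s\<close>-separated set covers. Its balls of radius
  \<open>s / 2\<close> are disjoint, which bounds its cardinality; the same count, applied to all
  separated sets, shows that one of maximal cardinality exists.\<close>

lemma finite_covering:
  fixes y :: 'a
  assumes R: "0 < R" and s: "0 < s"
  obtains Z where "finite Z" "Z \<subseteq> ball y R" "ball y R \<subseteq> (\<Union>z\<in>Z. ball z s)"
    "real (card Z) * V (s / 2) \<le> CV\<^sup>2 * V (R + s)"
proof -
  define sep where "sep Z \<longleftrightarrow> finite Z \<and> Z \<subseteq> ball y R \<and> (\<forall>a\<in>Z. \<forall>b\<in>Z. a \<noteq> b \<longrightarrow> s \<le> dist a b)" for Z :: "'a set"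
  have count: "real (card Z) * V (s / 2) \<le> CV\<^sup>2 * V (R + s)" if Z: "sep Z" for Z
  proof -
    have disj: "disjoint_family_on (\<lambda>z. ball z (s/2)) Z"
      unfolding disjoint_family_on_def
    proof (intro ballI impI)
      fix a b assume "a \<in> Z" "b \<in> Z" "a \<noteq> b"
      then have "s \<le> dist a b" using Z by (auto simp: sep_def)
      then show "ball a (s/2) \<inter> ball b (s/2) = {}" by (intro disjoint_ballI) simp
    qed
    have fin: "finite Z" using Z by (simp add: sep_def)
    have "real (card Z) * (V (s/2) / CV) = (\<Sum>z\<in>Z. V (s/2) / CV)" by simp
    also have "\<dots> \<le> (\<Sum>z\<in>Z. measure m (ball z (s/2)))" using s by (intro sum_mono V_lower) simp
    also have "\<dots> = measure m (\<Union>z\<in>Z. ball z (s/2))"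
    proof (rule measure_finite_Union[symmetric])
      show "emeasure m (ball z (s/2)) \<noteq> \<infinity>" for z using ball_finite[of z "s/2"] by simp
    qed (use disj fin in \<open>auto simp: sets_m\<close>)
    also have "\<dots> \<le> measure m (ball y (R + s))"
    proof (rule measure_mono_fmeasurable)
      show "(\<Union>z\<in>Z. ball z (s/2)) \<subseteq> ball y (R + s)"
      proof
        fix w assume "w \<in> (\<Union>z\<in>Z. ball z (s/2))"
        then obtain z where z: "z \<in> Z" "dist z w < s/2" by auto
        then have "dist y z < R" using Z by (auto simp: sep_def)
        then show "w \<in> ball y (R + s)" using z(2) dist_triangle[of y w z] s by simp
      qed
      show "ball y (R + s) \<in> fmeasurable m" using ball_finite[of y "R + s"] by (simp add: fmeasurable_def sets_m)
    qed (use fin in \<open>auto simp: sets_m\<close>)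
    also have "\<dots> \<le> CV * V (R + s)" using R s by (intro V_upper) simp
    finally show ?thesis using CV by (simp add: field_simps power2_eq_square)
  qed
  obtain n :: nat where n: "CV\<^sup>2 * V (R + s) / V (s / 2) \<le> real n" using real_arch_simple by blast
  have bound: "card Z \<le> n" if "sep Z" for Z
  proof -
    have "real (card Z) \<le> CV\<^sup>2 * V (R + s) / V (s / 2)" using count[OF that] V_pos[of "s/2"] s by (simp add: field_simps)
    then show ?thesis using n by linarith
  qed
  have "sep {}" by (simp add: sep_def)
  moreover have "\<forall>Z. sep Z \<longrightarrow> card Z < Suc n" using bound by (simp add: less_Suc_eq_le)
  ultimately have "\<exists>Z. sep Z \<and> (\<forall>Z'. sep Z' \<longrightarrow> card Z' \<le> card Z)"
    by (rule Lattices_Big.ex_has_greatest_nat)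
  then obtain Z where Z: "sep Z" "\<And>Z'. sep Z' \<Longrightarrow> card Z' \<le> card Z" by auto
  have "ball y R \<subseteq> (\<Union>z\<in>Z. ball z s)"
  proof
    fix w assume w: "w \<in> ball y R"
    show "w \<in> (\<Union>z\<in>Z. ball z s)"
    proof (rule ccontr)
      assume "\<not> ?thesis"
      then have far: "\<And>z. z \<in> Z \<Longrightarrow> s \<le> dist z w" by (auto simp: not_less)
      then have "w \<notin> Z" using s by fastforce
      moreover have "sep (insert w Z)"
        using Z(1) w far unfolding sep_def by (auto simp: dist_commute)
      ultimately show False using Z(2)[of "insert w Z"] Z(1) by (auto simp: sep_def)
    qed
  qed
  then show ?thesis using that[of Z] Z(1) count[OF Z(1)] by (auto simp: sep_def)
qed

text \<open>The time \<open>T = \<Psi> (a r)\<close> is chosen so large that the heat semigroup at time \<open>T\<close>, restricted to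
  the ball, is a contraction with factor \<open>1/2\<close> on bounded functions.  Hence \<open>g = Q T g - f\<close>
  is solvable on the ball, and the time integral of \<open>g\<close> up to \<open>T\<close> has Laplacian \<open>f\<close> there.\<close>

lemma ball_correction:
  obtains C\<^sub>4 where "0 < C\<^sub>4"
    "\<And>f y r M. f \<in> L2 m \<Longrightarrow> 0 < r \<Longrightarrow> 0 \<le> M \<Longrightarrow> (\<And>x. x \<in> ball y r \<Longrightarrow> \<bar>f x\<bar> \<le> M) \<Longrightarrow>
      \<exists>v k. v \<in> \<F> \<and> \<L> v k \<and> (\<forall>x\<in>ball y r. k x = f x) \<and> (\<forall>x. \<bar>v x\<bar> \<le> C\<^sub>4 * \<Psi> r * M) \<and>
        (L2_norm \<nu> (grad v))\<^sup>2 \<le> C\<^sub>4 * \<Psi> r * V r * M\<^sup>2"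
proof -
  \<comment> \<open>At time \<open>\<Psi> (a * r)\<close> the kernel is at most
    \<open>A * exp c\<^sub>2 / V (a * r)\<close>, and the ball has measure at most
    \<open>CV * V r\<close>. The factor 2 makes the product at most 1/2.\<close>
  obtain a where a: "1 \<le> a" "\<And>r. 0 < r \<Longrightarrow> (2 * (A * exp c\<^sub>2 * CV)) * V r \<le> V (a * r)"
    using reverse_doubling by metis
  define D where "D = C * a powr \<beta>\<^sub>2"
  have D: "0 < D" using a C by (simp add: D_def)
  have main: "\<exists>v k. v \<in> \<F> \<and> \<L> v k \<and> (\<forall>x\<in>ball y r. k x = f x) \<and> (\<forall>x. \<bar>v x\<bar> \<le> (2 * D + 8 * D * CV) * \<Psi> r * M) \<and>
        (L2_norm \<nu> (grad v))\<^sup>2 \<le> (2 * D + 8 * D * CV) * \<Psi> r * V r * M\<^sup>2"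
    if f: "f \<in> L2 m" and r: "0 < r" and M: "0 \<le> M" and fM: "\<And>x. x \<in> ball y r \<Longrightarrow> \<bar>f x\<bar> \<le> M" for f y r M
  proof -
    let ?B = "ball y r"
    define T where "T = \<Psi> (a * r)"
    have ar: "0 < a * r" using a r by simp
    have T: "0 < T" "\<Psi>i T = a * r" "T \<le> D * \<Psi> r"
      using \<Psi>_pos[OF ar] \<Psi>i_\<Psi>[OF ar] \<Psi>_upper[OF r a(1)] by (auto simp: T_def D_def)
    have B[measurable]: "?B \<in> sets m" by (simp add: sets_m)
    note [measurable] = L2_measurable[OF f]
    have supp_L2: "g \<in> L2 m \<and> (nm g)\<^sup>2 \<le> G\<^sup>2 * (CV * V r)"
      if gm: "g \<in> borel_measurable m" and gG: "\<And>x. \<bar>g x\<bar> \<le> G * indicator ?B x" for g G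
    proof -
      have i: "(indicator ?B :: 'a \<Rightarrow> real) \<in> L2 m" "nm (indicator ?B) = sqrt (measure m ?B)"
        using L2_norm_indicator[OF B ball_finite] by auto
      have gL: "g \<in> L2 m"
        by (rule L2_dominated[OF L2_scale[OF i(1), of G] gm]) (use gG in \<open>auto intro: order_trans[OF _ abs_ge_self]\<close>)
      have "(nm g)\<^sup>2 = (\<integral>x. (g x)\<^sup>2 \<partial>m)" by (rule L2_norm_power2)
      also have "\<dots> \<le> (\<integral>x. (G * indicator ?B x)\<^sup>2 \<partial>m)"
      proof (rule integral_mono[OF L2_integrable_power2[OF gL] L2_integrable_power2[OF L2_scale[OF i(1)]]])
        show "(g x)\<^sup>2 \<le> (G * indicator ?B x)\<^sup>2" for x
          unfolding abs_le_square_iff[symmetric] using gG[of x] by (rule order_trans[OF _ abs_ge_self])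
      qed
      also have "\<dots> = (nm (\<lambda>x. G * indicator ?B x))\<^sup>2" by (rule L2_norm_power2[symmetric])
      also have "\<dots> = G\<^sup>2 * measure m ?B" by (simp add: L2_norm_scale i(2) power_mult_distrib)
      also have "\<dots> \<le> G\<^sup>2 * (CV * V r)" by (intro mult_left_mono V_upper r) simp
      finally show ?thesis using gL by simp
    qed
    have half: "\<bar>Q T g z\<bar> \<le> G / 2"
      if gm: "g \<in> borel_measurable m" and gG: "\<And>x. \<bar>g x\<bar> \<le> G * indicator ?B x" for g G z
    proof -
      have gL: "g \<in> L2 m" using supp_L2[OF gm gG] by simp
      have G: "0 \<le> G" using order_trans[OF abs_ge_zero gG[of y]] r by simp
      define k where "k = A * exp c\<^sub>2 / V (a * r)"
      have k: "0 < k" using A_pos V_pos[OF ar] by (simp add: k_def)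
      have pk: "0 \<le> p T z w \<and> p T z w \<le> k" for w
        using kernel_nonneg[OF T(1)] kernel_diagonal_upper[OF T(1), of z w] T(2) by (simp add: k_def)
      have iB: "integrable m (\<lambda>w. k * G * indicator ?B w)"
        using ball_finite[of y r] by simp
      have "\<bar>Q T g z\<bar> \<le> (\<integral>w. \<bar>p T z w * g w\<bar> \<partial>m)"
        unfolding Q_eq_ip[OF T(1)] by (rule integral_abs_bound)
      also have "\<dots> \<le> (\<integral>w. k * G * indicator ?B w \<partial>m)"
      proof (rule integral_mono)
        show "integrable m (\<lambda>w. \<bar>p T z w * g w\<bar>)"
          using L2_mult_integrable[OF kernel_L2[OF T(1)] gL] by (rule integrable_abs)
        show "\<bar>p T z w * g w\<bar> \<le> k * G * indicator ?B w" for w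
          using mult_mono[of "p T z w" k "\<bar>g w\<bar>" "G * indicator ?B w"] pk[of w] gG[of w] k
          by (simp add: abs_mult mult.assoc)
      qed (rule iB)
      also have "\<dots> = k * G * measure m ?B" using ball_finite[of y r] by (simp add: space_m)
      also have "\<dots> \<le> k * G * (CV * V r)" using k G by (intro mult_left_mono V_upper r) auto
      also have "\<dots> = G * (A * exp c\<^sub>2 * CV * V r) / V (a * r)" by (simp add: k_def)
      also have "\<dots> \<le> G * (V (a * r) / 2) / V (a * r)"
        using a(2)[OF r] G V_pos[OF ar] by (intro divide_right_mono mult_left_mono) auto
      also have "\<dots> = G / 2" using V_pos[OF ar] by simp
      finally show ?thesis .
    qed
    \<comment> \<open>The terms of the Neumann series for \<open>g = Q T g - f\<close> on the ball,
      cut off outside it in every step so that the contraction \<open>half\<close> applies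
      again.\<close>
    define d where "d = rec_nat (\<lambda>x. - indicator ?B x * f x) (\<lambda>_ e x. indicator ?B x * Q T e x)"
    have d0: "d 0 = (\<lambda>x. - indicator ?B x * f x)" and dS: "\<And>n. d (Suc n) = (\<lambda>x. indicator ?B x * Q T (d n) x)"
      by (simp_all add: d_def)
    have dm: "d n \<in> borel_measurable m" for n
    proof (induction n)
      case 0
      then show ?case unfolding d0 by measurable
    next
      case (Suc n)
      note [measurable] = Suc
      show ?case unfolding dS by measurable
    qed
    have dM: "\<bar>d n x\<bar> \<le> M * (1/2) ^ n * indicator ?B x" for n x
    proof (induction n arbitrary: x)
      case 0
      then show ?case using fM[of x] by (auto simp: d0 indicator_def)
    next
      case (Suc n)
      have "\<bar>Q T (d n) x\<bar> \<le> M * (1/2) ^ n / 2" using dm Suc by (rule half)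
      then show ?case by (auto simp: dS indicator_def)
    qed
    define g where "g x = (\<Sum>n. d n x)" for x
    have geo: "summable (\<lambda>n. M * (1/2) ^ n)" "(\<Sum>n. M * (1/2) ^ n) = 2 * M"
      using suminf_geometric[of "1/2 :: real"] by (auto simp: suminf_mult summable_geometric)
    have dM': "norm (d n x) \<le> M * (1/2) ^ n" for n x
    proof (cases "x \<in> ?B")
      case True
      then show ?thesis using dM[of n x] by simp
    next
      case False
      then have "d n x = 0" using dM[of n x] by simp
      then show ?thesis using M by simp
    qed
    have dsum: "summable (\<lambda>n. d n x)" for x
      by (rule summable_comparison_test'[OF geo(1), of 0]) (use dM' in auto)
    have gm: "g \<in> borel_measurable m" unfolding g_def[abs_def] using dm by (rule borel_measurable_suminf)
    have gout: "g x = 0" if "x \<notin> ?B" for x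
    proof -
      have "d n x = 0" for n using dM[of n x] that by simp
      then show ?thesis by (simp add: g_def)
    qed
    have tail: "\<bar>g x - (\<Sum>n<N. d n x)\<bar> \<le> 2 * M * (1/2) ^ N * indicator ?B x" for N x
    proof (cases "x \<in> ?B")
      case True
      have "g x - (\<Sum>n<N. d n x) = (\<Sum>n. d (n + N) x)"
        unfolding g_def by (rule suminf_minus_initial_segment[OF dsum, symmetric])
      also have "\<bar>\<dots>\<bar> \<le> (\<Sum>n. M * (1/2) ^ n * (1/2) ^ N)"
        unfolding real_norm_def[symmetric]
      proof (rule norm_suminf_le)
        show "norm (d (n + N) x) \<le> M * (1/2) ^ n * (1/2) ^ N" for n
          using dM'[of "n + N" x] by (simp add: power_add mult.assoc)
        show "summable (\<lambda>n. M * (1/2) ^ n * (1/2 :: real) ^ N)" using geo(1) by (rule summable_mult2)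
      qed
      also have "\<dots> = 2 * M * (1/2) ^ N" using geo by (simp add: suminf_mult2[symmetric])
      finally show ?thesis using True by simp
    next
      case False
      have "d n x = 0" for n using dM[of n x] False by simp
      then show ?thesis using False by (simp add: gout)
    qed
    have gB: "\<bar>g x\<bar> \<le> 2 * M * indicator ?B x" for x using tail[of x 0] by simp
    have gL: "g \<in> L2 m" and gN: "(nm g)\<^sup>2 \<le> (2 * M)\<^sup>2 * (CV * V r)"
      using supp_L2[OF gm gB] by auto
    have dL: "d n \<in> L2 m" for n using supp_L2[OF dm dM] by simp
    \<comment> \<open>The tails are bounded by multiples of the indicator of the ball, so
      \<open>half\<close> itself shows that \<open>Q T\<close> passes through the series, at every
      point and with a geometric rate.\<close>
    have Qg: "(\<lambda>n. Q T (d n) x) sums Q T g x" for x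
      unfolding sums_def
    proof (rule LIM_zero_cancel)
      have SL: "(\<lambda>x. \<Sum>n<N. d n x) \<in> L2 m" and SQ: "Q T (\<lambda>x. \<Sum>n<N. d n x) x = (\<Sum>n<N. Q T (d n) x)" for N
      proof (induction N)
        case 0
        { case 1 then show ?case by (simp add: L2_def) }
        { case 2 then show ?case by (simp add: Q_def) }
      next
        case (Suc N)
        { case 1 then show ?case using L2_add[OF Suc(1) dL[of N]] by simp }
        { case 2
          have "Q T (\<lambda>x. \<Sum>n<Suc N. d n x) x = Q T (\<lambda>x. \<Sum>n<N. d n x) x + Q T (d N) x"
            using L2_mult_integrable[OF kernel_L2[OF T(1)] Suc(1)] L2_mult_integrable[OF kernel_L2[OF T(1)] dL[of N]]
            by (simp add: Q_eq_ip[OF T(1)] distrib_left)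
          then show ?case using Suc(2) by simp }
      qed
      show "(\<lambda>N. (\<Sum>n<N. Q T (d n) x) - Q T g x) \<longlonglongrightarrow> 0"
      proof (rule Lim_null_comparison)
        show "\<forall>\<^sub>F N in sequentially. norm ((\<Sum>n<N. Q T (d n) x) - Q T g x) \<le> M * (1/2) ^ N"
        proof (rule always_eventually, rule allI)
          fix N
          have "(\<Sum>n<N. Q T (d n) x) - Q T g x = - Q T (\<lambda>x. g x - (\<Sum>n<N. d n x)) x"
            using Q_diff[OF T(1) gL SL] SQ by simp
          moreover have "\<bar>Q T (\<lambda>x. g x - (\<Sum>n<N. d n x)) x\<bar> \<le> 2 * M * (1/2) ^ N / 2"
            using L2_measurable[OF L2_diff[OF gL SL]] tail by (rule half)
          ultimately show "norm ((\<Sum>n<N. Q T (d n) x) - Q T g x) \<le> M * (1/2) ^ N" by simp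
        qed
        show "(\<lambda>N. M * (1/2) ^ N) \<longlonglongrightarrow> 0" using geo(1) by (rule summable_LIMSEQ_zero)
      qed
    qed
    have geq: "g x = Q T g x - f x" if x: "x \<in> ?B" for x
    proof -
      have "g x = d 0 x + (\<Sum>n. d (Suc n) x)"
        unfolding g_def using suminf_split_head[OF dsum] by simp
      also have "(\<Sum>n. d (Suc n) x) = (\<Sum>n. Q T (d n) x)" using x by (simp add: dS)
      also have "\<dots> = Q T g x" using Qg by (simp add: sums_iff)
      finally show ?thesis using x by (simp add: d0)
    qed
    let ?v = "time_integral T g" and ?k = "\<lambda>x. Q T g x - g x"
    obtain w where w: "w \<in> \<F>" "AE x in m. ?v x = w x" "\<L> w ?k"
      "\<And>v. v \<in> \<F> \<Longrightarrow> energy \<nu> l \<gamma> w v = - ip ?k v"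
      by (rule laplacian_obtain[OF laplacian_time_integral[OF gL T(1)]]) (rule that)
    have vL: "?v \<in> L2 m" "nm ?v \<le> T * nm g" using time_integral_Minkowski(2,3)[OF gL, of T] T by auto
    have "\<bar>g x\<bar> \<le> 2 * M" for x using gB[of x] M by (cases "x \<in> ?B") (auto simp: gout)
    then have vb: "\<bar>?v x\<bar> \<le> T * (2 * M)" for x
      using T M by (intro time_integral_bound gL) auto
    \<comment> \<open>The correction is the continuous version \<open>w\<close> of the time
      integral; full support carries the bound over to every point.\<close>
    have wb: "\<bar>w x\<bar> \<le> T * (2 * M)" for x
    proof (rule AE_le_imp_le[of "\<lambda>x. \<bar>w x\<bar>" "\<lambda>x. T * (2 * M)" UNIV])
      show "continuous_on UNIV (\<lambda>x. \<bar>w x\<bar>)" using \<F>_continuous[OF w(1)] by (intro continuous_intros)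
      show "AE x in m. x \<in> UNIV \<longrightarrow> \<bar>w x\<bar> \<le> T * (2 * M)" using w(2) by eventually_elim (use vb in metis)
    qed auto
    have kL: "?k \<in> L2 m" "nm ?k \<le> 2 * nm g"
      using L2_norm_triangle_diff[OF Q_L2[OF T(1) gL] gL] nm_Q_le[OF T(1) gL] by (auto intro: L2_diff Q_L2 T gL)
    \<comment> \<open>The energy is minus the pairing of \<open>w\<close> with its Laplacian, of
      norms at most \<open>T * nm g\<close> and \<open>2 * nm g\<close>. Since \<open>g\<close> is
      at most \<open>2 * M\<close> on the ball and zero elsewhere, this gives the constant
      8.\<close>
    have "(L2_norm \<nu> (grad w))\<^sup>2 = energy \<nu> l \<gamma> w w"
      unfolding L2_norm_power2 energy_def by (simp add: power2_eq_square)
    also have "\<dots> = - ip ?k w" by (rule w(4)[OF w(1)])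
    also have "\<dots> \<le> nm ?k * nm w" using L2_Cauchy_Schwarz[OF kL(1) \<F>_L2[OF w(1)]] by linarith
    also have "nm w = nm ?v" using w vL by (intro nm_cong[symmetric]) (auto intro: \<F>_L2)
    also have "nm ?k * nm ?v \<le> (2 * nm g) * (T * nm g)" using kL vL T by (intro mult_mono) auto
    also have "\<dots> = 2 * T * (nm g)\<^sup>2" by (simp add: power2_eq_square)
    also have "\<dots> \<le> 2 * (D * \<Psi> r) * ((2 * M)\<^sup>2 * (CV * V r))"
      using gN T \<Psi>_pos[OF r] D by (intro mult_mono) auto
    also have "\<dots> = 8 * D * CV * (\<Psi> r * V r * M\<^sup>2)" by (simp add: power_mult_distrib)
    also have "\<dots> \<le> (2 * D + 8 * D * CV) * (\<Psi> r * V r * M\<^sup>2)"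
      using D \<Psi>_pos[OF r] V_pos[OF r] by (intro mult_right_mono) auto
    finally have en: "(L2_norm \<nu> (grad w))\<^sup>2 \<le> (2 * D + 8 * D * CV) * \<Psi> r * V r * M\<^sup>2" by (simp add: mult.assoc)
    have "\<bar>w x\<bar> \<le> (2 * D + 8 * D * CV) * \<Psi> r * M" for x
    proof -
      have "\<bar>w x\<bar> \<le> 2 * (T * M)" using wb[of x] by simp
      also have "\<dots> \<le> 2 * (D * \<Psi> r * M)" using T M by (intro mult_left_mono mult_right_mono) auto
      also have "\<dots> = 2 * D * (\<Psi> r * M)" by simp
      also have "\<dots> \<le> (2 * D + 8 * D * CV) * (\<Psi> r * M)"
        using D CV M \<Psi>_pos[OF r] by (intro mult_right_mono) auto
      finally show ?thesis by (simp add: mult.assoc)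
    qed
    moreover have "\<forall>x\<in>?B. ?k x = f x" using geq by auto
    ultimately show ?thesis using w(1,3) en by (intro exI[of _ w] exI[of _ ?k] conjI) auto
  qed
  have "0 < 2 * D + 8 * D * CV" using D CV by (simp add: add_pos_nonneg)
  then show ?thesis using main that[of "2 * D + 8 * D * CV"] by blast
qed

end

context heat_kernel_upper
begin

lemma dyadic_ratio: "0 < 2 * (1/2) powr \<beta>\<^sub>1" "2 * (1/2) powr \<beta>\<^sub>1 < 1"
proof -
  have "(2::real) powr 1 < 2 powr \<beta>\<^sub>1" using \<beta>\<^sub>1 by (intro powr_less_mono) auto
  then show "2 * (1/2) powr \<beta>\<^sub>1 < (1 :: real)" by (simp add: powr_divide)
qed simp

text \<open>The corrections on concentric balls of radii \<open>a R / 2\<^sup>j\<close> telescope: their differences are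
  harmonic on the smaller ball, so the reverse Hoelder inequality bounds the gradients by a geometric
  series.  What remains is the gradient of the last correction, which is small in measure.\<close>

lemma local_gradient_estimate:
  assumes RH: "RH \<iota> m \<nu> l \<gamma>"
  obtains a K\<^sub>5 where "1 < a" "0 < K\<^sub>5"
    "\<And>u f y\<^sub>0 R U M. u \<in> \<F> \<Longrightarrow> \<L> u f \<Longrightarrow> 0 < R \<Longrightarrow> 0 \<le> U \<Longrightarrow> 0 \<le> M \<Longrightarrow>
       (\<And>x. x \<in> ball y\<^sub>0 (2 * a * R) \<Longrightarrow> \<bar>u x\<bar> \<le> U) \<Longrightarrow> (\<And>x. x \<in> ball y\<^sub>0 (2 * a * R) \<Longrightarrow> \<bar>f x\<bar> \<le> M) \<Longrightarrow>
       AE z in \<nu>. z \<in> ball y\<^sub>0 R \<longrightarrow> \<bar>grad u z\<bar> \<le> K\<^sub>5 * (U / R + \<Psi> (a * R) / R * M)"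
proof -
  obtain a Cr where a: "1 < a" and Cr: "1 < Cr" and
    rh: "\<And>x r h. 0 < r \<Longrightarrow> harmonic_on \<iota> m \<nu> l \<gamma> (ball x (a * r)) h \<Longrightarrow>
        esssup (restrict_space \<nu> (ball x r)) (\<lambda>z. ennreal \<bar>weak_grad_loc \<iota> m \<nu> l \<gamma> h z\<bar>)
          \<le> ennreal (Cr / r * (1 / measure m (ball x (a * r)) * (LINT y:ball x (a * r)|m. \<bar>h y\<bar>)))"
    using RH unfolding RH_def by blast
  obtain C\<^sub>4 where C4: "0 < C\<^sub>4" and corr:
    "\<And>f y r M. f \<in> L2 m \<Longrightarrow> 0 < r \<Longrightarrow> 0 \<le> M \<Longrightarrow> (\<And>x. x \<in> ball y r \<Longrightarrow> \<bar>f x\<bar> \<le> M) \<Longrightarrow>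
      \<exists>v k. v \<in> \<F> \<and> \<L> v k \<and> (\<forall>x\<in>ball y r. k x = f x) \<and> (\<forall>x. \<bar>v x\<bar> \<le> C\<^sub>4 * \<Psi> r * M) \<and>
        (L2_norm \<nu> (grad v))\<^sup>2 \<le> C\<^sub>4 * \<Psi> r * V r * M\<^sup>2"
    by (rule ball_correction) (rule that; blast)
  obtain D where D: "1 \<le> D" "\<And>r. 0 < r \<Longrightarrow> V (2 * a * r) \<le> D * V r" using V_scale[of "2 * a"] a by auto
  define q where "q = (1/2 :: real) powr \<beta>\<^sub>1"
  have q: "0 < q" "2 * q < 1" using dyadic_ratio by (auto simp: q_def)
  \<comment> \<open>The summands account for \<open>u\<close>, for the first correction, and for the
    geometric series of differences of consecutive corrections.\<close>
  define K\<^sub>5 where "K\<^sub>5 = Cr + Cr * C\<^sub>4 + 4 * Cr * C\<^sub>4 * C / (1 - 2 * q)"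
  have K5: "0 < K\<^sub>5" using Cr C4 C q by (auto simp: K\<^sub>5_def intro!: add_pos_nonneg)
  have "AE z in \<nu>. z \<in> ball y\<^sub>0 R \<longrightarrow> \<bar>grad u z\<bar> \<le> K\<^sub>5 * (U / R + \<Psi> (a * R) / R * M)"
    if u: "u \<in> \<F>" "\<L> u f" and R: "0 < R" and UM: "0 \<le> U" "0 \<le> M"
      and uU: "\<And>x. x \<in> ball y\<^sub>0 (2 * a * R) \<Longrightarrow> \<bar>u x\<bar> \<le> U"
      and fM: "\<And>x. x \<in> ball y\<^sub>0 (2 * a * R) \<Longrightarrow> \<bar>f x\<bar> \<le> M" for u f y\<^sub>0 R U M
  proof -
    define r where "r j = R * (1/2) ^ j" for j :: nat
    have r: "0 < r j" "r (Suc j) = r j / 2" "r j \<le> R" "r 0 = R" for j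
      using R by (auto simp: r_def mult_left_le power_le_one)
    have ar: "0 < a * r j" "a * r j \<le> a * R" for j using r a by auto
    define S where "S = \<Psi> (a * R)"
    have S: "0 < S" using a R by (auto simp: S_def intro: \<Psi>_pos)
    have \<Psi>r: "\<Psi> (a * r j) \<le> C * S * q ^ j" for j
      using \<Psi>_dyadic[of "a * R" j] a R by (simp add: r_def S_def q_def mult.assoc)
    \<comment> \<open>The corrections are centred at arbitrary points \<open>y\<close> of the ball
      of radius \<open>R\<close>, because that ball is later covered by small ones. Their domains
      reach to \<open>(1 + a) * R\<close>, at most \<open>2 * a * R\<close>.\<close>
    have sub: "x \<in> ball y\<^sub>0 (2 * a * R)" if "y \<in> ball y\<^sub>0 R" "x \<in> ball y (a * r j)" for x y j
    proof -
      have "dist y\<^sub>0 x < R + a * r j" using that dist_triangle[of y\<^sub>0 x y] by simp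
      also have "\<dots> \<le> 2 * a * R" 
      proof -
        have "1 * R \<le> a * R" using a R by (intro mult_right_mono) auto
        moreover have "2 * a * R = 2 * (a * R)" by simp
        ultimately show ?thesis using ar(2)[of j] by linarith
      qed
      finally show ?thesis by simp
    qed
    define Cor where "Cor y j vk \<longleftrightarrow> fst vk \<in> \<F> \<and> \<L> (fst vk) (snd vk) \<and> (\<forall>x\<in>ball y (a * r j). snd vk x = f x) \<and>
       (\<forall>x. \<bar>fst vk x\<bar> \<le> C\<^sub>4 * \<Psi> (a * r j) * M) \<and>
       (L2_norm \<nu> (grad (fst vk)))\<^sup>2 \<le> C\<^sub>4 * \<Psi> (a * r j) * V (a * r j) * M\<^sup>2" for y j vk
    define vk where "vk y j = (SOME vk. Cor y j vk)" for y j
    define v where "v y j = fst (vk y j)" for y j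
    define k where "k y j = snd (vk y j)" for y j
    have "Cor y j (vk y j)" if y: "y \<in> ball y\<^sub>0 R" for y j
    proof -
      have "\<exists>v k. v \<in> \<F> \<and> \<L> v k \<and> (\<forall>x\<in>ball y (a * r j). k x = f x) \<and> (\<forall>x. \<bar>v x\<bar> \<le> C\<^sub>4 * \<Psi> (a * r j) * M) \<and>
        (L2_norm \<nu> (grad v))\<^sup>2 \<le> C\<^sub>4 * \<Psi> (a * r j) * V (a * r j) * M\<^sup>2"
        by (rule corr[OF laplacian_L2(2)[OF u(2)] ar(1) UM(2) fM[OF sub[OF y]]])
      then have "\<exists>vk. Cor y j vk" unfolding Cor_def by auto
      then show ?thesis unfolding vk_def by (rule someI_ex)
    qed
    then have v: "v y j \<in> \<F>" "\<L> (v y j) (k y j)" "\<And>x. x \<in> ball y (a * r j) \<Longrightarrow> k y j x = f x"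
      "\<And>x. \<bar>v y j x\<bar> \<le> C\<^sub>4 * \<Psi> (a * r j) * M"
      "(L2_norm \<nu> (grad (v y j)))\<^sup>2 \<le> C\<^sub>4 * \<Psi> (a * r j) * V (a * r j) * M\<^sup>2"
      if "y \<in> ball y\<^sub>0 R" for y j
      using that unfolding Cor_def v_def k_def by auto
    define K0 where "K0 = Cr / R * (U + C\<^sub>4 * S * M)"
    \<comment> \<open>The difference at level \<open>j\<close> is at most twice the bound of order
      \<open>q ^ j\<close> and lives on radius \<open>r (Suc j) = R / 2 ^ (j + 1)\<close>. This
      yields \<open>W * (2 * q) ^ j\<close>, with 4 from these two factors 2.\<close>
    define W where "W = 4 * Cr * C\<^sub>4 * C * S * M / R"
    have W: "0 \<le> W" using Cr C4 C S UM R by (simp add: W_def)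
    have K0: "0 \<le> K0" using Cr C4 S UM R by (simp add: K0_def)
    have chain: "AE z in \<nu>. z \<in> ball y (r J) \<longrightarrow> \<bar>grad u z - grad (v y J) z\<bar> \<le> K0 + (\<Sum>j<J. W * (2 * q) ^ j)"
      if y: "y \<in> ball y\<^sub>0 R" for y J
    proof (induction J)
      case 0
      have h: "harmonic_on \<iota> m \<nu> l \<gamma> (ball y (a * r 0)) (\<lambda>x. u x - v y 0 x)"
        using ar(1)[of 0] v(3)[OF y, of _ 0] by (intro harmonic_diff[OF u(2,1) v(2,1)[OF y]]) auto
      have "AE z in \<nu>. z \<in> ball y (r 0) \<longrightarrow> \<bar>grad (\<lambda>x. u x - v y 0 x) z\<bar> \<le> Cr / r 0 * (U + C\<^sub>4 * S * M)"
      proof (rule gradient_bound_harmonic[OF rh a _ r(1) \<F>_diff[OF u(1) v(1)[OF y]] h])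
        fix x assume "x \<in> ball y (a * r 0)"
        then have "\<bar>u x\<bar> \<le> U" by (intro uU sub[OF y])
        then show "\<bar>u x - v y 0 x\<bar> \<le> U + C\<^sub>4 * S * M"
          using v(4)[OF y, of 0 x] unfolding r(4) S_def[symmetric] by linarith
      qed (use Cr in auto)
      then show ?case
        using grad_diff[OF u(1) v(1)[OF y, of 0]] by eventually_elim (simp add: K0_def r(4))
    next
      case (Suc J)
      let ?w = "\<lambda>x. v y J x - v y (Suc J) x"
      have inc: "ball y (a * r (Suc J)) \<subseteq> ball y (a * r J)" "ball y (r (Suc J)) \<subseteq> ball y (r J)"
        using r(1)[of J] a by (auto simp: r(2) intro!: subset_ball)
      have h: "harmonic_on \<iota> m \<nu> l \<gamma> (ball y (a * r (Suc J))) ?w"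
      proof (rule harmonic_diff[OF v(2,1)[OF y] v(2,1)[OF y]])
        show "ball y (a * r (Suc J)) \<noteq> {}" using ar(1)[of "Suc J"] by auto
        fix x assume x: "x \<in> ball y (a * r (Suc J))"
        then show "k y J x = k y (Suc J) x" using v(3)[OF y, of x J] v(3)[OF y, of x "Suc J"] inc(1) by auto
      qed simp
      have "AE z in \<nu>. z \<in> ball y (r (Suc J)) \<longrightarrow> \<bar>grad ?w z\<bar> \<le> Cr / r (Suc J) * (2 * (C\<^sub>4 * (C * S * q ^ J) * M))"
      proof (rule gradient_bound_harmonic[OF rh a _ r(1) \<F>_diff[OF v(1)[OF y] v(1)[OF y]] h])
        fix x
        have "C\<^sub>4 * \<Psi> (a * r J) * M \<le> C\<^sub>4 * (C * S * q ^ J) * M"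
          using \<Psi>r[of J] C4 UM by (intro mult_right_mono mult_left_mono) auto
        moreover have "C\<^sub>4 * \<Psi> (a * r (Suc J)) * M \<le> C\<^sub>4 * \<Psi> (a * r J) * M"
          using C4 UM ar(1)[of "Suc J"] r(1)[of J] a by (intro mult_right_mono mult_left_mono \<Psi>_mono) (auto simp: r(2))
        ultimately show "\<bar>?w x\<bar> \<le> 2 * (C\<^sub>4 * (C * S * q ^ J) * M)"
          using v(4)[OF y, of J x] v(4)[OF y, of "Suc J" x] by linarith
      qed (use Cr in auto)
      moreover have "Cr / r (Suc J) * (2 * (C\<^sub>4 * (C * S * q ^ J) * M)) = W * (2 * q) ^ J"
        using R by (simp add: W_def r_def power_mult_distrib power_divide)
      ultimately have "AE z in \<nu>. z \<in> ball y (r (Suc J)) \<longrightarrow> \<bar>grad ?w z\<bar> \<le> W * (2 * q) ^ J" by simp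
      then show ?case
        using Suc grad_diff[OF v(1)[OF y, of J] v(1)[OF y, of "Suc J"]]
      proof eventually_elim
        case (elim z)
        show ?case
        proof
          assume z: "z \<in> ball y (r (Suc J))"
          then have "\<bar>grad (v y J) z - grad (v y (Suc J)) z\<bar> \<le> W * (2 * q) ^ J" using elim(1,3) by simp
          moreover have "\<bar>grad u z - grad (v y J) z\<bar> \<le> K0 + (\<Sum>j<J. W * (2 * q) ^ j)" using elim(2) z inc(2) by blast
          ultimately show "\<bar>grad u z - grad (v y (Suc J)) z\<bar> \<le> K0 + (\<Sum>j<Suc J. W * (2 * q) ^ j)"
            unfolding sum.lessThan_Suc by linarith
        qed
      qed
    qed
    define K where "K = K0 + W / (1 - 2 * q)"
    have geo: "(\<Sum>j<J. W * (2 * q) ^ j) \<le> W / (1 - 2 * q)" for J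
    proof -
      have "(\<Sum>j<J. (2 * q) ^ j) \<le> (\<Sum>j. (2 * q) ^ j)"
        using q by (intro sum_le_suminf summable_geometric) auto
      also have "\<dots> = 1 / (1 - 2 * q)" using q by (intro suminf_geometric) auto
      finally show ?thesis using W mult_left_mono[of "\<Sum>j<J. (2 * q) ^ j" "1 / (1 - 2 * q)" W] by (simp add: sum_distrib_left)
    qed
    have chainK: "AE z in \<nu>. z \<in> ball y (r J) \<longrightarrow> \<bar>grad u z - grad (v y J) z\<bar> \<le> K" if "y \<in> ball y\<^sub>0 R" for y J
      using chain[OF that, of J] by (rule eventually_mono) (use geo[of J] in \<open>auto simp: K_def\<close>)
    have KK: "K \<le> K\<^sub>5 * (U / R + \<Psi> (a * R) / R * M)"
    proof -
      have "K = Cr * (U / R) + (Cr * C\<^sub>4 + 4 * Cr * C\<^sub>4 * C / (1 - 2 * q)) * (S / R * M)"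
        using R q by (simp add: K_def K0_def W_def field_simps)
      also have "\<dots> \<le> K\<^sub>5 * (U / R) + K\<^sub>5 * (S / R * M)"
        using Cr C4 C q UM R S by (intro add_mono mult_right_mono) (auto simp: K\<^sub>5_def)
      finally show ?thesis by (simp add: S_def distrib_left)
    qed
    have gradm: "grad w \<in> borel_measurable \<nu>" if "w \<in> \<F>" for w using \<F>_grad[OF that] by (rule L2_measurable)
    \<comment> \<open>At level \<open>J\<close>, wherever the gradient of \<open>u\<close> exceeds
      \<open>K + e\<close> some last correction has gradient at least \<open>e\<close>. Chebyshev
      bounds such a set per ball by a multiple of \<open>\<Psi> (a * r J) * V (a * r J)\<close>. The
      number of balls times \<open>V (r J / 2)\<close> stays bounded, so the factor
      \<open>q ^ J\<close> from \<Psi> remains.\<close>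
    have small: "AE z in \<nu>. \<not> (z \<in> ball y\<^sub>0 R \<and> K + e \<le> \<bar>grad u z\<bar>)" if e: "0 < e" for e
    proof -
      note [measurable] = gradm[OF u(1)]
      let ?S = "{z \<in> space \<nu>. K + e \<le> \<bar>grad u z\<bar>} \<inter> (ball y\<^sub>0 R \<inter> skeleton \<iota>)"
      have Sm: "?S \<in> sets \<nu>" by (intro sets.Int open_skeleton_sets) auto
      define X where "X = C\<^sub>4 * D * CV\<^sup>2 * V (2 * R) * M\<^sup>2 / e\<^sup>2 * (C * S)"
      have le: "emeasure \<nu> ?S \<le> ennreal (X * q ^ J)" for J
      proof -
        obtain Z where Z: "finite Z" "Z \<subseteq> ball y\<^sub>0 R" "ball y\<^sub>0 R \<subseteq> (\<Union>z\<in>Z. ball z (r J))"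
          "real (card Z) * V (r J / 2) \<le> CV\<^sup>2 * V (R + r J)"
          using finite_covering[OF R r(1), of y\<^sub>0 J] by metis
        let ?T = "\<lambda>y. {z \<in> space \<nu>. e \<le> \<bar>grad (v y J) z\<bar>}"
        have Tm: "?T y \<in> sets \<nu>" if "y \<in> Z" for y
        proof -
          have "y \<in> ball y\<^sub>0 R" using that Z(2) by blast
          note [measurable] = gradm[OF v(1)[OF this, of J]]
          show ?thesis by measurable
        qed
        have "AE z in \<nu>. \<forall>y\<in>Z. z \<in> ball y (r J) \<longrightarrow> \<bar>grad u z - grad (v y J) z\<bar> \<le> K"
          using chainK Z by (intro AE_finite_allI) auto
        then have "AE z in \<nu>. z \<in> ?S \<longrightarrow> z \<in> (\<Union>y\<in>Z. ?T y)"
        proof eventually_elim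
          case (elim z)
          show ?case
          proof
            assume z: "z \<in> ?S"
            then obtain y where y: "y \<in> Z" "z \<in> ball y (r J)" using Z(3) by blast
            then have "\<bar>grad u z - grad (v y J) z\<bar> \<le> K" using elim by blast
            then have "e \<le> \<bar>grad (v y J) z\<bar>" using z by auto
            then show "z \<in> (\<Union>y\<in>Z. ?T y)" using y(1) z by auto
          qed
        qed
        then have "emeasure \<nu> ?S \<le> emeasure \<nu> (\<Union>y\<in>Z. ?T y)"
          using Tm Z(1) by (intro emeasure_mono_AE) auto
        also have "\<dots> \<le> (\<Sum>y\<in>Z. emeasure \<nu> (?T y))"
          using Tm Z(1) by (intro emeasure_subadditive_finite) auto
        also have "\<dots> \<le> (\<Sum>y\<in>Z. ennreal (C\<^sub>4 * \<Psi> (a * r J) * V (a * r J) * M\<^sup>2 / e\<^sup>2))"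
        proof (rule sum_mono)
          fix y assume "y \<in> Z"
          then have y: "y \<in> ball y\<^sub>0 R" using Z(2) by blast
          show "emeasure \<nu> (?T y) \<le> ennreal (C\<^sub>4 * \<Psi> (a * r J) * V (a * r J) * M\<^sup>2 / e\<^sup>2)"
            using L2_Chebyshev[OF \<F>_grad[OF v(1)[OF y, of J]] e]
            by (rule order_trans) (intro ennreal_leI divide_right_mono v(5)[OF y], simp)
        qed
        also have "\<dots> = ennreal (real (card Z) * (C\<^sub>4 * \<Psi> (a * r J) * V (a * r J) * M\<^sup>2 / e\<^sup>2))"
          unfolding sum_constant by (subst ennreal_mult') (simp_all add: ennreal_of_nat_eq_real_of_nat)
        also have "\<dots> \<le> ennreal (X * q ^ J)"
        proof (rule ennreal_leI)
          have "real (card Z) * V (a * r J) \<le> real (card Z) * (D * V (r J / 2))"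
            using D(2)[of "r J / 2"] r(1)[of J] by (intro mult_left_mono) auto
          also have "\<dots> = D * (real (card Z) * V (r J / 2))" by simp
          also have "\<dots> \<le> D * (CV\<^sup>2 * V (2 * R))"
          proof (intro mult_left_mono)
            have "V (R + r J) \<le> V (2 * R)" using r(1,3)[of J] R by (intro V_le) auto
            then have "CV\<^sup>2 * V (R + r J) \<le> CV\<^sup>2 * V (2 * R)" by (intro mult_left_mono) auto
            then show "real (card Z) * V (r J / 2) \<le> CV\<^sup>2 * V (2 * R)" using Z(4) by linarith
          qed (use D in simp)
          finally have 1: "real (card Z) * V (a * r J) \<le> D * (CV\<^sup>2 * V (2 * R))" .
          have "real (card Z) * (C\<^sub>4 * \<Psi> (a * r J) * V (a * r J) * M\<^sup>2 / e\<^sup>2) =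
            (C\<^sub>4 * M\<^sup>2 / e\<^sup>2) * ((real (card Z) * V (a * r J)) * \<Psi> (a * r J))" by simp
          also have "\<dots> \<le> (C\<^sub>4 * M\<^sup>2 / e\<^sup>2) * ((D * (CV\<^sup>2 * V (2 * R))) * (C * S * q ^ J))"
          proof (rule mult_left_mono[OF mult_mono[OF 1 \<Psi>r[of J]]])
            show "0 \<le> D * (CV\<^sup>2 * V (2 * R))" using D(1) V_pos[of "2 * R"] R by simp
            show "0 \<le> \<Psi> (a * r J)" using \<Psi>_pos[OF ar(1)[of J]] by simp
            show "0 \<le> C\<^sub>4 * M\<^sup>2 / e\<^sup>2" using C4 by simp
          qed
          also have "\<dots> = X * q ^ J" by (simp add: X_def)
          finally show "real (card Z) * (C\<^sub>4 * \<Psi> (a * r J) * V (a * r J) * M\<^sup>2 / e\<^sup>2) \<le> X * q ^ J" .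
        qed
        finally show ?thesis .
      qed
      have "(\<lambda>J. ennreal (X * q ^ J)) \<longlonglongrightarrow> ennreal (X * 0)"
        using q by (intro tendsto_ennrealI tendsto_mult tendsto_const LIMSEQ_realpow_zero) auto
      then have "emeasure \<nu> ?S \<le> ennreal (X * 0)"
        by (rule LIMSEQ_le_const) (use le in blast)
      then have "?S \<in> null_sets \<nu>" using Sm by (auto intro: null_setsI)
      from AE_not_in[OF this] AE_space show ?thesis
        by eventually_elim (auto simp: space_\<nu>)
    qed
    have "AE z in \<nu>. \<forall>n::nat. \<not> (z \<in> ball y\<^sub>0 R \<and> K + 1 / real (Suc n) \<le> \<bar>grad u z\<bar>)"
      by (subst AE_all_countable) (intro allI small, simp)
    then show ?thesis
    proof eventually_elim
      case (elim z)
      show ?case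
      proof
        assume z: "z \<in> ball y\<^sub>0 R"
        have "\<bar>grad u z\<bar> \<le> K"
        proof (rule field_le_epsilon)
          fix e :: real assume "0 < e"
          then obtain n where "1 / real (Suc n) < e" using nat_approx_posE by metis
          then show "\<bar>grad u z\<bar> \<le> K + e" using elim[rule_format, of n] z by simp
        qed
        then show "\<bar>grad u z\<bar> \<le> K\<^sub>5 * (U / R + \<Psi> (a * R) / R * M)" using KK by linarith
      qed
    qed
  qed
  then show ?thesis using that[OF a K5] by blast
qed

text \<open>Taking logarithms turns a bound at every scale into an upper bound for the rate, so the
  supremum over scales can be taken afterwards. Until here all estimates are kept at single scales,
  for which continuity and comparison are elementary.\<close>

lemma exp_rate:
  assumes e: "0 < e" and M: "0 \<le> M" and le: "\<And>\<rho>. 0 < \<rho> \<Longrightarrow> X \<le> M * exp (- e * (d / \<rho> - t / \<Psi> \<rho>))"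
  shows "X \<le> M * exp (- e * scale_rate \<Psi> d t)"
proof (cases "0 < X")
  case True
  have "0 < M * exp (- e * (d / 1 - t / \<Psi> 1))" using True le[of 1] by linarith
  then have M: "0 < M" by (simp add: zero_less_mult_iff)
  have "scale_rate \<Psi> d t \<le> (ln M - ln X) / e"
  proof (rule rate_le)
    fix \<rho> :: real assume "0 < \<rho>"
    then have "ln X \<le> ln (M * exp (- e * (d / \<rho> - t / \<Psi> \<rho>)))" using True le by (intro ln_mono) auto
    also have "\<dots> = ln M - e * (d / \<rho> - t / \<Psi> \<rho>)" using M by (simp add: ln_mult)
    finally show "d / \<rho> - t / \<Psi> \<rho> \<le> (ln M - ln X) / e" using e by (simp add: field_simps)
  qed
  then have "ln X \<le> ln M - e * scale_rate \<Psi> d t" using e by (simp add: field_simps)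
  then have "exp (ln X) \<le> exp (ln M - e * scale_rate \<Psi> d t)" by simp
  then show ?thesis using True M by (simp add: exp_diff exp_minus field_simps)
next
  case False
  have "0 \<le> M * exp (- e * scale_rate \<Psi> d t)" using M by simp
  then show ?thesis using False by linarith
qed

lemma scale_rate_mono:
  assumes t: "0 < t" and d: "0 \<le> d" "d \<le> d'"
  shows "scale_rate \<Psi> d t \<le> scale_rate \<Psi> d' t"
proof (rule rate_le)
  fix r :: real assume r: "0 < r"
  have "d / r \<le> d' / r" using d r by (intro divide_right_mono) auto
  then show "d / r - t / \<Psi> r \<le> scale_rate \<Psi> d' t" using rate_upper[OF t _ r, of d'] d by linarith
qed

theorem gradient_estimate:
  assumes RH: "RH \<iota> m \<nu> l \<gamma>"
  shows "Grad m \<nu> l \<gamma> p \<Psi>"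
proof -
  obtain a K\<^sub>5 where a: "1 < a" and K5: "0 < K\<^sub>5" and loc:
    "\<And>u f y\<^sub>0 R U M. u \<in> \<F> \<Longrightarrow> \<L> u f \<Longrightarrow> 0 < R \<Longrightarrow> 0 \<le> U \<Longrightarrow> 0 \<le> M \<Longrightarrow>
       (\<And>x. x \<in> ball y\<^sub>0 (2 * a * R) \<Longrightarrow> \<bar>u x\<bar> \<le> U) \<Longrightarrow> (\<And>x. x \<in> ball y\<^sub>0 (2 * a * R) \<Longrightarrow> \<bar>f x\<bar> \<le> M) \<Longrightarrow>
       AE z in \<nu>. z \<in> ball y\<^sub>0 R \<longrightarrow> \<bar>grad u z\<bar> \<le> K\<^sub>5 * (U / R + \<Psi> (a * R) / R * M)"
    by (rule local_gradient_estimate[OF RH]) (rule that; blast)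
  obtain B where B: "0 < B"
    and up: "\<And>t x y \<rho>. 0 < t \<Longrightarrow> 0 < \<rho> \<Longrightarrow> p t x y \<le> B / V (\<Psi>i t) * exp (- (c\<^sub>2/2) * (dist x y / \<rho> - 2 * t / \<Psi> \<rho>))"
    and dup: "\<And>t x y \<rho>. 0 < t \<Longrightarrow> 0 < \<rho> \<Longrightarrow> \<bar>pdot t x y\<bar> \<le> B / (t * V (\<Psi>i t)) * exp (- (c\<^sub>2/2) * (dist x y / \<rho> - 2 * t / \<Psi> \<rho>))"
    by (rule kernel_and_derivative_upper) (rule that; blast)
  obtain c K where c: "0 < c" and shift: "\<And>t d \<rho>\<^sub>0. 0 < t \<Longrightarrow> 0 \<le> d \<Longrightarrow> 0 < \<rho>\<^sub>0 \<Longrightarrow>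
    \<exists>\<rho>>0. c * (d / \<rho>\<^sub>0 - t / \<Psi> \<rho>\<^sub>0) - K \<le> (d - 2 * \<Psi>i t) / \<rho> - 2 * t / \<Psi> \<rho>"
    by (rule rate_shift) (rule that; blast)
  \<comment> \<open>One half is lost in the interpolation for the time derivative, the factor
    \<open>c\<close> in \<open>rate_shift\<close>.\<close>
  define e where "e = c\<^sub>2 / 2 * c"
  have e: "0 < e" using c c\<^sub>2 by (simp add: e_def)
  define M0 where "M0 = B * exp (c\<^sub>2 / 2 * K)"
  have M0: "0 < M0" using B by (simp add: M0_def)
  \<comment> \<open>The distance \<open>dist x y + \<Psi>i t\<close> exceeds that of every point
    near \<open>y\<close>, which is what the final bound needs, while the hypothesis is available at
    \<open>w\<close>, at least \<open>2 * \<Psi>i t\<close> less far away in the worst case.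
    \<open>rate_shift\<close> bridges exactly this gap.\<close>
  have near: "X \<le> M0 * b * exp (- e * scale_rate \<Psi> (dist x y + \<Psi>i t) t)"
    if t: "0 < t" and w: "w \<in> ball y (\<Psi>i t)" and b: "0 < b"
      and X: "\<And>\<rho>. 0 < \<rho> \<Longrightarrow> X \<le> B * b * exp (- (c\<^sub>2/2) * (dist x w / \<rho> - 2 * t / \<Psi> \<rho>))" for X b x y w t
  proof (rule exp_rate[OF e])
    show "0 \<le> M0 * b" using M0 b by simp
    fix \<rho>\<^sub>0 :: real assume "0 < \<rho>\<^sub>0"
    let ?d = "dist x y + \<Psi>i t"
    have "0 \<le> ?d" using \<Psi>i_pos[OF t] by (intro add_nonneg_nonneg) auto
    then obtain \<rho> where \<rho>: "0 < \<rho>" "c * (?d / \<rho>\<^sub>0 - t / \<Psi> \<rho>\<^sub>0) - K \<le> (?d - 2 * \<Psi>i t) / \<rho> - 2 * t / \<Psi> \<rho>"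
      using shift[OF t _ \<open>0 < \<rho>\<^sub>0\<close>] by blast
    have "?d - 2 * \<Psi>i t \<le> dist x w" using w dist_triangle[of x y w] by (simp add: dist_commute)
    then have "(?d - 2 * \<Psi>i t) / \<rho> \<le> dist x w / \<rho>" using \<rho>(1) by (intro divide_right_mono) auto
    then have le: "c * (?d / \<rho>\<^sub>0 - t / \<Psi> \<rho>\<^sub>0) - K \<le> dist x w / \<rho> - 2 * t / \<Psi> \<rho>" using \<rho>(2) by linarith
    have "X \<le> B * b * exp (- (c\<^sub>2/2) * (dist x w / \<rho> - 2 * t / \<Psi> \<rho>))" by (rule X[OF \<rho>(1)])
    also have "\<dots> \<le> B * b * exp (- (c\<^sub>2/2) * (c * (?d / \<rho>\<^sub>0 - t / \<Psi> \<rho>\<^sub>0) - K))"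
      using le c\<^sub>2 B b by (intro mult_left_mono) auto
    also have "\<dots> = B * b * (exp (c\<^sub>2/2 * K) * exp (- e * (?d / \<rho>\<^sub>0 - t / \<Psi> \<rho>\<^sub>0)))"
    proof -
      have "exp (- (c\<^sub>2/2) * (c * \<tau> - K)) = exp (c\<^sub>2/2 * K) * exp (- e * \<tau>)" for \<tau>
        unfolding exp_add[symmetric] e_def by (simp add: field_simps)
      then show ?thesis by simp
    qed
    finally show "X \<le> M0 * b * exp (- e * (?d / \<rho>\<^sub>0 - t / \<Psi> \<rho>\<^sub>0))" by (simp add: M0_def ac_simps)
  qed
  \<comment> \<open>Two equal terms \<open>U / r\<close> with
    \<open>1 / r = 2 * a / \<Psi>i t\<close> give \<open>4 * a\<close>; \<open>CV\<close> replaces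
    \<open>V\<close> by the measure of the ball around \<open>x\<close>.\<close>
  define C0 where "C0 = 4 * a * K\<^sub>5 * M0 * CV"
  have C0: "0 < C0" using a K5 M0 CV by (simp add: C0_def)
  \<comment> \<open>The exceptional null set of the local estimate depends on its centre, so the
    space is covered by balls around countably many centres.\<close>
  obtain N :: "'a set" where N: "countable N" "\<And>X. open X \<Longrightarrow> X \<noteq> {} \<Longrightarrow> \<exists>d\<in>N. d \<in> X"
    using countable_dense_exists by auto
  have "AE z in \<nu>. \<bar>grad (p t x) z\<bar> \<le> C0 / (\<Psi>i t * measure m (ball x (\<Psi>i t))) * exp (- e * scale_rate \<Psi> (dist x z) t)"
    if t: "0 < t" for t x
  proof -
    let ?R = "\<Psi>i t"
    have R: "0 < ?R" using t by (rule \<Psi>i_pos)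
    have V: "0 < V ?R" using R by (rule V_pos)
    \<comment> \<open>The local estimate then looks at a ball of radius exactly
      \<open>\<Psi>i t\<close>, and \<open>\<Psi> (a * r)\<close> is at most \<open>t\<close>, so
      its two terms are of the same size.\<close>
    define r where "r = ?R / (2 * a)"
    have r: "0 < r" "2 * a * r = ?R" "a * r = ?R / 2" "r \<le> ?R"
      using R a by (auto simp: r_def field_simps)
    have one: "AE z in \<nu>. z \<in> ball y r \<longrightarrow> \<bar>grad (p t x) z\<bar> \<le> C0 / (?R * measure m (ball x ?R)) * exp (- e * scale_rate \<Psi> (dist x z) t)" for y
    proof -
      define \<epsilon> where "\<epsilon> = exp (- e * scale_rate \<Psi> (dist x y + ?R) t)"
      have \<epsilon>: "0 < \<epsilon>" by (simp add: \<epsilon>_def)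
      define U where "U = M0 / V ?R * \<epsilon>"
      have U: "0 \<le> U" using M0 V \<epsilon> by (simp add: U_def)
      have "\<bar>p t x w\<bar> \<le> U" if w: "w \<in> ball y (2 * a * r)" for w
      proof -
        have "p t x w \<le> M0 * (1 / V ?R) * exp (- e * scale_rate \<Psi> (dist x y + ?R) t)"
          using w up[OF t, of _ x w] V unfolding r(2) by (intro near[OF t]) auto
        then show ?thesis using kernel_nonneg[OF t, of x w] by (simp add: U_def \<epsilon>_def)
      qed
      moreover have "\<bar>pdot t x w\<bar> \<le> U / t" if w: "w \<in> ball y (2 * a * r)" for w
      proof -
        have "\<bar>pdot t x w\<bar> \<le> M0 * (1 / (t * V ?R)) * exp (- e * scale_rate \<Psi> (dist x y + ?R) t)"
          using w dup[OF t, of _ x w] V t unfolding r(2) by (intro near[OF t]) auto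
        then show ?thesis by (simp add: U_def \<epsilon>_def ac_simps)
      qed
      ultimately have "AE z in \<nu>. z \<in> ball y r \<longrightarrow> \<bar>grad (p t x) z\<bar> \<le> K\<^sub>5 * (U / r + \<Psi> (a * r) / r * (U / t))"
        using U t by (intro loc[OF kernel_domain[OF t] laplacian_kernel[OF t] r(1)]) auto
      moreover have "K\<^sub>5 * (U / r + \<Psi> (a * r) / r * (U / t)) \<le> C0 / (?R * measure m (ball x ?R)) * \<epsilon>"
      proof -
        have "\<Psi> (a * r) \<le> \<Psi> ?R" unfolding r(3) using R by (intro \<Psi>_mono) auto
        then have "\<Psi> (a * r) / r * (U / t) \<le> t / r * (U / t)"
          using U t r(1) by (intro mult_right_mono divide_right_mono) (auto simp: \<Psi>_\<Psi>i)
        also have "\<dots> = U / r" using t by simp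
        finally have "K\<^sub>5 * (U / r + \<Psi> (a * r) / r * (U / t)) \<le> K\<^sub>5 * (U / r + U / r)"
          using K5 by (intro mult_left_mono add_left_mono) auto
        also have "\<dots> = 4 * a * K\<^sub>5 * M0 * \<epsilon> / ?R * (1 / V ?R)"
          using a R V by (simp add: r_def U_def field_simps)
        also have "\<dots> \<le> 4 * a * K\<^sub>5 * M0 * \<epsilon> / ?R * (CV / measure m (ball x ?R))"
          using V_upper[OF R, of x] measure_ball_pos[OF R, of x] V a K5 M0 \<epsilon> R
          by (intro mult_left_mono) (auto simp: field_simps)
        also have "\<dots> = C0 / (?R * measure m (ball x ?R)) * \<epsilon>" by (simp add: C0_def)
        finally show ?thesis .
      qed
      ultimately show ?thesis
      proof (elim eventually_mono, intro impI)
        fix z assume le: "z \<in> ball y r \<longrightarrow> \<bar>grad (p t x) z\<bar> \<le> K\<^sub>5 * (U / r + \<Psi> (a * r) / r * (U / t))"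
          and le2: "K\<^sub>5 * (U / r + \<Psi> (a * r) / r * (U / t)) \<le> C0 / (?R * measure m (ball x ?R)) * \<epsilon>"
          and z: "z \<in> ball y r"
        have "dist x z \<le> dist x y + ?R" using z r(4) dist_triangle[of x z y] by simp
        then have "scale_rate \<Psi> (dist x z) t \<le> scale_rate \<Psi> (dist x y + ?R) t"
          by (intro scale_rate_mono t) auto
        then have "\<epsilon> \<le> exp (- e * scale_rate \<Psi> (dist x z) t)" using e by (simp add: \<epsilon>_def)
        then have "C0 / (?R * measure m (ball x ?R)) * \<epsilon> \<le> C0 / (?R * measure m (ball x ?R)) * exp (- e * scale_rate \<Psi> (dist x z) t)"
          using C0 R by (intro mult_left_mono) auto
        then show "\<bar>grad (p t x) z\<bar> \<le> C0 / (?R * measure m (ball x ?R)) * exp (- e * scale_rate \<Psi> (dist x z) t)"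
          using le le2 z by linarith
      qed
    qed
    have "AE z in \<nu>. \<forall>y\<in>N. z \<in> ball y r \<longrightarrow> \<bar>grad (p t x) z\<bar> \<le> C0 / (?R * measure m (ball x ?R)) * exp (- e * scale_rate \<Psi> (dist x z) t)"
      using one by (simp only: AE_ball_countable[OF N(1)]) blast
    then show ?thesis
    proof eventually_elim
      case (elim z)
      have "ball z r \<noteq> {}" using r(1) by simp
      then obtain y where y: "y \<in> N" "y \<in> ball z r" using N(2)[of "ball z r"] by blast
      then have "z \<in> ball y r" by (simp add: dist_commute)
      then show ?case using elim y(1) by blast
    qed
  qed
  then show ?thesis unfolding Grad_def using C0 e by (intro exI[of _ C0] exI[of _ e]) auto
qed

end

theorem theorem5p3:
  fixes \<iota> :: ereal
    and l :: "nat \<Rightarrow> real" and \<gamma> :: "nat \<Rightarrow> real \<Rightarrow> 'a::{heine_borel, second_countable_topology}"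
    and m \<nu> :: "'a measure"
    and V \<Psi> :: "real \<Rightarrow> real"
    and P :: "real \<Rightarrow> ('a \<Rightarrow> real) \<Rightarrow> 'a \<Rightarrow> real"
    and p :: "real \<Rightarrow> 'a \<Rightarrow> 'a \<Rightarrow> real"
  assumes unbounded: "\<not> bounded (UNIV :: 'a set)"
    and geodesic: "geodesic_space TYPE('a)"
    and local_tree: "uniform_local_tree TYPE('a) \<iota>"
    and orientation: "orientation \<iota> l \<gamma>"
    and length_measure: "length_measure \<iota> \<nu>"
    and radon: "radon_measure m"
    and UVG: "UVG m V"
    and semigroup: "semigroup_generated_by m (laplacian \<iota> m \<nu> l \<gamma>) P"
    and kernel: "heat_kernel m P p"
    and kernel_continuous: "continuous_on ({0<..} \<times> UNIV \<times> UNIV) (\<lambda>(t, x, y). p t x y)"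
    and kernel_domain: "\<And>t x. 0 < t \<Longrightarrow> p t x \<in> form_domain \<iota> m \<nu> l \<gamma>"
    and scale: "scale_function \<Psi>"
    and UHK: "UHK m p \<Psi>"
    and RH: "RH \<iota> m \<nu> l \<gamma>"
  shows "Grad m \<nu> l \<gamma> p \<Psi>"
proof -
  obtain C \<beta>\<^sub>1 \<beta>\<^sub>2 where sc: "scale \<Psi> C \<beta>\<^sub>1 \<beta>\<^sub>2" using scale_functionE[OF scale] .
  obtain CV where CV: "1 \<le> CV" and uvg: "\<And>x r. 0 < r \<Longrightarrow> 0 < inverse CV * V r \<and>
        ennreal (inverse CV * V r) \<le> emeasure m (ball x r) \<and>
        emeasure m (ball x r) \<le> ennreal (CV * V r) \<and> V (2 * r) \<le> CV * V r"
    using UVG unfolding UVG_def by blast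
  obtain C\<^sub>1 c\<^sub>2 where uhk: "0 < C\<^sub>1" "0 < c\<^sub>2" "\<And>t. 0 < t \<Longrightarrow> AE (x, y) in m \<Otimes>\<^sub>M m.
        p t x y \<le> C\<^sub>1 / measure m (ball x (scale_inverse \<Psi> t)) * exp (- c\<^sub>2 * scale_rate \<Psi> (dist x y) t)"
    using UHK unfolding UHK_def by blast
  have sets_m: "sets m = sets borel" using radon by (simp add: radon_measure_def)
  have fin: "emeasure m (ball x r) < \<infinity>" for x :: 'a and r
  proof (cases "0 < r")
    case True
    then show ?thesis using uvg[OF True, of x] by (auto intro: le_less_trans)
  qed (simp add: ball_empty)
  have pos: "0 < emeasure m U" if U: "open U" "U \<noteq> {}" for U :: "'a set"
  proof -
    obtain x r where xr: "0 < r" "ball x r \<subseteq> U" using U by (metis all_not_in_conv open_contains_ball)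
    have "0 < ennreal (inverse CV * V r)" using uvg[OF xr(1)] by simp
    also have "\<dots> \<le> emeasure m (ball x r)" using uvg[OF xr(1)] by simp
    also have "\<dots> \<le> emeasure m U" using xr U by (intro emeasure_mono) (auto simp: sets_m)
    finally show ?thesis .
  qed
  have Vpos: "0 < V r" if "0 < r" for r
    using uvg[OF that] CV by (simp add: zero_less_mult_iff)
  have meas: "V r / CV \<le> measure m (ball x r) \<and> measure m (ball x r) \<le> CV * V r" if r: "0 < r" for x :: 'a and r
  proof -
    have e: "emeasure m (ball x r) = ennreal (measure m (ball x r))" using fin[of x r] by (simp add: emeasure_eq_ennreal_measure)
    show ?thesis
      using uvg[OF r, of x] Vpos[OF r] CV unfolding e by (simp add: ennreal_le_iff field_simps)
  qed
  interpret heat_kernel_upper \<iota> l \<gamma> \<nu> m P p \<Psi> C \<beta>\<^sub>1 \<beta>\<^sub>2 V CV C\<^sub>1 c\<^sub>2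
  proof (intro heat_kernel_upper.intro heat_semigroup.intro local_tree_form.intro local_tree_gradient.intro
      local_tree_form_axioms.intro heat_semigroup_axioms.intro heat_kernel_upper_axioms.intro)
    show "mono_on {0..} V" using UVG by (simp add: UVG_def)
    show "V (2 * r) \<le> CV * V r" if "0 < r" for r using uvg[OF that] by blast
    show "V r / CV \<le> measure m (ball x r)" "measure m (ball x r) \<le> CV * V r" if "0 < r" for x :: 'a and r
      using meas[OF that] by auto
  qed (fact | use fin pos Vpos uhk CV sc in auto)+
  show ?thesis by (rule gradient_estimate[OF RH])
qed

end
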